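(* Let $\Gamma$ be a countable group with an infinite normal subgroup $\Gamma_0$ such that the inclusion $\Gamma_0\subset\Gamma$ has relative property (T) and $\Gamma/\Gamma_0$ is a finitely generated group. Let $\Gamma\curvearrowright^{\alpha}X$ be a free ergodic measure preserving profinite action on a standard probability space $(X,\mu)$ such that the restriction of $\alpha$ to $\Gamma_0$ is also ergodic. Suppose that $\alpha$ is the limit of the actions $\Gamma\curvearrowright^{\alpha_n}X_n$, with $X_n$ finite, and, for every $n$, let $r_n:X\to X_n$ be the quotient map. For every $n$ and $a\in X_n$, denote $X_{a,n}=r_n^{-1}(\{a\})$ and $\Gamma_{a,n}=\{\gamma\in\Gamma:\gamma X_{a,n}=X_{a,n}\}$. Let $\Lambda\curvearrowright^{\beta}Y$ be a free ergodic measure preserving action of a countable group $\Lambda$ on a standard probability space $(Y,\nu)$ and let $\theta:\mathcal R_{\Gamma}\rightarrow\mathcal R_{\Lambda}^t$ be an orbit equivalence, for some $t>0$. Then we can find $n$, $a\in X_n$, a finite index subgroup $\Lambda_0$ of $\Lambda$, $\tau\in[\mathcal R_\Lambda]$ and a group isomorphism $\psi:\Gamma_{a,n}\rightarrow\Lambda_0$ such that $Y_0=(\tau\circ\theta)(X_{a,n})$ is a $\Lambda_0$-invariant set and $(\tau\circ\theta)|_{X_{a,n}}:X_{a,n}\rightarrow Y_0$ conjugates the actions $\Gamma_{a,n}\curvearrowright X_{a,n}$ and $\Lambda_0\curvearrowright Y_0$. Moreover, $\nu(Y_0)=[\Lambda:\Lambda_0]^{-1}$, $t=[\Lambda:\Lambda_0]^{-1}[\Gamma:\Gamma_{a,n}]\in\mathbb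 Q$, and the action $\Lambda\curvearrowright Y$ is obtained by inducing the action $\Lambda_0\curvearrowright Y_0$ to $\Lambda$.
   Context: A standard probability space is one isomorphic to the unit interval with Lebesgue measure. Equalities of sets and maps are understood up to null sets. An action is free if $\mu(\{x:\gamma x=x\})=0$ for all $\gamma\neq e$. Relative property (T): an inclusion of countable groups $\Gamma_0\subset\Gamma$ has relative property (T) if any unitary representation of $\Gamma$ which weakly contains the trivial representation of $\Gamma$ must contain the trivial representation of $\Gamma_0$. Profinite actions: a measure preserving action $\Gamma\curvearrowright(X,\mu)$ is profinite if it is the inverse limit of a sequence of measure preserving actions $\Gamma\curvearrowright(X_n,\mu_n)$ on finite probability spaces. Here one is given measure preserving, onto, $\Gamma$-equivariant maps $q_n:X_{n+1}\to X_n$; $X=\{(x_n)_n : x_n\in X_n,\ q_n(x_{n+1})=x_n\ \forall n\}$; $\mu$ is the unique probability measure making all coordinate maps $r_n:X\to X_n$ measurable and measure preserving; and $\gamma(x_n)_n=(\gamma x_n)_n$. Equivalence relations: for a measure preserving action $\Gamma\curvearrowright(X,\mu)$, $\mathcal R_\Gamma=\{(x,\gamma x):x\in X,\gamma\in\Gamma\}$. For an ergodic countable measure preserving equivalence relation $\mathcal R$ on a standard probability space $(Y,\nu)$, let $\tilde Y=Y\times\mathbb N$ with measure $\tilde\nu=\nu\times c$ ($c$ the counting measure on $\mathbb N$) and let $\widetilde{\mathcal R}$ be the equivalence relation on $\tilde Y$ given by $(x,i)\widetilde{\mathcal R}(y,j)\Leftrightarrow x\mathcal Ry$. For $t>0$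 and a measurable set $Y'\subset\tilde Y$ with $\tilde\nu(Y')=t$, the $t$-amplification $\mathcal R^t$ is the isomorphism class of the restriction $\widetilde{\mathcal R}\cap(Y'\times Y')$ on the probability space $(Y',t^{-1}\tilde\nu|_{Y'})$; it depends only on $t$ and not on the choice of $Y'$. An orbit equivalence (isomorphism) $\theta:\mathcal R\to\mathcal S$ of countable measure preserving equivalence relations on two probability spaces is a probability space isomorphism $\theta$ between these spaces which is a bijection between the $\mathcal R$-orbit of $x$ and the $\mathcal S$-orbit of $\theta(x)$ for a.e. $x$. The full group $[\mathcal R]$ of a countable measure preserving equivalence relation $\mathcal R$ on a probability space consists of the automorphisms $\tau$ of that space with $\tau(x)\mathcal R x$ for a.e. $x$. Conjugation: $(\tau\circ\theta)|_{X_{a,n}}$ conjugates $\Gamma_{a,n}\curvearrowright X_{a,n}$ and $\Lambda_0\curvearrowright Y_0$ (via $\psi$) means that it is an isomorphism of these spaces with normalized measures and $(\tau\circ\theta)(\gamma x)=\psi(\gamma)(\tau\circ\theta)(x)$ for all $\gamma\in\Gamma_{a,n}$ and a.e. $x\in X_{a,n}$. Induced action: "$\Lambda\curvearrowright Y$ is obtained by inducing $\Lambda_0\curvearrowright Y_0$ to $\Lambda$" means that, up to null sets, $Y$ is the disjoint union of the sets $\lambda_iY_0$, where $\lambda_i$ runs over representatives of the cosets $\Lambda/\Lambda_0$ (equivalently $Y\cong\Lambda\times_{\Lambda_0}Y_0$ as $\Lambda$-spaces). *)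

theory Defs
  imports
    "HOL-Probability.Probability"
    "HOL-Algebra.Generated_Groups"
    "HOL-Algebra.Group_Action"
    "HOL-Algebra.Left_Coset"
    "HOL-Algebra.Module"
begin

section \<open>Unitary representations and relative property (T)\<close>

definition complex_ring :: "complex ring" where
  "complex_ring = \<lparr>carrier = UNIV, mult = (*), one = 1, zero = 0, add = (+)\<rparr>"

text \<open>The record \<open>module\<close> carries unused fields \<open>mult\<close> and \<open>one\<close>; the module axioms ignore them.\<close>

record 'h hilbert = "(complex, 'h) module" +
  hinner :: "'h \<Rightarrow> 'h \<Rightarrow> complex"

definition hnorm :: "('h, 'z) hilbert_scheme \<Rightarrow> 'h \<Rightarrow> real" where
  "hnorm H x = sqrt (Re (hinner H x x))"

locale complex_hilbert_space = module complex_ring H for H (structure) +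
  assumes hinner_add:
      "\<lbrakk>x \<in> carrier H; y \<in> carrier H; z \<in> carrier H\<rbrakk>
        \<Longrightarrow> hinner H (x \<oplus> y) z = hinner H x z + hinner H y z"
    and hinner_smult:
      "\<lbrakk>x \<in> carrier H; z \<in> carrier H\<rbrakk> \<Longrightarrow> hinner H (c \<odot> x) z = c * hinner H x z"
    and hinner_cnj:
      "\<lbrakk>x \<in> carrier H; y \<in> carrier H\<rbrakk> \<Longrightarrow> hinner H y x = cnj (hinner H x y)"
    and hinner_pos:
      "\<lbrakk>x \<in> carrier H; x \<noteq> \<zero>\<rbrakk> \<Longrightarrow> Re (hinner H x x) > 0"
    and hcomplete:
      "\<lbrakk>\<And>k::nat. s k \<in> carrier H;
        \<And>e. e > 0 \<Longrightarrow> \<exists>K. \<forall>j\<ge>K. \<forall>k\<ge>K. hnorm H (s j \<ominus> s k) < e\<rbrakk>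
        \<Longrightarrow> \<exists>l\<in>carrier H. (\<lambda>k. hnorm H (s k \<ominus> l)) \<longlonglongrightarrow> 0"

definition linear_isometry_on ::
  "('h, 'z) hilbert_scheme \<Rightarrow> ('k, 'w) hilbert_scheme \<Rightarrow> ('h \<Rightarrow> 'k) \<Rightarrow> bool" where
  "linear_isometry_on H K T \<longleftrightarrow>
     T \<in> carrier H \<rightarrow> carrier K \<and>
     (\<forall>x\<in>carrier H. \<forall>y\<in>carrier H. T (x \<oplus>\<^bsub>H\<^esub> y) = T x \<oplus>\<^bsub>K\<^esub> T y) \<and>
     (\<forall>c. \<forall>x\<in>carrier H. T (c \<odot>\<^bsub>H\<^esub> x) = c \<odot>\<^bsub>K\<^esub> T x) \<and>
     (\<forall>x\<in>carrier H. \<forall>y\<in>carrier H. hinner K (T x) (T y) = hinner H x y)"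

definition unitary_rep ::
  "('g, 'a) monoid_scheme \<Rightarrow> ('h, 'z) hilbert_scheme \<Rightarrow> ('g \<Rightarrow> 'h \<Rightarrow> 'h) \<Rightarrow> bool" where
  "unitary_rep G H \<pi> \<longleftrightarrow>
     complex_hilbert_space H \<and> group_action G (carrier H) \<pi> \<and>
     (\<forall>g\<in>carrier G. linear_isometry_on H H (\<pi> g))"

text \<open>Weak containment in the sense of Fell: the diagonal matrix coefficients of \<open>\<sigma>\<close> are limits,
  uniformly on finite subsets of the discrete group \<open>G\<close>, of finite sums of diagonal matrix
  coefficients of \<open>\<pi>\<close>.\<close>

definition weakly_contains ::
  "('g, 'a) monoid_scheme \<Rightarrow> ('h, 'z) hilbert_scheme \<Rightarrow> ('g \<Rightarrow> 'h \<Rightarrow> 'h)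
    \<Rightarrow> ('k, 'w) hilbert_scheme \<Rightarrow> ('g \<Rightarrow> 'k \<Rightarrow> 'k) \<Rightarrow> bool" where
  "weakly_contains G H \<pi> K \<sigma> \<longleftrightarrow>
     (\<forall>\<xi>\<in>carrier K. \<forall>F e. finite F \<and> F \<subseteq> carrier G \<and> (e::real) > 0 \<longrightarrow>
       (\<exists>(m::nat) \<eta>. (\<forall>i<m. \<eta> i \<in> carrier H) \<and>
          (\<forall>g\<in>F. cmod (hinner K (\<sigma> g \<xi>) \<xi> - (\<Sum>i<m. hinner H (\<pi> g (\<eta> i)) (\<eta> i))) < e)))"

text \<open>Containment of the restriction of \<open>\<sigma>\<close> to \<open>S\<close> in the restriction of \<open>\<pi>\<close> to \<open>S\<close>.\<close>

definition contains_rep ::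
  "'g set \<Rightarrow> ('h, 'z) hilbert_scheme \<Rightarrow> ('g \<Rightarrow> 'h \<Rightarrow> 'h)
    \<Rightarrow> ('k, 'w) hilbert_scheme \<Rightarrow> ('g \<Rightarrow> 'k \<Rightarrow> 'k) \<Rightarrow> bool" where
  "contains_rep S H \<pi> K \<sigma> \<longleftrightarrow>
     (\<exists>T. linear_isometry_on K H T \<and> (\<forall>g\<in>S. \<forall>\<xi>\<in>carrier K. T (\<sigma> g \<xi>) = \<pi> g (T \<xi>)))"

definition complex_line :: "complex hilbert" where
  "complex_line = \<lparr>carrier = UNIV, mult = (*), one = 1, zero = 0, add = (+), smult = (*),
     hinner = (\<lambda>z w. z * cnj w)\<rparr>"

definition trivial_rep :: "'g \<Rightarrow> complex \<Rightarrow> complex" where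
  "trivial_rep g z = z"

text \<open>HOL cannot quantify over types inside a formula, so the underlying set of the Hilbert space is
  taken in the fixed type \<open>nat \<Rightarrow> complex\<close>. This type contains a copy of every separable Hilbert
  space. No generality is lost for countable \<open>G\<close>: if \<open>\<pi>\<close> weakly contains the trivial representation,
  then so does its restriction to the closed invariant subspace generated by countably many
  suitable vectors.\<close>

definition relative_property_T :: "('g, 'a) monoid_scheme \<Rightarrow> 'g set \<Rightarrow> bool" where
  "relative_property_T G G0 \<longleftrightarrow>
     (\<forall>(H :: (nat \<Rightarrow> complex) hilbert) \<pi>.
        unitary_rep G H \<pi> \<and> weakly_contains G H \<pi> complex_line trivial_rep
          \<longrightarrow> contains_rep G0 H \<pi> complex_line trivial_rep)"

definition finitely_generated_group :: "('g, 'a) monoid_scheme \<Rightarrow> bool" where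
  "finitely_generated_group G \<longleftrightarrow>
     group G \<and> (\<exists>S. finite S \<and> S \<subseteq> carrier G \<and> generate G S = carrier G)"


section \<open>Measure spaces up to null sets\<close>

text \<open>\<open>f\<close> restricts to a measure preserving bijection, measurable in both directions, between conull
  sets. Measurability refers to the completions, so that it does not matter whether a space is
  presented with its Borel or with its Lebesgue sets. The values of \<open>f\<close> on the remaining null set
  are irrelevant.\<close>

definition iso_mod_null :: "'x measure \<Rightarrow> 'y measure \<Rightarrow> ('x \<Rightarrow> 'y) \<Rightarrow> bool" where
  "iso_mod_null M N f \<longleftrightarrow>
     (\<exists>A B. A \<subseteq> space M \<and> space M - A \<in> null_sets (completion M) \<and>
            B \<subseteq> space N \<and> space N - B \<in> null_sets (completion N) \<and>
            bij_betw f A B \<and>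
            (\<forall>E\<subseteq>A. (E \<in> sets (completion M) \<longleftrightarrow> f ` E \<in> sets (completion N)) \<and>
                   (E \<in> sets (completion M) \<longrightarrow>
                      emeasure (completion N) (f ` E) = emeasure (completion M) E)))"

definition standard_prob_space :: "'x measure \<Rightarrow> bool" where
  "standard_prob_space M \<longleftrightarrow>
     prob_space M \<and> (\<exists>f. iso_mod_null M (lebesgue_on {0..1::real}) f)"

definition normalized_restriction :: "'x measure \<Rightarrow> 'x set \<Rightarrow> 'x measure" where
  "normalized_restriction M A = scale_measure (1 / emeasure M A) (restrict_space M A)"


section \<open>Measure preserving actions\<close>

definition measure_preserving_map :: "'x measure \<Rightarrow> 'y measure \<Rightarrow> ('x \<Rightarrow> 'y) \<Rightarrow> bool" where
  "measure_preserving_map M N f \<longleftrightarrow> f \<in> measurable M N \<and> distr M N f = N"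

definition pmp_action ::
  "('g, 'a) monoid_scheme \<Rightarrow> 'x measure \<Rightarrow> ('g \<Rightarrow> 'x \<Rightarrow> 'x) \<Rightarrow> bool" where
  "pmp_action G M \<alpha> \<longleftrightarrow>
     prob_space M \<and> group_action G (space M) \<alpha> \<and>
     (\<forall>g\<in>carrier G. measure_preserving_map M M (\<alpha> g))"

definition free_action ::
  "('g, 'a) monoid_scheme \<Rightarrow> 'x measure \<Rightarrow> ('g \<Rightarrow> 'x \<Rightarrow> 'x) \<Rightarrow> bool" where
  "free_action G M \<alpha> \<longleftrightarrow> (\<forall>g\<in>carrier G. g \<noteq> \<one>\<^bsub>G\<^esub> \<longrightarrow> (AE x in M. \<alpha> g x \<noteq> x))"

text \<open>Ergodicity of the restriction of the action to a set \<open>S\<close> of group elements.\<close>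

definition ergodic_on :: "'g set \<Rightarrow> 'x measure \<Rightarrow> ('g \<Rightarrow> 'x \<Rightarrow> 'x) \<Rightarrow> bool" where
  "ergodic_on S M \<alpha> \<longleftrightarrow>
     (\<forall>A\<in>sets M. (\<forall>g\<in>S. AE x in M. \<alpha> g x \<in> A \<longleftrightarrow> x \<in> A) \<longrightarrow>
        emeasure M A = 0 \<or> emeasure M (space M - A) = 0)"

text \<open>The action \<open>\<alpha>\<close> on \<open>M\<close> is the inverse limit of the actions \<open>\<alpha>n n\<close> on the finite probability
  spaces \<open>\<mu> n\<close> along the maps \<open>q n\<close>. Points of the limit are sequences and the \<open>n\<close>-th quotient map
  \<open>r\<^sub>n\<close> is evaluation at \<open>n\<close>.\<close>

definition profinite_limit ::
  "('g, 'a) monoid_scheme \<Rightarrow> (nat \<Rightarrow> 'b) measure \<Rightarrow> ('g \<Rightarrow> (nat \<Rightarrow> 'b) \<Rightarrow> (nat \<Rightarrow> 'b))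
    \<Rightarrow> (nat \<Rightarrow> 'b measure) \<Rightarrow> (nat \<Rightarrow> 'g \<Rightarrow> 'b \<Rightarrow> 'b) \<Rightarrow> (nat \<Rightarrow> 'b \<Rightarrow> 'b) \<Rightarrow> bool" where
  "profinite_limit G M \<alpha> \<mu> \<alpha>n q \<longleftrightarrow>
     (\<forall>n. finite (space (\<mu> n)) \<and> sets (\<mu> n) = Pow (space (\<mu> n)) \<and> pmp_action G (\<mu> n) (\<alpha>n n)) \<and>
     (\<forall>n. measure_preserving_map (\<mu> (Suc n)) (\<mu> n) (q n) \<and>
          q n ` space (\<mu> (Suc n)) = space (\<mu> n) \<and>
          (\<forall>g\<in>carrier G. \<forall>x\<in>space (\<mu> (Suc n)). q n (\<alpha>n (Suc n) g x) = \<alpha>n n g (q n x))) \<and>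
     space M = {x. \<forall>n. x n \<in> space (\<mu> n) \<and> q n (x (Suc n)) = x n} \<and>
     sets M = sets (restrict_space (Pi\<^sub>M UNIV \<mu>) (space M)) \<and>
     (\<forall>n. measure_preserving_map M (\<mu> n) (\<lambda>x. x n)) \<and>
     pmp_action G M \<alpha> \<and>
     (\<forall>g\<in>carrier G. \<forall>x\<in>space M. \<forall>n. \<alpha> g x n = \<alpha>n n g (x n))"

definition level_set :: "(nat \<Rightarrow> 'b) measure \<Rightarrow> nat \<Rightarrow> 'b \<Rightarrow> (nat \<Rightarrow> 'b) set" where
  "level_set M n a = {x \<in> space M. x n = a}"

definition set_stabilizer ::
  "('g, 'a) monoid_scheme \<Rightarrow> ('g \<Rightarrow> 'x \<Rightarrow> 'x) \<Rightarrow> 'x set \<Rightarrow> 'g set" where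
  "set_stabilizer G \<alpha> A = {g \<in> carrier G. \<alpha> g ` A = A}"

definition invariant_mod_null ::
  "'g set \<Rightarrow> 'x measure \<Rightarrow> ('g \<Rightarrow> 'x \<Rightarrow> 'x) \<Rightarrow> 'x set \<Rightarrow> bool" where
  "invariant_mod_null S M \<alpha> A \<longleftrightarrow> (\<forall>g\<in>S. AE x in M. \<alpha> g x \<in> A \<longleftrightarrow> x \<in> A)"

text \<open>The index is only meaningful when there are finitely many cosets (otherwise \<open>card\<close> is 0).\<close>

definition group_index :: "('g, 'a) monoid_scheme \<Rightarrow> 'g set \<Rightarrow> nat" where
  "group_index G H = card (lcosets\<^bsub>G\<^esub> H)"

definition coset_representatives :: "('g, 'a) monoid_scheme \<Rightarrow> 'g set \<Rightarrow> 'g set \<Rightarrow> bool" where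
  "coset_representatives G H T \<longleftrightarrow>
     T \<subseteq> carrier G \<and> (\<forall>C\<in>lcosets\<^bsub>G\<^esub> H. \<exists>!g. g \<in> T \<and> g \<in> C)"

definition induced_from ::
  "('g, 'a) monoid_scheme \<Rightarrow> 'g set \<Rightarrow> 'x measure \<Rightarrow> ('g \<Rightarrow> 'x \<Rightarrow> 'x) \<Rightarrow> 'x set \<Rightarrow> bool" where
  "induced_from G H M \<alpha> Y0 \<longleftrightarrow>
     (\<forall>T. coset_representatives G H T \<longrightarrow>
        (\<forall>g\<in>T. \<forall>h\<in>T. g \<noteq> h \<longrightarrow> (AE x in M. x \<notin> \<alpha> g ` Y0 \<inter> \<alpha> h ` Y0)) \<and>
        (AE x in M. x \<in> (\<Union>g\<in>T. \<alpha> g ` Y0)))"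


section \<open>Orbit equivalence relations, amplifications, full groups\<close>

definition orbit_relation ::
  "('g, 'a) monoid_scheme \<Rightarrow> 'x measure \<Rightarrow> ('g \<Rightarrow> 'x \<Rightarrow> 'x) \<Rightarrow> ('x \<times> 'x) set" where
  "orbit_relation G M \<alpha> = {(x, \<alpha> g x) | x g. x \<in> space M \<and> g \<in> carrier G}"

definition amp_space :: "'y measure \<Rightarrow> ('y \<times> nat) measure" where
  "amp_space N = N \<Otimes>\<^sub>M count_space UNIV"

definition amp_relation :: "('y \<times> 'y) set \<Rightarrow> (('y \<times> nat) \<times> ('y \<times> nat)) set" where
  "amp_relation R = {((x, i), (y, j)) | x i y j. (x, y) \<in> R}"

definition restrict_relation :: "('x \<times> 'x) set \<Rightarrow> 'x set \<Rightarrow> ('x \<times> 'x) set" where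
  "restrict_relation R A = R \<inter> A \<times> A"

definition orbit_equivalence ::
  "'x measure \<Rightarrow> ('x \<times> 'x) set \<Rightarrow> 'y measure \<Rightarrow> ('y \<times> 'y) set \<Rightarrow> ('x \<Rightarrow> 'y) \<Rightarrow> bool" where
  "orbit_equivalence M R N S \<theta> \<longleftrightarrow>
     iso_mod_null M N \<theta> \<and> (AE x in M. bij_betw \<theta> (R `` {x}) (S `` {\<theta> x}))"

definition full_group :: "'x measure \<Rightarrow> ('x \<times> 'x) set \<Rightarrow> ('x \<Rightarrow> 'x) set" where
  "full_group M R = {\<tau>. iso_mod_null M M \<tau> \<and> (AE x in M. (x, \<tau> x) \<in> R)}"

end

theory Submission
  imports Defs
begin

text \<open>The orbit equivalence defines a cocycle \<open>w\<close> with values in \<open>\<Lambda>\<close> by \<open>\<theta> (\<gamma> x) = w \<gamma> x \<cdot> \<theta> x\<close>. Let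
  \<open>\<Gamma>\<close> act on \<open>X \<times> X \<times> \<Lambda>\<close> by \<open>\<gamma> (x, y, l) = (\<gamma> x, \<gamma> y, w \<gamma> x \<cdot> l \<cdot> (w \<gamma> y)\<^sup>-\<^sup>1)\<close>. As \<open>n\<close> grows, the
  normalized indicator functions of the sets \<open>{(x, y, 1) | x\<^sub>n = y\<^sub>n}\<close> become almost invariant vectors,
  because every \<open>w \<gamma>\<close> is approximated by functions of finitely many coordinates. Relative property (T)
  makes one of them uniformly almost invariant under \<open>\<Gamma>\<^sub>0\<close>, so for \<open>\<gamma>\<close> in \<open>\<Gamma>\<^sub>0\<close> that stabilizes a level
  set \<open>X\<^sub>a\<^sub>,\<^sub>n\<close>, the function \<open>w \<gamma>\<close> is nearly constant there, with a value \<open>\<psi> \<gamma>\<close> that is multiplicative in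
  \<open>\<gamma>\<close>. An invariant vector close to the indicator function of \<open>X\<^sub>a\<^sub>,\<^sub>n \<times> {1}\<close> in the square integrable
  functions on \<open>X \<times> \<Lambda>\<close> yields a map \<open>\<phi>\<close> that untwists \<open>w\<close> to the homomorphism \<open>\<psi>\<close>. Ergodicity of
  \<open>\<Gamma>\<^sub>0\<close> on the level sets extends this from \<open>\<Gamma>\<^sub>0\<close> to each further element on a deeper level, and finitely
  many generators of \<open>\<Gamma> / \<Gamma>\<^sub>0\<close> can be treated on a common level.

  Then \<open>q x = \<phi>(x)\<^sup>-\<^sup>1 \<theta> x\<close> satisfies \<open>q (\<gamma> x) = \<psi> \<gamma> (q x)\<close>. The set of points at which \<open>q\<close> is injective is
  invariant, hence conull on a deeper level set, and there \<open>q\<close> conjugates the actions. A partial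
  isomorphism within the orbits extends to an element of the full group, which yields \<open>\<tau>\<close>, and the
  translates of a fundamental set have measures adding up to 1, which yields the indices.\<close>

section \<open>Square integrable functions\<close>

text \<open>The homomorphism \<psi> is not known beforehand, so at the start no action on X \<times>
  \<Lambda> can be twisted by it. On X \<times> X \<times> \<Lambda> the cocycle acts from both
  sides and \<psi> does not occur; Fubini then turns agreement of \<open>w g x\<close> and
  \<open>w g y\<close> for most pairs into one value per group element. What relative property (T)
  contributes is uniformity: one level serves all elements of \<open>\<Gamma>\<^sub>0\<close>. Any
  other element of the stabilizer may ask for a deeper level of its own. Two obstacles shape the
  formal side. Property (T) speaks about Hilbert spaces of sequences, while the vectors here are
  functions on infinite measure spaces, so a separable invariant subspace has to be encoded by
  coefficients. The orbit equivalence is given up to null sets and with respect to completions,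
  while the actions on product spaces need a cocycle identity that holds at every point and a
  cocycle measurable for the original \<sigma>-algebra. Invariant conull sets provide the former;
  the latter rests on the fact that coordinates separate the points of X. The number t enters only
  as the factor by which partial isomorphisms scale measure.\<close>

definition l2 :: "'z measure \<Rightarrow> ('z \<Rightarrow> complex) set" where
  "l2 S = {f \<in> borel_measurable S. integrable S (\<lambda>z. (cmod (f z))\<^sup>2)}"

definition ip :: "'z measure \<Rightarrow> ('z \<Rightarrow> complex) \<Rightarrow> ('z \<Rightarrow> complex) \<Rightarrow> complex" where
  "ip S f g = (\<integral>z. f z * cnj (g z) \<partial>S)"

text \<open>The square of the norm. Estimates are carried out with squares, which are integrals; the
  price is that the triangle inequality becomes \<open>nq_triangle2\<close>, with a factor 2 at each
  use, and many numerical constants below come from there.\<close>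

definition nq :: "'z measure \<Rightarrow> ('z \<Rightarrow> complex) \<Rightarrow> real" where
  "nq S f = (\<integral>z. (cmod (f z))\<^sup>2 \<partial>S)"

lemma l2_measurable [measurable_dest]: "f \<in> l2 S \<Longrightarrow> f \<in> borel_measurable S"
  by (simp add: l2_def)

lemma l2_integrable: "f \<in> l2 S \<Longrightarrow> integrable S (\<lambda>z. (cmod (f z))\<^sup>2)"
  by (simp add: l2_def)

lemma nq_nonneg [simp]: "nq S f \<ge> 0"
  by (simp add: nq_def)

lemma cmod_mult_le_squares: "cmod (a * b) \<le> (cmod a)\<^sup>2 + (cmod b)\<^sup>2"
proof -
  have "0 \<le> (cmod a - cmod b)\<^sup>2" "0 \<le> (cmod a)\<^sup>2" "0 \<le> (cmod b)\<^sup>2" by auto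
  moreover have "0 \<le> cmod a * cmod b" by simp
  ultimately show ?thesis unfolding power2_diff norm_mult by linarith
qed

lemma l2_ip_integrable:
  assumes f: "f \<in> l2 S" and g: "g \<in> l2 S"
  shows "integrable S (\<lambda>z. f z * cnj (g z))"
proof (rule Bochner_Integration.integrable_bound)
  show "integrable S (\<lambda>z. (cmod (f z))\<^sup>2 + (cmod (g z))\<^sup>2)"
    using f g by (simp add: l2_integrable)
  show "(\<lambda>z. f z * cnj (g z)) \<in> borel_measurable S" using f g
    by (auto simp: l2_def intro!: borel_measurable_times borel_measurable_continuous_on[OF continuous_on_cnj[OF continuous_on_id]])
  show "AE x in S. norm (f x * cnj (g x)) \<le> norm ((cmod (f x))\<^sup>2 + (cmod (g x))\<^sup>2)"
    using cmod_mult_le_squares[of "f _" "cnj (g _)"] by simp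
qed

lemma cmod_add_sq_le: "(cmod (a + b))\<^sup>2 \<le> 2 * (cmod a)\<^sup>2 + 2 * (cmod b)\<^sup>2"
proof -
  have "(cmod (a + b))\<^sup>2 \<le> (cmod a + cmod b)\<^sup>2"
    by (simp add: norm_triangle_ineq power_mono)
  also have "\<dots> \<le> 2 * (cmod a)\<^sup>2 + 2 * (cmod b)\<^sup>2"
    using zero_le_power2[of "cmod a - cmod b"] by (simp add: power2_diff power2_sum)
  finally show ?thesis .
qed

lemma l2_add:
  assumes f: "f \<in> l2 S" and g: "g \<in> l2 S"
  shows "(\<lambda>z. f z + g z) \<in> l2 S"
proof -
  have "integrable S (\<lambda>z. (cmod (f z + g z))\<^sup>2)"
  proof (rule Bochner_Integration.integrable_bound)
    show "integrable S (\<lambda>z. 2 * (cmod (f z))\<^sup>2 + 2 * (cmod (g z))\<^sup>2)"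
      using f g by (simp add: l2_integrable)
    show "(\<lambda>z. (cmod (f z + g z))\<^sup>2) \<in> borel_measurable S" using f g by (auto simp: l2_def)
  qed (use cmod_add_sq_le in auto)
  then show ?thesis using f g by (auto simp: l2_def)
qed

lemma l2_scale: "f \<in> l2 S \<Longrightarrow> (\<lambda>z. c * f z) \<in> l2 S"
  by (auto simp: l2_def norm_mult power_mult_distrib)

lemma l2_zero [simp]: "(\<lambda>z. 0) \<in> l2 S"
  by (simp add: l2_def)

lemma l2_diff: "f \<in> l2 S \<Longrightarrow> g \<in> l2 S \<Longrightarrow> (\<lambda>z. f z - g z) \<in> l2 S"
  using l2_add[of f S "\<lambda>z. (-1) * g z"] l2_scale[of g S "-1"] by simp

lemma ip_add_left:
  assumes "f \<in> l2 S" "g \<in> l2 S" "h \<in> l2 S"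
  shows "ip S (\<lambda>z. f z + g z) h = ip S f h + ip S g h"
  using l2_ip_integrable[OF assms(1,3)] l2_ip_integrable[OF assms(2,3)]
  by (simp add: ip_def ring_distribs)

lemma ip_diff_left:
  assumes "f \<in> l2 S" "g \<in> l2 S" "h \<in> l2 S"
  shows "ip S (\<lambda>z. f z - g z) h = ip S f h - ip S g h"
  using l2_ip_integrable[OF assms(1,3)] l2_ip_integrable[OF assms(2,3)]
  by (simp add: ip_def left_diff_distrib)

lemma ip_scale_left: "ip S (\<lambda>z. c * f z) h = c * ip S f h"
  by (simp add: ip_def mult.assoc)

lemma ip_cnj: "ip S g f = cnj (ip S f g)"
  unfolding ip_def by (subst Bochner_Integration.integral_cnj[symmetric]) (simp add: mult.commute)

lemma ip_zero [simp]: "ip S (\<lambda>z. 0) g = 0" "ip S g (\<lambda>z. 0) = 0"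
  by (simp_all add: ip_def)

lemma ip_add_right:
  assumes "f \<in> l2 S" "g \<in> l2 S" "h \<in> l2 S"
  shows "ip S h (\<lambda>z. f z + g z) = ip S h f + ip S h g"
  using ip_add_left[OF assms] by (metis complex_cnj_add ip_cnj)

lemma ip_diff_right:
  assumes "f \<in> l2 S" "g \<in> l2 S" "h \<in> l2 S"
  shows "ip S h (\<lambda>z. f z - g z) = ip S h f - ip S h g"
  using ip_diff_left[OF assms] by (metis complex_cnj_diff ip_cnj)

lemma ip_self: "ip S f f = complex_of_real (nq S f)"
proof -
  have "(\<integral>z. f z * cnj (f z) \<partial>S) = (\<integral>z. complex_of_real ((cmod (f z))\<^sup>2) \<partial>S)"
    by (simp only: complex_norm_square)
  also have "\<dots> = complex_of_real (\<integral>z. (cmod (f z))\<^sup>2 \<partial>S)"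
    by (rule integral_complex_of_real)
  finally show ?thesis by (simp add: ip_def nq_def)
qed

lemma nq_scale: "nq S (\<lambda>z. c * f z) = (cmod c)\<^sup>2 * nq S f"
  by (simp add: nq_def norm_mult power_mult_distrib)

lemma nq_minus_commute: "nq S (\<lambda>z. f z - g z) = nq S (\<lambda>z. g z - f z)"
  by (simp add: nq_def norm_minus_commute)

lemma nq_add:
  assumes "f \<in> l2 S" "g \<in> l2 S"
  shows "nq S (\<lambda>z. f z + g z) = nq S f + nq S g + 2 * Re (ip S f g)"
proof -
  have "ip S (\<lambda>z. f z + g z) (\<lambda>z. f z + g z) = ip S f f + ip S f g + ip S g f + ip S g g"
    using assms by (simp add: ip_add_left ip_add_right l2_add)
  then have "Re (ip S (\<lambda>z. f z + g z) (\<lambda>z. f z + g z))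
      = Re (ip S f f) + Re (ip S f g) + Re (ip S g f) + Re (ip S g g)" by simp
  moreover have "Re (ip S g f) = Re (ip S f g)" by (subst ip_cnj) simp
  ultimately show ?thesis by (simp add: ip_self)
qed

lemma nq_diff:
  assumes "f \<in> l2 S" "g \<in> l2 S"
  shows "nq S (\<lambda>z. f z - g z) = nq S f + nq S g - 2 * Re (ip S f g)"
proof -
  have "ip S (\<lambda>z. f z - g z) (\<lambda>z. f z - g z) = ip S f f - ip S f g - ip S g f + ip S g g"
    using assms by (simp add: ip_diff_left ip_diff_right l2_diff)
  then have "Re (ip S (\<lambda>z. f z - g z) (\<lambda>z. f z - g z))
      = Re (ip S f f) - Re (ip S f g) - Re (ip S g f) + Re (ip S g g)" by simp
  moreover have "Re (ip S g f) = Re (ip S f g)" by (subst ip_cnj) simp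
  ultimately show ?thesis by (simp add: ip_self)
qed

text \<open>In midpoint form the law shows that two vectors are close as soon as both are almost as
  short as their midpoint. This is how least vectors of midpoint-closed sets are found.\<close>

lemma nq_parallelogram:
  assumes "f \<in> l2 S" "g \<in> l2 S"
  shows "nq S (\<lambda>z. f z - g z) = 2 * nq S f + 2 * nq S g - 4 * nq S (\<lambda>z. (f z + g z) / 2)"
proof -
  have "nq S (\<lambda>z. (1/2) * (f z + g z)) = (1/4) * nq S (\<lambda>z. f z + g z)"
    by (subst nq_scale) (simp add: power2_eq_square)
  then show ?thesis using assms by (simp add: nq_add nq_diff)
qed

lemma nq_add_le:
  assumes "f \<in> l2 S" "g \<in> l2 S"
  shows "nq S (\<lambda>z. f z + g z) \<le> 2 * nq S f + 2 * nq S g"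
  using nq_add[OF assms] nq_diff[OF assms] nq_nonneg[of S "\<lambda>z. f z - g z"] by simp

lemma nq_triangle2:
  assumes "f \<in> l2 S" "g \<in> l2 S" "h \<in> l2 S"
  shows "nq S (\<lambda>z. f z - g z) \<le> 2 * nq S (\<lambda>z. f z - h z) + 2 * nq S (\<lambda>z. g z - h z)"
  using nq_add_le[OF l2_diff[OF assms(1,3)] l2_diff[OF assms(3,2)]]
  by (simp add: nq_minus_commute[of S g h])

lemma ip_cauchy_schwarz:
  assumes f: "f \<in> l2 S" and g: "g \<in> l2 S"
  shows "(cmod (ip S f g))\<^sup>2 \<le> nq S f * nq S g"
proof -
  have "0 \<le> nq S f - (2 * s - s\<^sup>2 * nq S g) * (cmod (ip S f g))\<^sup>2" for s :: real
  proof -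
    define c where "c = complex_of_real s * ip S f g"
    have "0 \<le> nq S (\<lambda>z. f z - c * g z)" by simp
    also have "\<dots> = nq S f + (cmod c)\<^sup>2 * nq S g - 2 * Re (ip S f (\<lambda>z. c * g z))"
      using f g by (simp add: nq_diff l2_scale nq_scale)
    also have "ip S f (\<lambda>z. c * g z) = cnj c * ip S f g"
      by (simp add: ip_def mult.left_commute[of _ "cnj c"])
    also have "\<dots> = of_real (s * (cmod (ip S f g))\<^sup>2)"
      by (simp add: c_def complex_norm_square mult.commute del: of_real_power)
    finally show ?thesis
      by (simp add: c_def norm_mult power_mult_distrib algebra_simps)
  qed
  note * = this
  show ?thesis
  proof (cases "nq S g = 0")
    case True
    show ?thesis
    proof (rule ccontr)
      assume "\<not> ?thesis"
      with True have p: "(cmod (ip S f g))\<^sup>2 > 0" by simp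
      define x where "x = (cmod (ip S f g))\<^sup>2"
      have "0 \<le> nq S f - (2 * ((nq S f + 1) / x)) * x"
        using *[of "(nq S f + 1) / x"] True by (simp add: x_def)
      also have "(2 * ((nq S f + 1) / x)) * x = 2 * nq S f + 2"
        using p by (simp add: x_def[symmetric])
      finally have "0 \<le> nq S f - (2 * nq S f + 2)" .
      then show False using nq_nonneg[of S f] by linarith
    qed
  next
    case False
    then have p: "nq S g > 0" using nq_nonneg[of S g] by linarith
    have "0 \<le> nq S f - (1 / nq S g) * (cmod (ip S f g))\<^sup>2"
      using *[of "1 / nq S g"] p by (simp add: power2_eq_square)
    then show ?thesis using p by (simp add: field_simps)
  qed
qed

lemma nq_eq_0_iff:
  assumes "f \<in> l2 S"
  shows "nq S f = 0 \<longleftrightarrow> (AE z in S. f z = 0)"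
  using integral_nonneg_eq_0_iff_AE[OF l2_integrable[OF assms]] by (simp add: nq_def)

lemma ip_cong_AE:
  assumes "f \<in> l2 S" "f' \<in> l2 S" "g \<in> l2 S" "g' \<in> l2 S"
    and "AE z in S. f z = f' z" "AE z in S. g z = g' z"
  shows "ip S f g = ip S f' g'"
  unfolding ip_def
  by (rule integral_cong_AE)
     (use assms in \<open>auto simp: l2_ip_integrable intro: borel_measurable_integrable\<close>)

lemma nq_cong_AE:
  assumes "f \<in> l2 S" "f' \<in> l2 S" "AE z in S. f z = f' z"
  shows "nq S f = nq S f'"
  using ip_cong_AE[of f S f' f f'] assms by (simp add: ip_self)

lemma nn_integral_nq:
  assumes "f \<in> l2 S"
  shows "(\<integral>\<^sup>+z. ennreal ((cmod (f z))\<^sup>2) \<partial>S) = ennreal (nq S f)"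
  unfolding nq_def by (rule nn_integral_eq_integral[OF l2_integrable[OF assms]]) simp

lemma l2I_nn:
  assumes "f \<in> borel_measurable S" "(\<integral>\<^sup>+z. ennreal ((cmod (f z))\<^sup>2) \<partial>S) < \<infinity>"
  shows "f \<in> l2 S"
  using assms by (auto simp: l2_def integrable_iff_bounded)

text \<open>Riesz-Fischer. A subsequence converges so fast in norm that it converges almost
  everywhere; Fatou's lemma then both places the limit in \<open>l2 S\<close> and gives norm
  convergence of the whole sequence.\<close>

theorem l2_complete:
  assumes s: "\<And>k::nat. s k \<in> l2 S"
    and cauchy: "\<And>e. e > 0 \<Longrightarrow> \<exists>K. \<forall>j\<ge>K. \<forall>k\<ge>K. nq S (\<lambda>z. s j z - s k z) < e"
  shows "\<exists>f\<in>l2 S. (\<lambda>k. nq S (\<lambda>z. s k z - f z)) \<longlonglongrightarrow> 0"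
proof -
  \<comment> \<open>The rate 1/8 leaves room for the weight \<open>4 ^ k\<close> below: the weighted
    integrals are at most \<open>(1/2) ^ k\<close>, hence summable, and finiteness of the weighted
    sum at a point bounds \<open>d k z\<close> by a multiple of \<open>(1/2) ^ k\<close>.\<close>
  have "\<exists>K. \<forall>j\<ge>K. \<forall>i\<ge>K. nq S (\<lambda>z. s j z - s i z) < (1/8) ^ k" for k
    by (rule cauchy) simp
  then obtain K where K: "\<And>k j i. j \<ge> K k \<Longrightarrow> i \<ge> K k \<Longrightarrow> nq S (\<lambda>z. s j z - s i z) < (1/8) ^ k"
    by metis
  \<comment> \<open>Partial sums make the index monotone and keep it at least
    \<open>K k\<close>.\<close>
  define r where "r = (\<lambda>k. \<Sum>i\<le>k. K i)"
  have rK: "r k \<ge> K k" for k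
    unfolding r_def by (rule member_le_sum) auto
  have rmono: "r k \<le> r (Suc k)" for k by (simp add: r_def)
  have rKs: "r (Suc k) \<ge> K k" for k using rK[of k] rmono[of k] by simp
  define d where "d = (\<lambda>k z. s (r (Suc k)) z - s (r k) z)"
  have [measurable]: "s k \<in> borel_measurable S" for k using s by (simp add: l2_measurable)
  have dl: "d k \<in> l2 S" for k unfolding d_def by (intro l2_diff s)
  have [measurable]: "d k \<in> borel_measurable S" for k using dl by (simp add: l2_measurable)
  have dn: "nq S (d k) < (1/8) ^ k" for k unfolding d_def by (rule K[OF rKs rK])
  have "(\<integral>\<^sup>+z. (\<Sum>k. ennreal (4 ^ k * (cmod (d k z))\<^sup>2)) \<partial>S)
      = (\<Sum>k. \<integral>\<^sup>+z. ennreal (4 ^ k * (cmod (d k z))\<^sup>2) \<partial>S)"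
    by (rule nn_integral_suminf) simp
  also have "\<dots> = (\<Sum>k. ennreal (4 ^ k * nq S (d k)))"
    by (simp add: ennreal_mult nn_integral_cmult nn_integral_nq[OF dl])
  also have "\<dots> \<le> (\<Sum>k. ennreal ((1/2) ^ k))"
  proof (intro suminf_le ennreal_leI)
    fix k show "4 ^ k * nq S (d k) \<le> (1 / 2) ^ k"
    proof -
      have "4 ^ k * nq S (d k) \<le> 4 ^ k * (1/8) ^ k"
        using dn[of k] by (intro mult_left_mono) auto
      then show ?thesis by (simp flip: power_mult_distrib)
    qed
  qed auto
  also have "\<dots> = ennreal (\<Sum>k. (1/2) ^ k)"
    by (intro suminf_ennreal2) (auto intro: summable_geometric)
  also have "\<dots> < \<infinity>" by simp
  finally have "AE z in S. (\<Sum>k. ennreal (4 ^ k * (cmod (d k z))\<^sup>2)) \<noteq> \<infinity>"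
    by (intro nn_integral_PInf_AE) auto
  then have conv: "AE z in S. convergent (\<lambda>k. s (r k) z)"
  proof eventually_elim
    case (elim z)
    have sm: "summable (\<lambda>k. 4 ^ k * (cmod (d k z))\<^sup>2)"
      using elim by (intro summable_suminf_not_top) (auto simp: top_ennreal_def infinity_ennreal_def)
    define C where "C = (\<Sum>k. 4 ^ k * (cmod (d k z))\<^sup>2)"
    have "cmod (d k z) \<le> sqrt C * (1/2) ^ k" for k
    proof -
      have "4 ^ k * (cmod (d k z))\<^sup>2 \<le> C"
        unfolding C_def using sum_le_suminf[OF sm, of "{k}"] by simp
      moreover have "4 ^ k * (cmod (d k z))\<^sup>2 = (2 ^ k * cmod (d k z))\<^sup>2"
        by (simp add: power2_eq_square power_mult_distrib[symmetric] mult_ac)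
      ultimately have "2 ^ k * cmod (d k z) \<le> sqrt C"
        by (intro real_le_rsqrt) simp
      then show ?thesis by (simp add: field_simps)
    qed
    moreover have "summable (\<lambda>k. sqrt C * (1/2) ^ k)"
      by (intro summable_mult summable_geometric) simp
    ultimately have "summable (\<lambda>k. d k z)"
      using summable_comparison_test'[of "\<lambda>k. sqrt C * (1/2) ^ k" 0 "\<lambda>k. d k z"] by blast
    then have "convergent (\<lambda>n. \<Sum>k<n. d k z)" by (simp add: summable_iff_convergent)
    moreover have "(\<Sum>k<n. d k z) = s (r n) z - s (r 0) z" for n
      unfolding d_def by (rule sum_lessThan_telescope)
    ultimately have "convergent (\<lambda>n. s (r n) z - s (r 0) z)" by simp
    then have "convergent (\<lambda>n. (s (r n) z - s (r 0) z) + s (r 0) z)"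
      by (intro convergent_add convergent_const)
    then show ?case by simp
  qed
  define f where "f z = lim (\<lambda>k. s (r k) z)" for z
  have [measurable]: "f \<in> borel_measurable S"
    unfolding f_def by (rule borel_measurable_lim_metric) simp
  have lim: "AE z in S. (\<lambda>k. s (r k) z) \<longlonglongrightarrow> f z"
    using conv by eventually_elim (simp add: f_def convergent_LIMSEQ_iff)
  \<comment> \<open>Stated with nonnegative integrals because \<open>f\<close> is not yet known to
    be square integrable.\<close>
  have fat: "(\<integral>\<^sup>+z. ennreal ((cmod (s j z - f z))\<^sup>2) \<partial>S) \<le> ennreal ((1/8) ^ k)" if "j \<ge> K k" for j k
  proof -
    have "(\<integral>\<^sup>+z. ennreal ((cmod (s j z - f z))\<^sup>2) \<partial>S)
      = (\<integral>\<^sup>+z. liminf (\<lambda>i. ennreal ((cmod (s j z - s (r i) z))\<^sup>2)) \<partial>S)"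
    proof (rule nn_integral_cong_AE, use lim in eventually_elim)
      case (elim z)
      have "(\<lambda>i. ennreal ((cmod (s j z - s (r i) z))\<^sup>2)) \<longlonglongrightarrow> ennreal ((cmod (s j z - f z))\<^sup>2)"
        by (intro tendsto_intros elim)
      from lim_imp_Liminf[OF _ this] show ?case by simp
    qed
    also have "\<dots> \<le> liminf (\<lambda>i. \<integral>\<^sup>+z. ennreal ((cmod (s j z - s (r i) z))\<^sup>2) \<partial>S)"
      by (rule nn_integral_liminf) simp
    also have "\<dots> \<le> liminf (\<lambda>i. ennreal ((1/8) ^ k))"
    proof (rule Liminf_mono)
      have "\<forall>i\<ge>k. (\<integral>\<^sup>+z. ennreal ((cmod (s j z - s (r i) z))\<^sup>2) \<partial>S) \<le> ennreal ((1/8) ^ k)"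
      proof (intro allI impI)
        fix i assume "k \<le> i"
        then have "r i \<ge> K k" using rK[of k] lift_Suc_mono_le[of r, OF rmono] le_trans by blast
        then have "nq S (\<lambda>z. s j z - s (r i) z) < (1/8) ^ k" using that by (intro K)
        then show "(\<integral>\<^sup>+z. ennreal ((cmod (s j z - s (r i) z))\<^sup>2) \<partial>S) \<le> ennreal ((1/8) ^ k)"
          by (subst nn_integral_nq) (auto intro: l2_diff s ennreal_leI)
      qed
      then show "\<forall>\<^sub>F i in sequentially. (\<integral>\<^sup>+z. ennreal ((cmod (s j z - s (r i) z))\<^sup>2) \<partial>S) \<le> ennreal ((1/8) ^ k)"
        unfolding eventually_sequentially by blast
    qed
    also have "\<dots> = ennreal ((1/8) ^ k)" by (simp add: Liminf_const)
    finally show ?thesis .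
  qed
  have sfl: "(\<lambda>z. s (K k) z - f z) \<in> l2 S" for k
    by (rule l2I_nn) (use s in \<open>auto intro!: le_less_trans[OF fat[OF order_refl]]\<close>)
  have "(\<lambda>z. s (K 0) z - (s (K 0) z - f z)) \<in> l2 S"
    by (rule l2_diff[OF s sfl])
  then have fl: "f \<in> l2 S" by simp
  have "nq S (\<lambda>z. s j z - f z) \<le> (1/8) ^ k" if "j \<ge> K k" for j k
  proof -
    have "ennreal (nq S (\<lambda>z. s j z - f z)) \<le> ennreal ((1/8) ^ k)"
      using fat[OF that] by (subst (asm) nn_integral_nq) (auto intro: l2_diff s fl)
    then show ?thesis by (subst (asm) ennreal_le_iff) auto
  qed
  note fin = this
  have "(\<lambda>k. nq S (\<lambda>z. s k z - f z)) \<longlonglongrightarrow> 0"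
  proof (rule LIMSEQ_I)
    fix e :: real assume "e > 0"
    then obtain k where k: "(1/8::real) ^ k < e" using real_arch_pow_inv[of e "1/8"] by auto
    show "\<exists>no. \<forall>n\<ge>no. norm (nq S (\<lambda>z. s n z - f z) - 0) < e"
      using fin[of k] k by (intro exI[of _ "K k"]) (auto intro: le_less_trans)
  qed
  with fl show ?thesis by blast
qed

lemma ip_tendsto:
  assumes s: "\<And>k::nat. s k \<in> l2 S" and f: "f \<in> l2 S" and g: "g \<in> l2 S"
    and lim: "(\<lambda>k. nq S (\<lambda>z. s k z - f z)) \<longlonglongrightarrow> 0"
  shows "(\<lambda>k. ip S (s k) g) \<longlonglongrightarrow> ip S f g"
proof (rule LIM_zero_cancel, rule tendsto_norm_zero_cancel)
  have bd: "cmod (ip S (s k) g - ip S f g) \<le> sqrt (nq S (\<lambda>z. s k z - f z) * nq S g)" for k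
    using ip_cauchy_schwarz[OF l2_diff[OF s[of k] f] g] ip_diff_left[OF s[of k] f g]
    by (simp add: real_le_rsqrt)
  have "(\<lambda>k. sqrt (nq S (\<lambda>z. s k z - f z) * nq S g)) \<longlonglongrightarrow> sqrt (0 * nq S g)"
    by (intro tendsto_intros lim)
  then have "(\<lambda>k. sqrt (nq S (\<lambda>z. s k z - f z) * nq S g)) \<longlonglongrightarrow> 0" by simp
  from tendsto_sandwich[OF _ _ tendsto_const this] bd
  show "(\<lambda>x. norm (ip S (s x) g - ip S f g)) \<longlonglongrightarrow> 0"
    by (simp add: eventually_sequentially)
qed

section \<open>Koopman representations and invariant projections\<close>

text \<open>The measure may be infinite: the main instances are products of a probability space with
  counting measure on a countable group. The action laws hold at every point, so that only
  invariance statements carry exceptional null sets.\<close>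

locale mp_action = group G for G (structure) +
  fixes S :: "'z measure" and T :: "'a \<Rightarrow> 'z \<Rightarrow> 'z"
  assumes T_measurable: "g \<in> carrier G \<Longrightarrow> T g \<in> measurable S S"
    and T_distr: "g \<in> carrier G \<Longrightarrow> distr S S (T g) = S"
    and T_mult: "\<lbrakk>g \<in> carrier G; h \<in> carrier G; z \<in> space S\<rbrakk> \<Longrightarrow> T (g \<otimes> h) z = T g (T h z)"
    and T_one: "z \<in> space S \<Longrightarrow> T \<one> z = z"
begin

definition rep :: "'a \<Rightarrow> ('z \<Rightarrow> complex) \<Rightarrow> 'z \<Rightarrow> complex" where
  "rep g f = (\<lambda>z. f (T (inv g) z))"

definition inv_l2 :: "'a set \<Rightarrow> ('z \<Rightarrow> complex) set" where
  "inv_l2 K = {f \<in> l2 S. \<forall>g\<in>K. AE z in S. rep g f z = f z}"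

lemma T_space: "g \<in> carrier G \<Longrightarrow> z \<in> space S \<Longrightarrow> T g z \<in> space S"
  using T_measurable measurable_space by metis

lemma rep_measurable: "g \<in> carrier G \<Longrightarrow> f \<in> borel_measurable S \<Longrightarrow> rep g f \<in> borel_measurable S"
  unfolding rep_def using T_measurable[of "inv g"] by (simp add: measurable_compose)

lemma integral_T:
  fixes f :: "'z \<Rightarrow> 'w::{banach, second_countable_topology}"
  assumes "g \<in> carrier G" "f \<in> borel_measurable S"
  shows "(\<integral>z. f (T g z) \<partial>S) = (\<integral>z. f z \<partial>S)"
  using integral_distr[OF T_measurable[OF assms(1)], of f] assms T_distr by simp

lemma rep_l2:
  assumes "g \<in> carrier G" "f \<in> l2 S" shows "rep g f \<in> l2 S"
proof -
  have "integrable (distr S S (T (inv g))) (\<lambda>z. (cmod (f z))\<^sup>2)"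
    using assms T_distr[of "inv g"] by (simp add: l2_integrable)
  then have "integrable S (\<lambda>z. (cmod (f (T (inv g) z)))\<^sup>2)"
    using assms T_measurable[of "inv g"] by (subst (asm) integrable_distr_eq) (auto simp: l2_measurable)
  then show ?thesis using rep_measurable[OF assms(1)] assms by (simp add: l2_def rep_def)
qed

lemma ip_rep:
  assumes "g \<in> carrier G" "f \<in> l2 S" "h \<in> l2 S" shows "ip S (rep g f) (rep g h) = ip S f h"
  unfolding ip_def rep_def
  by (rule integral_T[of "inv g" "\<lambda>z. f z * cnj (h z)"])
     (use assms in \<open>auto intro: borel_measurable_integrable l2_ip_integrable\<close>)

lemma nq_rep: "g \<in> carrier G \<Longrightarrow> f \<in> l2 S \<Longrightarrow> nq S (rep g f) = nq S f"
  using ip_rep[of g f f] by (simp add: ip_self)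

lemma rep_mult:
  "g \<in> carrier G \<Longrightarrow> h \<in> carrier G \<Longrightarrow> z \<in> space S \<Longrightarrow> rep (g \<otimes> h) f z = rep g (rep h f) z"
  by (simp add: rep_def inv_mult_group T_mult)

lemma rep_one: "z \<in> space S \<Longrightarrow> rep \<one> f z = f z"
  by (simp add: rep_def T_one)

lemma T_inv [simp]:
  assumes "g \<in> carrier G" "x \<in> space S"
  shows "T (inv g) (T g x) = x" "T g (T (inv g) x) = x"
  using T_mult[of "inv g" g x] T_mult[of g "inv g" x] assms T_one by auto

lemma image_T:
  assumes g: "g \<in> carrier G" and A: "A \<subseteq> space S"
  shows "T g ` A = T (inv g) -` A \<inter> space S"
proof (intro equalityI subsetI)
  fix y assume "y \<in> T g ` A"
  then obtain x where "x \<in> A" "y = T g x" by blast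
  then show "y \<in> T (inv g) -` A \<inter> space S" using assms T_space by auto
next
  fix y assume "y \<in> T (inv g) -` A \<inter> space S"
  then show "y \<in> T g ` A" using g by (intro image_eqI[of _ _ "T (inv g) y"]) auto
qed

lemma image_T_sets [measurable]: "g \<in> carrier G \<Longrightarrow> A \<in> sets S \<Longrightarrow> T g ` A \<in> sets S"
  using measurable_sets[OF T_measurable[of "inv g"], of A] sets.sets_into_space[of A S]
  by (simp add: image_T)

lemma emeasure_vimage_T:
  "g \<in> carrier G \<Longrightarrow> A \<in> sets S \<Longrightarrow> emeasure S (T g -` A \<inter> space S) = emeasure S A"
  using emeasure_distr[OF T_measurable[of g], of A] T_distr[of g] by simp

lemma emeasure_image_T:
  "g \<in> carrier G \<Longrightarrow> A \<in> sets S \<Longrightarrow> emeasure S (T g ` A) = emeasure S A"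
  using emeasure_vimage_T[of "inv g" A] sets.sets_into_space[of A S] by (simp add: image_T)

lemma measure_image_T:
  "g \<in> carrier G \<Longrightarrow> A \<in> sets S \<Longrightarrow> measure S (T g ` A) = measure S A"
  by (simp add: measure_def emeasure_image_T)

lemma AE_T:
  assumes "g \<in> carrier G" "AE z in S. P z" shows "AE z in S. P (T g z)"
proof -
  have "AE z in distr S S (T g). P z" unfolding T_distr[OF assms(1)] by (rule assms(2))
  then show ?thesis by (rule AE_distrD[OF T_measurable[OF assms(1)]])
qed

lemma rep_cong_AE: "g \<in> carrier G \<Longrightarrow> AE z in S. f z = f' z \<Longrightarrow> AE z in S. rep g f z = rep g f' z"
  unfolding rep_def by (rule AE_T) auto

lemma ip_rep_left:
  assumes "g \<in> carrier G" "f \<in> l2 S" "h \<in> l2 S" shows "ip S (rep g f) h = ip S f (rep (inv g) h)"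
proof -
  have "ip S f (rep (inv g) h) = ip S (rep g f) (rep g (rep (inv g) h))"
    using assms by (simp add: ip_rep rep_l2)
  also have "\<dots> = ip S (rep g f) h"
    using assms by (intro ip_cong_AE) (auto intro!: rep_l2 simp: rep_mult[symmetric] rep_one)
  finally show ?thesis by simp
qed

lemma inv_l2I: "f \<in> l2 S \<Longrightarrow> (\<And>g. g \<in> K \<Longrightarrow> AE z in S. rep g f z = f z) \<Longrightarrow> f \<in> inv_l2 K"
  by (simp add: inv_l2_def)

lemma inv_l2D: "f \<in> inv_l2 K \<Longrightarrow> f \<in> l2 S" "f \<in> inv_l2 K \<Longrightarrow> g \<in> K \<Longrightarrow> AE z in S. rep g f z = f z"
  by (simp_all add: inv_l2_def)

text \<open>A stand-in for the convex hull of the \<open>K\<close>-orbit of \<xi>. Midpoints suffice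
  for the parallelogram argument, and properties of all hull elements follow by rule
  induction.\<close>

inductive_set mid_hull :: "'a set \<Rightarrow> ('z \<Rightarrow> complex) \<Rightarrow> ('z \<Rightarrow> complex) set"
  for K :: "'a set" and \<xi> :: "'z \<Rightarrow> complex" where
  base: "\<xi> \<in> mid_hull K \<xi>"
| rep: "\<lbrakk>u \<in> mid_hull K \<xi>; g \<in> K\<rbrakk> \<Longrightarrow> rep g u \<in> mid_hull K \<xi>"
| mid: "\<lbrakk>u \<in> mid_hull K \<xi>; v \<in> mid_hull K \<xi>\<rbrakk> \<Longrightarrow> (\<lambda>z. (u z + v z) / 2) \<in> mid_hull K \<xi>"

lemma hull_l2:
  assumes "u \<in> mid_hull K \<xi>" "K \<subseteq> carrier G" "\<xi> \<in> l2 S" shows "u \<in> l2 S"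
  using assms
proof (induction rule: mid_hull.induct)
  case (rep u g) then show ?case by (auto intro: rep_l2)
next
  case (mid u v)
  then have "(\<lambda>z. (1/2) * (u z + v z)) \<in> l2 S" by (intro l2_scale l2_add) auto
  then show ?case by simp
qed

text \<open>Translation by \<open>K\<close> and midpoints do not change the pairing with an
  invariant vector. In the limit this makes the least vector of the hull the orthogonal projection
  of \<xi> to the invariant vectors.\<close>

lemma hull_ip:
  assumes "u \<in> mid_hull K \<xi>" "K \<subseteq> carrier G" "\<xi> \<in> l2 S" "\<zeta> \<in> inv_l2 K"
  shows "ip S u \<zeta> = ip S \<xi> \<zeta>"
  using assms
proof (induction rule: mid_hull.induct)
  case (rep u g)
  then have u: "u \<in> l2 S" "\<zeta> \<in> l2 S" "g \<in> carrier G" by (auto intro: hull_l2 inv_l2D)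
  have "ip S (rep g u) \<zeta> = ip S (rep g u) (rep g \<zeta>)"
    using u inv_l2D(2)[OF rep.prems(3) rep.hyps(2)] by (intro ip_cong_AE) (auto intro: rep_l2)
  then show ?case using rep u by (simp add: ip_rep)
next
  case (mid u v)
  then have u: "u \<in> l2 S" "v \<in> l2 S" "\<zeta> \<in> l2 S" by (auto intro: hull_l2 inv_l2D)
  have "ip S (\<lambda>z. (1/2) * (u z + v z)) \<zeta> = (1/2) * (ip S u \<zeta> + ip S v \<zeta>)"
    using u by (subst ip_scale_left) (simp add: ip_add_left)
  then show ?case using mid by simp
qed auto

lemma nq_mid_le:
  assumes "u \<in> l2 S" "v \<in> l2 S" "\<xi> \<in> l2 S" "nq S (\<lambda>z. u z - \<xi> z) \<le> e" "nq S (\<lambda>z. v z - \<xi> z) \<le> e"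
  shows "nq S (\<lambda>z. (u z + v z) / 2 - \<xi> z) \<le> e"
proof -
  have "(\<lambda>z. (u z + v z) / 2 - \<xi> z) = (\<lambda>z. ((u z - \<xi> z) + (v z - \<xi> z)) / 2)"
    by (auto simp: field_simps)
  then show ?thesis
    using nq_parallelogram[OF l2_diff[OF assms(1,3)] l2_diff[OF assms(2,3)]] assms(4,5)
      nq_nonneg[of S "\<lambda>z. (u z - \<xi> z) - (v z - \<xi> z)"] by simp
qed

text \<open>The induction needs the bound for every translate of \<open>u\<close>, not only for
  \<open>u\<close> itself: in the case of \<open>rep h u\<close> the new factor is absorbed into
  \<open>g \<otimes> h\<close>.\<close>

lemma hull_dist:
  assumes "u \<in> mid_hull K \<xi>" "subgroup K G" "\<xi> \<in> l2 S"
    and "\<And>g. g \<in> K \<Longrightarrow> nq S (\<lambda>z. rep g \<xi> z - \<xi> z) \<le> e"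
  shows "g \<in> K \<Longrightarrow> nq S (\<lambda>z. rep g u z - \<xi> z) \<le> e"
  using assms
proof (induction arbitrary: g rule: mid_hull.induct)
  case (rep u h g)
  have K: "K \<subseteq> carrier G" using rep.prems by (simp add: subgroup.subset)
  have gh: "g \<otimes> h \<in> K" using rep by (simp add: subgroup.m_closed)
  have l: "u \<in> l2 S" using rep K hull_l2 by blast
  have "nq S (\<lambda>z. rep g (rep h u) z - \<xi> z) = nq S (\<lambda>z. rep (g \<otimes> h) u z - \<xi> z)"
    using rep K l gh by (intro nq_cong_AE l2_diff rep_l2 AE_I2) (auto simp: rep_mult subset_iff)
  then show ?case using rep.IH[OF gh] rep.prems by simp
next
  case (mid u v g)
  have K: "K \<subseteq> carrier G" using mid.prems by (simp add: subgroup.subset)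
  have l: "u \<in> l2 S" "v \<in> l2 S" using mid K hull_l2 by blast+
  have "nq S (\<lambda>z. (rep g u z + rep g v z) / 2 - \<xi> z) \<le> e"
    using mid K l by (intro nq_mid_le rep_l2) auto
  then show ?case by (simp add: rep_def)
qed

text \<open>The vector of least norm in the closed hull of the orbit is unique, hence invariant. The
  last conclusion says that a vector moved only slightly by all of \<open>K\<close> is near an
  invariant one; its factor 2 is the loss in \<open>nq_triangle2\<close>.\<close>

theorem invariant_projection:
  assumes K: "subgroup K G" and \<xi>: "\<xi> \<in> l2 S"
  obtains \<eta> where "\<eta> \<in> inv_l2 K" "\<And>\<zeta>. \<zeta> \<in> inv_l2 K \<Longrightarrow> ip S (\<lambda>z. \<xi> z - \<eta> z) \<zeta> = 0"
    "\<And>e. (\<And>g. g \<in> K \<Longrightarrow> nq S (\<lambda>z. rep g \<xi> z - \<xi> z) \<le> e) \<Longrightarrow> nq S (\<lambda>z. \<xi> z - \<eta> z) \<le> 2 * e"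
proof -
  have Kc: "K \<subseteq> carrier G" using K by (simp add: subgroup.subset)
  have Vl: "u \<in> l2 S" if "u \<in> mid_hull K \<xi>" for u using hull_l2[OF that Kc \<xi>] .
  define d where "d = Inf (nq S ` mid_hull K \<xi>)"
  have bdd: "bdd_below (nq S ` mid_hull K \<xi>)" by (rule bdd_belowI[of _ 0]) auto
  have dle: "d \<le> nq S u" if "u \<in> mid_hull K \<xi>" for u
    unfolding d_def using that bdd by (simp add: cINF_lower)
  have "\<exists>u\<in>mid_hull K \<xi>. nq S u < d + 1 / real (Suc k)" for k
    using cInf_lessD[of "nq S ` mid_hull K \<xi>" "d + 1 / real (Suc k)"] mid_hull.base[of \<xi> K]
    by (force simp: d_def[symmetric])
  then obtain v where v: "\<And>k. v k \<in> mid_hull K \<xi>" "\<And>k. nq S (v k) < d + 1 / real (Suc k)" by metis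
  have vl: "v k \<in> l2 S" for k using v Vl by blast
  \<comment> \<open>The midpoint of \<open>u\<close> and \<open>w\<close> lies in the hull, so its
    squared norm is at least \<open>d\<close>, and the parallelogram law leaves little room for the
    difference.\<close>
  have close: "nq S (\<lambda>z. u z - w z) \<le> 2 * a + 2 * b"
    if "u \<in> mid_hull K \<xi>" "w \<in> mid_hull K \<xi>" "nq S u \<le> d + a" "nq S w \<le> d + b" for u w a b
    using nq_parallelogram[OF Vl[OF that(1)] Vl[OF that(2)]] dle[OF mid_hull.mid[OF that(1,2)]] that(3,4)
    by simp
  have vv: "nq S (\<lambda>z. v j z - v k z) \<le> 2 * (1 / real (Suc j)) + 2 * (1 / real (Suc k))" for j k
    using v(2)[of j] v(2)[of k] by (intro close v) auto
  have "\<exists>\<eta>\<in>l2 S. (\<lambda>k. nq S (\<lambda>z. v k z - \<eta> z)) \<longlonglongrightarrow> 0"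
  proof (rule l2_complete[OF vl])
    fix e :: real assume "e > 0"
    then obtain n where n: "1 / real (Suc n) < e / 4" using nat_approx_posE[of "e/4"] by auto
    show "\<exists>K. \<forall>j\<ge>K. \<forall>k\<ge>K. nq S (\<lambda>z. v j z - v k z) < e"
    proof (intro exI[of _ n] allI impI)
      fix j k assume jk: "n \<le> j" "n \<le> k"
      then have "1 / real (Suc j) \<le> 1 / real (Suc n)" "1 / real (Suc k) \<le> 1 / real (Suc n)"
        by (auto simp: frac_le)
      then show "nq S (\<lambda>z. v j z - v k z) < e" using vv[of j k] n by linarith
    qed
  qed
  then obtain \<eta> where \<eta>: "\<eta> \<in> l2 S" "(\<lambda>k. nq S (\<lambda>z. v k z - \<eta> z)) \<longlonglongrightarrow> 0" by auto
  have lim1: "(\<lambda>k. 1 / real (Suc k)) \<longlonglongrightarrow> 0" using LIMSEQ_inverse_real_of_nat by (simp add: inverse_eq_divide)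
  have inv: "\<eta> \<in> inv_l2 K"
  proof (rule inv_l2I[OF \<eta>(1)])
    fix g assume g: "g \<in> K"
    then have gc: "g \<in> carrier G" using Kc by auto
    \<comment> \<open>Two uses of \<open>nq_triangle2\<close>, through \<open>rep g (v k)\<close>
      and then \<open>v k\<close>, produce 6 and 16; \<open>rep g (v k)\<close> and
      \<open>v k\<close> are close because both are almost minimal in the hull.\<close>
    have bd: "nq S (\<lambda>z. rep g \<eta> z - \<eta> z) \<le> 6 * nq S (\<lambda>z. v k z - \<eta> z) + 16 * (1 / real (Suc k))" for k
    proof -
      have "nq S (rep g (v k)) \<le> d + 1 / real (Suc k)" using v(2)[of k] nq_rep[OF gc vl] by simp
      then have 1: "nq S (\<lambda>z. rep g (v k) z - v k z) \<le> 2 * (1 / real (Suc k)) + 2 * (1 / real (Suc k))"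
        using v(2)[of k] by (intro close v mid_hull.rep g) auto
      have "rep g (\<lambda>z. v k z - \<eta> z) = (\<lambda>z. rep g (v k) z - rep g \<eta> z)" by (simp add: rep_def)
      then have 2: "nq S (\<lambda>z. rep g (v k) z - rep g \<eta> z) = nq S (\<lambda>z. v k z - \<eta> z)"
        using nq_rep[OF gc l2_diff[OF vl \<eta>(1)]] by metis
      have "nq S (\<lambda>z. rep g \<eta> z - \<eta> z)
          \<le> 2 * nq S (\<lambda>z. rep g \<eta> z - rep g (v k) z) + 2 * nq S (\<lambda>z. \<eta> z - rep g (v k) z)"
        by (intro nq_triangle2 rep_l2 gc \<eta>(1) vl)
      moreover have "nq S (\<lambda>z. \<eta> z - rep g (v k) z) \<le> 2 * nq S (\<lambda>z. \<eta> z - v k z) + 2 * nq S (\<lambda>z. rep g (v k) z - v k z)"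
        by (intro nq_triangle2 rep_l2 gc \<eta>(1) vl)
      ultimately show ?thesis using 1 2 nq_minus_commute[of S "rep g \<eta>" "rep g (v k)"]
        nq_minus_commute[of S \<eta> "v k"] by linarith
    qed
    have "(\<lambda>k. 6 * nq S (\<lambda>z. v k z - \<eta> z) + 16 * (1 / real (Suc k))) \<longlonglongrightarrow> 6 * 0 + 16 * 0"
      by (intro tendsto_intros \<eta> lim1)
    then have "nq S (\<lambda>z. rep g \<eta> z - \<eta> z) \<le> 6 * 0 + 16 * 0"
      by (rule LIMSEQ_le_const) (use bd in auto)
    then have "nq S (\<lambda>z. rep g \<eta> z - \<eta> z) = 0" using nq_nonneg[of S "\<lambda>z. rep g \<eta> z - \<eta> z"] by linarith
    then show "AE z in S. rep g \<eta> z = \<eta> z"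
      by (subst (asm) nq_eq_0_iff) (auto intro!: l2_diff rep_l2 gc \<eta>(1))
  qed
  show ?thesis
  proof (rule that[OF inv])
    fix \<zeta> assume z: "\<zeta> \<in> inv_l2 K"
    have "(\<lambda>k. ip S (v k) \<zeta>) \<longlonglongrightarrow> ip S \<eta> \<zeta>"
      by (rule ip_tendsto[OF vl \<eta>(1) inv_l2D(1)[OF z] \<eta>(2)])
    moreover have "ip S (v k) \<zeta> = ip S \<xi> \<zeta>" for k by (rule hull_ip[OF v(1) Kc \<xi> z])
    ultimately have "ip S \<eta> \<zeta> = ip S \<xi> \<zeta>" by (simp add: LIMSEQ_const_iff)
    then show "ip S (\<lambda>z. \<xi> z - \<eta> z) \<zeta> = 0"
      using ip_diff_left[OF \<xi> \<eta>(1) inv_l2D(1)[OF z]] by simp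
  next
    fix e assume e: "\<And>g. g \<in> K \<Longrightarrow> nq S (\<lambda>z. rep g \<xi> z - \<xi> z) \<le> e"
    have bd: "nq S (\<lambda>z. \<xi> z - \<eta> z) \<le> 2 * e + 2 * nq S (\<lambda>z. v k z - \<eta> z)" for k
    proof -
      have "nq S (\<lambda>z. rep \<one> (v k) z - \<xi> z) \<le> e"
        using hull_dist[OF v(1) K \<xi> e] subgroup.one_closed[OF K] by blast
      moreover have "nq S (\<lambda>z. rep \<one> (v k) z - \<xi> z) = nq S (\<lambda>z. v k z - \<xi> z)"
        by (intro nq_cong_AE l2_diff rep_l2 vl \<xi>) (auto simp: rep_one)
      ultimately show ?thesis using nq_triangle2[OF \<xi> \<eta>(1) vl[of k]]
        nq_minus_commute[of S \<xi> "v k"] nq_minus_commute[of S \<eta> "v k"] by linarith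
    qed
    have "(\<lambda>k. 2 * e + 2 * nq S (\<lambda>z. v k z - \<eta> z)) \<longlonglongrightarrow> 2 * e + 2 * 0"
      by (intro tendsto_intros \<eta>)
    then have "nq S (\<lambda>z. \<xi> z - \<eta> z) \<le> 2 * e + 2 * 0"
      by (rule LIMSEQ_le_const) (use bd in auto)
    then show "nq S (\<lambda>z. \<xi> z - \<eta> z) \<le> 2 * e" by simp
  qed
qed

end

section \<open>Separable models and relative property (T)\<close>

lemma ip_scale_right: "ip S h (\<lambda>z. c * f z) = cnj c * ip S h f"
  by (simp add: ip_def mult.left_commute[of _ "cnj c"])

lemma cring_complex_ring: "cring complex_ring"
proof (rule cringI)
  show "abelian_group complex_ring"
  proof (rule abelian_groupI)
    fix x assume "x \<in> carrier complex_ring"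
    then show "\<exists>y\<in>carrier complex_ring. y \<oplus>\<^bsub>complex_ring\<^esub> x = \<zero>\<^bsub>complex_ring\<^esub>"
      by (intro bexI[of _ "- x"]) (auto simp: complex_ring_def)
  qed (auto simp: complex_ring_def)
  show "comm_monoid complex_ring"
    by (rule comm_monoidI) (auto simp: complex_ring_def)
qed (auto simp: complex_ring_def algebra_simps)

text \<open>The representation lives in the closed subspace \<open>W = {e\<^sub>m}\<^sup>\<bottom>\<^sup>\<bottom>\<close> generated by a
  countable family of vectors; the coefficients against that family embed \<open>W\<close> into
  \<open>nat \<Rightarrow> complex\<close>, the type over which relative property (T) is formulated.\<close>

locale l2_sequence_model = mp_action G S T for G (structure) and S :: "'z measure" and T +
  fixes e :: "nat \<Rightarrow> 'z \<Rightarrow> complex"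
  assumes e_l2: "e m \<in> l2 S"
    and e_rep: "\<lbrakk>g \<in> carrier G; h \<in> l2 S; \<And>m. ip S (e m) h = 0\<rbrakk> \<Longrightarrow> ip S (rep g (e m)) h = 0"
begin

definition W :: "('z \<Rightarrow> complex) set" where
  "W = {f \<in> l2 S. \<forall>h\<in>l2 S. (\<forall>m. ip S (e m) h = 0) \<longrightarrow> ip S f h = 0}"

definition enc :: "('z \<Rightarrow> complex) \<Rightarrow> nat \<Rightarrow> complex" where
  "enc f = (\<lambda>m. ip S f (e m))"

text \<open>A choice of representative; by \<open>enc_inj\<close> it is determined by
  \<open>s\<close> up to a null set.\<close>

definition dec :: "(nat \<Rightarrow> complex) \<Rightarrow> 'z \<Rightarrow> complex" where
  "dec s = (SOME f. f \<in> W \<and> enc f = s)"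

text \<open>Vectors are coefficient sequences with coordinatewise operations, but the inner product
  is transported from \<open>S\<close>, since the family \<open>e\<close> need not be orthonormal.
  That the chosen representatives do not matter is \<open>hinner_enc\<close>.\<close>

definition H :: "(nat \<Rightarrow> complex) hilbert" where
  "H = \<lparr>carrier = enc ` W, mult = (\<lambda>s t. s), one = (\<lambda>m. 0), zero = (\<lambda>m. 0),
     add = (\<lambda>s t m. s m + t m), smult = (\<lambda>c s m. c * s m), hinner = (\<lambda>s t. ip S (dec s) (dec t))\<rparr>"

text \<open>Extensional outside the carrier, as elements of \<open>Bij (carrier H)\<close> have to
  be.\<close>

definition \<pi> :: "'a \<Rightarrow> (nat \<Rightarrow> complex) \<Rightarrow> nat \<Rightarrow> complex" where
  "\<pi> g = (\<lambda>s\<in>carrier H. enc (rep g (dec s)))"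

lemma W_l2: "f \<in> W \<Longrightarrow> f \<in> l2 S" by (simp add: W_def)

lemma e_W: "e m \<in> W" by (simp add: W_def e_l2)

lemma W_add: "f \<in> W \<Longrightarrow> g \<in> W \<Longrightarrow> (\<lambda>z. f z + g z) \<in> W"
  by (auto simp: W_def ip_add_left intro: l2_add)

lemma W_diff: "f \<in> W \<Longrightarrow> g \<in> W \<Longrightarrow> (\<lambda>z. f z - g z) \<in> W"
  by (auto simp: W_def ip_diff_left intro: l2_diff)

lemma W_scale: "f \<in> W \<Longrightarrow> (\<lambda>z. c * f z) \<in> W"
  by (auto simp: W_def ip_scale_left intro: l2_scale)

lemma W_zero: "(\<lambda>z. 0) \<in> W" by (simp add: W_def)

lemma W_rep:
  assumes "g \<in> carrier G" "f \<in> W" shows "rep g f \<in> W"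
proof -
  have "ip S (rep g f) h = 0" if h: "h \<in> l2 S" "\<And>m. ip S (e m) h = 0" for h
  proof -
    have "ip S (e m) (rep (inv g) h) = 0" for m
      using ip_rep_left[OF assms(1) e_l2 h(1)] e_rep[OF assms(1) h] by metis
    then show ?thesis using assms h ip_rep_left[OF assms(1) W_l2[OF assms(2)] h(1)]
      by (auto simp: W_def rep_l2)
  qed
  then show ?thesis using assms by (auto simp: W_def rep_l2)
qed

lemma W_limit:
  assumes "\<And>k::nat. s k \<in> W" "f \<in> l2 S" "(\<lambda>k. nq S (\<lambda>z. s k z - f z)) \<longlonglongrightarrow> 0"
  shows "f \<in> W"
proof -
  have "ip S f h = 0" if h: "h \<in> l2 S" "\<forall>m. ip S (e m) h = 0" for h
  proof -
    have "(\<lambda>k. ip S (s k) h) \<longlonglongrightarrow> ip S f h"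
      using assms h by (intro ip_tendsto) (auto intro: W_l2)
    moreover have "ip S (s k) h = 0" for k using assms(1)[of k] h by (simp add: W_def)
    ultimately show ?thesis by (simp add: LIMSEQ_const_iff)
  qed
  then show ?thesis using assms by (simp add: W_def)
qed

lemma enc_add: "f \<in> l2 S \<Longrightarrow> g \<in> l2 S \<Longrightarrow> enc (\<lambda>z. f z + g z) = (\<lambda>m. enc f m + enc g m)"
  by (simp add: enc_def ip_add_left e_l2)

lemma enc_diff: "f \<in> l2 S \<Longrightarrow> g \<in> l2 S \<Longrightarrow> enc (\<lambda>z. f z - g z) = (\<lambda>m. enc f m - enc g m)"
  by (simp add: enc_def ip_diff_left e_l2)

lemma enc_scale: "enc (\<lambda>z. c * f z) = (\<lambda>m. c * enc f m)"
  by (simp add: enc_def ip_scale_left)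

lemma enc_cong: "f \<in> l2 S \<Longrightarrow> g \<in> l2 S \<Longrightarrow> AE z in S. f z = g z \<Longrightarrow> enc f = enc g"
  by (auto simp: enc_def e_l2 intro!: ip_cong_AE)

text \<open>An element of \<open>W\<close> orthogonal to every \<open>e m\<close> is orthogonal to
  all of \<open>W\<close>, in particular to itself. This makes \<open>enc\<close> injective up to
  null sets.\<close>

lemma enc_eq_0:
  assumes "f \<in> W" "enc f = (\<lambda>m. 0)" shows "AE z in S. f z = 0"
proof -
  have "ip S (e m) f = 0" for m using fun_cong[OF assms(2), of m] ip_cnj[of S "e m" f] by (simp add: enc_def)
  then have "ip S f f = 0" using assms by (simp add: W_def)
  then show ?thesis using nq_eq_0_iff[OF W_l2[OF assms(1)]] by (simp add: ip_self)
qed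

lemma enc_inj:
  assumes "f \<in> W" "g \<in> W" "enc f = enc g" shows "AE z in S. f z = g z"
  using enc_eq_0[OF W_diff[OF assms(1,2)]] assms by (simp add: enc_diff W_l2)

lemma dec_W: "s \<in> carrier H \<Longrightarrow> dec s \<in> W" "s \<in> carrier H \<Longrightarrow> enc (dec s) = s"
  using someI_ex[of "\<lambda>f. f \<in> W \<and> enc f = s"] by (auto simp: H_def dec_def)

lemma enc_H: "f \<in> W \<Longrightarrow> enc f \<in> carrier H" by (simp add: H_def)

lemma dec_enc: "f \<in> W \<Longrightarrow> AE z in S. dec (enc f) z = f z"
  using enc_inj dec_W enc_H by metis

lemma H_cases: assumes "s \<in> carrier H" obtains f where "f \<in> W" "s = enc f"
  using assms dec_W by metis

lemma hinner_enc: "f \<in> W \<Longrightarrow> g \<in> W \<Longrightarrow> hinner H (enc f) (enc g) = ip S f g"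
  using dec_enc dec_W enc_H by (auto simp: H_def intro!: ip_cong_AE W_l2)

lemma add_enc: "f \<in> W \<Longrightarrow> g \<in> W \<Longrightarrow> enc f \<oplus>\<^bsub>H\<^esub> enc g = enc (\<lambda>z. f z + g z)"
  by (simp add: enc_add W_l2 H_def)

lemma smult_enc: "c \<odot>\<^bsub>H\<^esub> enc f = enc (\<lambda>z. c * f z)"
  by (simp add: enc_scale H_def)

lemma zero_enc: "\<zero>\<^bsub>H\<^esub> = enc (\<lambda>z. 0)"
  by (simp add: enc_def H_def)

lemma pi_enc:
  assumes "g \<in> carrier G" "f \<in> W" shows "\<pi> g (enc f) = enc (rep g f)"
  using assms dec_W[OF enc_H[OF assms(2)]]
  by (auto simp: \<pi>_def enc_H intro!: enc_cong W_rep rep_cong_AE dec_enc W_l2)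

lemma H_abelian: "abelian_group H"
proof (rule abelian_groupI)
  fix x assume "x \<in> carrier H"
  then obtain f where f: "f \<in> W" "x = enc f" by (rule H_cases)
  show "\<exists>y\<in>carrier H. y \<oplus>\<^bsub>H\<^esub> x = \<zero>\<^bsub>H\<^esub>"
    using W_scale[OF f(1), of "-1"] f
    by (intro bexI[of _ "enc (\<lambda>z. -1 * f z)"]) (simp_all add: add_enc zero_enc enc_H)
next
  show "x \<oplus>\<^bsub>H\<^esub> y \<in> carrier H" if "x \<in> carrier H" "y \<in> carrier H" for x y
    using that by (elim H_cases) (auto simp: add_enc enc_H W_add)
  show "\<zero>\<^bsub>H\<^esub> \<in> carrier H" by (simp add: zero_enc enc_H W_zero)
qed (auto simp: H_def algebra_simps)

lemma minus_enc: "f \<in> W \<Longrightarrow> g \<in> W \<Longrightarrow> enc f \<ominus>\<^bsub>H\<^esub> enc g = enc (\<lambda>z. f z - g z)"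
proof -
  assume fg: "f \<in> W" "g \<in> W"
  interpret abelian_group H by (rule H_abelian)
  have "\<ominus>\<^bsub>H\<^esub> enc g = enc (\<lambda>z. (-1) * g z)"
    using fg W_scale[OF fg(2), of "-1"] by (intro minus_equality) (simp_all add: add_enc zero_enc enc_H)
  then have "enc f \<ominus>\<^bsub>H\<^esub> enc g = enc f \<oplus>\<^bsub>H\<^esub> enc (\<lambda>z. (-1) * g z)" by (simp add: a_minus_def)
  also have "\<dots> = enc (\<lambda>z. f z + (-1) * g z)" by (rule add_enc[OF fg(1) W_scale[OF fg(2)]])
  finally show ?thesis by simp
qed

lemma hnorm_enc: "f \<in> W \<Longrightarrow> hnorm H (enc f) = sqrt (nq S f)"
  by (simp add: hnorm_def hinner_enc ip_self)

lemma H_hilbert: "complex_hilbert_space H"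
proof (intro complex_hilbert_space.intro complex_hilbert_space_axioms.intro)
  show "module complex_ring H"
  proof (rule moduleI[OF cring_complex_ring H_abelian])
    show "a \<odot>\<^bsub>H\<^esub> x \<in> carrier H" if "x \<in> carrier H" for a x
      using that by (elim H_cases) (auto simp: smult_enc enc_H W_scale)
  qed (auto simp: complex_ring_def H_def algebra_simps)
  show "hinner H (x \<oplus>\<^bsub>H\<^esub> y) z = hinner H x z + hinner H y z"
    if "x \<in> carrier H" "y \<in> carrier H" "z \<in> carrier H" for x y z
    using that by (elim H_cases) (simp add: add_enc hinner_enc W_add ip_add_left W_l2)
  show "hinner H (c \<odot>\<^bsub>H\<^esub> x) z = c * hinner H x z" if "x \<in> carrier H" "z \<in> carrier H" for c x z
    using that by (elim H_cases) (simp add: smult_enc hinner_enc W_scale ip_scale_left)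
  show "hinner H y x = cnj (hinner H x y)" for x y
    unfolding H_def by simp (rule ip_cnj)
  show "0 < Re (hinner H x x)" if x: "x \<in> carrier H" "x \<noteq> \<zero>\<^bsub>H\<^esub>" for x
  proof -
    obtain f where f: "f \<in> W" "x = enc f" using x(1) by (rule H_cases)
    have "nq S f \<noteq> 0"
      using x(2) f enc_cong[of f "\<lambda>z. 0"] by (auto simp: nq_eq_0_iff[OF W_l2] zero_enc W_l2)
    then show ?thesis using f nq_nonneg[of S f] by (simp add: hinner_enc ip_self order_less_le)
  qed
  show "\<exists>l\<in>carrier H. (\<lambda>k. hnorm H (s k \<ominus>\<^bsub>H\<^esub> l)) \<longlonglongrightarrow> 0"
    if s: "\<And>k::nat. s k \<in> carrier H"
      and c: "\<And>e. e > 0 \<Longrightarrow> \<exists>K. \<forall>j\<ge>K. \<forall>k\<ge>K. hnorm H (s j \<ominus>\<^bsub>H\<^esub> s k) < e" for s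
  proof -
    define f where "f k = dec (s k)" for k
    have f: "f k \<in> W" "s k = enc (f k)" for k using dec_W[OF s[of k]] by (simp_all add: f_def)
    have hn: "hnorm H (s j \<ominus>\<^bsub>H\<^esub> s k) = sqrt (nq S (\<lambda>z. f j z - f k z))" for j k
      using f by (simp add: minus_enc hnorm_enc W_diff)
    have "\<exists>g\<in>l2 S. (\<lambda>k. nq S (\<lambda>z. f k z - g z)) \<longlonglongrightarrow> 0"
    proof (rule l2_complete)
      fix e :: real assume "e > 0"
      then obtain K where "\<forall>j\<ge>K. \<forall>k\<ge>K. hnorm H (s j \<ominus>\<^bsub>H\<^esub> s k) < sqrt e" using c[of "sqrt e"] by auto
      then show "\<exists>K. \<forall>j\<ge>K. \<forall>k\<ge>K. nq S (\<lambda>z. f j z - f k z) < e" unfolding hn by auto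
    qed (use f W_l2 in auto)
    then obtain g where g: "g \<in> l2 S" "(\<lambda>k. nq S (\<lambda>z. f k z - g z)) \<longlonglongrightarrow> 0" by auto
    have gW: "g \<in> W" by (rule W_limit[OF f(1) g])
    have "(\<lambda>k. sqrt (nq S (\<lambda>z. f k z - g z))) \<longlonglongrightarrow> sqrt 0" by (intro tendsto_real_sqrt g)
    then show ?thesis using f gW
      by (intro bexI[of _ "enc g"]) (simp_all add: minus_enc hnorm_enc W_diff enc_H)
  qed
qed

lemma pi_carrier: "g \<in> carrier G \<Longrightarrow> s \<in> carrier H \<Longrightarrow> \<pi> g s \<in> carrier H"
  by (elim H_cases) (simp add: pi_enc W_rep enc_H)

lemma pi_mult:
  assumes "g \<in> carrier G" "h \<in> carrier G" "s \<in> carrier H"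
  shows "\<pi> (g \<otimes> h) s = \<pi> g (\<pi> h s)"
proof -
  obtain f where f: "f \<in> W" "s = enc f" using assms(3) by (rule H_cases)
  then show ?thesis using assms
    by (auto simp: pi_enc W_rep rep_mult intro!: enc_cong rep_l2 W_l2)
qed

lemma pi_one: "s \<in> carrier H \<Longrightarrow> \<pi> \<one> s = s"
  by (elim H_cases) (auto simp: pi_enc rep_one intro!: enc_cong W_rep W_l2)

lemma pi_Bij: "g \<in> carrier G \<Longrightarrow> \<pi> g \<in> Bij (carrier H)"
proof -
  assume g: "g \<in> carrier G"
  have "bij_betw (\<pi> g) (carrier H) (carrier H)"
    by (rule bij_betwI[where g="\<pi> (inv g)"])
       (use g in \<open>auto simp: pi_carrier pi_mult[symmetric] pi_one\<close>)
  then show ?thesis by (simp add: Bij_def) (simp add: \<pi>_def)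
qed

lemma H_unitary: "unitary_rep G H \<pi>"
  unfolding unitary_rep_def
proof (intro conjI ballI H_hilbert)
  show "group_action G (carrier H) \<pi>"
    unfolding group_action_def
  proof (intro group_hom.intro group_hom_axioms.intro group_axioms group_BijGroup homI)
    show "\<pi> x \<in> carrier (BijGroup (carrier H))" if "x \<in> carrier G" for x
      using pi_Bij[OF that] by (simp add: BijGroup_def)
    show "\<pi> (x \<otimes> y) = \<pi> x \<otimes>\<^bsub>BijGroup (carrier H)\<^esub> \<pi> y" if "x \<in> carrier G" "y \<in> carrier G" for x y
    proof
      fix s show "\<pi> (x \<otimes> y) s = (\<pi> x \<otimes>\<^bsub>BijGroup (carrier H)\<^esub> \<pi> y) s"
        using that pi_mult[OF that, of s] by (simp add: BijGroup_def pi_Bij compose_def) (simp add: \<pi>_def)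
    qed
  qed
next
  fix g assume g: "g \<in> carrier G"
  show "linear_isometry_on H H (\<pi> g)"
    unfolding linear_isometry_on_def
  proof (intro conjI ballI allI)
    show "\<pi> g \<in> carrier H \<rightarrow> carrier H" using g by (simp add: pi_carrier)
    fix x assume x: "x \<in> carrier H"
    show "\<pi> g (c \<odot>\<^bsub>H\<^esub> x) = c \<odot>\<^bsub>H\<^esub> \<pi> g x" for c
      using x by (elim H_cases) (simp add: smult_enc pi_enc g W_scale, simp add: rep_def)
    fix y assume y: "y \<in> carrier H"
    show "\<pi> g (x \<oplus>\<^bsub>H\<^esub> y) = \<pi> g x \<oplus>\<^bsub>H\<^esub> \<pi> g y"
      using x y by (elim H_cases) (simp add: add_enc pi_enc g W_add W_rep, simp add: rep_def)
    show "hinner H (\<pi> g x) (\<pi> g y) = hinner H x y"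
      using x y by (elim H_cases) (simp add: pi_enc g W_rep hinner_enc ip_rep W_l2)
  qed
qed

end

text \<open>If the components of the \<open>\<xi> k\<close> orthogonal to the
  \<open>G0\<close>-invariant vectors stayed away from 0, then, normalized, they would still be
  almost invariant under \<open>G\<close>. The representation generated by them would weakly contain
  the trivial one and yet have no \<open>G0\<close>-invariant vector other than 0.\<close>

theorem (in mp_action) relative_T_almost_invariant:
  assumes T: "relative_property_T G G0" and G0: "G0 \<lhd> G" and cG: "countable (carrier G)"
    and \<xi>: "\<And>k::nat. \<xi> k \<in> l2 S" "\<And>k. nq S (\<xi> k) = 1"
    and ai: "\<And>g. g \<in> carrier G \<Longrightarrow> (\<lambda>k. nq S (\<lambda>z. rep g (\<xi> k) z - \<xi> k z)) \<longlonglongrightarrow> 0"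
    and d: "d > 0"
  obtains k \<eta> where "\<eta> \<in> inv_l2 G0" "nq S (\<lambda>z. \<xi> k z - \<eta> z) < d"
proof (rule ccontr)
  assume neg: "\<not> thesis"
  note G0s = normal_imp_subgroup[OF G0]
  have G0c: "G0 \<subseteq> carrier G" using G0s by (rule subgroup.subset)
  have "\<exists>\<eta>. \<eta> \<in> inv_l2 G0 \<and> (\<forall>\<theta>. \<theta> \<in> inv_l2 G0 \<longrightarrow> ip S (\<lambda>z. \<xi> k z - \<eta> z) \<theta> = 0)" for k
    using invariant_projection[OF G0s \<xi>(1)[of k]] by metis
  then obtain \<eta> where \<eta>: "\<And>k. \<eta> k \<in> inv_l2 G0"
    "\<And>k \<theta>. \<theta> \<in> inv_l2 G0 \<Longrightarrow> ip S (\<lambda>z. \<xi> k z - \<eta> k z) \<theta> = 0" by metis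
  define \<zeta> where "\<zeta> k = (\<lambda>z. \<xi> k z - \<eta> k z)" for k
  have \<eta>l: "\<eta> k \<in> l2 S" for k using \<eta>(1) by (rule inv_l2D)
  have \<zeta>l: "\<zeta> k \<in> l2 S" for k unfolding \<zeta>_def by (intro l2_diff \<xi> \<eta>l)
  have \<zeta>o: "ip S (\<zeta> k) \<theta> = 0" if "\<theta> \<in> inv_l2 G0" for k \<theta> using \<eta>(2)[OF that] by (simp add: \<zeta>_def)
  have \<zeta>d: "nq S (\<zeta> k) \<ge> d" for k using neg that[OF \<eta>(1)] by (force simp: \<zeta>_def not_less)
  \<comment> \<open>Here normality enters: the space of \<open>G0\<close>-invariant vectors is
    stable under all of \<open>G\<close>, because \<open>h \<otimes> g = g \<otimes> h'\<close> with
    a conjugate \<open>h'\<close> of \<open>h\<close>.\<close>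
  have rinv: "rep g \<theta> \<in> inv_l2 G0" if g: "g \<in> carrier G" and th: "\<theta> \<in> inv_l2 G0" for g \<theta>
  proof (rule inv_l2I)
    show "rep g \<theta> \<in> l2 S" using g th by (auto intro: rep_l2 inv_l2D)
    fix h assume h: "h \<in> G0"
    then have hc: "h \<in> carrier G" using G0c by auto
    define h' where "h' = inv g \<otimes> h \<otimes> g"
    have h': "h' \<in> G0" "h' \<in> carrier G" using normal.inv_op_closed1[OF G0 g h] G0c by (auto simp: h'_def)
    have e: "h \<otimes> g = g \<otimes> h'" using g hc by (simp add: h'_def m_assoc[symmetric])
    have "AE z in S. rep g (rep h' \<theta>) z = rep g \<theta> z"
      by (rule rep_cong_AE[OF g inv_l2D(2)[OF th h'(1)]])
    moreover have "AE z in S. rep h (rep g \<theta>) z = rep g (rep h' \<theta>) z"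
      using g hc h' by (intro AE_I2) (simp add: rep_mult[symmetric] e)
    ultimately show "AE z in S. rep h (rep g \<theta>) z = rep g \<theta> z" by eventually_elim simp
  qed
  \<comment> \<open>The decomposition of \<open>\<xi> k\<close> into \<open>\<eta> k\<close> and
    \<open>\<zeta> k\<close> is carried along by \<open>g\<close>, so by Pythagoras the displacement
    of a component is at most that of the whole vector.\<close>
  have \<zeta>ai: "nq S (\<lambda>z. rep g (\<zeta> k) z - \<zeta> k z) \<le> nq S (\<lambda>z. rep g (\<xi> k) z - \<xi> k z)"
    if g: "g \<in> carrier G" for g k
  proof -
    define a where "a = (\<lambda>z. rep g (\<zeta> k) z - \<zeta> k z)"
    define b where "b = (\<lambda>z. rep g (\<eta> k) z - \<eta> k z)"
    have l: "a \<in> l2 S" "b \<in> l2 S" unfolding a_def b_def by (intro l2_diff rep_l2 g \<zeta>l \<eta>l)+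
    have "ip S a (rep g (\<eta> k)) = 0" "ip S a (\<eta> k) = 0"
      using \<zeta>o[OF rinv[OF g \<eta>(1)], of k] \<zeta>o[OF \<eta>(1), of k] \<zeta>o[OF rinv[OF inv_closed[OF g] \<eta>(1)], of k]
        \<zeta>o[OF rinv[OF inv_closed[OF g] rinv[OF g \<eta>(1)]], of k] g
      by (simp_all add: a_def ip_diff_left \<zeta>l \<eta>l rep_l2 ip_rep ip_rep_left)
    then have "ip S a b = 0" unfolding b_def
      using ip_diff_right[OF rep_l2[OF g \<eta>l] \<eta>l l(1)] by simp
    then have "nq S (\<lambda>z. a z + b z) = nq S a + nq S b" using nq_add[OF l] by simp
    moreover have "(\<lambda>z. a z + b z) = (\<lambda>z. rep g (\<xi> k) z - \<xi> k z)"
      by (auto simp: a_def b_def \<zeta>_def rep_def)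
    ultimately show ?thesis using nq_nonneg[of S b] by (simp add: a_def)
  qed
  \<comment> \<open>All translates of all \<open>\<zeta> k\<close> in one sequence; up to null sets
    it is stable under \<open>G\<close>, so the subspace \<open>W\<close> that it generates is
    invariant.\<close>
  define e where "e m = (case prod_decode m of (i, k) \<Rightarrow> rep (from_nat_into (carrier G) i) (\<zeta> k))" for m
  have ne: "carrier G \<noteq> {}" using one_closed by blast
  have fni: "from_nat_into (carrier G) i \<in> carrier G" for i by (rule from_nat_into[OF ne])
  have eI: "\<exists>m. e m = rep g (\<zeta> k)" if gc: "g \<in> carrier G" for g k
  proof -
    obtain i where "from_nat_into (carrier G) i = g" using from_nat_into_surj[OF cG gc] by auto
    then have "e (prod_encode (i, k)) = rep g (\<zeta> k)" by (simp add: e_def)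
    then show ?thesis ..
  qed
  interpret l2_sequence_model G S T e
  proof
    show "e m \<in> l2 S" for m by (auto simp: e_def split: prod.split intro!: rep_l2 \<zeta>l fni)
    show "ip S (rep g (e m)) h = 0"
      if g: "g \<in> carrier G" and h: "h \<in> l2 S" and z: "\<And>m. ip S (e m) h = 0" for g h m
    proof -
      obtain i k where m: "prod_decode m = (i, k)" by fastforce
      let ?i = "from_nat_into (carrier G) i"
      have "ip S (rep g (e m)) h = ip S (rep (g \<otimes> ?i) (\<zeta> k)) h"
        using g fni h m by (intro ip_cong_AE) (auto simp: e_def rep_mult intro!: rep_l2 \<zeta>l)
      then show ?thesis using eI[OF m_closed[OF g fni], of i k] z by metis
    qed
  qed
  have \<zeta>W: "\<zeta> k \<in> W" for k
  proof -
    have "rep \<one> (\<zeta> k) \<in> W" using eI[OF one_closed, of k] e_W by metis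
    moreover have "ip S (\<zeta> k) h = ip S (rep \<one> (\<zeta> k)) h" if "h \<in> l2 S" for h
      using that by (intro ip_cong_AE) (auto simp: rep_one intro!: rep_l2 \<zeta>l)
    ultimately show ?thesis by (auto simp: W_def \<zeta>l)
  qed
  \<comment> \<open>Invariant vectors are orthogonal to each translate of each
    \<open>\<zeta> k\<close>, hence to \<open>W\<close>. A unit vector of \<open>W\<close> fixed by
    \<open>G0\<close> would be orthogonal to itself.\<close>
  have Wo: "ip S f \<theta> = 0" if f: "f \<in> W" and th: "\<theta> \<in> inv_l2 G0" for f \<theta>
  proof -
    have "ip S (e m) \<theta> = 0" for m
    proof -
      obtain i k where m: "prod_decode m = (i, k)" by fastforce
      show ?thesis using m \<zeta>o[OF rinv[OF inv_closed[OF fni] th]] inv_l2D(1)[OF th]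
        by (simp add: e_def ip_rep_left[OF fni \<zeta>l])
    qed
    then show ?thesis using f inv_l2D(1)[OF th] by (simp add: W_def)
  qed
  have "weakly_contains G H \<pi> complex_line trivial_rep"
    unfolding weakly_contains_def
  proof (intro ballI allI impI, elim conjE)
    fix x :: complex and F and \<epsilon> :: real
    assume F: "finite F" "F \<subseteq> carrier G" and eps: "\<epsilon> > 0"
    define b where "b g k = (cmod x)\<^sup>2 * sqrt (nq S (\<lambda>z. rep g (\<xi> k) z - \<xi> k z) / d)" for g k
    have "(\<lambda>k. b g k) \<longlonglongrightarrow> (cmod x)\<^sup>2 * sqrt (0 / d)" if "g \<in> F" for g
      unfolding b_def using that F d by (intro tendsto_intros ai) auto
    then have "\<forall>g\<in>F. \<forall>\<^sub>F k in sequentially. b g k < \<epsilon>"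
      using eps by (intro ballI order_tendstoD(2)) auto
    then have "\<forall>\<^sub>F k in sequentially. \<forall>g\<in>F. b g k < \<epsilon>"
      using F(1) by (simp add: eventually_ball_finite_distrib)
    then obtain k where k: "\<And>g. g \<in> F \<Longrightarrow> b g k < \<epsilon>"
      using eventually_happens'[OF sequentially_bot] by blast
    \<comment> \<open>Scales \<open>\<zeta> k\<close> to norm \<open>cmod x\<close>, so that a
      single summand approximates the coefficient \<open>x * cnj x\<close> of the trivial
      representation. The lower bound \<open>d\<close> for \<open>nq S (\<zeta> k)\<close> controls
      the error after scaling.\<close>
    define c where "c = x / of_real (sqrt (nq S (\<zeta> k)))"
    have np: "nq S (\<zeta> k) > 0" using d \<zeta>d[of k] by linarith
    have cc: "c * cnj c * of_real (nq S (\<zeta> k)) = x * cnj x"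
      using np by (simp add: c_def flip: of_real_mult)
    define u where "u = (\<lambda>z. c * \<zeta> k z)"
    have u: "u \<in> W" unfolding u_def by (intro W_scale \<zeta>W)
    have "cmod (hinner complex_line (trivial_rep g x) x - (\<Sum>i<(1::nat). hinner H (\<pi> g (enc u)) (enc u))) < \<epsilon>"
      if g: "g \<in> F" for g
    proof -
      have gc: "g \<in> carrier G" using g F by auto
      have ru: "rep g u = (\<lambda>z. c * rep g (\<zeta> k) z)" by (simp add: u_def rep_def)
      have "hinner H (\<pi> g (enc u)) (enc u) = ip S (rep g u) u"
        using u gc by (simp add: pi_enc hinner_enc W_rep)
      also have "\<dots> = c * cnj c * ip S (rep g (\<zeta> k)) (\<zeta> k)"
        by (simp add: ru, simp add: u_def ip_scale_left ip_scale_right)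
      finally have 1: "hinner H (\<pi> g (enc u)) (enc u) = c * cnj c * ip S (rep g (\<zeta> k)) (\<zeta> k)" .
      have "x * cnj x - c * cnj c * ip S (rep g (\<zeta> k)) (\<zeta> k)
          = c * cnj c * (ip S (\<zeta> k) (\<zeta> k) - ip S (rep g (\<zeta> k)) (\<zeta> k))"
        by (simp add: right_diff_distrib ip_self cc)
      also have "\<dots> = - (c * cnj c * ip S (\<lambda>z. rep g (\<zeta> k) z - \<zeta> k z) (\<zeta> k))"
        using gc by (simp add: ip_diff_left rep_l2 \<zeta>l right_diff_distrib)
      finally have 2: "cmod (x * cnj x - c * cnj c * ip S (rep g (\<zeta> k)) (\<zeta> k))
          = (cmod c)\<^sup>2 * cmod (ip S (\<lambda>z. rep g (\<zeta> k) z - \<zeta> k z) (\<zeta> k))"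
        by (simp add: norm_mult power2_eq_square)
      have c2: "(cmod c)\<^sup>2 = (cmod x)\<^sup>2 / nq S (\<zeta> k)"
        using np by (simp add: c_def norm_divide power_divide)
      have "cmod (ip S (\<lambda>z. rep g (\<zeta> k) z - \<zeta> k z) (\<zeta> k))
          \<le> sqrt (nq S (\<lambda>z. rep g (\<zeta> k) z - \<zeta> k z) * nq S (\<zeta> k))"
        using ip_cauchy_schwarz[OF l2_diff[OF rep_l2[OF gc \<zeta>l] \<zeta>l] \<zeta>l] by (simp add: real_le_rsqrt)
      also have "\<dots> \<le> sqrt (nq S (\<lambda>z. rep g (\<xi> k) z - \<xi> k z) * nq S (\<zeta> k))"
        using \<zeta>ai[OF gc, of k] np by (simp add: mult_right_mono)
      finally have "(cmod c)\<^sup>2 * cmod (ip S (\<lambda>z. rep g (\<zeta> k) z - \<zeta> k z) (\<zeta> k))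
          \<le> (cmod x)\<^sup>2 * (sqrt (nq S (\<lambda>z. rep g (\<xi> k) z - \<xi> k z) * nq S (\<zeta> k)) / nq S (\<zeta> k))"
        using np unfolding c2 by (simp add: divide_right_mono mult_left_mono)
      also have "sqrt (nq S (\<lambda>z. rep g (\<xi> k) z - \<xi> k z) * nq S (\<zeta> k)) / nq S (\<zeta> k)
          = sqrt (nq S (\<lambda>z. rep g (\<xi> k) z - \<xi> k z) / nq S (\<zeta> k))"
        using np by (simp add: real_sqrt_mult real_sqrt_divide real_div_sqrt field_simps)
      also have "(cmod x)\<^sup>2 * \<dots> \<le> b g k"
        unfolding b_def using np d \<zeta>d[of k] by (intro mult_left_mono real_sqrt_le_mono divide_left_mono) auto
      finally show ?thesis using k[OF g] 1 2
        by (simp add: complex_line_def trivial_rep_def)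
    qed
    then show "\<exists>(m::nat) \<eta>. (\<forall>i<m. \<eta> i \<in> carrier H) \<and>
      (\<forall>g\<in>F. cmod (hinner complex_line (trivial_rep g x) x - (\<Sum>i<m. hinner H (\<pi> g (\<eta> i)) (\<eta> i))) < \<epsilon>)"
      using u by (intro exI[of _ 1] exI[of _ "\<lambda>_. enc u"]) (auto simp: enc_H)
  qed
  with T H_unitary have "contains_rep G0 H \<pi> complex_line trivial_rep"
    unfolding relative_property_T_def by blast
  then obtain V where V: "linear_isometry_on complex_line H V"
    "\<And>g y. g \<in> G0 \<Longrightarrow> V (trivial_rep g y) = \<pi> g (V y)"
    by (auto simp: contains_rep_def complex_line_def)
  have V1: "V 1 \<in> carrier H" "hinner H (V 1) (V 1) = 1"
    using V(1) by (auto simp: linear_isometry_on_def complex_line_def)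
  obtain f where f: "f \<in> W" "V 1 = enc f" using V1(1) by (rule H_cases)
  have "f \<in> inv_l2 G0"
  proof (rule inv_l2I[OF W_l2[OF f(1)]])
    fix g assume g: "g \<in> G0"
    then have gc: "g \<in> carrier G" using G0c by auto
    have "enc (rep g f) = enc f" using V(2)[OF g, of 1] f gc by (simp add: pi_enc trivial_rep_def)
    then show "AE z in S. rep g f z = f z" using enc_inj W_rep gc f by blast
  qed
  then have "ip S f f = 0" using Wo f by blast
  moreover have "ip S f f = 1" using V1(2) f by (simp add: hinner_enc)
  ultimately show False by simp
qed

section \<open>Profinite systems\<close>

text \<open>The properties of an inverse limit that the argument uses, in terms of coordinates:
  \<open>refine\<close> says that a coordinate determines the earlier ones,
  \<open>equivariant\<close> that the action descends to each coordinate, \<open>generated\<close>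
  that the coordinates determine the measurable sets.\<close>

locale profinite_system = mp_action G M \<alpha> + prob_space M
    for G (structure) and M :: "(nat \<Rightarrow> 'b) measure" and \<alpha> +
  fixes G0 :: "'a set"
  assumes G0_normal: "G0 \<lhd> G" and countable_G: "countable (carrier G)"
    and level_measurable: "level_set M n a \<in> sets M"
    and finite_level: "finite ((\<lambda>x. x n) ` space M)"
    and refine: "\<lbrakk>x \<in> space M; y \<in> space M; x (Suc n) = y (Suc n)\<rbrakk> \<Longrightarrow> x n = y n"
    and equivariant: "\<lbrakk>g \<in> carrier G; x \<in> space M; y \<in> space M; x n = y n\<rbrakk> \<Longrightarrow> \<alpha> g x n = \<alpha> g y n"
    and generated: "sets M = sigma_sets (space M) {level_set M n a | n a. True}"
    and G0_ergodic: "ergodic_on G0 M \<alpha>"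
begin

text \<open>Indexed by a point instead of a vertex of the n-th finite space, so the level sets along
  a branch are nested and, for \<open>x\<close> in the space, nonempty.\<close>

abbreviation X :: "nat \<Rightarrow> (nat \<Rightarrow> 'b) \<Rightarrow> (nat \<Rightarrow> 'b) set" where
  "X n x \<equiv> level_set M n (x n)"

definition St :: "nat \<Rightarrow> (nat \<Rightarrow> 'b) \<Rightarrow> 'a set" where
  "St n x = {g \<in> carrier G. \<alpha> g x n = x n}"

definition cyl :: "nat \<Rightarrow> 'b set \<Rightarrow> (nat \<Rightarrow> 'b) set" where
  "cyl n A = {x \<in> space M. x n \<in> A}"

lemma X_iff: "y \<in> X n x \<longleftrightarrow> y \<in> space M \<and> y n = x n"
  by (auto simp: level_set_def)

lemma X_sets [measurable, simp]: "X n x \<in> sets M"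
  by (rule level_measurable)

lemma refine_le: "m \<le> n \<Longrightarrow> x \<in> space M \<Longrightarrow> y \<in> space M \<Longrightarrow> x n = y n \<Longrightarrow> x m = y m"
  by (induction rule: inc_induct) (auto intro: refine)

lemma G0_subgroup: "subgroup G0 G"
  by (rule normal_imp_subgroup[OF G0_normal])

lemma G0_carrier: "g \<in> G0 \<Longrightarrow> g \<in> carrier G"
  using G0_subgroup subgroup.subset by blast

lemma \<alpha>_level_iff:
  "\<lbrakk>g \<in> carrier G; x \<in> space M; y \<in> space M\<rbrakk> \<Longrightarrow> \<alpha> g x n = \<alpha> g y n \<longleftrightarrow> x n = y n"
  using equivariant[of g x y n] equivariant[of "inv g" "\<alpha> g x" "\<alpha> g y" n] T_space by auto

lemma image_X:
  assumes g: "g \<in> carrier G" and x: "x \<in> space M" shows "\<alpha> g ` X n x = X n (\<alpha> g x)"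
proof (intro equalityI subsetI)
  fix y assume "y \<in> \<alpha> g ` X n x"
  then show "y \<in> X n (\<alpha> g x)" using g x by (auto simp: X_iff T_space \<alpha>_level_iff)
next
  fix y assume "y \<in> X n (\<alpha> g x)"
  then have y: "y \<in> space M" "y n = \<alpha> g x n" by (auto simp: X_iff)
  then have "\<alpha> (inv g) y n = x n"
    using equivariant[of "inv g" y "\<alpha> g x" n] g x T_space by simp
  then show "y \<in> \<alpha> g ` X n x"
    using g y T_space by (intro image_eqI[of _ _ "\<alpha> (inv g) y"]) (auto simp: X_iff)
qed

text \<open>Level sets are blocks: an element of \<open>G\<close> maps a level set onto a level set
  of the same depth, so it stabilizes one as soon as it keeps the coordinate of one of its
  points.\<close>

lemma St_eq: "x \<in> space M \<Longrightarrow> set_stabilizer G \<alpha> (X n x) = St n x"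
proof (intro equalityI subsetI)
  fix g assume x: "x \<in> space M" and "g \<in> set_stabilizer G \<alpha> (X n x)"
  then have g: "g \<in> carrier G" "X n (\<alpha> g x) = X n x" by (auto simp: set_stabilizer_def image_X)
  then have "\<alpha> g x \<in> X n x" using x T_space by (auto simp: X_iff)
  then show "g \<in> St n x" using g by (auto simp: St_def X_iff)
next
  fix g assume x: "x \<in> space M" and g: "g \<in> St n x"
  then show "g \<in> set_stabilizer G \<alpha> (X n x)" by (auto simp: set_stabilizer_def image_X St_def)
qed

lemma St_carrier: "g \<in> St n x \<Longrightarrow> g \<in> carrier G"
  by (simp add: St_def)

lemma St_subgroup: "x \<in> space M \<Longrightarrow> subgroup (St n x) G"
proof (rule subgroupI)
  assume x: "x \<in> space M"
  show "St n x \<subseteq> carrier G" by (auto simp: St_def)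
  show "St n x \<noteq> {}" using x T_one by (auto simp: St_def intro!: exI[of _ \<one>])
  show "inv g \<in> St n x" if "g \<in> St n x" for g
    using that x equivariant[of "inv g" "\<alpha> g x" x n] T_space by (auto simp: St_def)
  show "g \<otimes> h \<in> St n x" if "g \<in> St n x" "h \<in> St n x" for g h
    using that x equivariant[of g "\<alpha> h x" x n] T_space by (auto simp: St_def T_mult)
qed

lemma St_X:
  assumes "x \<in> space M" "y \<in> X n x" shows "St n y = St n x"
  using assms \<alpha>_level_iff[of _ x y n] by (auto simp: St_def X_iff)

lemma St_level_iff: "\<lbrakk>x \<in> space M; y \<in> space M; g \<in> St n x\<rbrakk> \<Longrightarrow> \<alpha> g y \<in> X n x \<longleftrightarrow> y \<in> X n x"
  using \<alpha>_level_iff[of g y x n] T_space by (auto simp: St_def X_iff)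

lemma St_antimono: "m \<le> n \<Longrightarrow> x \<in> space M \<Longrightarrow> St n x \<subseteq> St m x"
  using refine_le T_space by (auto simp: St_def)

lemma X_antimono: "m \<le> n \<Longrightarrow> x \<in> space M \<Longrightarrow> X n x \<subseteq> X m x"
  using refine_le by (auto simp: X_iff)

lemma cyl_eq: "cyl n A = (\<Union>a\<in>A \<inter> (\<lambda>x. x n) ` space M. level_set M n a)"
  by (auto simp: cyl_def level_set_def)

lemma cyl_sets [measurable, simp]: "cyl n A \<in> sets M"
  unfolding cyl_eq by (intro sets.finite_UN level_measurable) (auto intro: finite_level)

lemma cyl_raise: "m \<le> n \<Longrightarrow> cyl m A = cyl n ((\<lambda>x. x n) ` cyl m A)"
  using refine_le[of m n] unfolding cyl_def by force

lemma cyl_UN: "(\<Union>i\<in>I. cyl n (A i)) = cyl n (\<Union>i\<in>I. A i)" by (auto simp: cyl_def)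

text \<open>Approximable sets form a \<sigma>-algebra. For a countable union, half of
  \<open>e\<close> pays for cutting it off at \<open>N\<close>; the other half is shared by the
  first \<open>N\<close> approximations, which \<open>cyl_raise\<close> brings to a common
  level.\<close>

lemma cyl_approx0:
  assumes "E \<in> sets M" "e > 0"
  shows "\<exists>n A. measure M ((E - cyl n A) \<union> (cyl n A - E)) < e"
  using assms unfolding generated
proof (induction arbitrary: e rule: sigma_sets.induct)
  case (Basic a)
  then obtain n b where "a = level_set M n b" by auto
  then have "a = cyl n {b}" by (auto simp: cyl_def level_set_def)
  then have "(a - cyl n {b}) \<union> (cyl n {b} - a) = {}" by auto
  then show ?case using Basic(2) by (metis measure_empty)
next
  case Empty
  have "({} - cyl 0 {}) \<union> (cyl 0 {} - {}) = {}" by (auto simp: cyl_def)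
  then show ?case using Empty by (metis measure_empty)
next
  case (Compl a)
  then obtain n A where nA: "measure M ((a - cyl n A) \<union> (cyl n A - a)) < e" by blast
  have "a \<in> sets M" using Compl generated by simp
  then have "a \<subseteq> space M" by (rule sets.sets_into_space)
  then have "((space M - a) - cyl n (- A)) \<union> (cyl n (- A) - (space M - a)) = (a - cyl n A) \<union> (cyl n A - a)"
    by (auto simp: cyl_def)
  then show ?case using nA by metis
next
  case (Union a)
  have aM [measurable]: "a i \<in> sets M" for i using Union generated by simp
  have "(\<lambda>n. measure M (\<Union>i<n. a i)) \<longlonglongrightarrow> measure M (\<Union>n. \<Union>i<n. a i)"
    by (intro finite_Lim_measure_incseq) (auto simp: incseq_def intro: less_le_trans)
  moreover have "(\<Union>n. \<Union>i<n. a i) = (\<Union>i. a i)" by auto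
  ultimately have "(\<lambda>n. measure M (\<Union>i<n. a i)) \<longlonglongrightarrow> measure M (\<Union>i. a i)" by simp
  then have "\<forall>\<^sub>F n in sequentially. measure M (\<Union>i. a i) - e / 2 < measure M (\<Union>i<n. a i)"
    using Union(3) by (intro order_tendstoD) auto
  then obtain N where N: "measure M (\<Union>i. a i) - e / 2 < measure M (\<Union>i<N. a i)"
    using eventually_happens'[OF sequentially_bot] by blast
  have "\<exists>n A. measure M ((a i - cyl n A) \<union> (cyl n A - a i)) < e / (2 * real (Suc N))" for i
    using Union by simp
  then obtain k A where kA: "\<And>i. measure M ((a i - cyl (k i) (A i)) \<union> (cyl (k i) (A i) - a i)) < e / (2 * real (Suc N))"
    by metis
  define n where "n = Max (k ` {..N})"
  have kn: "i < N \<Longrightarrow> k i \<le> n" for i unfolding n_def by (intro Max_ge) auto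
  define C where "C = (\<Union>i<N. (\<lambda>x. x n) ` cyl (k i) (A i))"
  have C: "cyl n C = (\<Union>i<N. cyl (k i) (A i))"
    unfolding C_def cyl_UN[symmetric] using kn cyl_raise by auto
  have "measure M (((\<Union>i. a i) - cyl n C) \<union> (cyl n C - (\<Union>i. a i)))
     \<le> measure M (((\<Union>i. a i) - (\<Union>i<N. a i)) \<union> (\<Union>i<N. (a i - cyl (k i) (A i)) \<union> (cyl (k i) (A i) - a i)))"
    unfolding C by (intro finite_measure_mono) auto
  also have "\<dots> \<le> measure M ((\<Union>i. a i) - (\<Union>i<N. a i))
      + measure M (\<Union>i<N. (a i - cyl (k i) (A i)) \<union> (cyl (k i) (A i) - a i))"
    by (intro measure_Un_le) auto
  also have "measure M (\<Union>i<N. (a i - cyl (k i) (A i)) \<union> (cyl (k i) (A i) - a i))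
      \<le> (\<Sum>i<N. measure M ((a i - cyl (k i) (A i)) \<union> (cyl (k i) (A i) - a i)))"
    by (intro finite_measure_subadditive_finite) auto
  also have "\<dots> \<le> (\<Sum>i<N. e / (2 * real (Suc N)))"
    using kA by (intro sum_mono less_imp_le)
  also have "\<dots> \<le> e / 2" using Union(3) by (simp add: field_simps)
  also have "measure M ((\<Union>i. a i) - (\<Union>i<N. a i)) = measure M (\<Union>i. a i) - measure M (\<Union>i<N. a i)"
    by (intro finite_measure_Diff) auto
  finally have "measure M (((\<Union>i. a i) - cyl n C) \<union> (cyl n C - (\<Union>i. a i))) < e" using N by simp
  then show ?case by blast
qed

lemma cyl_approx:
  assumes "E \<in> sets M" "e > 0"
  obtains n A where "n \<ge> n0" "measure M ((E - cyl n A) \<union> (cyl n A - E)) < e"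
proof -
  obtain m A where m: "measure M ((E - cyl m A) \<union> (cyl m A - E)) < e"
    using cyl_approx0[OF assms] by blast
  show ?thesis
    using m cyl_raise[of m "max m n0" A] by (intro that[of "max m n0" "(\<lambda>x. x (max m n0)) ` cyl m A"]) auto
qed

text \<open>A substitute for Lebesgue density points: if each level set of positive measure at some
  deep level missed \<open>E\<close> by a fixed proportion, so would every cylinder of that level,
  including one that approximates \<open>E\<close>.\<close>

lemma density:
  assumes E [measurable]: "E \<in> sets M" and pos: "measure M E > 0" and e: "e > 0"
  obtains n x where "n \<ge> n0" "x \<in> space M" "measure M (X n x) > 0"
    "measure M (X n x - E) < e * measure M (X n x)"
proof (rule ccontr)
  note found = that
  assume neg: "\<not> thesis"
  \<comment> \<open>Capping at 1 makes \<open>\<delta> \<le> measure M E / 2\<close>, so the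
    approximating cylinder has more than half of the measure of \<open>E\<close>. A proportion
    \<open>e'\<close> of this cylinder lying outside \<open>E\<close> would then amount to at least
    \<open>\<delta>\<close>.\<close>
  define e' where "e' = min e 1"
  have e': "e' > 0" "e' \<le> 1" "e' \<le> e" using e by (auto simp: e'_def)
  define \<delta> where "\<delta> = e' * measure M E / 2"
  have d: "\<delta> > 0" "\<delta> \<le> measure M E / 2" using e' pos by (auto simp: \<delta>_def mult_left_le_one_le)
  obtain n A where nA: "n \<ge> n0" "measure M ((E - cyl n A) \<union> (cyl n A - E)) < \<delta>"
    using cyl_approx[OF E d(1), of n0] .
  let ?I = "A \<inter> (\<lambda>x. x n) ` space M"
  have fI: "finite ?I" using finite_level by auto
  have b: "e' * measure M (level_set M n a) \<le> measure M (level_set M n a - E)" if aI: "a \<in> ?I" for a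
  proof -
    obtain x where x: "x \<in> space M" "a = x n" using aI by auto
    show ?thesis
    proof (cases "measure M (X n x) > 0")
      case True
      then have "e * measure M (X n x) \<le> measure M (X n x - E)"
        using neg found[OF nA(1) x(1)] by (meson not_le_imp_less)
      moreover have "e' * measure M (X n x) \<le> e * measure M (X n x)" using e' by (intro mult_right_mono) auto
      ultimately show ?thesis using x by simp
    next
      case False
      then have "measure M (X n x) = 0" using measure_nonneg[of M "X n x"] by linarith
      then show ?thesis using x by simp
    qed
  qed
  have disj: "disjoint_family_on (\<lambda>a. level_set M n a) ?I" "disjoint_family_on (\<lambda>a. level_set M n a - E) ?I"
    by (auto simp: disjoint_family_on_def level_set_def)
  have "e' * measure M (cyl n A) = (\<Sum>a\<in>?I. e' * measure M (level_set M n a))"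
    unfolding cyl_eq using fI disj level_measurable
    by (subst finite_measure_finite_Union) (auto simp: sum_distrib_left)
  also have "\<dots> \<le> (\<Sum>a\<in>?I. measure M (level_set M n a - E))" by (intro sum_mono b)
  also have "\<dots> = measure M (\<Union>a\<in>?I. level_set M n a - E)"
    using fI disj level_measurable by (subst finite_measure_finite_Union) auto
  also have "\<dots> = measure M (cyl n A - E)" unfolding cyl_eq by (rule arg_cong[where f="measure M"]) auto
  also have "\<dots> \<le> measure M ((E - cyl n A) \<union> (cyl n A - E))" by (intro finite_measure_mono) auto
  finally have 1: "e' * measure M (cyl n A) < \<delta>" using nA by simp
  have "measure M E \<le> measure M (cyl n A \<union> ((E - cyl n A) \<union> (cyl n A - E)))"
    by (intro finite_measure_mono) auto
  also have "\<dots> \<le> measure M (cyl n A) + measure M ((E - cyl n A) \<union> (cyl n A - E))"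
    by (intro measure_Un_le) auto
  finally have "measure M E / 2 < measure M (cyl n A)" using nA(2) d(2) by simp
  then have "e' * (measure M E / 2) \<le> e' * measure M (cyl n A)" using e' by (intro mult_left_mono) auto
  then show False using 1 by (simp add: \<delta>_def)
qed

lemma invariant_01:
  assumes "A \<in> sets M" "\<And>g. g \<in> G0 \<Longrightarrow> AE x in M. \<alpha> g x \<in> A \<longleftrightarrow> x \<in> A"
  shows "A \<in> null_sets M \<or> space M - A \<in> null_sets M"
  using G0_ergodic assms unfolding ergodic_on_def by (auto simp: null_sets_def)

text \<open>The union of the level sets reached from \<open>x\<close> by \<open>G0\<close> is
  invariant and of positive measure, hence conull by ergodicity, so it meets every other level set
  of positive measure.\<close>

lemma transitive:
  assumes x: "x \<in> space M" and y: "y \<in> space M"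
    and px: "measure M (X n x) > 0" and py: "measure M (X n y) > 0"
  obtains g where "g \<in> G0" "\<alpha> g x n = y n"
proof -
  define A where "A = cyl n {\<alpha> g x n | g. g \<in> G0}"
  have inv: "\<alpha> h z \<in> A \<longleftrightarrow> z \<in> A" if h: "h \<in> G0" and z: "z \<in> space M" for h z
  proof
    note hc = G0_carrier[OF h]
    assume "\<alpha> h z \<in> A"
    then obtain g where g: "g \<in> G0" "\<alpha> h z n = \<alpha> g x n" by (auto simp: A_def cyl_def)
    then have "z n = \<alpha> (inv h \<otimes> g) x n"
      using equivariant[of "inv h" "\<alpha> h z" "\<alpha> g x" n] hc z x T_space G0_carrier by (auto simp: T_mult)
    moreover have "inv h \<otimes> g \<in> G0"
      using h g G0_subgroup by (simp add: subgroup.m_closed subgroup.m_inv_closed)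
    ultimately show "z \<in> A" using z by (auto simp: A_def cyl_def)
  next
    note hc = G0_carrier[OF h]
    assume "z \<in> A"
    then obtain g where g: "g \<in> G0" "z n = \<alpha> g x n" by (auto simp: A_def cyl_def)
    then have "\<alpha> h z n = \<alpha> (h \<otimes> g) x n"
      using equivariant[of h z "\<alpha> g x" n] hc z x T_space G0_carrier by (auto simp: T_mult)
    moreover have "h \<otimes> g \<in> G0" using h g G0_subgroup by (simp add: subgroup.m_closed)
    ultimately show "\<alpha> h z \<in> A" using z hc T_space by (auto simp: A_def cyl_def)
  qed
  have A: "A \<in> sets M" by (simp add: A_def)
  have "\<one> \<in> G0" using G0_subgroup by (rule subgroup.one_closed)
  then have "X n x \<subseteq> A" using T_one[OF x] by (force simp: A_def cyl_def X_iff)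
  then have "A \<notin> null_sets M" using px null_sets_subset[of A M "X n x"]
    by (auto simp: null_sets_def measure_def)
  then have "space M - A \<in> null_sets M" using invariant_01[OF A] inv by blast
  then have "\<not> X n y \<subseteq> space M - A" using py null_sets_subset[of "space M - A" M "X n y"]
    by (auto simp: null_sets_def measure_def)
  then obtain z where "z \<in> A" "z n = y n" by (auto simp: X_iff)
  then show ?thesis using that by (auto simp: A_def cyl_def)
qed

lemma equal_mass:
  assumes "x \<in> space M" "y \<in> space M" "measure M (X n x) > 0" "measure M (X n y) > 0"
  shows "measure M (X n x) = measure M (X n y)"
proof -
  obtain g where g: "g \<in> G0" "\<alpha> g x n = y n" using transitive[OF assms] .
  then have "\<alpha> g ` X n x = X n y" using assms image_X[of g x n] G0_carrier by simp
  then show ?thesis using measure_image_T[of g "X n x"] g G0_carrier by simp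
qed

text \<open>Saturate \<open>B\<close> by \<open>G0\<close>: the result is invariant, hence null or
  conull. Elements outside the stabilizer move \<open>B\<close> off the level set and those inside
  preserve it up to null sets, so the saturation meets the level set only in \<open>B\<close>, up to
  a null set.\<close>

lemma ergodic_level:
  assumes x: "x \<in> space M" and B [measurable]: "B \<in> sets M" and BX: "B \<subseteq> X n x"
    and inv: "\<And>g. g \<in> G0 \<Longrightarrow> g \<in> St n x \<Longrightarrow> AE y in M. \<alpha> g y \<in> B \<longleftrightarrow> y \<in> B"
  shows "B \<in> null_sets M \<or> X n x - B \<in> null_sets M"
proof -
  define A where "A = (\<Union>g\<in>G0. \<alpha> g ` B)"
  have cG0: "countable G0" using countable_G G0_subgroup subgroup.subset countable_subset by metis
  have Bs: "B \<subseteq> space M" using B by (rule sets.sets_into_space)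
  have A [measurable]: "A \<in> sets M" unfolding A_def using G0_carrier
    by (intro sets.countable_UN' cG0) auto
  have 1: "\<alpha> h z \<in> A" if h: "h \<in> G0" and z: "z \<in> A" for h z
  proof -
    obtain g b where gb: "g \<in> G0" "b \<in> B" "z = \<alpha> g b" using z by (auto simp: A_def)
    then have "\<alpha> h z = \<alpha> (h \<otimes> g) b" using h Bs G0_carrier by (auto simp: T_mult)
    moreover have "h \<otimes> g \<in> G0" using h gb G0_subgroup by (simp add: subgroup.m_closed)
    ultimately show ?thesis using gb by (auto simp: A_def)
  qed
  have 2: "z \<in> A" if h: "h \<in> G0" and z: "\<alpha> h z \<in> A" "z \<in> space M" for h z
    using 1[of "inv h" "\<alpha> h z"] h z G0_subgroup G0_carrier[OF h] by (simp add: subgroup.m_inv_closed)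
  have BA: "B \<subseteq> A"
  proof
    fix b assume "b \<in> B"
    then show "b \<in> A" using T_one[of b] Bs subgroup.one_closed[OF G0_subgroup]
      by (force simp: A_def)
  qed
  have "A \<in> null_sets M \<or> space M - A \<in> null_sets M"
    by (rule invariant_01[OF A]) (auto intro!: AE_I2 intro: 1 2)
  then show ?thesis
  proof
    assume "A \<in> null_sets M"
    then show ?thesis using BA B null_sets_subset by blast
  next
    assume null: "space M - A \<in> null_sets M"
    have "X n x \<inter> \<alpha> g ` B - B \<in> null_sets M" if g: "g \<in> G0" for g
    proof (cases "g \<in> St n x")
      case True
      note gc = G0_carrier[OF g]
      have "inv g \<in> G0" "inv g \<in> St n x"
        using g True G0_subgroup St_subgroup[OF x] by (auto intro: subgroup.m_inv_closed)
      then have "AE y in M. \<alpha> (inv g) y \<in> B \<longleftrightarrow> y \<in> B" by (rule inv)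
      then have "AE y in M. y \<notin> X n x \<inter> \<alpha> g ` B - B"
        by eventually_elim (use gc Bs in auto)
      then show ?thesis using gc by (subst (asm) AE_iff_null_sets[symmetric]) auto
    next
      case False
      have "X n x \<inter> \<alpha> g ` B = {}"
      proof (rule ccontr)
        assume "X n x \<inter> \<alpha> g ` B \<noteq> {}"
        then obtain b where b: "b \<in> B" "\<alpha> g b n = x n" by (auto simp: X_iff)
        then have "b n = x n" "b \<in> space M" using BX by (auto simp: X_iff)
        then have "\<alpha> g x n = x n" using b equivariant[of g x b n] G0_carrier[OF g] x by simp
        then show False using False G0_carrier[OF g] by (simp add: St_def)
      qed
      then show ?thesis by (simp add: Int_commute)
    qed
    then have "(\<Union>g\<in>G0. X n x \<inter> \<alpha> g ` B - B) \<in> null_sets M" using cG0 by (intro null_sets_UN') auto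
    then have "(space M - A) \<union> (\<Union>g\<in>G0. X n x \<inter> \<alpha> g ` B - B) \<in> null_sets M"
      using null by (rule null_sets.Un[rotated])
    moreover have "X n x - B \<subseteq> (space M - A) \<union> (\<Union>g\<in>G0. X n x \<inter> \<alpha> g ` B - B)"
      by (auto simp: A_def X_iff)
    ultimately have "X n x - B \<in> null_sets M" using null_sets_subset by (metis B X_sets sets.Diff)
    then show ?thesis by simp
  qed
qed

end

section \<open>Diagonal actions, skew products and indicator vectors\<close>

lemma mp_action_diagonal:
  assumes "mp_action G Z \<tau>" "sigma_finite_measure Z"
  shows "mp_action G (Z \<Otimes>\<^sub>M Z) (\<lambda>g (x, y). (\<tau> g x, \<tau> g y))"
proof -
  interpret mp_action G Z \<tau> by fact
  show ?thesis
  proof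
    fix g assume g: "g \<in> carrier G"
    note [measurable] = T_measurable[OF g]
    show "(\<lambda>(x, y). (\<tau> g x, \<tau> g y)) \<in> Z \<Otimes>\<^sub>M Z \<rightarrow>\<^sub>M Z \<Otimes>\<^sub>M Z" by measurable
    show "distr (Z \<Otimes>\<^sub>M Z) (Z \<Otimes>\<^sub>M Z) (\<lambda>(x, y). (\<tau> g x, \<tau> g y)) = Z \<Otimes>\<^sub>M Z"
      using pair_measure_distr[of "\<tau> g" Z Z "\<tau> g" Z Z] T_distr[OF g] assms(2) by simp
  qed (auto simp: space_pair_measure T_mult T_one)
qed

lemma measurable_pair_countable_snd:
  assumes "countable C" "\<And>l. l \<in> C \<Longrightarrow> (\<lambda>z. f (z, l)) \<in> measurable Z K"
  shows "f \<in> measurable (Z \<Otimes>\<^sub>M count_space C) K"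
proof -
  have "(\<lambda>p. f (snd p, fst p)) \<in> measurable (count_space C \<Otimes>\<^sub>M Z) K"
    using assms by (intro measurable_pair_measure_countable1) auto
  from measurable_compose[OF measurable_pair_swap' this] show ?thesis
    by (simp add: case_prod_beta)
qed

text \<open>Each fibre map permutes \<open>C\<close> and so preserves counting measure; Fubini
  reduces the rest to the base. The fibre maps \<open>c\<close> are left general because two kinds
  occur, with the inverse of \<open>w g y\<close> or of \<open>\<psi> g\<close> multiplied from the
  right.\<close>

lemma mp_action_skew:
  assumes "mp_action G Z \<tau>" "countable C"
    and bij: "\<And>g z. g \<in> carrier G \<Longrightarrow> z \<in> space Z \<Longrightarrow> bij_betw (c g z) C C"
    and meas: "\<And>g l. g \<in> carrier G \<Longrightarrow> l \<in> C \<Longrightarrow> (\<lambda>z. c g z l) \<in> measurable Z (count_space C)"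
    and mult: "\<And>g h z l. \<lbrakk>g \<in> carrier G; h \<in> carrier G; z \<in> space Z; l \<in> C\<rbrakk>
        \<Longrightarrow> c (g \<otimes>\<^bsub>G\<^esub> h) z l = c g (\<tau> h z) (c h z l)"
    and one: "\<And>z l. z \<in> space Z \<Longrightarrow> l \<in> C \<Longrightarrow> c \<one>\<^bsub>G\<^esub> z l = l"
  shows "mp_action G (Z \<Otimes>\<^sub>M count_space C) (\<lambda>g (z, l). (\<tau> g z, c g z l))"
proof -
  interpret mp_action G Z \<tau> by fact
  interpret C: sigma_finite_measure "count_space C"
    using assms(2) by (rule sigma_finite_measure_count_space_countable)
  let ?S = "Z \<Otimes>\<^sub>M count_space C"
  show ?thesis
  proof
    fix g assume g: "g \<in> carrier G"
    note [measurable] = T_measurable[OF g]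
    have m [measurable]: "(\<lambda>(z, l). (\<tau> g z, c g z l)) \<in> measurable ?S ?S"
      using meas[OF g] by (intro measurable_pair_countable_snd assms(2)) simp
    then show "(\<lambda>(z, l). (\<tau> g z, c g z l)) \<in> measurable ?S ?S" .
    show "distr ?S ?S (\<lambda>(z, l). (\<tau> g z, c g z l)) = ?S"
    proof (rule measure_eqI)
      fix E assume "E \<in> sets (distr ?S ?S (\<lambda>(z, l). (\<tau> g z, c g z l)))"
      then have E [measurable]: "E \<in> sets ?S" by simp
      have "emeasure (distr ?S ?S (\<lambda>(z, l). (\<tau> g z, c g z l))) E
          = emeasure ?S ((\<lambda>(z, l). (\<tau> g z, c g z l)) -` E \<inter> space ?S)"
        by (rule emeasure_distr[OF m E])
      also have "\<dots> = (\<integral>\<^sup>+z. \<integral>\<^sup>+l. indicator ((\<lambda>(z, l). (\<tau> g z, c g z l)) -` E \<inter> space ?S) (z, l) \<partial>count_space C \<partial>Z)"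
        by (rule C.emeasure_pair_measure) (rule measurable_sets[OF m E])
      also have "\<dots> = (\<integral>\<^sup>+z. \<integral>\<^sup>+l. indicator E (\<tau> g z, c g z l) \<partial>count_space C \<partial>Z)"
        by (intro nn_integral_cong) (auto simp: indicator_def space_pair_measure)
      also have "\<dots> = (\<integral>\<^sup>+z. \<integral>\<^sup>+l. indicator E (\<tau> g z, l) \<partial>count_space C \<partial>Z)"
        by (intro nn_integral_cong nn_integral_bij_count_space[OF bij] g)
      also have "\<dots> = (\<integral>\<^sup>+z. \<integral>\<^sup>+l. indicator E (z, l) \<partial>count_space C \<partial>distr Z Z (\<tau> g))"
        by (intro nn_integral_distr[symmetric] T_measurable g) measurable
      also have "\<dots> = emeasure ?S E"
        unfolding T_distr[OF g] by (rule C.emeasure_pair_measure[symmetric, OF E])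
      finally show "emeasure (distr ?S ?S (\<lambda>(z, l). (\<tau> g z, c g z l))) E = emeasure ?S E" .
    qed simp
  qed (auto simp: space_pair_measure T_mult T_one mult one)
qed

text \<open>A set and its translate have the same finite measure, so the two halves of their
  symmetric difference weigh the same; this is the factor 2.\<close>

lemma (in mp_action) nq_rep_indicator:
  assumes g: "g \<in> carrier G" and D [measurable]: "D \<in> sets S" and fin: "emeasure S D < \<infinity>"
  shows "(\<lambda>z. of_real c * indicator D z) \<in> l2 S"
    and "nq S (\<lambda>z. rep g (\<lambda>z. of_real c * indicator D z) z - of_real c * indicator D z)
      = 2 * c\<^sup>2 * measure S (D - T g -` D)"
proof -
  note [measurable] = T_measurable[OF g] T_measurable[OF inv_closed[OF g]]
  let ?f = "\<lambda>z. complex_of_real c * indicator D z"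
  define A where "A = T (inv g) -` D \<inter> space S"
  have A [measurable]: "A \<in> sets S" unfolding A_def by (rule measurable_sets[OF T_measurable[OF inv_closed[OF g]] D])
  have eA: "emeasure S A = emeasure S D"
    using emeasure_distr[OF T_measurable[OF inv_closed[OF g]] D] T_distr[OF inv_closed[OF g]] by (simp add: A_def)
  have "integrable S (\<lambda>z. c\<^sup>2 * indicator D z)" using fin by simp
  moreover have "(\<lambda>z. (cmod (?f z))\<^sup>2) = (\<lambda>z. c\<^sup>2 * indicator D z)"
    by (auto simp: indicator_def)
  ultimately show "?f \<in> l2 S" by (simp add: l2_def)
  have "T g -` (A \<inter> D) \<inter> space S = D - (D - T g -` D)"
    using sets.sets_into_space[OF D] T_space[OF g] T_mult[of "inv g" g] g T_one by (auto simp: A_def)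
  then have "emeasure S (A \<inter> D) = emeasure S (D - (D - T g -` D))"
    using emeasure_distr[OF T_measurable[OF g], of "A \<inter> D"] T_distr[OF g] by simp
  then have AD: "measure S (A \<inter> D) = measure S (D - (D - T g -` D))" by (simp add: measure_def)
  have DD: "D - T g -` D \<in> sets S"
  proof -
    have "D - T g -` D = D - (T g -` D \<inter> space S)" using sets.sets_into_space[OF D] by auto
    then show ?thesis using measurable_sets[OF T_measurable[OF g] D] D by (metis sets.Diff)
  qed
  have fA: "A \<in> fmeasurable S" "D \<in> fmeasurable S" using fin eA by (auto intro: fmeasurableI)
  have "measure S ((A - D) \<union> (D - A)) = measure S (A - D) + measure S (D - A)"
    using fA by (intro measure_Un_AE) auto
  also have "\<dots> = (measure S A - measure S (A \<inter> D)) + (measure S D - measure S (A \<inter> D))"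
    using fA measure_Diff[of S A "A \<inter> D"] measure_Diff[of S D "A \<inter> D"]
    by (simp add: Diff_Int fmeasurable_def top_unique less_top[symmetric])
  also have "measure S (A \<inter> D) = measure S D - measure S (D - T g -` D)"
    unfolding AD using fA DD by (intro measure_Diff) (auto simp: fmeasurable_def top_unique less_top[symmetric])
  also have "measure S A = measure S D" using eA by (simp add: measure_def)
  finally have m: "measure S ((A - D) \<union> (D - A)) = 2 * measure S (D - T g -` D)" by simp
  have "nq S (\<lambda>z. rep g ?f z - ?f z) = (\<integral>z. c\<^sup>2 * indicator ((A - D) \<union> (D - A)) z \<partial>S)"
    unfolding nq_def
  proof (rule Bochner_Integration.integral_cong[OF refl])
    fix z assume "z \<in> space S"
    then show "(cmod (rep g ?f z - ?f z))\<^sup>2 = c\<^sup>2 * indicator ((A - D) \<union> (D - A)) z"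
      by (auto simp: rep_def A_def indicator_def)
  qed
  also have "\<dots> = 2 * c\<^sup>2 * measure S (D - T g -` D)" using m by simp
  finally show "nq S (\<lambda>z. rep g ?f z - ?f z) = 2 * c\<^sup>2 * measure S (D - T g -` D)" .
qed

section \<open>Masses of level sets and functions of one coordinate\<close>

context profinite_system
begin

definition regular :: "(nat \<Rightarrow> 'b) \<Rightarrow> bool" where
  "regular x \<longleftrightarrow> x \<in> space M \<and> (\<forall>n. measure M (X n x) > 0)"

lemma AE_regular: "AE x in M. regular x"
proof -
  have "AE x in M. measure M (X n x) > 0" for n
  proof -
    let ?I = "{a \<in> (\<lambda>x. x n) ` space M. measure M (level_set M n a) = 0}"
    have "(\<Union>a\<in>?I. level_set M n a) \<in> null_sets M"
      using finite_level[of n] level_measurable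
      by (intro null_sets_UN' countable_finite) (auto simp: null_sets_def emeasure_eq_measure)
    moreover have "{x \<in> space M. \<not> measure M (X n x) > 0} \<subseteq> (\<Union>a\<in>?I. level_set M n a)"
    proof
      fix x assume "x \<in> {x \<in> space M. \<not> measure M (X n x) > 0}"
      then have "x \<in> space M" "measure M (X n x) = 0" using measure_nonneg[of M "X n x"] by auto
      then show "x \<in> (\<Union>a\<in>?I. level_set M n a)" by (intro UN_I[of "x n"]) (auto simp: X_iff)
    qed
    ultimately show ?thesis by (rule AE_I')
  qed
  then have "AE x in M. \<forall>n. measure M (X n x) > 0" by (simp add: AE_all_countable)
  then show ?thesis by (auto simp: regular_def intro: AE_mp)
qed

lemma ex_regular: "\<exists>x. regular x"
  using eventually_happens'[OF ae_filter_bot AE_regular] not_empty by simp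

text \<open>The choice of the point is immaterial by \<open>equal_mass\<close>.\<close>

definition mass :: "nat \<Rightarrow> real" where
  "mass n = measure M (X n (SOME x. regular x))"

lemma mass_pos: "mass n > 0"
  using someI_ex[OF ex_regular] by (simp add: mass_def regular_def)

lemma mass_eq: "x \<in> space M \<Longrightarrow> measure M (X n x) > 0 \<Longrightarrow> measure M (X n x) = mass n"
  using someI_ex[OF ex_regular] unfolding mass_def regular_def by (intro equal_mass) auto

lemma AE_mass: "AE x in M. measure M (X n x) = mass n"
  using AE_regular by eventually_elim (auto simp: regular_def intro: mass_eq)

lemma same_level_sets [measurable]: "{z \<in> space (M \<Otimes>\<^sub>M M). fst z n = snd z n} \<in> sets (M \<Otimes>\<^sub>M M)"
proof -
  have "{z \<in> space (M \<Otimes>\<^sub>M M). fst z n = snd z n}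
      = (\<Union>a\<in>(\<lambda>x. x n) ` space M. level_set M n a \<times> level_set M n a)"
    by (auto simp: space_pair_measure level_set_def)
  then show ?thesis by (simp only:) (intro sets.finite_UN finite_level pair_measureI level_measurable)
qed

text \<open>Almost every fibre of the relation of agreeing in coordinate \<open>n\<close> is a level
  set of measure \<open>mass n\<close>, over either factor.\<close>

lemma measure_same_level:
  assumes B [measurable]: "B \<in> sets M"
  shows "measure (M \<Otimes>\<^sub>M M) {z \<in> space (M \<Otimes>\<^sub>M M). fst z n = snd z n \<and> fst z \<in> B} = mass n * measure M B"
    "measure (M \<Otimes>\<^sub>M M) {z \<in> space (M \<Otimes>\<^sub>M M). fst z n = snd z n \<and> snd z \<in> B} = mass n * measure M B"
proof -
  interpret P: pair_prob_space M M ..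
  have 0: "{z \<in> space (M \<Otimes>\<^sub>M M). fst z n = snd z n \<and> fst z \<in> B} \<in> sets (M \<Otimes>\<^sub>M M)"
    "{z \<in> space (M \<Otimes>\<^sub>M M). fst z n = snd z n \<and> snd z \<in> B} \<in> sets (M \<Otimes>\<^sub>M M)"
    using same_level_sets[of n] by auto
  have "(\<integral>\<^sup>+x. emeasure M (X n x) * indicator B x \<partial>M) = (\<integral>\<^sup>+x. ennreal (mass n) * indicator B x \<partial>M)"
    by (rule nn_integral_cong_AE, use AE_mass[of n] in eventually_elim) (simp add: emeasure_eq_measure)
  also have "\<dots> = ennreal (mass n * measure M B)"
    using mass_pos[of n] by (simp add: nn_integral_cmult_indicator emeasure_eq_measure ennreal_mult)
  finally have 1: "(\<integral>\<^sup>+x. emeasure M (X n x) * indicator B x \<partial>M) = ennreal (mass n * measure M B)" .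
  have "emeasure (M \<Otimes>\<^sub>M M) {z \<in> space (M \<Otimes>\<^sub>M M). fst z n = snd z n \<and> fst z \<in> B}
      = (\<integral>\<^sup>+x. emeasure M (X n x) * indicator B x \<partial>M)"
    unfolding emeasure_pair_measure_alt[OF 0(1)]
    by (intro nn_integral_cong)
       (auto simp: indicator_def space_pair_measure level_set_def vimage_def intro!: arg_cong[where f="emeasure M"])
  then show "measure (M \<Otimes>\<^sub>M M) {z \<in> space (M \<Otimes>\<^sub>M M). fst z n = snd z n \<and> fst z \<in> B} = mass n * measure M B"
    using 1 mass_pos[of n] by (simp add: measure_def)
  have "emeasure (M \<Otimes>\<^sub>M M) {z \<in> space (M \<Otimes>\<^sub>M M). fst z n = snd z n \<and> snd z \<in> B}
      = (\<integral>\<^sup>+x. emeasure M (X n x) * indicator B x \<partial>M)"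
    unfolding P.emeasure_pair_measure_alt2[OF 0(2)]
    by (intro nn_integral_cong)
       (auto simp: indicator_def space_pair_measure level_set_def vimage_def intro!: arg_cong[where f="emeasure M"])
  then show "measure (M \<Otimes>\<^sub>M M) {z \<in> space (M \<Otimes>\<^sub>M M). fst z n = snd z n \<and> snd z \<in> B} = mass n * measure M B"
    using 1 mass_pos[of n] by (simp add: measure_def)
qed

text \<open>Finitely many values account for most of the space, and each of their preimages is close
  to a cylinder; on a common level \<open>m\<close> the value can be read off from
  \<open>x m\<close>.\<close>

lemma level_function_approx:
  assumes f [measurable]: "f \<in> measurable M (count_space C)" and C: "countable C" and e: "e > 0"
  obtains m v where "measure M {x \<in> space M. f x \<noteq> v (x m)} < e"
    "{x \<in> space M. f x \<noteq> v (x m)} \<in> sets M"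
proof -
  define c where "c = from_nat_into C"
  have Cne: "C \<noteq> {}" using measurable_space[OF f] not_empty by auto
  have cs: "range c = C" unfolding c_def using Cne C by (rule range_from_nat_into)
  define E where "E i = {x \<in> space M. f x = c i}" for i
  have E [measurable]: "E i \<in> sets M" for i
    using measurable_sets[OF f, of "{c i}"] cs by (auto simp: E_def vimage_def Int_def conj_commute)
  have UE: "(\<Union>i. E i) = space M" using measurable_space[OF f] cs by (force simp: E_def)
  have "(\<lambda>n. measure M (\<Union>i<n. E i)) \<longlonglongrightarrow> measure M (\<Union>n. \<Union>i<n. E i)"
    by (intro finite_Lim_measure_incseq) (auto simp: incseq_def intro: less_le_trans)
  moreover have "(\<Union>n. \<Union>i<n. E i) = (\<Union>i. E i)" by auto
  ultimately have "(\<lambda>n. measure M (\<Union>i<n. E i)) \<longlonglongrightarrow> 1" by (simp add: UE prob_space)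
  then have "\<forall>\<^sub>F n in sequentially. 1 - e / 2 < measure M (\<Union>i<n. E i)"
    using e by (intro order_tendstoD) auto
  then obtain N where N: "1 - e / 2 < measure M (\<Union>i<N. E i)"
    using eventually_happens'[OF sequentially_bot] by blast
  have "\<exists>n A. measure M ((E i - cyl n A) \<union> (cyl n A - E i)) < e / (2 * real (Suc N))" for i
    using e by (intro cyl_approx0) auto
  then obtain k A where kA: "\<And>i. measure M ((E i - cyl (k i) (A i)) \<union> (cyl (k i) (A i) - E i)) < e / (2 * real (Suc N))"
    by metis
  define m where "m = Max (k ` {..N})"
  have km: "k i \<le> m" if "i < N" for i unfolding m_def using that by (intro Max_ge) auto
  define B where "B i = (\<lambda>x. x m) ` cyl (k i) (A i)" for i
  have B: "cyl m (B i) = cyl (k i) (A i)" if "i < N" for i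
    unfolding B_def using cyl_raise[OF km[OF that]] by simp
  \<comment> \<open>The sets \<open>B i\<close> may overlap. Off \<open>bad\<close>, membership of
    \<open>x m\<close> in \<open>B i\<close> forces \<open>x\<close> into \<open>E i\<close>, so
    every admissible choice yields the right value.\<close>
  define v where "v b = c (SOME i. i < N \<and> b \<in> B i)" for b
  define bad where "bad = (space M - (\<Union>i<N. E i)) \<union> (\<Union>i<N. (E i - cyl m (B i)) \<union> (cyl m (B i) - E i))"
  have bad [measurable]: "bad \<in> sets M" unfolding bad_def by auto
  have good: "f x = v (x m)" if x: "x \<in> space M" "x \<notin> bad" for x
  proof -
    obtain i where i: "i < N" "x \<in> E i" using x by (auto simp: bad_def)
    then have "x m \<in> B i" using x by (auto simp: bad_def cyl_def)
    then have s: "(SOME i. i < N \<and> x m \<in> B i) < N \<and> x m \<in> B (SOME i. i < N \<and> x m \<in> B i)"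
      using i by (intro someI[of "\<lambda>i. i < N \<and> x m \<in> B i"]) auto
    then have "x \<in> E (SOME i. i < N \<and> x m \<in> B i)" using x by (auto simp: bad_def cyl_def)
    then show ?thesis by (simp add: E_def v_def)
  qed
  have "measure M bad \<le> measure M (space M - (\<Union>i<N. E i))
      + measure M (\<Union>i<N. (E i - cyl m (B i)) \<union> (cyl m (B i) - E i))"
    unfolding bad_def by (intro measure_Un_le) auto
  also have "measure M (space M - (\<Union>i<N. E i)) = 1 - measure M (\<Union>i<N. E i)"
    by (intro prob_compl) auto
  also have "measure M (\<Union>i<N. (E i - cyl m (B i)) \<union> (cyl m (B i) - E i))
      \<le> (\<Sum>i<N. measure M ((E i - cyl m (B i)) \<union> (cyl m (B i) - E i)))"
    by (intro finite_measure_subadditive_finite) auto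
  also have "\<dots> \<le> (\<Sum>i<N. e / (2 * real (Suc N)))"
    using kA B by (intro sum_mono less_imp_le) auto
  also have "\<dots> \<le> e / 2" using e by (simp add: field_simps)
  finally have mb: "measure M bad < e" using N by simp
  define J where "J = (\<lambda>x. x m) ` space M"
  have eq: "{x \<in> space M. f x \<noteq> v (x m)} = (\<Union>b\<in>J. level_set M m b - {x \<in> space M. f x = v b})"
    by (auto simp: J_def level_set_def)
  have "{x \<in> space M. f x = v b} \<in> sets M" for b
  proof -
    have "v b \<in> C" using cs by (auto simp: v_def)
    then show ?thesis using measurable_sets[OF f, of "{v b}"] by (auto simp: vimage_def Int_def conj_commute)
  qed
  then have ms: "{x \<in> space M. f x \<noteq> v (x m)} \<in> sets M"
    unfolding eq using finite_level[of m] level_measurable by (intro sets.finite_UN) (auto simp: J_def)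
  have "measure M {x \<in> space M. f x \<noteq> v (x m)} \<le> measure M bad"
    using good by (intro finite_measure_mono) auto
  then show ?thesis using mb ms by (intro that[of v m]) auto
qed

end

section \<open>Cocycles of profinite systems\<close>

text \<open>The cocycle identity is demanded at every point, so that it defines genuine actions on
  products; for an orbit equivalence this is arranged by giving \<open>w\<close> a default value on
  an invariant null set.\<close>

locale cocycle_system = profinite_system G M \<alpha> G0 + L: group L
    for G (structure) and M :: "(nat \<Rightarrow> 'b) measure" and \<alpha> and G0 and L +
  fixes w :: "'a \<Rightarrow> (nat \<Rightarrow> 'b) \<Rightarrow> 'l"
  assumes T: "relative_property_T G G0" and countable_L: "countable (carrier L)"
    and w_measurable: "g \<in> carrier G \<Longrightarrow> w g \<in> measurable M (count_space (carrier L))"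
    and w_mult: "\<lbrakk>g \<in> carrier G; h \<in> carrier G; x \<in> space M\<rbrakk>
      \<Longrightarrow> w (g \<otimes> h) x = w g (\<alpha> h x) \<otimes>\<^bsub>L\<^esub> w h x"
begin

lemma w_closed [simp]: "g \<in> carrier G \<Longrightarrow> x \<in> space M \<Longrightarrow> w g x \<in> carrier L"
  using measurable_space[OF w_measurable] by auto

lemma w_one [simp]: "x \<in> space M \<Longrightarrow> w \<one> x = \<one>\<^bsub>L\<^esub>"
  using w_mult[of \<one> \<one> x] T_one[of x] L.r_cancel_one'[of "w \<one> x" "w \<one> x"] by simp

lemma w_sets [measurable]:
  assumes "g \<in> carrier G" shows "{x \<in> space M. w g x = l} \<in> sets M"
proof (cases "l \<in> carrier L")
  case True
  then show ?thesis using measurable_sets[OF w_measurable[OF assms], of "{l}"]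
    by (auto simp: vimage_def Int_def conj_commute)
next
  case False
  then have "{x \<in> space M. w g x = l} = {}" using w_closed[OF assms] by blast
  then show ?thesis by (simp only: sets.empty_sets)
qed

definition S2 :: "(((nat \<Rightarrow> 'b) \<times> (nat \<Rightarrow> 'b)) \<times> 'l) measure" where
  "S2 = (M \<Otimes>\<^sub>M M) \<Otimes>\<^sub>M count_space (carrier L)"

definition T2 :: "'a \<Rightarrow> ((nat \<Rightarrow> 'b) \<times> (nat \<Rightarrow> 'b)) \<times> 'l \<Rightarrow> ((nat \<Rightarrow> 'b) \<times> (nat \<Rightarrow> 'b)) \<times> 'l" where
  "T2 = (\<lambda>g (z, l). ((\<lambda>(x, y). (\<alpha> g x, \<alpha> g y)) z, w g (fst z) \<otimes>\<^bsub>L\<^esub> l \<otimes>\<^bsub>L\<^esub> inv\<^bsub>L\<^esub> w g (snd z)))"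

lemma mp_action_2: "mp_action G S2 T2"
  unfolding S2_def T2_def
proof (rule mp_action_skew[OF mp_action_diagonal countable_L])
  show "mp_action G M \<alpha>" ..
  show "sigma_finite_measure M" ..
next
  fix g z assume "g \<in> carrier G" "z \<in> space (M \<Otimes>\<^sub>M M)"
  then have w: "w g (fst z) \<in> carrier L" "w g (snd z) \<in> carrier L" by (auto simp: space_pair_measure)
  then show "bij_betw (\<lambda>l. w g (fst z) \<otimes>\<^bsub>L\<^esub> l \<otimes>\<^bsub>L\<^esub> inv\<^bsub>L\<^esub> w g (snd z)) (carrier L) (carrier L)"
    by (intro bij_betwI[where g="\<lambda>l. inv\<^bsub>L\<^esub> w g (fst z) \<otimes>\<^bsub>L\<^esub> l \<otimes>\<^bsub>L\<^esub> w g (snd z)"])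
       (auto simp: L.m_assoc, auto simp: L.m_assoc[symmetric])
next
  fix g l assume g: "g \<in> carrier G" and l: "l \<in> carrier L"
  note [measurable] = w_measurable[OF g]
  have "(\<lambda>z. (w g (fst z), w g (snd z))) \<in> measurable (M \<Otimes>\<^sub>M M) (count_space (carrier L) \<Otimes>\<^sub>M count_space (carrier L))"
    by measurable
  then have "(\<lambda>z. (w g (fst z), w g (snd z))) \<in> measurable (M \<Otimes>\<^sub>M M) (count_space (carrier L \<times> carrier L))"
    by (simp add: pair_measure_countable countable_L)
  from measurable_compose[OF this, of "\<lambda>(a, b). a \<otimes>\<^bsub>L\<^esub> l \<otimes>\<^bsub>L\<^esub> inv\<^bsub>L\<^esub> b" "count_space (carrier L)"]
  show "(\<lambda>z. w g (fst z) \<otimes>\<^bsub>L\<^esub> l \<otimes>\<^bsub>L\<^esub> inv\<^bsub>L\<^esub> w g (snd z)) \<in> measurable (M \<Otimes>\<^sub>M M) (count_space (carrier L))"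
    using l by (simp add: case_prod_beta Pi_def)
next
  fix g h z l
  assume gh: "g \<in> carrier G" "h \<in> carrier G" "z \<in> space (M \<Otimes>\<^sub>M M)" "l \<in> carrier L"
  obtain x y where z: "z = (x, y)" "x \<in> space M" "y \<in> space M" using gh by (auto simp: space_pair_measure)
  have c: "\<alpha> h x \<in> space M" "\<alpha> h y \<in> space M" using gh z T_space by auto
  show "w (g \<otimes> h) (fst z) \<otimes>\<^bsub>L\<^esub> l \<otimes>\<^bsub>L\<^esub> inv\<^bsub>L\<^esub> w (g \<otimes> h) (snd z) =
       w g (fst ((\<lambda>(x, y). (\<alpha> h x, \<alpha> h y)) z)) \<otimes>\<^bsub>L\<^esub> (w h (fst z) \<otimes>\<^bsub>L\<^esub> l \<otimes>\<^bsub>L\<^esub> inv\<^bsub>L\<^esub> w h (snd z)) \<otimes>\<^bsub>L\<^esub>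
       inv\<^bsub>L\<^esub> w g (snd ((\<lambda>(x, y). (\<alpha> h x, \<alpha> h y)) z))"
    using gh z c by (simp add: w_mult L.inv_mult_group L.m_assoc)
qed (auto simp: space_pair_measure)

lemma emeasure_S2:
  assumes "Q \<in> sets (M \<Otimes>\<^sub>M M)"
  shows "Q \<times> {\<one>\<^bsub>L\<^esub>} \<in> sets S2" "emeasure S2 (Q \<times> {\<one>\<^bsub>L\<^esub>}) = emeasure (M \<Otimes>\<^sub>M M) Q"
    "measure S2 (Q \<times> {\<one>\<^bsub>L\<^esub>}) = measure (M \<Otimes>\<^sub>M M) Q"
proof -
  interpret C: sigma_finite_measure "count_space (carrier L)"
    using countable_L by (rule sigma_finite_measure_count_space_countable)
  show "Q \<times> {\<one>\<^bsub>L\<^esub>} \<in> sets S2" unfolding S2_def using assms by (intro pair_measureI) auto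
  show *: "emeasure S2 (Q \<times> {\<one>\<^bsub>L\<^esub>}) = emeasure (M \<Otimes>\<^sub>M M) Q"
    unfolding S2_def using assms by (subst C.emeasure_pair_measure_Times) (auto simp: emeasure_count_space)
  then show "measure S2 (Q \<times> {\<one>\<^bsub>L\<^esub>}) = measure (M \<Otimes>\<^sub>M M) Q" by (simp add: measure_def)
qed

definition Df :: "'a \<Rightarrow> ((nat \<Rightarrow> 'b) \<times> (nat \<Rightarrow> 'b)) set" where
  "Df g = {z \<in> space (M \<Otimes>\<^sub>M M). w g (fst z) \<noteq> w g (snd z)}"

lemma Df_sets: assumes g: "g \<in> carrier G" shows "Df g \<in> sets (M \<Otimes>\<^sub>M M)"
proof -
  have "Df g = space (M \<Otimes>\<^sub>M M) - (\<Union>l\<in>carrier L. {x \<in> space M. w g x = l} \<times> {x \<in> space M. w g x = l})"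
    using w_closed[OF g] by (auto simp: Df_def space_pair_measure)
  moreover have "(\<Union>l\<in>carrier L. {x \<in> space M. w g x = l} \<times> {x \<in> space M. w g x = l}) \<in> sets (M \<Otimes>\<^sub>M M)"
    using countable_L w_sets[OF g] by (intro sets.countable_UN' pair_measureI) auto
  ultimately show ?thesis by auto
qed

definition lev :: "nat \<Rightarrow> ((nat \<Rightarrow> 'b) \<times> (nat \<Rightarrow> 'b)) set" where
  "lev n = {z \<in> space (M \<Otimes>\<^sub>M M). fst z n = snd z n}"

lemma lev_sets [measurable]: "lev n \<in> sets (M \<Otimes>\<^sub>M M)"
  unfolding lev_def by (rule same_level_sets)

text \<open>A point over \<open>(x, y)\<close> in the fibre of the unit stays in that fibre exactly
  when \<open>w g x = w g y\<close>, so the displacement of such an indicator function measures how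
  far \<open>w g\<close> is from being constant.\<close>

lemma diff_T2:
  assumes g: "g \<in> carrier G" and Q: "Q \<subseteq> space (M \<Otimes>\<^sub>M M)"
    and inv: "\<And>x y. (x, y) \<in> Q \<Longrightarrow> (\<alpha> g x, \<alpha> g y) \<in> Q"
  shows "(Q \<times> {\<one>\<^bsub>L\<^esub>}) - T2 g -` (Q \<times> {\<one>\<^bsub>L\<^esub>}) = (Q \<inter> Df g) \<times> {\<one>\<^bsub>L\<^esub>}"
proof -
  have eq: "a \<otimes>\<^bsub>L\<^esub> \<one>\<^bsub>L\<^esub> \<otimes>\<^bsub>L\<^esub> inv\<^bsub>L\<^esub> b = \<one>\<^bsub>L\<^esub> \<longleftrightarrow> a = b" if "a \<in> carrier L" "b \<in> carrier L" for a b
    using that by (metis L.inv_closed L.inv_equality L.inv_inv L.r_inv L.r_one)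
  show ?thesis
  proof (intro equalityI subsetI)
    fix p assume p: "p \<in> (Q \<times> {\<one>\<^bsub>L\<^esub>}) - T2 g -` (Q \<times> {\<one>\<^bsub>L\<^esub>})"
    then obtain x y where xy: "p = ((x, y), \<one>\<^bsub>L\<^esub>)" "(x, y) \<in> Q" by auto
    have m: "x \<in> space M" "y \<in> space M" using xy Q by (auto simp: space_pair_measure)
    then show "p \<in> (Q \<inter> Df g) \<times> {\<one>\<^bsub>L\<^esub>}"
      using p xy inv[OF xy(2)] eq[of "w g x" "w g y"] g by (auto simp: T2_def Df_def space_pair_measure)
  next
    fix p assume p: "p \<in> (Q \<inter> Df g) \<times> {\<one>\<^bsub>L\<^esub>}"
    then obtain x y where xy: "p = ((x, y), \<one>\<^bsub>L\<^esub>)" "(x, y) \<in> Q" "(x, y) \<in> Df g" by auto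
    have m: "x \<in> space M" "y \<in> space M" using xy Q by (auto simp: space_pair_measure)
    then show "p \<in> (Q \<times> {\<one>\<^bsub>L\<^esub>}) - T2 g -` (Q \<times> {\<one>\<^bsub>L\<^esub>})"
      using p xy eq[of "w g x" "w g y"] g by (auto simp: T2_def Df_def)
  qed
qed

text \<open>Approximate \<open>w g\<close> by a function of coordinate \<open>m\<close>. Two points
  that agree in coordinate \<open>n \<ge> m\<close> can have different values only if one of them is
  exceptional, and by \<open>measure_same_level\<close> such pairs have proportion at most
  \<open>2 * measure M B\<close>.\<close>

lemma Df_asymptotic:
  assumes g: "g \<in> carrier G"
  shows "(\<lambda>n. measure (M \<Otimes>\<^sub>M M) (lev n \<inter> Df g) / mass n) \<longlonglongrightarrow> 0"
proof (rule LIMSEQ_I)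
  interpret P: pair_prob_space M M ..
  fix e :: real assume e: "e > 0"
  obtain m v where mv: "measure M {x \<in> space M. w g x \<noteq> v (x m)} < e / 2"
    "{x \<in> space M. w g x \<noteq> v (x m)} \<in> sets M"
    by (rule level_function_approx[OF w_measurable[OF g] countable_L half_gt_zero[OF e]])
  define B where "B = {x \<in> space M. w g x \<noteq> v (x m)}"
  have B [measurable]: "B \<in> sets M" using mv by (simp add: B_def)
  show "\<exists>no. \<forall>n\<ge>no. norm (measure (M \<Otimes>\<^sub>M M) (lev n \<inter> Df g) / mass n - 0) < e"
  proof (intro exI[of _ m] allI impI)
    fix n assume n: "n \<ge> m"
    let ?A = "{z \<in> space (M \<Otimes>\<^sub>M M). fst z n = snd z n \<and> fst z \<in> B}"
    let ?B = "{z \<in> space (M \<Otimes>\<^sub>M M). fst z n = snd z n \<and> snd z \<in> B}"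
    have AB: "?A \<in> sets (M \<Otimes>\<^sub>M M)" "?B \<in> sets (M \<Otimes>\<^sub>M M)"
      using same_level_sets[of n] by auto
    have sub: "lev n \<inter> Df g \<subseteq> ?A \<union> ?B"
    proof
      fix z assume z: "z \<in> lev n \<inter> Df g"
      then have "fst z m = snd z m"
        using refine_le[OF n, of "fst z" "snd z"] by (auto simp: lev_def space_pair_measure)
      then show "z \<in> ?A \<union> ?B" using z by (cases z) (auto simp: lev_def Df_def B_def space_pair_measure)
    qed
    have "measure (M \<Otimes>\<^sub>M M) (lev n \<inter> Df g) \<le> measure (M \<Otimes>\<^sub>M M) (?A \<union> ?B)"
      using AB sub by (intro P.finite_measure_mono) auto
    also have "\<dots> \<le> mass n * measure M B + mass n * measure M B"
      using measure_Un_le[OF AB] by (simp add: measure_same_level)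
    also have "\<dots> < mass n * e"
      using mv mass_pos[of n] by (simp add: B_def)
    finally show "norm (measure (M \<Otimes>\<^sub>M M) (lev n \<inter> Df g) / mass n - 0) < e"
      using mass_pos[of n] by (simp add: divide_less_eq mult.commute abs_of_nonneg)
  qed
qed

text \<open>The invariant vector is close to the indicator function only in total. Distributing the
  error over the level sets of level \<open>n\<close> locates one of them on which it is small
  relative to its measure; this choice precedes \<open>g\<close>, and only the value
  \<open>l\<close> depends on \<open>g\<close>.\<close>

theorem almost_constant:
  assumes d: "d > 0"
  obtains n x where "x \<in> space M" "measure M (X n x) > 0"
    "\<And>g. g \<in> G0 \<Longrightarrow> g \<in> St n x \<Longrightarrow>
      \<exists>l\<in>carrier L. measure M {y \<in> X n x. w g y \<noteq> l} \<le> d * measure M (X n x)"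
proof -
  note found = that
  interpret P: pair_prob_space M M ..
  interpret D: mp_action G S2 T2 by (rule mp_action_2)
  define \<xi> where "\<xi> n = (\<lambda>z. complex_of_real (1 / sqrt (mass n)) * indicator (lev n \<times> {\<one>\<^bsub>L\<^esub>}) z)" for n
  have fin: "emeasure S2 (Q \<times> {\<one>\<^bsub>L\<^esub>}) < \<infinity>" if Qm: "Q \<in> sets (M \<Otimes>\<^sub>M M)" for Q
    using emeasure_S2(2)[OF Qm] by (simp add: P.emeasure_eq_measure)
  have sq: "(1 / sqrt (mass n))\<^sup>2 = 1 / mass n" for n using mass_pos[of n] by (simp add: power_divide)
  note rep_ind = D.nq_rep_indicator[OF _ emeasure_S2(1) fin, where c="1 / sqrt (mass _)"]
  have \<xi>l: "\<xi> n \<in> l2 S2" for n unfolding \<xi>_def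
    using D.nq_rep_indicator(1)[OF _ emeasure_S2(1)[OF lev_sets] fin[OF lev_sets]] one_closed by blast
  have mlev: "measure (M \<Otimes>\<^sub>M M) (lev n) = mass n" for n
  proof -
    have "lev n = {z \<in> space (M \<Otimes>\<^sub>M M). fst z n = snd z n \<and> fst z \<in> space M}"
      by (auto simp: lev_def space_pair_measure)
    then show ?thesis using measure_same_level(1)[of "space M" n] by (simp add: prob_space)
  qed
  have \<xi>1: "nq S2 (\<xi> n) = 1" for n
  proof -
    have "(\<lambda>z. (cmod (\<xi> n z))\<^sup>2) = (\<lambda>z. (1 / mass n) * indicator (lev n \<times> {\<one>\<^bsub>L\<^esub>}) z)"
      using mass_pos[of n] by (auto simp: \<xi>_def indicator_def norm_divide power_divide)
    then show ?thesis using emeasure_S2(1)[OF lev_sets[of n]] mass_pos[of n]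
      by (simp add: nq_def emeasure_S2(3)[OF lev_sets] mlev)
  qed
  have ai: "(\<lambda>n. nq S2 (\<lambda>z. D.rep g (\<xi> n) z - \<xi> n z)) \<longlonglongrightarrow> 0" if g: "g \<in> carrier G" for g
  proof -
    have "nq S2 (\<lambda>z. D.rep g (\<xi> n) z - \<xi> n z) = 2 * (measure (M \<Otimes>\<^sub>M M) (lev n \<inter> Df g) / mass n)" for n
    proof -
      have "nq S2 (\<lambda>z. D.rep g (\<xi> n) z - \<xi> n z) = 2 * (1 / sqrt (mass n))\<^sup>2
          * measure S2 ((lev n \<times> {\<one>\<^bsub>L\<^esub>}) - T2 g -` (lev n \<times> {\<one>\<^bsub>L\<^esub>}))"
        unfolding \<xi>_def by (rule D.nq_rep_indicator(2)[OF g emeasure_S2(1)[OF lev_sets] fin[OF lev_sets]])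
      also have "(lev n \<times> {\<one>\<^bsub>L\<^esub>}) - T2 g -` (lev n \<times> {\<one>\<^bsub>L\<^esub>}) = (lev n \<inter> Df g) \<times> {\<one>\<^bsub>L\<^esub>}"
        using g equivariant by (intro diff_T2) (auto simp: lev_def space_pair_measure T_space)
      also have "measure S2 \<dots> = measure (M \<Otimes>\<^sub>M M) (lev n \<inter> Df g)"
        by (rule emeasure_S2(3)) (use Df_sets[OF g] in auto)
      finally show ?thesis unfolding sq by simp
    qed
    moreover have "(\<lambda>n. 2 * (measure (M \<Otimes>\<^sub>M M) (lev n \<inter> Df g) / mass n)) \<longlonglongrightarrow> 2 * 0"
      by (intro tendsto_intros Df_asymptotic g)
    ultimately show ?thesis by simp
  qed
  \<comment> \<open>The final estimate bounds the proportion of pairs with different values by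
    \<open>2 * e\<close>, which has to be below \<open>d\<close>.\<close>
  define e where "e = d / 3"
  have e: "e > 0" using d by (simp add: e_def)
  obtain n \<eta> where \<eta>: "\<eta> \<in> D.inv_l2 G0" "nq S2 (\<lambda>z. \<xi> n z - \<eta> z) < e"
    using D.relative_T_almost_invariant[OF T G0_normal countable_G \<xi>l \<xi>1 ai e] by blast
  have \<eta>l: "\<eta> \<in> l2 S2" using \<eta>(1) by (rule D.inv_l2D)
  define \<zeta> where "\<zeta> = (\<lambda>z. \<xi> n z - \<eta> z)"
  have \<zeta>l: "\<zeta> \<in> l2 S2" unfolding \<zeta>_def by (intro l2_diff \<xi>l \<eta>l)
  define Q where "Q a = (level_set M n a \<times> level_set M n a) \<times> carrier L" for a
  have Q [measurable]: "Q a \<in> sets S2" for a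
    unfolding Q_def S2_def using level_measurable by (intro pair_measureI) auto
  define I where "I = (\<lambda>x. x n) ` space M"
  have fI: "finite I" unfolding I_def by (rule finite_level)
  have ind_l2: "(\<lambda>z. indicator A z * f z) \<in> l2 S2" if A: "A \<in> sets S2" and f: "f \<in> l2 S2" for A f
  proof -
    have "(\<lambda>z. (cmod (indicator A z * f z))\<^sup>2) = (\<lambda>z. indicator A z * (cmod (f z))\<^sup>2)"
      by (auto simp: indicator_def)
    then show ?thesis using A l2_integrable[OF f] l2_measurable[OF f] integrable_mult_indicator[of A S2 "\<lambda>z. (cmod (f z))\<^sup>2"]
      by (auto simp: l2_def)
  qed
  \<comment> \<open>The blocks are disjoint, so their shares of \<open>nq S2 \<zeta>\<close> add up
    to at most the total.\<close>
  have sumQ: "(\<Sum>a\<in>I. nq S2 (\<lambda>z. indicator (Q a) z * \<zeta> z)) \<le> nq S2 \<zeta>"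
  proof -
    have eq: "(cmod (indicator (Q a) z * \<zeta> z))\<^sup>2 = indicator (Q a) z * (cmod (\<zeta> z))\<^sup>2" for a z
      by (auto simp: indicator_def)
    have int: "integrable S2 (\<lambda>z. indicator (Q a) z * (cmod (\<zeta> z))\<^sup>2)" for a
      using integrable_mult_indicator[OF Q l2_integrable[OF \<zeta>l]] by simp
    have "(\<Sum>a\<in>I. nq S2 (\<lambda>z. indicator (Q a) z * \<zeta> z)) = (\<integral>z. (\<Sum>a\<in>I. indicator (Q a) z * (cmod (\<zeta> z))\<^sup>2) \<partial>S2)"
      unfolding nq_def eq by (rule Bochner_Integration.integral_sum[symmetric]) (rule int)
    also have "\<dots> \<le> nq S2 \<zeta>" unfolding nq_def
    proof (rule integral_mono)
      fix z assume "z \<in> space S2"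
      have "(\<Sum>a\<in>I. indicator (Q a) z :: real) \<le> 1"
      proof (cases "\<exists>a\<in>I. z \<in> Q a")
        case True
        then obtain a where a: "a \<in> I" "z \<in> Q a" by blast
        have "(\<Sum>a\<in>I. indicator (Q a) z :: real) = (\<Sum>b\<in>I. if b = a then 1 else 0)"
          using a(2) by (intro sum.cong) (auto simp: indicator_def Q_def level_set_def)
        then show ?thesis using a fI by simp
      next
        case False
        then show ?thesis by (simp add: indicator_def)
      qed
      then show "(\<Sum>a\<in>I. indicator (Q a) z * (cmod (\<zeta> z))\<^sup>2) \<le> (cmod (\<zeta> z))\<^sup>2"
        unfolding sum_distrib_right[symmetric] by (simp add: mult_left_le_one_le sum_nonneg)
    qed (use int l2_integrable[OF \<zeta>l] in auto)
    finally show ?thesis .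
  qed
  \<comment> \<open>Pigeonhole with the measures of the level sets as weights. The strict inequality
    also excludes level sets of measure 0.\<close>
  have "\<exists>a\<in>I. nq S2 (\<lambda>z. indicator (Q a) z * \<zeta> z) < e * measure M (level_set M n a)"
  proof (rule ccontr)
    assume "\<not> ?thesis"
    then have "(\<Sum>a\<in>I. e * measure M (level_set M n a)) \<le> (\<Sum>a\<in>I. nq S2 (\<lambda>z. indicator (Q a) z * \<zeta> z))"
      by (intro sum_mono) (auto simp: not_less)
    moreover have "(\<Sum>a\<in>I. measure M (level_set M n a)) = measure M (\<Union>a\<in>I. level_set M n a)"
      using fI level_measurable by (intro finite_measure_finite_Union[symmetric])
        (auto simp: disjoint_family_on_def level_set_def)
    moreover have "(\<Union>a\<in>I. level_set M n a) = space M" by (auto simp: I_def level_set_def)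
    ultimately have "e \<le> nq S2 \<zeta>" using sumQ by (simp add: sum_distrib_left[symmetric] prob_space)
    then show False using \<eta>(2) by (simp add: \<zeta>_def)
  qed
  then obtain x where x: "x \<in> space M"
    and xq: "nq S2 (\<lambda>z. indicator (Q (x n)) z * \<zeta> z) < e * measure M (X n x)"
    by (auto simp: I_def)
  have pos: "measure M (X n x) > 0"
  proof (rule ccontr)
    assume "\<not> ?thesis"
    then have "measure M (X n x) = 0" using measure_nonneg[of M "X n x"] by linarith
    then show False using xq nq_nonneg[of S2 "\<lambda>z. indicator (Q (x n)) z * \<zeta> z"] by simp
  qed
  define m where "m = mass n"
  have m: "m > 0" "measure M (X n x) = m" using mass_pos mass_eq[OF x pos] by (auto simp: m_def)
  show ?thesis
  proof (rule found[OF x pos])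
    fix g assume g0: "g \<in> G0" and gS: "g \<in> St n x"
    have g: "g \<in> carrier G" using g0 by (rule G0_carrier)
    let ?Q = "Q (x n)"
    define \<xi>' where "\<xi>' = (\<lambda>z. indicator ?Q z * \<xi> n z)"
    define \<eta>' where "\<eta>' = (\<lambda>z. indicator ?Q z * \<eta> z)"
    have l': "\<xi>' \<in> l2 S2" "\<eta>' \<in> l2 S2" unfolding \<xi>'_def \<eta>'_def by (intro ind_l2 Q \<xi>l \<eta>l)+
    have inQ: "T2 h z \<in> ?Q" if h: "h \<in> St n x" and z: "z \<in> ?Q" for h z
      using h z x St_level_iff[OF x, of _ h] T_space[OF St_carrier[OF h]] w_closed[OF St_carrier[OF h]]
      by (auto simp: Q_def T2_def X_iff intro!: L.m_closed)
    have inQ': "z \<in> ?Q" if h: "h \<in> St n x" and z: "T2 h z \<in> ?Q" "z \<in> space S2" for h z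
      using inQ[of "inv h" "T2 h z"] D.T_mult[of "inv h" h z] D.T_one[of z] h z St_carrier[OF h]
        subgroup.m_inv_closed[OF St_subgroup[OF x] h] by simp
    have gi: "inv g \<in> St n x" using subgroup.m_inv_closed[OF St_subgroup[OF x] gS] .
    have "AE z in S2. D.rep g \<eta> z = \<eta> z" by (rule D.inv_l2D(2)[OF \<eta>(1) g0])
    \<comment> \<open>Cutting down to the block keeps the invariance because \<open>g\<close>
      stabilizes the level set.\<close>
    then have \<eta>inv: "AE z in S2. D.rep g \<eta>' z = \<eta>' z"
    proof (rule AE_mp, intro AE_I2 impI)
      fix z assume "z \<in> space S2" "D.rep g \<eta> z = \<eta> z"
      then show "D.rep g \<eta>' z = \<eta>' z"
        using inQ[OF gi, of z] inQ'[OF gi, of z] by (auto simp: D.rep_def \<eta>'_def indicator_def)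
    qed
    have d1: "nq S2 (\<lambda>z. \<xi>' z - \<eta>' z) < e * m"
    proof -
      have "(\<lambda>z. \<xi>' z - \<eta>' z) = (\<lambda>z. indicator ?Q z * \<zeta> z)"
        by (auto simp: \<xi>'_def \<eta>'_def \<zeta>_def right_diff_distrib)
      then show ?thesis using xq m by simp
    qed
    have "nq S2 (\<lambda>z. D.rep g \<xi>' z - \<eta>' z) = nq S2 (D.rep g (\<lambda>z. \<xi>' z - \<eta>' z))"
      using \<eta>inv g l' by (intro nq_cong_AE l2_diff D.rep_l2) (auto simp: D.rep_def elim: eventually_mono)
    also have "\<dots> = nq S2 (\<lambda>z. \<xi>' z - \<eta>' z)" using g l' by (intro D.nq_rep l2_diff)
    finally have d2: "nq S2 (\<lambda>z. D.rep g \<xi>' z - \<eta>' z) = nq S2 (\<lambda>z. \<xi>' z - \<eta>' z)" .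
    have "nq S2 (\<lambda>z. D.rep g \<xi>' z - \<xi>' z) \<le> 2 * nq S2 (\<lambda>z. D.rep g \<xi>' z - \<eta>' z) + 2 * nq S2 (\<lambda>z. \<xi>' z - \<eta>' z)"
      using l' g by (intro nq_triangle2 D.rep_l2)
    \<comment> \<open>Both \<open>\<xi>'\<close> and its translate are within \<open>e * m\<close>
      of the invariant vector \<open>\<eta>'\<close>, in the sense of \<open>nq\<close>.\<close>
    then have d3: "nq S2 (\<lambda>z. D.rep g \<xi>' z - \<xi>' z) \<le> 4 * (e * m)" using d1 d2 by linarith
    let ?R = "X n x \<times> X n x"
    have R: "?R \<in> sets (M \<Otimes>\<^sub>M M)" by (intro pair_measureI) auto
    have \<xi>R: "\<xi>' = (\<lambda>z. complex_of_real (1 / sqrt m) * indicator (?R \<times> {\<one>\<^bsub>L\<^esub>}) z)"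
      by (auto simp: \<xi>'_def \<xi>_def m_def indicator_def Q_def lev_def X_iff space_pair_measure fun_eq_iff)
    have "nq S2 (\<lambda>z. D.rep g \<xi>' z - \<xi>' z) = 2 * (1 / sqrt m)\<^sup>2
          * measure S2 ((?R \<times> {\<one>\<^bsub>L\<^esub>}) - T2 g -` (?R \<times> {\<one>\<^bsub>L\<^esub>}))"
      unfolding \<xi>R by (rule D.nq_rep_indicator(2)[OF g emeasure_S2(1)[OF R] fin[OF R]])
    also have "(?R \<times> {\<one>\<^bsub>L\<^esub>}) - T2 g -` (?R \<times> {\<one>\<^bsub>L\<^esub>}) = (?R \<inter> Df g) \<times> {\<one>\<^bsub>L\<^esub>}"
      using g gS x St_level_iff[OF x, of _ g] by (intro diff_T2) (auto simp: space_pair_measure X_iff)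
    also have "measure S2 \<dots> = measure (M \<Otimes>\<^sub>M M) (?R \<inter> Df g)"
      by (rule emeasure_S2(3)) (use Df_sets[OF g] R in auto)
    finally have "2 * measure (M \<Otimes>\<^sub>M M) (?R \<inter> Df g) / m \<le> 4 * (e * m)"
      using d3 m(1) by (simp add: power_divide)
    then have RD: "measure (M \<Otimes>\<^sub>M M) (?R \<inter> Df g) \<le> 2 * e * m * m"
      using m(1) by (simp add: divide_le_eq)
    \<comment> \<open>Fubini: if every \<open>y\<close> disagreed with more than the proportion
      \<open>d\<close> of the level set, the set of disagreeing pairs would be too large. The value
      at a good \<open>y\<close> serves as \<open>l\<close>.\<close>
    have "\<exists>y\<in>X n x. measure M {z \<in> X n x. w g z \<noteq> w g y} \<le> d * m"
    proof (rule ccontr)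
      assume "\<not> ?thesis"
      then have big: "measure M {z \<in> X n x. w g z \<noteq> w g y} > d * m" if "y \<in> X n x" for y
        using that by (auto simp: not_le)
      have "ennreal (d * m) * emeasure M (X n x) = (\<integral>\<^sup>+y. ennreal (d * m) * indicator (X n x) y \<partial>M)"
        by (simp add: nn_integral_cmult_indicator)
      also have "\<dots> \<le> (\<integral>\<^sup>+y. emeasure M (Pair y -` (?R \<inter> Df g)) \<partial>M)"
      proof (rule nn_integral_mono)
        fix y assume y: "y \<in> space M"
        show "ennreal (d * m) * indicator (X n x) y \<le> emeasure M (Pair y -` (?R \<inter> Df g))"
        proof (cases "y \<in> X n x")
          case True
          have "Pair y -` (?R \<inter> Df g) = {z \<in> X n x. w g z \<noteq> w g y}"
            using True by (auto simp: Df_def space_pair_measure X_iff)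
          then show ?thesis using True big[OF True] d m by (simp add: emeasure_eq_measure ennreal_leI)
        qed simp
      qed
      also have "\<dots> = emeasure (M \<Otimes>\<^sub>M M) (?R \<inter> Df g)"
        using Df_sets[OF g] R by (intro emeasure_pair_measure_alt[symmetric]) auto
      also have "\<dots> \<le> ennreal (2 * e * m * m)" using RD by (simp add: P.emeasure_eq_measure ennreal_leI)
      finally have "d * m * m \<le> 2 * e * m * m"
        using d e m by (simp add: emeasure_eq_measure ennreal_mult[symmetric] del: ennreal_mult)
      then show False using d m by (simp add: e_def)
    qed
    then obtain y where y: "y \<in> X n x" "measure M {z \<in> X n x. w g z \<noteq> w g y} \<le> d * m" by blast
    then show "\<exists>l\<in>carrier L. measure M {y \<in> X n x. w g y \<noteq> l} \<le> d * measure M (X n x)"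
      using m g by (intro bexI[of _ "w g y"]) (auto simp: X_iff)
  qed
qed

end

section \<open>Untwisting the cocycle on the normal subgroup\<close>

lemma (in mp_action) mp_action_subgroup:
  assumes "subgroup K G" shows "mp_action (G\<lparr>carrier := K\<rparr>) S T"
proof -
  interpret K: group "G\<lparr>carrier := K\<rparr>" using assms by (rule subgroup.subgroup_is_group[OF _ group_axioms])
  have "K \<subseteq> carrier G" using assms by (rule subgroup.subset)
  then show ?thesis
    by unfold_locales (auto simp: T_measurable T_distr T_mult T_one subset_iff)
qed

lemma ex1_bij:
  assumes "bij_betw f A B" "\<And>a. a \<in> A \<Longrightarrow> Q (f a) \<longleftrightarrow> P a"
  shows "(\<exists>!b. b \<in> B \<and> Q b) \<longleftrightarrow> (\<exists>!a. a \<in> A \<and> P a)"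
proof -
  have 1: "\<And>b. b \<in> B \<Longrightarrow> \<exists>a\<in>A. b = f a" and 2: "\<And>a. a \<in> A \<Longrightarrow> f a \<in> B" and 3: "inj_on f A"
    using assms(1) by (auto simp: bij_betw_def)
  show ?thesis
  proof
    assume "\<exists>!b. b \<in> B \<and> Q b"
    then obtain b where b: "b \<in> B" "Q b" "\<And>c. c \<in> B \<Longrightarrow> Q c \<Longrightarrow> c = b" by blast
    then obtain a where a: "a \<in> A" "b = f a" using 1 by blast
    show "\<exists>!a. a \<in> A \<and> P a"
    proof (rule ex1I[of _ a])
      show "a \<in> A \<and> P a" using a b assms(2) by blast
      show "c = a" if "c \<in> A \<and> P c" for c
        using that b(3)[of "f c"] 2 assms(2) a 3 by (auto simp: inj_on_def)
    qed
  next
    assume "\<exists>!a. a \<in> A \<and> P a"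
    then obtain a where a: "a \<in> A" "P a" "\<And>c. c \<in> A \<Longrightarrow> P c \<Longrightarrow> c = a" by blast
    show "\<exists>!b. b \<in> B \<and> Q b"
    proof (rule ex1I[of _ "f a"])
      show "f a \<in> B \<and> Q (f a)" using a 2 assms(2) by blast
      show "c = f a" if "c \<in> B \<and> Q c" for c
        using that 1[of c] a(3) assms(2) by blast
    qed
  qed
qed

text \<open>The cosets with a representative in \<open>Q\<close> are closed under products and
  inverses, because \<open>Q\<close> is a subgroup and \<open>N\<close> is normal.\<close>

lemma generated_quotient_mod:
  fixes G (structure)
  assumes "N \<lhd> G" and "subgroup Q G"
    and "\<And>C. C \<in> S \<Longrightarrow> \<exists>q\<in>Q. C = N #>\<^bsub>G\<^esub> q"
    and "C \<in> generate (G Mod N) S"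
  shows "\<exists>q\<in>Q. C = N #>\<^bsub>G\<^esub> q"
proof -
  interpret normal N G by fact
  have Qc: "q \<in> carrier G" if "q \<in> Q" for q using that subgroup.subset[OF assms(2)] by auto
  show ?thesis using assms(4)
  proof (induction rule: generate.induct)
    case one
    have "N = N #> \<one>" using coset_mult_one[OF subset] by simp
    then show ?case using subgroup.one_closed[OF assms(2)] by auto
  next
    case (incl h) then show ?case using assms(3) by blast
  next
    case (inv h)
    then obtain q where q: "q \<in> Q" "h = N #> q" using assms(3) by blast
    then have "h \<in> carrier (G Mod N)" using Qc by (auto simp: FactGroup_def RCOSETS_def)
    then have "inv\<^bsub>G Mod N\<^esub> h = N #> inv q" using q Qc rcos_inv inv_FactGroup by simp
    then show ?case using q subgroup.m_inv_closed[OF assms(2)] by blast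
  next
    case (eng h1 h2)
    then obtain q1 q2 where q: "q1 \<in> Q" "h1 = N #> q1" "q2 \<in> Q" "h2 = N #> q2" by blast
    then have "h1 \<otimes>\<^bsub>G Mod N\<^esub> h2 = N #> (q1 \<otimes> q2)" using Qc rcos_sum by simp
    then show ?case using q subgroup.m_closed[OF assms(2)] by blast
  qed
qed

context cocycle_system
begin

lemma AE_X_nonempty:
  assumes "measure M (X n x) > 0" "AE y in M. y \<in> X n x \<longrightarrow> P y"
  obtains y where "y \<in> X n x" "P y"
proof (rule ccontr)
  note found = that
  assume neg: "\<not> thesis"
  have "AE y in M. y \<notin> X n x" using assms(2) by eventually_elim (use neg found in blast)
  then have "emeasure M (X n x) = 0" by (subst (asm) AE_iff_null_sets[symmetric]) auto
  then show False using assms(1) by (simp add: measure_def)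
qed

text \<open>The map \<open>\<phi>\<close> is read off from an invariant vector of the action on X
  \<times> \<Lambda> twisted by \<open>\<psi>\<close>: being near the indicator function of the unit
  fibre, the vector singles out one group element over almost every point. Multiplicativity of
  \<open>\<psi>\<close> makes the twisted formula an action.\<close>

theorem untwist_G0:
  obtains n x \<psi> \<phi> where "x \<in> space M" "measure M (X n x) > 0"
    "\<phi> \<in> measurable M (count_space (carrier L))"
    "\<And>g. g \<in> G0 \<Longrightarrow> g \<in> St n x \<Longrightarrow> \<psi> g \<in> carrier L"
    "\<And>g. g \<in> G0 \<Longrightarrow> g \<in> St n x \<Longrightarrow> AE y in M. y \<in> X n x \<longrightarrow>
        w g y = \<phi> (\<alpha> g y) \<otimes>\<^bsub>L\<^esub> \<psi> g \<otimes>\<^bsub>L\<^esub> inv\<^bsub>L\<^esub> \<phi> y"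
proof -
  note found = that
  \<comment> \<open>Two requirements: \<open>3 * d < 1\<close>, so that three exceptional sets
    cannot cover the level set, and \<open>16 * d < 1\<close>, so that the set \<open>A\<close>
    below has positive measure.\<close>
  define d :: real where "d = 1 / 20"
  have "d > 0" by (simp add: d_def)
  then obtain n x where x: "x \<in> space M" and pos: "measure M (X n x) > 0"
    and ac: "\<And>g. g \<in> G0 \<Longrightarrow> g \<in> St n x \<Longrightarrow>
      \<exists>l\<in>carrier L. measure M {y \<in> X n x. w g y \<noteq> l} \<le> d * measure M (X n x)"
    by (rule almost_constant) (rule that)
  define K where "K = G0 \<inter> St n x"
  have K: "subgroup K G" unfolding K_def by (rule subgroups_Inter_pair[OF G0_subgroup St_subgroup[OF x]])
  have Kc: "g \<in> carrier G" if "g \<in> K" for g using that by (simp add: K_def St_def)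
  define m where "m = measure M (X n x)"
  have m: "m > 0" using pos by (simp add: m_def)
  have "\<forall>g\<in>K. \<exists>l\<in>carrier L. measure M {y \<in> X n x. w g y \<noteq> l} \<le> d * m"
    using ac by (auto simp: K_def m_def)
  then obtain \<psi> where \<psi>: "\<And>g. g \<in> K \<Longrightarrow> \<psi> g \<in> carrier L"
    "\<And>g. g \<in> K \<Longrightarrow> measure M {y \<in> X n x. w g y \<noteq> \<psi> g} \<le> d * m" by metis
  have bad_sets: "{y \<in> X n x. w g y \<noteq> l} \<in> sets M" if "g \<in> carrier G" for g l
  proof -
    have "{y \<in> X n x. w g y \<noteq> l} = X n x - {y \<in> space M. w g y = l}" by (auto simp: X_iff)
    then show ?thesis using w_sets[OF that] by simp
  qed
  have \<psi>_mult: "\<psi> (g \<otimes> h) = \<psi> g \<otimes>\<^bsub>L\<^esub> \<psi> h" if g: "g \<in> K" and h: "h \<in> K" for g h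
  proof -
    have gh: "g \<otimes> h \<in> K" using K g h by (rule subgroup.m_closed)
    let ?A = "{y \<in> X n x. w (g \<otimes> h) y \<noteq> \<psi> (g \<otimes> h)}"
    let ?B = "{y \<in> X n x. w h y \<noteq> \<psi> h}"
    let ?C = "\<alpha> (inv h) ` {y \<in> X n x. w g y \<noteq> \<psi> g}"
    have s: "?A \<in> sets M" "?B \<in> sets M" "?C \<in> sets M"
      using g h gh Kc by (auto intro!: bad_sets image_T_sets)
    have "measure M (?A \<union> ?B \<union> ?C) \<le> measure M ?A + measure M ?B + measure M ?C"
      using measure_Un_le[of "?A \<union> ?B" M ?C] measure_Un_le[of ?A M ?B] s by simp
    also have "measure M ?C = measure M {y \<in> X n x. w g y \<noteq> \<psi> g}"
      using g h Kc by (intro measure_image_T bad_sets) auto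
    also have "measure M ?A + measure M ?B + measure M {y \<in> X n x. w g y \<noteq> \<psi> g} \<le> d * m + d * m + d * m"
      by (intro add_mono \<psi>(2) g h gh)
    also have "\<dots> < m" using m by (simp add: d_def)
    \<comment> \<open>One point outside the three exceptional sets proves the identity, since the
      values of \<open>\<psi>\<close> do not depend on the point.\<close>
    finally have "\<not> X n x \<subseteq> ?A \<union> ?B \<union> ?C"
      using finite_measure_mono[of "X n x" "?A \<union> ?B \<union> ?C"] s by (auto simp: m_def)
    then obtain y where y: "y \<in> X n x" "y \<notin> ?A" "y \<notin> ?B" "y \<notin> ?C" by blast
    have ym: "y \<in> space M" using y by (simp add: X_iff)
    have hy: "\<alpha> h y \<in> X n x" using St_level_iff[OF x ym, of h] h y by (simp add: K_def)
    have "w g (\<alpha> h y) = \<psi> g"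
    proof (rule ccontr)
      assume "w g (\<alpha> h y) \<noteq> \<psi> g"
      then have "y \<in> ?C" using hy ym h Kc by (intro image_eqI[of _ _ "\<alpha> h y"]) auto
      then show False using y by simp
    qed
    then show ?thesis using y w_mult[OF Kc[OF g] Kc[OF h] ym] by simp
  qed
  have \<psi>_one: "\<psi> \<one> = \<one>\<^bsub>L\<^esub>"
    using \<psi>_mult[of \<one> \<one>] subgroup.one_closed[OF K] \<psi>(1)[of \<one>] L.r_cancel_one'[of "\<psi> \<one>" "\<psi> \<one>"] by simp
  define c where "c g y l = w g y \<otimes>\<^bsub>L\<^esub> l \<otimes>\<^bsub>L\<^esub> inv\<^bsub>L\<^esub> \<psi> g" for g y l
  have c_bij: "bij_betw (c g y) (carrier L) (carrier L)" if "g \<in> K" "y \<in> space M" for g y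
  proof -
    have "w g y \<in> carrier L" "\<psi> g \<in> carrier L" using that Kc \<psi> by auto
    then show ?thesis unfolding c_def
      by (intro bij_betwI[where g="\<lambda>l. inv\<^bsub>L\<^esub> w g y \<otimes>\<^bsub>L\<^esub> l \<otimes>\<^bsub>L\<^esub> \<psi> g"])
         (auto simp: L.m_assoc, auto simp: L.m_assoc[symmetric])
  qed
  define S1 where "S1 = M \<Otimes>\<^sub>M count_space (carrier L)"
  define T1 where "T1 = (\<lambda>g (y, l). (\<alpha> g y, c g y l))"
  interpret C: sigma_finite_measure "count_space (carrier L)"
    using countable_L by (rule sigma_finite_measure_count_space_countable)
  interpret P: pair_sigma_finite M "count_space (carrier L)" ..
  have "mp_action (G\<lparr>carrier := K\<rparr>) S1 T1"
    unfolding S1_def T1_def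
  proof (rule mp_action_skew[OF mp_action_subgroup[OF K] countable_L])
    fix g l assume g: "g \<in> carrier (G\<lparr>carrier := K\<rparr>)" and l: "l \<in> carrier L"
    then have gK: "g \<in> K" by simp
    from measurable_compose[OF w_measurable[OF Kc[OF gK]], of "\<lambda>a. a \<otimes>\<^bsub>L\<^esub> l \<otimes>\<^bsub>L\<^esub> inv\<^bsub>L\<^esub> \<psi> g" "count_space (carrier L)"]
    show "(\<lambda>z. c g z l) \<in> M \<rightarrow>\<^sub>M count_space (carrier L)"
      using l \<psi>(1)[OF gK] by (simp add: c_def Pi_def)
  next
    fix g h z l assume a: "g \<in> carrier (G\<lparr>carrier := K\<rparr>)" "h \<in> carrier (G\<lparr>carrier := K\<rparr>)" "z \<in> space M" "l \<in> carrier L"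
    then have k: "g \<in> K" "h \<in> K" "g \<in> carrier G" "h \<in> carrier G" using Kc by auto
    then show "c (g \<otimes>\<^bsub>G\<lparr>carrier := K\<rparr>\<^esub> h) z l = c g (\<alpha> h z) (c h z l)"
      using a by (simp add: c_def w_mult \<psi>_mult \<psi> T_space L.inv_mult_group L.m_assoc)
  next
    fix z l assume "z \<in> space M" "l \<in> carrier L"
    then show "c \<one>\<^bsub>G\<lparr>carrier := K\<rparr>\<^esub> z l = l" by (simp add: c_def \<psi>_one)
  qed (simp add: c_bij)
  then interpret D: mp_action "G\<lparr>carrier := K\<rparr>" S1 T1 .
  let ?D = "X n x \<times> {\<one>\<^bsub>L\<^esub>}"
  define \<xi> where "\<xi> = (\<lambda>z. complex_of_real 1 * indicator ?D z)"
  have S1_times: "Q \<times> {\<one>\<^bsub>L\<^esub>} \<in> sets S1 \<and> emeasure S1 (Q \<times> {\<one>\<^bsub>L\<^esub>}) = emeasure M Q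
      \<and> measure S1 (Q \<times> {\<one>\<^bsub>L\<^esub>}) = measure M Q"
    if Q: "Q \<in> sets M" for Q
  proof -
    have "Q \<times> {\<one>\<^bsub>L\<^esub>} \<in> sets S1" unfolding S1_def using Q by (intro pair_measureI) auto
    moreover have "emeasure S1 (Q \<times> {\<one>\<^bsub>L\<^esub>}) = emeasure M Q"
      unfolding S1_def using Q by (subst C.emeasure_pair_measure_Times) (auto simp: emeasure_count_space)
    ultimately show ?thesis by (simp add: measure_def)
  qed
  have Df: "?D \<in> sets S1" "emeasure S1 ?D < \<infinity>" using S1_times[OF X_sets] by (simp_all add: emeasure_eq_measure)
  have \<xi>l: "\<xi> \<in> l2 S1" unfolding \<xi>_def by (rule D.nq_rep_indicator(1)[OF D.one_closed Df])
  have \<xi>d: "nq S1 (\<lambda>z. D.rep g \<xi> z - \<xi> z) \<le> 2 * (d * m)" if g: "g \<in> K" for g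
  proof -
    have gc: "g \<in> carrier G" using Kc g by simp
    have eq: "a \<otimes>\<^bsub>L\<^esub> \<one>\<^bsub>L\<^esub> \<otimes>\<^bsub>L\<^esub> inv\<^bsub>L\<^esub> b = \<one>\<^bsub>L\<^esub> \<longleftrightarrow> a = b" if "a \<in> carrier L" "b \<in> carrier L" for a b
      using that by (metis L.inv_closed L.inv_equality L.inv_inv L.r_inv L.r_one)
    have "nq S1 (\<lambda>z. D.rep g \<xi> z - \<xi> z) = 2 * 1\<^sup>2 * measure S1 (?D - T1 g -` ?D)"
      unfolding \<xi>_def by (rule D.nq_rep_indicator(2)[OF _ Df]) (simp add: g)
    also have "?D - T1 g -` ?D = {y \<in> X n x. w g y \<noteq> \<psi> g} \<times> {\<one>\<^bsub>L\<^esub>}"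
    proof (intro equalityI subsetI)
      fix p assume p: "p \<in> ?D - T1 g -` ?D"
      then obtain y where y: "p = (y, \<one>\<^bsub>L\<^esub>)" "y \<in> X n x" by auto
      have m: "y \<in> space M" using y by (auto simp: X_iff)
      have "\<alpha> g y \<in> X n x" using St_level_iff[OF x m, of g] g y by (simp add: K_def)
      then show "p \<in> {y \<in> X n x. w g y \<noteq> \<psi> g} \<times> {\<one>\<^bsub>L\<^esub>}"
        using p y eq[of "w g y" "\<psi> g"] g gc m \<psi> by (auto simp: T1_def c_def)
    next
      fix p assume p: "p \<in> {y \<in> X n x. w g y \<noteq> \<psi> g} \<times> {\<one>\<^bsub>L\<^esub>}"
      then obtain y where y: "p = (y, \<one>\<^bsub>L\<^esub>)" "y \<in> X n x" "w g y \<noteq> \<psi> g" by auto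
      have m: "y \<in> space M" using y by (auto simp: X_iff)
      then show "p \<in> ?D - T1 g -` ?D"
        using p y eq[of "w g y" "\<psi> g"] g gc \<psi> by (auto simp: T1_def c_def)
    qed
    also have "measure S1 ({y \<in> X n x. w g y \<noteq> \<psi> g} \<times> {\<one>\<^bsub>L\<^esub>}) \<le> d * m"
      using S1_times[OF bad_sets[OF gc]] \<psi>(2)[OF g] by simp
    finally show ?thesis by simp
  qed
  have "subgroup K (G\<lparr>carrier := K\<rparr>)" using D.subgroup_self by simp
  then obtain \<eta> where \<eta>: "\<eta> \<in> D.inv_l2 K" "nq S1 (\<lambda>z. \<xi> z - \<eta> z) \<le> 2 * (2 * (d * m))"
  proof (rule D.invariant_projection[OF _ \<xi>l])
    fix \<eta> assume a: "\<eta> \<in> D.inv_l2 K"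
      and b: "\<And>e. (\<And>g. g \<in> K \<Longrightarrow> nq S1 (\<lambda>z. D.rep g \<xi> z - \<xi> z) \<le> e) \<Longrightarrow> nq S1 (\<lambda>z. \<xi> z - \<eta> z) \<le> 2 * e"
    show thesis by (rule that[OF a b[OF \<xi>d]])
  qed
  have \<eta>l: "\<eta> \<in> l2 S1" using \<eta>(1) by (rule D.inv_l2D)
  have \<eta>inv: "AE z in S1. \<eta> (T1 g z) = \<eta> z" if g: "g \<in> K" for g
  proof -
    have g': "inv\<^bsub>G\<lparr>carrier := K\<rparr>\<^esub> g \<in> K" using D.inv_closed[of g] g by simp
    show ?thesis using D.inv_l2D(2)[OF \<eta>(1) g'] D.inv_inv[of g] g by (simp add: D.rep_def)
  qed
  \<comment> \<open>The threshold 1/2 lies midway between the values 0 and 1 of \<xi>: wherever over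
    the level set membership in \<open>F\<close> differs from membership in the unit fibre, \<xi>
    and \<eta> are at distance at least 1/2.\<close>
  define F where "F = {z \<in> space S1. Re (\<eta> z) > 1 / 2}"
  have [measurable]: "\<eta> \<in> borel_measurable S1" using \<eta>l by (rule l2_measurable)
  have F [measurable]: "F \<in> sets S1" unfolding F_def by measurable
  have Finv: "AE y in M. \<forall>l\<in>carrier L. (\<alpha> g y, c g y l) \<in> F \<longleftrightarrow> (y, l) \<in> F" if g: "g \<in> K" for g
  proof -
    have "AE z in S1. T1 g z \<in> F \<longleftrightarrow> z \<in> F"
      using \<eta>inv[OF g] by (rule AE_mp, intro AE_I2 impI) (use D.T_space[of g] g in \<open>auto simp: F_def\<close>)
    then have "AE z in M \<Otimes>\<^sub>M count_space (carrier L). T1 g z \<in> F \<longleftrightarrow> z \<in> F" unfolding S1_def .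
    from P.AE_pair[OF this] show ?thesis by (simp add: AE_count_space T1_def)
  qed
  define Fl where "Fl l = {y \<in> space M. (y, l) \<in> F}" for l
  have Fl [measurable]: "Fl l \<in> sets M" for l
  proof -
    have "Fl l = (\<lambda>y. (y, l)) -` F" unfolding Fl_def F_def by (auto simp: S1_def space_pair_measure)
    then show ?thesis using sets_Pair2[of F M "count_space (carrier L)" l] F by (simp add: S1_def)
  qed
  \<comment> \<open>The set \<open>F\<close> is invariant up to null sets and \<open>c g y\<close>
    is bijective on fibres, so having exactly one element of \<open>F\<close> in the fibre is an
    invariant condition.\<close>
  define A where "A = {y \<in> X n x. \<exists>!l. l \<in> carrier L \<and> (y, l) \<in> F}"
  have "A = X n x \<inter> (\<Union>l\<in>carrier L. Fl l - (\<Union>l'\<in>carrier L - {l}. Fl l'))"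
  proof (intro equalityI subsetI)
    fix y assume "y \<in> A"
    then obtain l where y: "y \<in> X n x" "l \<in> carrier L" "(y, l) \<in> F"
      and u: "\<And>l'. l' \<in> carrier L \<Longrightarrow> (y, l') \<in> F \<Longrightarrow> l' = l"
      unfolding A_def by blast
    have "y \<in> space M" using y(1) unfolding X_iff by (rule conjunct1)
    then have "y \<in> Fl l" "\<And>l'. l' \<in> carrier L - {l} \<Longrightarrow> y \<notin> Fl l'"
      unfolding Fl_def using y(3) u by blast+
    then have "y \<in> Fl l - (\<Union>l'\<in>carrier L - {l}. Fl l')" by blast
    then show "y \<in> X n x \<inter> (\<Union>l\<in>carrier L. Fl l - (\<Union>l'\<in>carrier L - {l}. Fl l'))"
      using y by blast
  next
    fix y assume "y \<in> X n x \<inter> (\<Union>l\<in>carrier L. Fl l - (\<Union>l'\<in>carrier L - {l}. Fl l'))"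
    then obtain l where y: "y \<in> X n x" "l \<in> carrier L" "y \<in> Fl l - (\<Union>l'\<in>carrier L - {l}. Fl l')"
      by blast
    have "y \<in> space M" using y(1) unfolding X_iff by (rule conjunct1)
    then have "(y, l) \<in> F" "\<And>l'. l' \<in> carrier L \<Longrightarrow> (y, l') \<in> F \<Longrightarrow> l' = l"
      using y(3) unfolding Fl_def by blast+
    then show "y \<in> A" using y unfolding A_def by blast
  qed
  moreover have "(\<Union>l\<in>carrier L. Fl l - (\<Union>l'\<in>carrier L - {l}. Fl l')) \<in> sets M"
    by (intro sets.countable_UN'' sets.Diff Fl countable_L countable_Diff)
  ultimately have A [measurable]: "A \<in> sets M" by auto
  have Ainv: "AE y in M. \<alpha> g y \<in> A \<longleftrightarrow> y \<in> A" if g: "g \<in> K" for g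
    using Finv[OF g]
  proof (rule AE_mp, intro AE_I2 impI)
    fix y assume y: "y \<in> space M" and f: "\<forall>l\<in>carrier L. (\<alpha> g y, c g y l) \<in> F \<longleftrightarrow> (y, l) \<in> F"
    have "\<alpha> g y \<in> X n x \<longleftrightarrow> y \<in> X n x" using g y x by (intro St_level_iff) (auto simp: K_def)
    moreover have "(\<exists>!l. l \<in> carrier L \<and> (\<alpha> g y, l) \<in> F) \<longleftrightarrow> (\<exists>!l. l \<in> carrier L \<and> (y, l) \<in> F)"
      using f by (intro ex1_bij[OF c_bij[OF g y]]) auto
    ultimately show "\<alpha> g y \<in> A \<longleftrightarrow> y \<in> A" by (simp add: A_def)
  qed
  \<comment> \<open>Chebyshev: over each point of the level set outside \<open>A\<close> the fibre
    contributes at least 1/4 to the squared distance of \<xi> and \<eta>, which is at most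
    \<open>4 * d * m\<close>.\<close>
  have "measure M (X n x - A) \<le> 16 * (d * m)"
  proof -
    have "ennreal (1/4) * emeasure M (X n x - A) = (\<integral>\<^sup>+y. ennreal (1/4) * indicator (X n x - A) y \<partial>M)"
      by (simp add: nn_integral_cmult_indicator)
    also have "\<dots> \<le> (\<integral>\<^sup>+y. \<integral>\<^sup>+l. ennreal ((cmod (\<xi> (y, l) - \<eta> (y, l)))\<^sup>2) \<partial>count_space (carrier L) \<partial>M)"
    proof (rule nn_integral_mono)
      fix y assume ym: "y \<in> space M"
      show "ennreal (1/4) * indicator (X n x - A) y
        \<le> (\<integral>\<^sup>+l. ennreal ((cmod (\<xi> (y, l) - \<eta> (y, l)))\<^sup>2) \<partial>count_space (carrier L))"
      proof (cases "y \<in> X n x - A")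
        case True
        have "\<exists>l\<in>carrier L. 1 / 2 \<le> cmod (\<xi> (y, l) - \<eta> (y, l))"
        proof (cases "(y, \<one>\<^bsub>L\<^esub>) \<in> F")
          case False
          then have "Re (\<xi> (y, \<one>\<^bsub>L\<^esub>) - \<eta> (y, \<one>\<^bsub>L\<^esub>)) \<ge> 1 / 2"
            using True ym by (simp add: F_def S1_def space_pair_measure \<xi>_def)
          then show ?thesis using complex_Re_le_cmod by (meson L.one_closed order_trans)
        next
          case one: True
          then obtain l where l: "l \<in> carrier L" "(y, l) \<in> F" "l \<noteq> \<one>\<^bsub>L\<^esub>"
            using True by (auto simp: A_def)
          then have "Re (\<eta> (y, l) - \<xi> (y, l)) \<ge> 1 / 2" by (simp add: F_def \<xi>_def indicator_def)
          then show ?thesis using l complex_Re_le_cmod norm_minus_commute by (metis order_trans)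
        qed
        then obtain l where l: "l \<in> carrier L" "1 / 2 \<le> cmod (\<xi> (y, l) - \<eta> (y, l))" by blast
        have "1 / 4 \<le> (cmod (\<xi> (y, l) - \<eta> (y, l)))\<^sup>2"
          using power_mono[OF l(2), of 2] by (simp add: power2_eq_square)
        then have "ennreal (1/4) \<le> ennreal ((cmod (\<xi> (y, l) - \<eta> (y, l)))\<^sup>2)" by (rule ennreal_leI)
        also have "\<dots> = (\<integral>\<^sup>+k. ennreal ((cmod (\<xi> (y, l) - \<eta> (y, l)))\<^sup>2) * indicator {l} k \<partial>count_space (carrier L))"
          using l(1) by (simp add: nn_integral_cmult_indicator emeasure_count_space)
        also have "\<dots> \<le> (\<integral>\<^sup>+l. ennreal ((cmod (\<xi> (y, l) - \<eta> (y, l)))\<^sup>2) \<partial>count_space (carrier L))"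
          by (intro nn_integral_mono) (auto simp: indicator_def)
        finally show ?thesis using True by simp
      qed simp
    qed
    also have "\<dots> = (\<integral>\<^sup>+z. ennreal ((cmod (\<xi> z - \<eta> z))\<^sup>2) \<partial>S1)"
      unfolding S1_def using l2_measurable[OF l2_diff[OF \<xi>l \<eta>l]]
      by (intro C.nn_integral_fst) (simp add: S1_def)
    also have "\<dots> = ennreal (nq S1 (\<lambda>z. \<xi> z - \<eta> z))" by (rule nn_integral_nq[OF l2_diff[OF \<xi>l \<eta>l]])
    also have "\<dots> \<le> ennreal (2 * (2 * (d * m)))" using \<eta>(2) by (rule ennreal_leI)
    finally have "1/4 * measure M (X n x - A) \<le> 2 * (2 * (d * m))"
      using m by (simp add: emeasure_eq_measure ennreal_mult[symmetric] d_def del: ennreal_mult)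
    then show ?thesis by simp
  qed
  then have "measure M (X n x - A) < m" using m by (simp add: d_def)
  moreover have AX: "A \<subseteq> X n x" by (auto simp: A_def)
  ultimately have "A \<notin> null_sets M"
    using finite_measure_Diff[of "X n x" A] by (auto simp: m_def null_sets_def measure_def)
  then have XA: "X n x - A \<in> null_sets M"
    using ergodic_level[OF x A AX] Ainv by (auto simp: K_def)
  \<comment> \<open>Off \<open>A\<close> the unit is a default that keeps \<open>\<phi>\<close> a
    total measurable map into the group; within the level set this concerns only a null set.\<close>
  define \<phi> where "\<phi> y = (if y \<in> A then (THE l. l \<in> carrier L \<and> (y, l) \<in> F) else \<one>\<^bsub>L\<^esub>)" for y
  have \<phi>A: "\<phi> y \<in> carrier L \<and> (y, \<phi> y) \<in> F" if "y \<in> A" for y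
    using that theI'[of "\<lambda>l. l \<in> carrier L \<and> (y, l) \<in> F"] by (simp add: \<phi>_def A_def)
  have \<phi>u: "l = \<phi> y" if "y \<in> A" "l \<in> carrier L" "(y, l) \<in> F" for y l
    using that \<phi>A[OF that(1)] by (auto simp: A_def)
  have \<phi>c: "\<phi> y \<in> carrier L" for y using \<phi>A[of y] by (auto simp: \<phi>_def)
  have \<phi>m: "\<phi> \<in> measurable M (count_space (carrier L))"
  proof (subst measurable_count_space_eq_countable[OF countable_L], intro conjI ballI)
    show "\<phi> \<in> space M \<rightarrow> carrier L" using \<phi>c by simp
    fix l assume l: "l \<in> carrier L"
    have "\<phi> -` {l} \<inter> space M = (A \<inter> Fl l) \<union> (if l = \<one>\<^bsub>L\<^esub> then space M - A else {})"
    proof -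
      have 1: "\<phi> y = l \<longleftrightarrow> y \<in> Fl l" if y: "y \<in> A" for y
        using \<phi>A[OF y] \<phi>u[OF y l] sets.sets_into_space[OF A] y unfolding Fl_def by blast
      have 2: "\<phi> y = \<one>\<^bsub>L\<^esub>" if "y \<notin> A" for y using that by (simp add: \<phi>_def)
      show ?thesis
      proof (intro equalityI subsetI)
        fix y assume y: "y \<in> \<phi> -` {l} \<inter> space M"
        show "y \<in> (A \<inter> Fl l) \<union> (if l = \<one>\<^bsub>L\<^esub> then space M - A else {})"
          using 1[of y] 2[of y] y by (cases "y \<in> A") auto
      next
        fix y assume y: "y \<in> (A \<inter> Fl l) \<union> (if l = \<one>\<^bsub>L\<^esub> then space M - A else {})"
        then have "y \<in> space M" using sets.sets_into_space[OF A] by (auto split: if_splits)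
        then show "y \<in> \<phi> -` {l} \<inter> space M"
          using 1[of y] 2[of y] y by (cases "y \<in> A") (auto split: if_splits)
      qed
    qed
    then show "\<phi> -` {l} \<inter> space M \<in> sets M" by auto
  qed
  have AEA: "AE y in M. y \<in> X n x \<longrightarrow> y \<in> A" using AE_not_in[OF XA] by eventually_elim auto
  show ?thesis
  proof (rule found[OF x pos \<phi>m])
    show "\<psi> g \<in> carrier L" if "g \<in> G0" "g \<in> St n x" for g using that \<psi> by (simp add: K_def)
    fix g assume "g \<in> G0" "g \<in> St n x"
    then have g: "g \<in> K" by (simp add: K_def)
    note gc = Kc[OF g]
    show "AE y in M. y \<in> X n x \<longrightarrow> w g y = \<phi> (\<alpha> g y) \<otimes>\<^bsub>L\<^esub> \<psi> g \<otimes>\<^bsub>L\<^esub> inv\<^bsub>L\<^esub> \<phi> y"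
      using AEA Finv[OF g] Ainv[OF g] AE_space
    proof eventually_elim
      case (elim y)
      show ?case
      proof
        assume "y \<in> X n x"
        then have yA: "y \<in> A" "\<alpha> g y \<in> A" using elim by auto
        have cl: "w g y \<in> carrier L" "\<psi> g \<in> carrier L" "\<phi> y \<in> carrier L" using elim gc \<psi> g \<phi>c by auto
        have "(\<alpha> g y, c g y (\<phi> y)) \<in> F" using elim \<phi>A[OF yA(1)] by blast
        then have "c g y (\<phi> y) = \<phi> (\<alpha> g y)" using cl by (intro \<phi>u[OF yA(2)]) (auto simp: c_def)
        then have "\<phi> (\<alpha> g y) = w g y \<otimes>\<^bsub>L\<^esub> \<phi> y \<otimes>\<^bsub>L\<^esub> inv\<^bsub>L\<^esub> \<psi> g" by (simp add: c_def)
        then show "w g y = \<phi> (\<alpha> g y) \<otimes>\<^bsub>L\<^esub> \<psi> g \<otimes>\<^bsub>L\<^esub> inv\<^bsub>L\<^esub> \<phi> y"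
          using cl by (simp add: L.m_assoc)
      qed
    qed
  qed
qed

end

lemma AE_positive_ex:
  assumes "A \<in> sets M" "emeasure M A \<noteq> 0" "AE y in M. P y"
  shows "\<exists>y\<in>A. P y"
proof (rule ccontr)
  assume "\<not> ?thesis"
  then have "AE y in M. y \<notin> A" using assms(3) by (auto elim: eventually_mono)
  then show False using assms(1,2) AE_iff_null_sets[OF assms(1)] by auto
qed

lemma (in group) inv_mult_cancel:
  assumes "x \<in> carrier G" "y \<in> carrier G"
  shows "x \<otimes> (inv x \<otimes> y) = y" "inv x \<otimes> (x \<otimes> y) = y"
  using assms by (simp_all add: m_assoc[symmetric])

section \<open>Extension to the whole stabilizer\<close>

context cocycle_system
begin

text \<open>With the conjugate \<open>h' = g \<otimes> h \<otimes> inv g\<close> in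
  \<open>G0\<close>, the two expansions of \<open>w\<close> at
  \<open>g \<otimes> h = h' \<otimes> g\<close> express \<open>w g\<close> at
  \<open>\<alpha> h y\<close> by \<open>w g y\<close>, \<open>\<psi> h'\<close> and
  \<open>\<psi> h\<close>. A majority value is fixed by this transformation, so the set where it is
  attained is invariant and ergodicity on the level set applies.\<close>

lemma majority_constant:
  assumes x0: "x0 \<in> space M"
    and \<psi>: "\<And>g. g \<in> G0 \<Longrightarrow> g \<in> St n0 x0 \<Longrightarrow> \<psi> g \<in> carrier L"
      "\<And>g. g \<in> G0 \<Longrightarrow> g \<in> St n0 x0 \<Longrightarrow> AE y in M. y \<in> X n0 x0 \<longrightarrow> w g y = \<psi> g"
    and n: "n0 \<le> n" and x: "x \<in> X n0 x0"
    and g: "g \<in> St n x" and k: "k \<in> carrier L"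
    and maj: "2 * measure M {y \<in> X n x. w g y \<noteq> k} < measure M (X n x)"
  shows "AE y in M. y \<in> X n x \<longrightarrow> w g y = k"
proof -
  have xm: "x \<in> space M" using x by (simp add: X_iff)
  have gc: "g \<in> carrier G" using g by (rule St_carrier)
  have Xsub: "X n x \<subseteq> X n0 x0" using X_antimono[OF n xm] x by (auto simp: X_iff)
  have Ssub: "St n x \<subseteq> St n0 x0" using St_antimono[OF n xm] St_X[OF x0 x] by simp
  note Sg = St_subgroup[OF xm, of n]
  define B where "B = {y \<in> X n x. w g y = k}"
  define C where "C = {y \<in> X n x. w g y \<noteq> k}"
  have "B = X n x \<inter> {y \<in> space M. w g y = k}" "C = X n x - B" by (auto simp: B_def C_def X_iff)
  then have BC [measurable]: "B \<in> sets M" "C \<in> sets M" using w_sets[OF gc] by auto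
  have inv: "AE y in M. \<alpha> h y \<in> B \<longleftrightarrow> y \<in> B" if h: "h \<in> G0" "h \<in> St n x" for h
  proof -
    have hc: "h \<in> carrier G" using h by (simp add: G0_carrier)
    define h' where "h' = g \<otimes> h \<otimes> inv g"
    have h'0: "h' \<in> G0" unfolding h'_def using normal.inv_op_closed2[OF G0_normal gc h(1)] .
    have h'S: "h' \<in> St n x" unfolding h'_def using g h Sg by (simp add: subgroup.m_closed subgroup.m_inv_closed)
    have h'c: "h' \<in> carrier G" using h'0 by (rule G0_carrier)
    have gh: "g \<otimes> h = h' \<otimes> g" using gc hc by (simp add: h'_def m_assoc)
    have p: "\<psi> h \<in> carrier L" "\<psi> h' \<in> carrier L" using \<psi>(1) h h'0 h'S Ssub by auto
    have 1: "AE y in M. y \<in> X n0 x0 \<longrightarrow> w h y = \<psi> h" using \<psi>(2) h Ssub by auto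
    have "AE y in M. y \<in> X n0 x0 \<longrightarrow> w h' y = \<psi> h'" using \<psi>(2) h'0 h'S Ssub by auto
    then have 2: "AE y in M. \<alpha> g y \<in> X n0 x0 \<longrightarrow> w h' (\<alpha> g y) = \<psi> h'" by (rule AE_T[OF gc])
    have rel: "AE y in M. y \<in> X n x \<longrightarrow> w g (\<alpha> h y) = \<psi> h' \<otimes>\<^bsub>L\<^esub> w g y \<otimes>\<^bsub>L\<^esub> inv\<^bsub>L\<^esub> \<psi> h"
      using 1 2
    proof eventually_elim
      case (elim y)
      show ?case
      proof
        assume y: "y \<in> X n x"
        then have ym: "y \<in> space M" by (simp add: X_iff)
        have gy: "\<alpha> g y \<in> X n x" using St_level_iff[OF xm ym g] y by simp
        have cl: "w g y \<in> carrier L" "w g (\<alpha> h y) \<in> carrier L" using gc hc ym T_space by auto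
        have "w g (\<alpha> h y) \<otimes>\<^bsub>L\<^esub> w h y = w h' (\<alpha> g y) \<otimes>\<^bsub>L\<^esub> w g y"
          using w_mult[OF gc hc ym] w_mult[OF h'c gc ym] gh by simp
        then have "w g (\<alpha> h y) \<otimes>\<^bsub>L\<^esub> \<psi> h = \<psi> h' \<otimes>\<^bsub>L\<^esub> w g y"
          using elim y gy Xsub by (simp add: subset_iff)
        then show "w g (\<alpha> h y) = \<psi> h' \<otimes>\<^bsub>L\<^esub> w g y \<otimes>\<^bsub>L\<^esub> inv\<^bsub>L\<^esub> \<psi> h"
          using cl p by (metis L.inv_solve_right' L.m_closed)
      qed
    qed
    \<comment> \<open>The points that \<open>h\<close> sends into the exceptional set. Since
      \<open>h\<close> preserves measure, \<open>C\<close> and \<open>D\<close> together do not fill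
      the level set; here the majority of more than one half is used.\<close>
    define D where "D = \<alpha> (inv h) ` C"
    have D [measurable]: "D \<in> sets M" unfolding D_def using hc BC by auto
    have "measure M (C \<union> D) \<le> measure M C + measure M D" by (intro measure_Un_le) auto
    also have "measure M D = measure M C" unfolding D_def using hc BC by (intro measure_image_T) auto
    finally have "measure M (C \<union> D) < measure M (X n x)" using maj by (simp add: C_def)
    moreover have "C \<union> D \<subseteq> X n x"
    proof -
      have "inv h \<in> St n x" using h Sg by (simp add: subgroup.m_inv_closed)
      then have "\<alpha> (inv h) y \<in> X n x" if "y \<in> C" for y
        using that St_level_iff[OF xm, of y "inv h"] by (auto simp: C_def X_iff)
      then show ?thesis by (auto simp: D_def C_def)
    qed
    ultimately have "measure M (X n x - (C \<union> D)) > 0" by (subst finite_measure_Diff) auto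
    then have ne: "emeasure M (X n x - (C \<union> D)) \<noteq> 0" by (simp add: emeasure_eq_measure)
    have "X n x - (C \<union> D) \<in> sets M" by auto
    from AE_positive_ex[OF this ne rel] obtain y where y: "y \<in> X n x - (C \<union> D)"
      "y \<in> X n x \<longrightarrow> w g (\<alpha> h y) = \<psi> h' \<otimes>\<^bsub>L\<^esub> w g y \<otimes>\<^bsub>L\<^esub> inv\<^bsub>L\<^esub> \<psi> h"
      by blast
    have ym: "y \<in> space M" using y by (simp add: X_iff)
    have "\<alpha> h y \<in> X n x" using St_level_iff[OF xm ym h(2)] y by simp
    moreover have "\<alpha> h y \<notin> C"
    proof
      assume "\<alpha> h y \<in> C"
      then have "y \<in> D" unfolding D_def using hc ym by (intro image_eqI[of _ _ "\<alpha> h y"]) auto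
      then show False using y by simp
    qed
    ultimately have kk: "k = \<psi> h' \<otimes>\<^bsub>L\<^esub> k \<otimes>\<^bsub>L\<^esub> inv\<^bsub>L\<^esub> \<psi> h" using y by (auto simp: C_def)
    show ?thesis using rel AE_space
    proof eventually_elim
      case (elim y)
      show ?case
      proof (cases "y \<in> X n x")
        case True
        then have hy: "\<alpha> h y \<in> X n x" using St_level_iff[OF xm _ h(2)] elim by simp
        have cl: "w g y \<in> carrier L" using gc elim by auto
        have "\<alpha> h y \<in> B \<longleftrightarrow> \<psi> h' \<otimes>\<^bsub>L\<^esub> w g y \<otimes>\<^bsub>L\<^esub> inv\<^bsub>L\<^esub> \<psi> h = \<psi> h' \<otimes>\<^bsub>L\<^esub> k \<otimes>\<^bsub>L\<^esub> inv\<^bsub>L\<^esub> \<psi> h"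
          using True hy elim kk by (simp add: B_def)
        also have "\<dots> \<longleftrightarrow> w g y = k" using cl p k by simp
        also have "\<dots> \<longleftrightarrow> y \<in> B" using True by (simp add: B_def)
        finally show ?thesis .
      next
        case False
        then have "\<alpha> h y \<notin> X n x" using St_level_iff[OF xm _ h(2)] elim by simp
        then show ?thesis using False by (auto simp: B_def)
      qed
    qed
  qed
  have BX: "B \<subseteq> X n x" by (auto simp: B_def)
  have "B \<in> null_sets M \<or> X n x - B \<in> null_sets M"
    by (rule ergodic_level[OF xm BC(1) BX inv])
  moreover have CX: "C = X n x - B" by (auto simp: B_def C_def)
  moreover have "B \<notin> null_sets M"
  proof
    assume "B \<in> null_sets M"
    then have "measure M B = 0" by (simp add: null_sets_def measure_def)
    then have "measure M C = measure M (X n x)" using finite_measure_Diff[OF X_sets[of n x] BC(1) BX] CX by simp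
    then show False using maj measure_nonneg[of M C] by (simp add: C_def)
  qed
  ultimately have "C \<in> null_sets M" by simp
  from AE_not_in[OF this] show ?thesis by eventually_elim (auto simp: C_def)
qed

text \<open>The values of \<open>w\<close> on lifts of the generators form one countably valued map,
  which takes a constant value on most of a deep level set. There the lifts are corrected by
  \<open>G0\<close> to stabilize that set, and \<open>majority_constant\<close> applies to each of
  them.\<close>

theorem constant_on_level:
  assumes fg: "finitely_generated_group (G Mod G0)"
    and x0: "x0 \<in> space M" and pos0: "measure M (X n0 x0) > 0"
    and \<psi>: "\<And>g. g \<in> G0 \<Longrightarrow> g \<in> St n0 x0 \<Longrightarrow> \<psi> g \<in> carrier L"
      "\<And>g. g \<in> G0 \<Longrightarrow> g \<in> St n0 x0 \<Longrightarrow> AE y in M. y \<in> X n0 x0 \<longrightarrow> w g y = \<psi> g"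
  obtains n x where "x \<in> space M" "measure M (X n x) > 0"
    "\<And>g. g \<in> St n x \<Longrightarrow> \<exists>k\<in>carrier L. AE y in M. y \<in> X n x \<longrightarrow> w g y = k"
proof -
  note found = that
  obtain S where S: "finite S" "S \<subseteq> carrier (G Mod G0)" "generate (G Mod G0) S = carrier (G Mod G0)"
    using fg by (auto simp: finitely_generated_group_def)
  \<comment> \<open>By transitivity every element of \<open>G\<close> can be brought into a given
    stabilizer by a factor from \<open>G0\<close> on the left, without changing its coset.\<close>
  have move: "\<exists>c\<in>G0. \<alpha> c (\<alpha> g x) n = x n" if g: "g \<in> carrier G" and x: "x \<in> space M" and p: "measure M (X n x) > 0"
    for g x n
  proof -
    have "measure M (X n (\<alpha> g x)) = measure M (X n x)"
      using measure_image_T[OF g X_sets, of n x] image_X[OF g x, of n] by simp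
    then show ?thesis using transitive[of "\<alpha> g x" x n] T_space[OF g x] x p by metis
  qed
  have "\<exists>g. g \<in> St n0 x0 \<and> C = G0 #> g" if C: "C \<in> S" for C
  proof -
    obtain g where g: "g \<in> carrier G" "C = G0 #> g" using S C by (auto simp: FactGroup_def RCOSETS_def)
    obtain c where c: "c \<in> G0" "\<alpha> c (\<alpha> g x0) n0 = x0 n0" using move[OF g(1) x0 pos0] by blast
    have cc: "c \<in> carrier G" using c G0_carrier by auto
    have "c \<otimes> g \<in> St n0 x0" using c g cc x0 by (simp add: St_def T_mult)
    moreover have "G0 #> (c \<otimes> g) = G0 #> g"
      using coset_join2[OF cc G0_subgroup c(1)] coset_mult_assoc[OF subgroup.subset[OF G0_subgroup] cc g(1)] by simp
    ultimately show ?thesis using g by metis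
  qed
  then obtain r where r: "\<And>C. C \<in> S \<Longrightarrow> r C \<in> St n0 x0" "\<And>C. C \<in> S \<Longrightarrow> C = G0 #> r C" by metis
  have rc: "r C \<in> carrier G" if "C \<in> S" for C using r that St_carrier by blast
  \<comment> \<open>Countable because there are finitely many generators; hence one of the sets
    \<open>E v\<close> has positive measure.\<close>
  define V where "V = (\<Pi>\<^sub>E C\<in>S. carrier L)"
  have V: "countable V" unfolding V_def using S(1) countable_L by (intro countable_PiE)
  define E where "E v = {y \<in> X n0 x0. \<forall>C\<in>S. w (r C) y = v C}" for v
  have E [measurable]: "E v \<in> sets M" for v
  proof -
    have "E v = X n0 x0 \<inter> {y \<in> space M. \<forall>C\<in>S. y \<in> {y \<in> space M. w (r C) y = v C}}"
      by (auto simp: E_def X_iff)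
    then show ?thesis using S(1) w_sets[OF rc] by (auto intro!: sets.sets_Collect_finite_All' simp del: X_iff)
  qed
  have "\<exists>v\<in>V. emeasure M (E v) \<noteq> 0"
  proof (rule ccontr)
    assume "\<not> ?thesis"
    then have "(\<Union>v\<in>V. E v) \<in> null_sets M" using V by (intro null_sets_UN') auto
    moreover have "X n0 x0 \<subseteq> (\<Union>v\<in>V. E v)"
    proof
      fix y assume y: "y \<in> X n0 x0"
      then have "(\<lambda>C\<in>S. w (r C) y) \<in> V" using rc by (auto simp: V_def X_iff)
      moreover have "y \<in> E (\<lambda>C\<in>S. w (r C) y)" using y by (auto simp: E_def)
      ultimately show "y \<in> (\<Union>v\<in>V. E v)" by blast
    qed
    ultimately have "X n0 x0 \<in> null_sets M" by (meson X_sets null_sets_subset)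
    then show False using pos0 by (simp add: null_sets_def measure_def)
  qed
  then obtain v where v: "v \<in> V" "measure M (E v) > 0"
    by (auto simp: emeasure_eq_measure zero_less_measure_iff)
  \<comment> \<open>The proportion 1/2 is the one required by
    \<open>majority_constant\<close>.\<close>
  obtain n x where n: "n \<ge> n0" and xm: "x \<in> space M" and pos: "measure M (X n x) > 0"
    and den: "measure M (X n x - E v) < 1 / 2 * measure M (X n x)"
    by (rule density[OF E v(2), of "1/2" n0]) auto
  have x: "x \<in> X n0 x0"
  proof -
    have "X n x \<inter> E v \<noteq> {}"
    proof
      assume "X n x \<inter> E v = {}"
      then have "X n x - E v = X n x" by auto
      then show False using den pos by simp
    qed
    then obtain y where "y \<in> X n x" "y \<in> X n0 x0" by (auto simp: E_def)
    then show ?thesis using refine_le[OF n, of x y] xm by (auto simp: X_iff)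
  qed
  have Xsub: "X n x \<subseteq> X n0 x0" using X_antimono[OF n xm] x by (auto simp: X_iff)
  have Ssub: "St n x \<subseteq> St n0 x0" using St_antimono[OF n xm] St_X[OF x0 x] by simp
  define Q where "Q = {g \<in> St n x. \<exists>k\<in>carrier L. AE y in M. y \<in> X n x \<longrightarrow> w g y = k}"
  note Sg = St_subgroup[OF xm, of n]
  have G0Q: "g \<in> Q" if "g \<in> G0" "g \<in> St n x" for g
  proof -
    have "AE y in M. y \<in> X n0 x0 \<longrightarrow> w g y = \<psi> g" using \<psi>(2) that Ssub by auto
    then have "AE y in M. y \<in> X n x \<longrightarrow> w g y = \<psi> g" by eventually_elim (use Xsub in auto)
    then show ?thesis using that \<psi>(1) Ssub by (auto simp: Q_def)
  qed
  have Qs: "subgroup Q G"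
  proof (rule subgroupI)
    show "Q \<subseteq> carrier G" using St_carrier by (auto simp: Q_def)
    show "Q \<noteq> {}" using G0Q[of \<one>] subgroup.one_closed[OF G0_subgroup] subgroup.one_closed[OF Sg] by auto
  next
    fix g assume g: "g \<in> Q"
    then have gS: "g \<in> St n x" and gc: "g \<in> carrier G" by (auto simp: Q_def St_def)
    obtain k where k: "k \<in> carrier L" "AE y in M. y \<in> X n x \<longrightarrow> w g y = k" using g by (auto simp: Q_def)
    have iS: "inv g \<in> St n x" using gS Sg by (simp add: subgroup.m_inv_closed)
    have "AE y in M. \<alpha> (inv g) y \<in> X n x \<longrightarrow> w g (\<alpha> (inv g) y) = k" using gc k(2) by (intro AE_T) auto
    then have "AE y in M. y \<in> X n x \<longrightarrow> w (inv g) y = inv\<^bsub>L\<^esub> k" using AE_space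
    proof eventually_elim
      case (elim y)
      show ?case
      proof
        assume y: "y \<in> X n x"
        then have "w g (\<alpha> (inv g) y) = k" using elim St_level_iff[OF xm, of y "inv g"] iS by simp
        then have "\<one>\<^bsub>L\<^esub> = k \<otimes>\<^bsub>L\<^esub> w (inv g) y" using w_mult[of g "inv g" y] gc elim by simp
        moreover have cl: "w (inv g) y \<in> carrier L" using gc elim by simp
        ultimately have "inv\<^bsub>L\<^esub> w (inv g) y = k" using k(1) by (intro L.inv_equality) simp_all
        then show "w (inv g) y = inv\<^bsub>L\<^esub> k" using cl by auto
      qed
    qed
    then show "inv g \<in> Q" using iS k by (auto simp: Q_def)
  next
    fix g h assume g: "g \<in> Q" and h: "h \<in> Q"
    then have gS: "g \<in> St n x" "h \<in> St n x" and gc: "g \<in> carrier G" "h \<in> carrier G" by (auto simp: Q_def St_def)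
    obtain k where k: "k \<in> carrier L" "AE y in M. y \<in> X n x \<longrightarrow> w g y = k" using g by (auto simp: Q_def)
    obtain l where l: "l \<in> carrier L" "AE y in M. y \<in> X n x \<longrightarrow> w h y = l" using h by (auto simp: Q_def)
    have "AE y in M. \<alpha> h y \<in> X n x \<longrightarrow> w g (\<alpha> h y) = k" using gc k(2) by (intro AE_T) auto
    then have "AE y in M. y \<in> X n x \<longrightarrow> w (g \<otimes> h) y = k \<otimes>\<^bsub>L\<^esub> l" using l(2) AE_space
      by eventually_elim (use gc gS St_level_iff[OF xm] in \<open>simp add: w_mult\<close>)
    moreover have "g \<otimes> h \<in> St n x" using gS Sg by (simp add: subgroup.m_closed)
    ultimately show "g \<otimes> h \<in> Q" using k l by (auto simp: Q_def)
  qed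
  have SQ: "\<exists>q\<in>Q. C = G0 #> q" if C: "C \<in> S" for C
  proof -
    obtain c where c: "c \<in> G0" "\<alpha> c (\<alpha> (r C) x) n = x n" using move[OF rc[OF C] xm pos] by blast
    have cc: "c \<in> carrier G" using c G0_carrier by auto
    define q where "q = c \<otimes> r C"
    have q: "q \<in> St n x" using c cc rc[OF C] xm by (simp add: q_def St_def T_mult)
    have qC: "C = G0 #> q" unfolding q_def
      using coset_join2[OF cc G0_subgroup c(1)] coset_mult_assoc[OF subgroup.subset[OF G0_subgroup] cc rc[OF C]] r(2)[OF C] by simp
    \<comment> \<open>Both \<open>q\<close> and the old lift stabilize the level set of
      \<open>x0\<close>, hence so does the correction \<open>c\<close>, and \<open>w c\<close> has
      the constant value \<open>\<psi> c\<close> there.\<close>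
    have "c = q \<otimes> inv (r C)" using cc rc[OF C] by (simp add: q_def m_assoc)
    then have cS: "c \<in> St n0 x0" using q Ssub r(1)[OF C] St_subgroup[OF x0, of n0]
      by (auto intro!: subgroup.m_closed subgroup.m_inv_closed)
    have vC: "v C \<in> carrier L" using v(1) C by (auto simp: V_def)
    define k where "k = \<psi> c \<otimes>\<^bsub>L\<^esub> v C"
    have k: "k \<in> carrier L" using vC \<psi>(1)[OF c(1) cS] by (simp add: k_def)
    have "AE y in M. \<alpha> (r C) y \<in> X n0 x0 \<longrightarrow> w c (\<alpha> (r C) y) = \<psi> c"
      by (rule AE_T[OF rc[OF C] \<psi>(2)[OF c(1) cS]])
    then have ae: "AE y in M. y \<in> {y \<in> X n x. w q y \<noteq> k} \<longrightarrow> y \<in> X n x - E v"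
    proof eventually_elim
      case (elim y)
      show ?case
      proof
        assume y: "y \<in> {y \<in> X n x. w q y \<noteq> k}"
        then have ym: "y \<in> space M" by (simp add: X_iff)
        have "\<alpha> (r C) y \<in> X n0 x0" using St_level_iff[OF x0 ym r(1)[OF C]] y Xsub by auto
        then have "w q y = \<psi> c \<otimes>\<^bsub>L\<^esub> w (r C) y" using elim w_mult[OF cc rc[OF C] ym] by (simp add: q_def)
        then have "w (r C) y \<noteq> v C" using y by (auto simp: k_def)
        then show "y \<in> X n x - E v" using y C by (auto simp: E_def)
      qed
    qed
    have "{y \<in> X n x. w q y \<noteq> k} = X n x - {y \<in> space M. w q y = k}" by (auto simp: X_iff)
    then have "{y \<in> X n x. w q y \<noteq> k} \<in> sets M" using w_sets[OF St_carrier[OF q]] by simp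
    then have "measure M {y \<in> X n x. w q y \<noteq> k} \<le> measure M (X n x - E v)"
      using ae by (intro finite_measure_mono_AE) auto
    then have maj: "2 * measure M {y \<in> X n x. w q y \<noteq> k} < measure M (X n x)" using den by simp
    have "AE y in M. y \<in> X n x \<longrightarrow> w q y = k"
      by (rule majority_constant[of x0 n0 \<psi> n x q k, OF x0 _ _ n x q k maj]) (fact \<psi>(1), fact \<psi>(2))
    then have "q \<in> Q" using q k by (auto simp: Q_def)
    then show ?thesis using qC by blast
  qed
  show ?thesis
  proof (rule found[OF xm pos])
    fix g assume g: "g \<in> St n x"
    then have gc: "g \<in> carrier G" by (rule St_carrier)
    have "G0 #> g \<in> generate (G Mod G0) S" unfolding S(3) using gc by (auto simp: FactGroup_def RCOSETS_def)
    then obtain q where q: "q \<in> Q" "G0 #> g = G0 #> q"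
      using generated_quotient_mod[OF G0_normal Qs SQ] by blast
    have qS: "q \<in> St n x" and qc: "q \<in> carrier G" using q by (auto simp: Q_def St_def)
    have "g \<in> G0 #> q" using q(2) rcos_self[OF gc G0_subgroup] by simp
    then obtain h where h: "h \<in> G0" "g = h \<otimes> q" by (auto simp: r_coset_def)
    then have "h = g \<otimes> inv q" using qc G0_carrier by (simp add: m_assoc)
    then have "h \<in> St n x" using g qS Sg by (simp add: subgroup.m_closed subgroup.m_inv_closed)
    then have "g \<in> Q" using G0Q h q Qs by (simp add: subgroup.m_closed)
    then show "\<exists>k\<in>carrier L. AE y in M. y \<in> X n x \<longrightarrow> w g y = k" by (simp add: Q_def)
  qed
qed

text \<open>The coboundary of \<open>\<phi>\<close> turns \<open>w\<close> into a cocycle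
  \<open>w'\<close> that is constant on a level set for each stabilizing element of
  \<open>G0\<close>; \<open>constant_on_level\<close> is applied to \<open>w'\<close> as a cocycle
  system in its own right.\<close>

theorem cocycle_superrigidity:
  assumes fg: "finitely_generated_group (G Mod G0)"
  obtains n x \<phi> \<psi> where "x \<in> space M" "measure M (X n x) > 0"
    "\<phi> \<in> measurable M (count_space (carrier L))"
    "\<psi> \<in> hom (G\<lparr>carrier := St n x\<rparr>) L"
    "\<And>g. g \<in> St n x \<Longrightarrow> AE y in M. y \<in> X n x \<longrightarrow> w g y = \<phi> (\<alpha> g y) \<otimes>\<^bsub>L\<^esub> \<psi> g \<otimes>\<^bsub>L\<^esub> inv\<^bsub>L\<^esub> \<phi> y"
proof -
  note found = that
  obtain n0 x0 \<psi>0 \<phi> where x0: "x0 \<in> space M" and pos0: "measure M (X n0 x0) > 0"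
    and \<phi> [measurable]: "\<phi> \<in> measurable M (count_space (carrier L))"
    and \<psi>0: "\<And>g. g \<in> G0 \<Longrightarrow> g \<in> St n0 x0 \<Longrightarrow> \<psi>0 g \<in> carrier L"
      "\<And>g. g \<in> G0 \<Longrightarrow> g \<in> St n0 x0 \<Longrightarrow> AE y in M. y \<in> X n0 x0 \<longrightarrow>
        w g y = \<phi> (\<alpha> g y) \<otimes>\<^bsub>L\<^esub> \<psi>0 g \<otimes>\<^bsub>L\<^esub> inv\<^bsub>L\<^esub> \<phi> y"
    by (rule untwist_G0) (rule that)
  have \<phi>c: "\<phi> y \<in> carrier L" if "y \<in> space M" for y using measurable_space[OF \<phi> that] by simp
  define w' where "w' g y = inv\<^bsub>L\<^esub> \<phi> (\<alpha> g y) \<otimes>\<^bsub>L\<^esub> w g y \<otimes>\<^bsub>L\<^esub> \<phi> y" for g y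
  interpret W: cocycle_system G M \<alpha> G0 L w'
  proof
    show "relative_property_T G G0" by (rule T)
    show "countable (carrier L)" by (rule countable_L)
  next
    fix g assume g: "g \<in> carrier G"
    note [measurable] = w_measurable[OF g] T_measurable[OF g]
    have "(\<lambda>y. (\<phi> (\<alpha> g y), w g y, \<phi> y)) \<in> measurable M
        (count_space (carrier L) \<Otimes>\<^sub>M (count_space (carrier L) \<Otimes>\<^sub>M count_space (carrier L)))"
      by measurable
    then have "(\<lambda>y. (\<phi> (\<alpha> g y), w g y, \<phi> y)) \<in> measurable M (count_space (carrier L \<times> carrier L \<times> carrier L))"
      by (simp add: pair_measure_countable countable_L)
    from measurable_compose[OF this, of "\<lambda>(a, b, c). inv\<^bsub>L\<^esub> a \<otimes>\<^bsub>L\<^esub> b \<otimes>\<^bsub>L\<^esub> c" "count_space (carrier L)"]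
    show "w' g \<in> measurable M (count_space (carrier L))"
      by (simp add: w'_def[abs_def] Pi_def)
  next
    fix g h y assume a: "g \<in> carrier G" "h \<in> carrier G" "y \<in> space M"
    have c: "\<phi> y \<in> carrier L" "\<phi> (\<alpha> h y) \<in> carrier L" "\<phi> (\<alpha> g (\<alpha> h y)) \<in> carrier L"
      "w h y \<in> carrier L" "w g (\<alpha> h y) \<in> carrier L" using a \<phi>c T_space by auto
    show "w' (g \<otimes> h) y = w' g (\<alpha> h y) \<otimes>\<^bsub>L\<^esub> w' h y"
      using a c by (simp add: w'_def T_mult w_mult L.m_assoc L.inv_mult_cancel)
  qed
  have untw: "w g y = \<phi> (\<alpha> g y) \<otimes>\<^bsub>L\<^esub> k \<otimes>\<^bsub>L\<^esub> inv\<^bsub>L\<^esub> \<phi> y \<longleftrightarrow> w' g y = k"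
    if "g \<in> carrier G" "y \<in> space M" "k \<in> carrier L" for g y k
  proof -
    have c: "\<phi> y \<in> carrier L" "\<phi> (\<alpha> g y) \<in> carrier L" "w g y \<in> carrier L"
      using that \<phi>c T_space by auto
    show ?thesis
    proof
      assume "w g y = \<phi> (\<alpha> g y) \<otimes>\<^bsub>L\<^esub> k \<otimes>\<^bsub>L\<^esub> inv\<^bsub>L\<^esub> \<phi> y"
      then show "w' g y = k" using c that by (simp add: w'_def L.m_assoc L.inv_mult_cancel)
    next
      assume "w' g y = k"
      then have "k = w' g y" ..
      then show "w g y = \<phi> (\<alpha> g y) \<otimes>\<^bsub>L\<^esub> k \<otimes>\<^bsub>L\<^esub> inv\<^bsub>L\<^esub> \<phi> y"
        using c by (simp add: w'_def L.m_assoc L.inv_mult_cancel)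
    qed
  qed
  have w'0: "AE y in M. y \<in> X n0 x0 \<longrightarrow> w' g y = \<psi>0 g" if "g \<in> G0" "g \<in> St n0 x0" for g
    using \<psi>0(2)[OF that] AE_space
    by eventually_elim (use untw \<psi>0(1)[OF that] G0_carrier that in auto)
  obtain n x where x: "x \<in> space M" and pos: "measure M (X n x) > 0"
    and k: "\<And>g. g \<in> St n x \<Longrightarrow> \<exists>k\<in>carrier L. AE y in M. y \<in> X n x \<longrightarrow> w' g y = k"
    by (rule W.constant_on_level[OF fg x0 pos0 \<psi>0(1) w'0]) (auto intro: that)
  obtain \<psi> where \<psi>: "\<And>g. g \<in> St n x \<Longrightarrow> \<psi> g \<in> carrier L"
    "\<And>g. g \<in> St n x \<Longrightarrow> AE y in M. y \<in> X n x \<longrightarrow> w' g y = \<psi> g"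
    using k by metis
  have hom: "\<psi> \<in> hom (G\<lparr>carrier := St n x\<rparr>) L"
  proof (rule homI)
    show "\<psi> g \<in> carrier L" if "g \<in> carrier (G\<lparr>carrier := St n x\<rparr>)" for g using that \<psi> by simp
    fix g h assume "g \<in> carrier (G\<lparr>carrier := St n x\<rparr>)" "h \<in> carrier (G\<lparr>carrier := St n x\<rparr>)"
    then have gh: "g \<in> St n x" "h \<in> St n x" "g \<in> carrier G" "h \<in> carrier G" by (auto simp: St_carrier)
    have ghS: "g \<otimes> h \<in> St n x" using gh St_subgroup[OF x] by (simp add: subgroup.m_closed)
    have "AE y in M. \<alpha> h y \<in> X n x \<longrightarrow> w' g (\<alpha> h y) = \<psi> g" using gh \<psi>(2) by (intro AE_T) auto
    then have "AE y in M. y \<in> X n x \<longrightarrow> \<psi> (g \<otimes> h) = \<psi> g \<otimes>\<^bsub>L\<^esub> \<psi> h"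
      using \<psi>(2)[OF gh(2)] \<psi>(2)[OF ghS] AE_space
    proof eventually_elim
      case (elim y)
      show ?case
      proof
        assume y: "y \<in> X n x"
        then have "\<alpha> h y \<in> X n x" using gh(2) St_level_iff[OF x, of y h] elim by simp
        then have "w' g (\<alpha> h y) = \<psi> g" "w' h y = \<psi> h" "w' (g \<otimes> h) y = \<psi> (g \<otimes> h)"
          using elim y by simp_all
        then show "\<psi> (g \<otimes> h) = \<psi> g \<otimes>\<^bsub>L\<^esub> \<psi> h" using W.w_mult[of g h y] gh elim by simp
      qed
    qed
    \<comment> \<open>The equation does not involve \<open>y\<close>, so one witness proves
      it.\<close>
    then obtain y where "\<psi> (g \<otimes> h) = \<psi> g \<otimes>\<^bsub>L\<^esub> \<psi> h"
      by (rule AE_X_nonempty[of n x, OF pos])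
    then show "\<psi> (g \<otimes>\<^bsub>G\<lparr>carrier := St n x\<rparr>\<^esub> h) = \<psi> g \<otimes>\<^bsub>L\<^esub> \<psi> h" by simp
  qed
  have tw: "AE y in M. y \<in> X n x \<longrightarrow> w g y = \<phi> (\<alpha> g y) \<otimes>\<^bsub>L\<^esub> \<psi> g \<otimes>\<^bsub>L\<^esub> inv\<^bsub>L\<^esub> \<phi> y"
    if g: "g \<in> St n x" for g
    using \<psi>(2)[OF g] AE_space by eventually_elim (use untw \<psi>(1)[OF g] St_carrier[OF g] in auto)
  show ?thesis by (rule found[OF x pos \<phi> hom tw])
qed

end

section \<open>Measure preserving partial isomorphisms\<close>

text \<open>In contrast to \<open>iso_mod_null\<close>, domain and range are explicit and nothing
  may fail on a null set, so such maps can be restricted, composed and glued. The factor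
  \<open>c\<close> accommodates the amplification by \<open>t\<close>.\<close>

definition piso :: "'x measure \<Rightarrow> 'y measure \<Rightarrow> ennreal \<Rightarrow> ('x \<Rightarrow> 'y) \<Rightarrow> 'x set \<Rightarrow> 'y set \<Rightarrow> bool" where
  "piso M N c f A B \<longleftrightarrow> A \<in> sets M \<and> B \<in> sets N \<and> bij_betw f A B \<and>
    (\<forall>E\<subseteq>A. (E \<in> sets M \<longleftrightarrow> f ` E \<in> sets N) \<and> (E \<in> sets M \<longrightarrow> emeasure N (f ` E) = c * emeasure M E))"

lemma pisoD:
  assumes "piso M N c f A B"
  shows "A \<in> sets M" "B \<in> sets N" "bij_betw f A B" "inj_on f A" "f ` A = B"
    "\<And>E. E \<subseteq> A \<Longrightarrow> E \<in> sets M \<longleftrightarrow> f ` E \<in> sets N"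
    "\<And>E. E \<subseteq> A \<Longrightarrow> E \<in> sets M \<Longrightarrow> emeasure N (f ` E) = c * emeasure M E"
    "emeasure N B = c * emeasure M A"
  using assms by (auto simp: piso_def bij_betw_def)

lemma pisoI:
  assumes "A \<in> sets M" "B \<in> sets N" "bij_betw f A B"
    "\<And>E. E \<subseteq> A \<Longrightarrow> E \<in> sets M \<longleftrightarrow> f ` E \<in> sets N"
    "\<And>E. E \<subseteq> A \<Longrightarrow> E \<in> sets M \<Longrightarrow> emeasure N (f ` E) = c * emeasure M E"
  shows "piso M N c f A B"
  using assms by (auto simp: piso_def)

lemma piso_vimage:
  assumes "piso M N c f A B" "E \<in> sets N"
  shows "{x \<in> A. f x \<in> E} \<in> sets M"
proof -
  have "f ` {x \<in> A. f x \<in> E} = B \<inter> E" using pisoD(5)[OF assms(1)] by auto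
  then show ?thesis using pisoD(2,6)[OF assms(1)] assms(2) by (metis (no_types, lifting) mem_Collect_eq sets.Int subsetI)
qed

lemma piso_restrict:
  assumes "piso M N c f A B" "A' \<subseteq> A" "A' \<in> sets M"
  shows "piso M N c f A' (f ` A')"
proof (rule pisoI)
  show "f ` A' \<in> sets N" using pisoD(6)[OF assms(1,2)] assms(3) by simp
  show "bij_betw f A' (f ` A')" using pisoD(4)[OF assms(1)] assms(2) by (meson inj_on_imp_bij_betw inj_on_subset)
qed (use assms pisoD[OF assms(1)] in auto)

lemma piso_cong:
  assumes "piso M N c f A B" "\<And>x. x \<in> A \<Longrightarrow> f x = g x"
  shows "piso M N c g A B"
proof -
  have im: "g ` E = f ` E" if "E \<subseteq> A" for E using assms(2) that by force
  have "bij_betw g A B" using assms pisoD(3) bij_betw_cong by metis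
  then show ?thesis using assms(1) im unfolding piso_def by auto
qed

lemma piso_comp:
  assumes f: "piso M N c f A B" and g: "piso N P d g B C"
  shows "piso M P (c * d) (g \<circ> f) A C"
proof (rule pisoI)
  show "A \<in> sets M" "C \<in> sets P" using pisoD(1)[OF f] pisoD(2)[OF g] .
  show "bij_betw (g \<circ> f) A C" by (rule bij_betw_trans[OF pisoD(3)[OF f] pisoD(3)[OF g]])
  fix E assume E: "E \<subseteq> A"
  then have fE: "f ` E \<subseteq> B" using pisoD(5)[OF f] by auto
  show "E \<in> sets M \<longleftrightarrow> (g \<circ> f) ` E \<in> sets P"
    using pisoD(6)[OF f E] pisoD(6)[OF g fE] by (simp add: image_comp)
  assume "E \<in> sets M"
  then show "emeasure P ((g \<circ> f) ` E) = c * d * emeasure M E"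
    unfolding image_comp[symmetric] using pisoD(6,7)[OF f E] pisoD(6,7)[OF g fE] by (simp add: ac_simps)
qed

lemma piso_inv:
  assumes f: "piso M N c f A B" and c: "c \<noteq> 0" "c \<noteq> \<infinity>"
  shows "piso N M (1 / c) (inv_into A f) B A"
proof (rule pisoI)
  show "A \<in> sets M" "B \<in> sets N" using pisoD(1,2)[OF f] .
  show "bij_betw (inv_into A f) B A" using pisoD(3)[OF f] by (rule bij_betw_inv_into)
  fix E assume E: "E \<subseteq> B"
  have fE: "f ` inv_into A f ` E = E" using E pisoD(5)[OF f] by (intro image_inv_into_cancel) auto
  have sub: "inv_into A f ` E \<subseteq> A" using E pisoD(5)[OF f] by (auto intro: inv_into_into)
  show "E \<in> sets N \<longleftrightarrow> inv_into A f ` E \<in> sets M" using pisoD(6)[OF f sub] fE by simp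
  assume "E \<in> sets N"
  then have "emeasure N E = c * emeasure M (inv_into A f ` E)" using pisoD(6,7)[OF f sub] fE by simp
  then have "emeasure N E / c = emeasure M (inv_into A f ` E)"
    using c mult_divide_eq_ennreal[of c "emeasure M (inv_into A f ` E)"] by (simp add: mult.commute)
  then show "emeasure M (inv_into A f ` E) = 1 / c * emeasure N E"
    by (simp add: divide_ennreal_def mult.commute)
qed

lemma piso_glue:
  assumes I: "countable I" and f: "\<And>i. i \<in> I \<Longrightarrow> piso M N c f (A i) (B i)"
    and dA: "disjoint_family_on A I" and dB: "disjoint_family_on B I"
  shows "piso M N c f (\<Union>i\<in>I. A i) (\<Union>i\<in>I. B i)"
proof (rule pisoI)
  show "(\<Union>i\<in>I. A i) \<in> sets M" "(\<Union>i\<in>I. B i) \<in> sets N"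
    using I f pisoD(1,2) by (blast intro: sets.countable_UN'')+
  have fB: "f x \<in> B i" if "i \<in> I" "x \<in> A i" for i x using pisoD(5)[OF f] that by blast
  have "inj_on f (\<Union>i\<in>I. A i)"
  proof (rule inj_onI)
    fix x y assume xy: "x \<in> (\<Union>i\<in>I. A i)" "y \<in> (\<Union>i\<in>I. A i)" and e: "f x = f y"
    then obtain i j where i: "i \<in> I" "x \<in> A i" "j \<in> I" "y \<in> A j" by blast
    then have "f x \<in> B i \<inter> B j" using fB e by force
    then have "i = j" using dB i unfolding disjoint_family_on_def by blast
    then show "x = y" using i e pisoD(4)[OF f[OF i(1)]] by (auto dest: inj_onD)
  qed
  moreover have "f ` (\<Union>i\<in>I. A i) = (\<Union>i\<in>I. B i)" using pisoD(5)[OF f] by (simp add: image_UN)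
  ultimately show "bij_betw f (\<Union>i\<in>I. A i) (\<Union>i\<in>I. B i)" by (simp add: bij_betw_def)
  fix E assume E: "E \<subseteq> (\<Union>i\<in>I. A i)"
  have Eu: "E = (\<Union>i\<in>I. E \<inter> A i)" using E by blast
  have fu: "f ` E = (\<Union>i\<in>I. f ` (E \<inter> A i))" using Eu by blast
  have fi: "f ` E \<inter> B i = f ` (E \<inter> A i)" if i: "i \<in> I" for i
  proof
    show "f ` E \<inter> B i \<subseteq> f ` (E \<inter> A i)"
    proof
      fix y assume y: "y \<in> f ` E \<inter> B i"
      then obtain x where x: "x \<in> E" "y = f x" by blast
      then obtain j where j: "j \<in> I" "x \<in> A j" using E by blast
      then have "y \<in> B i \<inter> B j" using fB x y by blast
      then have "i = j" using dB i j unfolding disjoint_family_on_def by blast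
      then show "y \<in> f ` (E \<inter> A i)" using x j by blast
    qed
  qed (use fB i in blast)
  have Ai: "E \<inter> A i \<in> sets M \<longleftrightarrow> f ` (E \<inter> A i) \<in> sets N" if "i \<in> I" for i
    by (rule pisoD(6)[OF f[OF that]]) simp
  show "E \<in> sets M \<longleftrightarrow> f ` E \<in> sets N"
  proof
    assume "E \<in> sets M"
    then have "f ` (E \<inter> A i) \<in> sets N" if "i \<in> I" for i using Ai that pisoD(1)[OF f] by blast
    then show "f ` E \<in> sets N" unfolding fu using I by (intro sets.countable_UN'') auto
  next
    assume "f ` E \<in> sets N"
    then have "E \<inter> A i \<in> sets M" if "i \<in> I" for i
      using Ai[OF that] fi[OF that] pisoD(2)[OF f[OF that]] by (metis sets.Int)
    then show "E \<in> sets M" using I by (subst Eu) (intro sets.countable_UN'', auto)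
  qed
  assume EM: "E \<in> sets M"
  then have s: "E \<inter> A i \<in> sets M" if "i \<in> I" for i using that pisoD(1)[OF f] by blast
  have "emeasure N (f ` E) = (\<integral>\<^sup>+i. emeasure N (f ` (E \<inter> A i)) \<partial>count_space I)"
    unfolding fu
  proof (rule emeasure_UN_countable[OF _ I])
    show "f ` (E \<inter> A i) \<in> sets N" if "i \<in> I" for i using s that Ai by blast
    show "disjoint_family_on (\<lambda>i. f ` (E \<inter> A i)) I"
      using dB fi unfolding disjoint_family_on_def by blast
  qed
  also have "\<dots> = (\<integral>\<^sup>+i. c * emeasure M (E \<inter> A i) \<partial>count_space I)"
    using s by (intro nn_integral_cong) (auto intro!: pisoD(7)[OF f])
  also have "\<dots> = c * (\<integral>\<^sup>+i. emeasure M (E \<inter> A i) \<partial>count_space I)"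
    by (rule nn_integral_cmult) simp
  also have "(\<integral>\<^sup>+i. emeasure M (E \<inter> A i) \<partial>count_space I) = emeasure M (\<Union>i\<in>I. E \<inter> A i)"
    using dA s by (intro emeasure_UN_countable[symmetric] I) (auto simp: disjoint_family_on_def)
  finally show "emeasure N (f ` E) = c * emeasure M E" using Eu by simp
qed

lemma piso_Un:
  assumes "piso M N c f A B" "piso M N c f A' B'" "A \<inter> A' = {}" "B \<inter> B' = {}"
  shows "piso M N c f (A \<union> A') (B \<union> B')"
proof -
  have "piso M N c f (\<Union>i\<in>{True, False}. if i then A else A') (\<Union>i\<in>{True, False}. if i then B else B')"
    using assms by (intro piso_glue) (auto simp: disjoint_family_on_def)
  then show ?thesis by (simp add: sup_commute)
qed

lemma piso_id: "A \<in> sets M \<Longrightarrow> piso M M 1 (\<lambda>x. x) A A"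
  by (rule pisoI) (auto simp: bij_betw_def)

section \<open>Completions and normalized restrictions\<close>

lemma completion_sandwich:
  assumes "E \<in> sets (completion M)"
  obtains S N' where "S \<in> sets M" "S \<subseteq> E" "N' \<in> null_sets M" "E - S \<subseteq> N'"
    "emeasure (completion M) E = emeasure M S"
proof -
  have 1: "main_part M E \<in> sets M" using assms by (rule main_part_sets)
  have 2: "main_part M E \<union> null_part M E = E" using assms by (rule main_part_null_part_Un)
  obtain N' where "N' \<in> null_sets M" "null_part M E \<subseteq> N'" using null_part[OF assms] by auto
  then show ?thesis using that[OF 1, of N'] 2 emeasure_completion[OF assms] by blast
qed

text \<open>A completion-measurable set differs from a measurable one by part of a null set, and
  null sets are transported in both directions; on the way back this uses
  \<open>c \<noteq> 0\<close>.\<close>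

lemma piso_completion:
  assumes A: "A \<in> sets M" and B: "B \<in> sets N" and bij: "bij_betw f A B" and c: "c \<noteq> 0"
    and img: "\<And>E. E \<in> sets M \<Longrightarrow> E \<subseteq> A \<Longrightarrow> f ` E \<in> sets N \<and> emeasure N (f ` E) = c * emeasure M E"
    and pre: "\<And>E. E \<in> sets N \<Longrightarrow> E \<subseteq> B \<Longrightarrow> {x \<in> A. f x \<in> E} \<in> sets M"
  shows "piso (completion M) (completion N) c f A B"
proof (rule pisoI)
  have inj: "inj_on f A" and fA: "f ` A = B" using bij by (auto simp: bij_betw_def)
  have fwd: "f ` E \<in> sets (completion N) \<and> emeasure (completion N) (f ` E) = c * emeasure (completion M) E"
    if E: "E \<subseteq> A" "E \<in> sets (completion M)" for E
  proof -
    obtain S N' where S: "S \<in> sets M" "S \<subseteq> E" "N' \<in> null_sets M" "E - S \<subseteq> N'"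
      "emeasure (completion M) E = emeasure M S" using completion_sandwich[OF E(2)] .
    have SA: "S \<subseteq> A" using S E by auto
    have "N' \<inter> A \<in> sets M" "emeasure M (N' \<inter> A) = 0"
      using S(3) A null_set_Int1 by (auto simp: null_sets_def intro: emeasure_eq_0[of N'])
    then have n: "f ` (N' \<inter> A) \<in> null_sets N" using img[of "N' \<inter> A"] by (auto simp: null_sets_def)
    have fE: "f ` E = f ` S \<union> f ` (E - S)" using S by blast
    have sub: "f ` (E - S) \<subseteq> f ` (N' \<inter> A)" using S E by blast
    have m: "f ` E \<in> sets (completion N)"
      by (rule sets_completionI[OF fE sub n]) (use img[OF S(1) SA] in simp)
    have "emeasure (completion N) (f ` E) = emeasure (completion N) (f ` S)"
    proof (rule emeasure_eq_AE)
      have "AE y in completion N. y \<notin> f ` (N' \<inter> A)" by (rule AE_completion[OF AE_not_in[OF n]])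
      then show "AE y in completion N. y \<in> f ` E \<longleftrightarrow> y \<in> f ` S"
        by eventually_elim (use fE sub in blast)
    qed (use m img[OF S(1) SA] in auto)
    then show ?thesis using m img[OF S(1) SA] S(5) by simp
  qed
  have bwd: "E \<in> sets (completion M)" if E: "E \<subseteq> A" "f ` E \<in> sets (completion N)" for E
  proof -
    obtain S N' where S: "S \<in> sets N" "S \<subseteq> f ` E" "N' \<in> null_sets N" "f ` E - S \<subseteq> N'"
      using completion_sandwich[OF E(2)] by metis
    have "S \<subseteq> B" using S(2) E(1) fA by blast
    then have S': "{x \<in> A. f x \<in> S} \<in> sets M" using pre S by auto
    have NB: "N' \<inter> B \<in> sets N" "emeasure N (N' \<inter> B) = 0"
      using S(3) B by (auto simp: null_sets_def intro: emeasure_eq_0[of N'])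
    then have N1: "{x \<in> A. f x \<in> N' \<inter> B} \<in> sets M" by (intro pre) auto
    have "f ` {x \<in> A. f x \<in> N' \<inter> B} = N' \<inter> B" using fA by auto
    then have "c * emeasure M {x \<in> A. f x \<in> N' \<inter> B} = 0" using img[OF N1] NB by simp
    then have N2: "{x \<in> A. f x \<in> N' \<inter> B} \<in> null_sets M" using c N1 by (auto simp: null_sets_def)
    have "{x \<in> A. f x \<in> S} \<subseteq> E"
    proof
      fix x assume x: "x \<in> {x \<in> A. f x \<in> S}"
      then obtain y where "y \<in> E" "f x = f y" using S by auto
      then show "x \<in> E" using inj x E by (auto dest: inj_onD)
    qed
    then have eq: "E = {x \<in> A. f x \<in> S} \<union> (E - {x \<in> A. f x \<in> S})" by auto
    have "E - {x \<in> A. f x \<in> S} \<subseteq> {x \<in> A. f x \<in> N' \<inter> B}" using S E fA by auto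
    then show ?thesis by (rule sets_completionI[OF eq _ N2 S'])
  qed
  show "A \<in> sets (completion M)" "B \<in> sets (completion N)" using A B by auto
  show "bij_betw f A B" by (rule bij)
  fix E assume E: "E \<subseteq> A"
  show "E \<in> sets (completion M) \<longleftrightarrow> f ` E \<in> sets (completion N)" using fwd bwd E by blast
  show "emeasure (completion N) (f ` E) = c * emeasure (completion M) E" if "E \<in> sets (completion M)"
    using fwd E that by blast
qed

lemma completion_normalized_restriction:
  assumes A: "A \<in> sets M" and m: "emeasure M A \<noteq> 0" "emeasure M A \<noteq> \<infinity>"
  shows "E \<in> sets (completion (normalized_restriction M A)) \<longleftrightarrow> E \<subseteq> A \<and> E \<in> sets (completion M)"
    and "E \<in> sets (completion M) \<Longrightarrow> E \<subseteq> A \<Longrightarrow>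
      emeasure (completion (normalized_restriction M A)) E = emeasure (completion M) E / emeasure M A"
    and "space (normalized_restriction M A) = A"
proof -
  let ?R = "normalized_restriction M A"
  have sp: "A \<inter> space M \<in> sets M" "A \<inter> space M = A" using A sets.sets_into_space[OF A] by (auto simp: Int_absorb2)
  have sR: "S \<in> sets ?R \<longleftrightarrow> S \<subseteq> A \<and> S \<in> sets M" for S
    using sets_restrict_space_iff[OF sp(1)] by (auto simp: normalized_restriction_def)
  have eR: "emeasure ?R S = emeasure M S / emeasure M A" if "S \<subseteq> A" for S
    using emeasure_restrict_space[OF sp(1) that]
    by (simp add: normalized_restriction_def divide_ennreal_def mult.commute)
  have nz: "1 / emeasure M A \<noteq> 0" using m by (simp add: divide_ennreal_def)
  have nR: "S \<in> null_sets ?R \<longleftrightarrow> S \<subseteq> A \<and> S \<in> null_sets M" for S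
    using sR[of S] eR[of S] m by (auto simp: null_sets_def divide_ennreal_def)
  show "space ?R = A" using sp by (simp add: normalized_restriction_def space_scale_measure space_restrict_space)
  have to: "E \<subseteq> A \<and> E \<in> sets (completion M)" if E: "E \<in> sets (completion ?R)" for E
  proof -
    obtain S N N' where S: "E = S \<union> N" "N \<subseteq> N'" "N' \<in> null_sets ?R" "S \<in> sets ?R"
      using sets_completionE[OF E] .
    then have "E \<in> sets (completion M)" using sR nR sets_completionI[OF S(1,2)] by blast
    moreover have "E \<subseteq> A" using S sR nR by blast
    ultimately show ?thesis by blast
  qed
  have rev: "E \<in> sets (completion ?R) \<and> emeasure (completion ?R) E = emeasure (completion M) E / emeasure M A"
    if E: "E \<subseteq> A" "E \<in> sets (completion M)" for E
  proof -
    obtain S N' where S: "S \<in> sets M" "S \<subseteq> E" "N' \<in> null_sets M" "E - S \<subseteq> N'"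
      "emeasure (completion M) E = emeasure M S" using completion_sandwich[OF E(2)] .
    have n: "N' \<inter> A \<in> null_sets ?R" using S(3) A by (auto simp: nR intro: null_set_Int2)
    have eq: "E = S \<union> (E - S)" using S by auto
    have SR: "S \<in> sets ?R" using sR S E by auto
    have m: "E \<in> sets (completion ?R)"
      by (rule sets_completionI[OF eq _ n SR]) (use S E in auto)
    have "emeasure (completion ?R) E = emeasure (completion ?R) S"
    proof (rule emeasure_eq_AE)
      have "AE y in completion ?R. y \<notin> N' \<inter> A" by (rule AE_completion[OF AE_not_in[OF n]])
      then show "AE y in completion ?R. y \<in> E \<longleftrightarrow> y \<in> S" by eventually_elim (use S E in blast)
    qed (use m SR in auto)
    then show ?thesis using m SR S eR[of S] E by simp
  qed
  show "E \<in> sets (completion ?R) \<longleftrightarrow> E \<subseteq> A \<and> E \<in> sets (completion M)" using to rev by blast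
  show "E \<in> sets (completion M) \<Longrightarrow> E \<subseteq> A \<Longrightarrow>
      emeasure (completion ?R) E = emeasure (completion M) E / emeasure M A" using rev by blast
qed

lemma (in group) lcosets_cases:
  assumes "subgroup H G" "g \<in> carrier G" "h \<in> carrier G"
  shows "g <# H = h <# H \<longleftrightarrow> inv h \<otimes> g \<in> H" "g \<in> g <# H" "g \<in> h <# H \<longleftrightarrow> inv h \<otimes> g \<in> H"
proof -
  have Hc: "H \<subseteq> carrier G" using assms(1) by (rule subgroup.subset)
  have mem: "a \<in> b <# H \<longleftrightarrow> inv b \<otimes> a \<in> H" if "a \<in> carrier G" "b \<in> carrier G" for a b
  proof
    assume "a \<in> b <# H"
    then obtain x where "x \<in> H" "a = b \<otimes> x" by (auto simp: l_coset_def)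
    then show "inv b \<otimes> a \<in> H" using that Hc inv_mult_cancel by auto
  next
    assume "inv b \<otimes> a \<in> H"
    moreover have "a = b \<otimes> (inv b \<otimes> a)" using that inv_mult_cancel by simp
    ultimately show "a \<in> b <# H" by (auto simp: l_coset_def)
  qed
  show gg: "g \<in> g <# H" using mem[of g g] assms subgroup.one_closed by auto
  show "g \<in> h <# H \<longleftrightarrow> inv h \<otimes> g \<in> H" using mem assms by simp
  show "g <# H = h <# H \<longleftrightarrow> inv h \<otimes> g \<in> H"
  proof
    assume "g <# H = h <# H" then show "inv h \<otimes> g \<in> H" using gg mem assms by simp
  next
    assume k: "inv h \<otimes> g \<in> H"
    have sub: "a <# H \<subseteq> b <# H" if ab: "a \<in> carrier G" "b \<in> carrier G" "inv b \<otimes> a \<in> H" for a b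
    proof
      fix x assume x: "x \<in> a <# H"
      then have xc: "x \<in> carrier G" using Hc ab by (auto simp: l_coset_def)
      then have "inv a \<otimes> x \<in> H" using mem x ab by simp
      then have "(inv b \<otimes> a) \<otimes> (inv a \<otimes> x) \<in> H" using ab assms(1) by (simp add: subgroup.m_closed)
      then have "inv b \<otimes> x \<in> H" using ab xc by (simp add: m_assoc inv_mult_cancel)
      then show "x \<in> b <# H" using mem xc ab by simp
    qed
    have "inv (inv h \<otimes> g) \<in> H" using k assms(1) by (simp add: subgroup.m_inv_closed)
    then have "inv g \<otimes> h \<in> H" using assms by (simp add: inv_mult_group)
    then show "g <# H = h <# H" using sub[of g h] sub[of h g] k assms by blast
  qed
qed

text \<open>An iterate of a partial map is defined only where the previous iterates have stayed in
  the domain, hence the shrinking domains in the induction.\<close>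

lemma piso_iterate:
  assumes \<rho>: "piso S S 1 \<rho> Z Z'" and D: "D \<in> sets S"
  shows "piso S S 1 (\<rho> ^^ n) {c \<in> D. \<forall>i<n. (\<rho> ^^ i) c \<in> Z} ((\<rho> ^^ n) ` {c \<in> D. \<forall>i<n. (\<rho> ^^ i) c \<in> Z})"
proof (induction n)
  case 0
  have "piso S S 1 (\<lambda>x. x) D D" using D by (rule piso_id)
  then show ?case by (simp add: piso_cong[of _ _ _ "\<lambda>x. x"])
next
  case (Suc n)
  let ?D = "\<lambda>n. {c \<in> D. \<forall>i<n. (\<rho> ^^ i) c \<in> Z}"
  have eq: "?D (Suc n) = {c \<in> ?D n. (\<rho> ^^ n) c \<in> Z}" by (auto simp: less_Suc_eq)
  have m: "?D (Suc n) \<in> sets S" unfolding eq by (rule piso_vimage[OF Suc pisoD(1)[OF \<rho>]])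
  have p: "piso S S 1 (\<rho> ^^ n) (?D (Suc n)) ((\<rho> ^^ n) ` ?D (Suc n))"
    by (rule piso_restrict[OF Suc _ m]) (use eq in blast)
  have "piso S S 1 \<rho> ((\<rho> ^^ n) ` ?D (Suc n)) (\<rho> ` (\<rho> ^^ n) ` ?D (Suc n))"
    by (rule piso_restrict[OF \<rho> _ pisoD(2)[OF p]]) auto
  from piso_comp[OF p this] show ?case by (simp add: image_comp o_def)
qed

text \<open>The chains \<open>c, \<rho> c, \<rho>\<^sup>2 c, \<dots>\<close> that start outside \<open>Z'\<close> leave \<open>Z\<close> after finitely many steps,
  because the images of a wandering set of positive measure do not fit into a set of finite measure.
  Sending the end of each chain back to its start extends \<open>\<rho>\<close> to an automorphism.\<close>

theorem piso_extend:
  assumes \<rho>: "piso S S 1 \<rho> Z Z'" and fin: "emeasure S (Z \<union> Z') \<noteq> \<infinity>"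
    and R: "\<And>z. z \<in> Z \<Longrightarrow> (z, \<rho> z) \<in> R" and R_refl: "\<And>z. z \<in> space S \<Longrightarrow> (z, z) \<in> R"
    and R_sym: "sym R" and R_trans: "trans R"
  obtains \<tau> A B where "piso S S 1 \<tau> A B" "space S - A \<in> null_sets S" "space S - B \<in> null_sets S"
    "Z \<subseteq> A" "\<And>z. z \<in> Z \<Longrightarrow> \<tau> z = \<rho> z" "\<And>z. z \<in> A \<Longrightarrow> (z, \<tau> z) \<in> R"
    "\<And>z. z \<in> A - (Z \<union> Z') \<Longrightarrow> \<tau> z = z" "\<And>z. z \<in> A \<inter> (Z \<union> Z') \<Longrightarrow> \<tau> z \<in> Z \<union> Z'"
proof -
  \<comment> \<open>The set \<open>C\<close> holds the starts of chains and \<open>V\<close> the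
    possible ends; \<open>D n\<close> consists of the starts whose chain takes at least
    \<open>n\<close> steps.\<close>
  define C where "C = Z - Z'"
  define V where "V = Z' - Z"
  define D where "D n = {c \<in> C. \<forall>i<n. (\<rho> ^^ i) c \<in> Z}" for n
  have Zm: "Z \<in> sets S" "Z' \<in> sets S" using pisoD(1,2)[OF \<rho>] .
  have Cm: "C \<in> sets S" "V \<in> sets S" using Zm by (auto simp: C_def V_def)
  have pD: "piso S S 1 (\<rho> ^^ n) (D n) ((\<rho> ^^ n) ` D n)" for n
    unfolding D_def by (rule piso_iterate[OF \<rho> Cm(1)])
  have Dm: "D n \<in> sets S" for n by (rule pisoD(1)[OF pD])
  have Dmono: "D m \<subseteq> D n" if "n \<le> m" for m n using that by (auto simp: D_def)
  have D_Z: "(\<rho> ^^ n) c \<in> Z" if "c \<in> D (Suc n)" for n c using that by (simp add: D_def)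
  have D_Z': "(\<rho> ^^ Suc n) c \<in> Z'" if "c \<in> D (Suc n)" for n c
    using D_Z[OF that] pisoD(5)[OF \<rho>] by auto
  have cancel: "c = (\<rho> ^^ k) c'" if "c \<in> D n" "c' \<in> D (n + k)" "(\<rho> ^^ n) c = (\<rho> ^^ (n + k)) c'" for n k c c'
    using that
  proof (induction n)
    case (Suc n)
    have "(\<rho> ^^ n) c \<in> Z" "(\<rho> ^^ (n + k)) c' \<in> Z" using Suc.prems D_Z by auto
    then have "(\<rho> ^^ n) c = (\<rho> ^^ (n + k)) c'"
      using Suc.prems(3) pisoD(4)[OF \<rho>] by (auto dest: inj_onD)
    then show ?case using Suc Dmono[of n "Suc n"] Dmono[of "n + k" "Suc (n + k)"] by auto
  qed simp
  \<comment> \<open>Equal points could be traced back by injectivity until the chain with fewer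
    steps reaches its start, which would then lie in \<open>Z'\<close>.\<close>
  have neq: "(\<rho> ^^ n) c \<noteq> (\<rho> ^^ m) c'" if "c \<in> D n" "c' \<in> D m" "n < m" for n m c c'
  proof
    assume e: "(\<rho> ^^ n) c = (\<rho> ^^ m) c'"
    define k where "k = m - Suc n"
    have m: "m = n + Suc k" using that(3) by (simp add: k_def)
    then have "c = (\<rho> ^^ Suc k) c'" using cancel[of c n c' "Suc k"] that e by auto
    moreover have "c' \<in> D (Suc k)" using that(2) Dmono[of "Suc k" m] m by auto
    ultimately have "c \<in> Z'" using D_Z'[of c' k] by simp
    then show False using that(1) by (simp add: D_def C_def)
  qed
  \<comment> \<open>The starts of infinite chains. Their iterates are disjoint, of equal measure and
    inside a set of finite measure.\<close>
  define W where "W = (\<Inter>n. D n)"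
  have Wm: "W \<in> sets S" unfolding W_def using Dm by auto
  have W0: "emeasure S W = 0"
  proof (rule ccontr)
    assume nz: "emeasure S W \<noteq> 0"
    have WD: "W \<subseteq> D n" for n by (auto simp: W_def)
    have im: "(\<rho> ^^ n) ` W \<in> sets S" "emeasure S ((\<rho> ^^ n) ` W) = emeasure S W" for n
      using pisoD(6,7)[OF pD WD, of n] Wm by auto
    have "disjoint_family (\<lambda>n. (\<rho> ^^ n) ` W)"
      unfolding disjoint_family_on_def
    proof (intro ballI impI)
      fix m n :: nat assume "m \<noteq> n"
      then show "(\<rho> ^^ m) ` W \<inter> (\<rho> ^^ n) ` W = {}"
        using neq[of _ m _ n] neq[of _ n _ m] WD by (cases "m < n") (fastforce simp: subset_iff)+
    qed
    then have "emeasure S (\<Union>n. (\<rho> ^^ n) ` W) = (\<integral>\<^sup>+n. emeasure S ((\<rho> ^^ n) ` W) \<partial>count_space UNIV)"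
      using im by (intro emeasure_UN_countable) auto
    also have "\<dots> = emeasure S W * \<infinity>" by (simp add: im emeasure_count_space)
    also have "\<dots> = \<infinity>" using nz by (simp add: ennreal_mult_top)
    finally have "emeasure S (\<Union>n. (\<rho> ^^ n) ` W) = \<infinity>" .
    moreover have "(\<Union>n. (\<rho> ^^ n) ` W) \<subseteq> Z \<union> Z'" using WD D_Z by blast
    then have "emeasure S (\<Union>n. (\<rho> ^^ n) ` W) \<le> emeasure S (Z \<union> Z')" using Zm by (intro emeasure_mono) auto
    ultimately show False using fin by (simp add: top_unique)
  qed
  \<comment> \<open>The starts of chains with exactly \<open>n\<close> steps; there the end point is
    the image under \<open>\<rho> ^^ n\<close>.\<close>
  define Cn where "Cn n = D n - D (Suc n)" for n
  define Vn where "Vn n = (\<rho> ^^ n) ` Cn n" for n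
  have Cnm: "Cn n \<in> sets S" for n using Dm by (simp add: Cn_def)
  have pC: "piso S S 1 (\<rho> ^^ n) (Cn n) (Vn n)" for n
    unfolding Vn_def by (rule piso_restrict[OF pD _ Cnm]) (auto simp: Cn_def)
  have Vn_V: "Vn n \<subseteq> V" for n
  proof
    fix v assume "v \<in> Vn n"
    then obtain c where c: "c \<in> D n" "c \<notin> D (Suc n)" "v = (\<rho> ^^ n) c" by (auto simp: Vn_def Cn_def)
    then have vZ: "v \<notin> Z" by (auto simp: D_def less_Suc_eq)
    have "n \<noteq> 0" using c vZ by (cases n) (auto simp: D_def C_def)
    then obtain k where "n = Suc k" by (cases n) auto
    then show "v \<in> V" using c vZ D_Z'[of c k] by (simp add: V_def)
  qed
  have dC: "disjoint_family Cn"
    unfolding disjoint_family_on_def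
  proof (intro ballI impI)
    fix m n :: nat assume "m \<noteq> n"
    then show "Cn m \<inter> Cn n = {}"
      using Dmono[of "Suc m" n] Dmono[of "Suc n" m] by (cases "m < n") (auto simp: Cn_def)
  qed
  have dV: "disjoint_family Vn"
    unfolding disjoint_family_on_def
  proof (intro ballI impI)
    fix m n :: nat assume "m \<noteq> n"
    then show "Vn m \<inter> Vn n = {}"
      using neq[of _ m _ n] neq[of _ n _ m] by (cases "m < n") (fastforce simp: Vn_def Cn_def)+
  qed
  define C' where "C' = (\<Union>n. Cn n)"
  define V' where "V' = (\<Union>n. Vn n)"
  define f where "f c = (\<rho> ^^ (THE n. c \<in> Cn n)) c" for c
  have f: "f c = (\<rho> ^^ n) c" if "c \<in> Cn n" for c n
  proof -
    have "(THE n. c \<in> Cn n) = n" using that dC by (intro the_equality) (auto simp: disjoint_family_on_def)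
    then show ?thesis by (simp add: f_def)
  qed
  have pf: "piso S S 1 f C' V'"
    unfolding C'_def V'_def
    by (rule piso_glue) (use dC dV piso_cong[OF pC f[symmetric]] in auto)
  have pg: "piso S S 1 (inv_into C' f) V' C'" using piso_inv[OF pf] by simp
  have C'W: "C - C' = W"
  proof -
    have "c \<in> C' \<or> c \<in> W" if c: "c \<in> C" for c
    proof (rule ccontr)
      assume n: "\<not> ?thesis"
      have "c \<in> D n" for n
      proof (induction n)
        case (Suc n) then show ?case using n by (auto simp: C'_def Cn_def)
      qed (use c in \<open>simp add: D_def\<close>)
      then show False using n by (simp add: W_def)
    qed
    moreover have "W \<subseteq> C" by (auto simp: W_def D_def)
    moreover have "W \<inter> C' = {}" by (auto simp: W_def C'_def Cn_def)
    ultimately show ?thesis by auto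
  qed
  have C'm: "C' \<in> sets S" "V' \<in> sets S" using pisoD(1,2)[OF pf] .
  have C'C: "C' \<subseteq> C" by (auto simp: C'_def Cn_def D_def)
  have V'V: "V' \<subseteq> V" using Vn_V by (auto simp: V'_def)
  \<comment> \<open>Since \<open>Z\<close> and \<open>Z'\<close> have the same finite measure, so
    have \<open>C\<close> and \<open>V\<close>. Almost all of \<open>C\<close> is matched with
    \<open>V'\<close>, which therefore exhausts \<open>V\<close> up to a null set.\<close>
  have finZ: "emeasure S Z \<noteq> \<infinity>" "emeasure S Z' \<noteq> \<infinity>"
    using fin Zm emeasure_mono[of Z "Z \<union> Z'" S] emeasure_mono[of Z' "Z \<union> Z'" S] by (auto simp: top_unique)
  have eZ: "emeasure S Z' = emeasure S Z" using pisoD(8)[OF \<rho>] by simp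
  have "emeasure S V = emeasure S (Z \<union> Z') - emeasure S Z"
    using Zm finZ emeasure_Diff[of S Z "Z \<union> Z'"] by (simp add: V_def Un_Diff)
  moreover have "emeasure S C = emeasure S (Z \<union> Z') - emeasure S Z'"
    using Zm finZ emeasure_Diff[of S Z' "Z \<union> Z'"] by (simp add: C_def Un_Diff)
  ultimately have eVC: "emeasure S V = emeasure S C" using eZ by simp
  have "C = C' \<union> W" using C'W C'C by auto
  then have "emeasure S C = emeasure S C'" using W0 Wm C'm by (simp add: emeasure_Un_null_set null_setsI)
  also have "\<dots> = emeasure S V'" using pisoD(8)[OF pf] by simp
  finally have eV: "emeasure S V' = emeasure S V" using eVC by simp
  have finV: "emeasure S V \<noteq> \<infinity>" using finZ(2) Zm emeasure_mono[of V Z' S] by (auto simp: V_def top_unique)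
  have "emeasure S (V - V') = emeasure S V - emeasure S V'"
    using C'm Cm V'V eV finV by (intro emeasure_Diff) auto
  then have VV: "V - V' \<in> null_sets S" using eV finV C'm Cm by (simp add: null_sets_def)
  define O' where "O' = space S - (Z \<union> Z')"
  define \<tau> where "\<tau> z = (if z \<in> Z then \<rho> z else if z \<in> V' then inv_into C' f z else z)" for z
  have p1: "piso S S 1 \<tau> Z Z'" by (rule piso_cong[OF \<rho>]) (simp add: \<tau>_def)
  have p2: "piso S S 1 \<tau> V' C'" by (rule piso_cong[OF pg]) (use V'V in \<open>auto simp: \<tau>_def V_def\<close>)
  have "O' \<in> sets S" using Zm by (auto simp: O'_def)
  then have p3: "piso S S 1 \<tau> O' O'"
    by (rule piso_cong[OF piso_id]) (use V'V in \<open>auto simp: \<tau>_def V_def O'_def\<close>)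
  have p12: "piso S S 1 \<tau> (Z \<union> V') (Z' \<union> C')"
    by (rule piso_Un[OF p1 p2]) (use V'V C'C in \<open>auto simp: V_def C_def\<close>)
  have p: "piso S S 1 \<tau> ((Z \<union> V') \<union> O') ((Z' \<union> C') \<union> O')"
    by (rule piso_Un[OF p12 p3]) (use V'V C'C in \<open>auto simp: V_def C_def O'_def\<close>)
  have Rn: "(c, (\<rho> ^^ n) c) \<in> R" if "c \<in> D n" for n c
    using that
  proof (induction n)
    case 0
    then show ?case using R_refl sets.sets_into_space[OF Cm(1)] by (auto simp: D_def)
  next
    case (Suc n)
    then have "(c, (\<rho> ^^ n) c) \<in> R" using Dmono[of n "Suc n"] by auto
    moreover have "((\<rho> ^^ n) c, \<rho> ((\<rho> ^^ n) c)) \<in> R" using R D_Z Suc by blast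
    ultimately show ?case using R_trans by (auto dest: transD)
  qed
  have g: "inv_into C' f v \<in> C' \<and> f (inv_into C' f v) = v" if "v \<in> V'" for v
    using that pisoD(5)[OF pf] by (auto intro: inv_into_into f_inv_into_f)
  show ?thesis
  proof (rule that[OF p])
    have "space S - ((Z \<union> V') \<union> O') = V - V'"
      using sets.sets_into_space[OF Zm(1)] sets.sets_into_space[OF Zm(2)] by (auto simp: O'_def V_def)
    then show "space S - ((Z \<union> V') \<union> O') \<in> null_sets S" using VV by simp
    have "space S - ((Z' \<union> C') \<union> O') = W"
      using sets.sets_into_space[OF Zm(1)] sets.sets_into_space[OF Zm(2)] C'W C'C by (auto simp: O'_def C_def)
    then show "space S - ((Z' \<union> C') \<union> O') \<in> null_sets S" using W0 Wm by (simp add: null_sets_def)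
    show "(z, \<tau> z) \<in> R" if z: "z \<in> (Z \<union> V') \<union> O'" for z
    proof -
      consider "z \<in> Z" | "z \<in> V'" "z \<notin> Z" | "z \<in> O'" "z \<notin> Z" "z \<notin> V'" using z by blast
      then show ?thesis
      proof cases
        case 2
        let ?c = "inv_into C' f z"
        obtain n where n: "?c \<in> Cn n" using g[OF 2(1)] by (auto simp: C'_def)
        then have "(?c, z) \<in> R" using Rn[of ?c n] f[OF n] g[OF 2(1)] by (simp add: Cn_def)
        then show ?thesis using 2 R_sym by (auto simp: \<tau>_def dest: symD)
      qed (auto simp: \<tau>_def R R_refl O'_def)
    qed
    show "\<tau> z \<in> Z \<union> Z'" if z: "z \<in> ((Z \<union> V') \<union> O') \<inter> (Z \<union> Z')" for z
      using z g[of z] C'C pisoD(5)[OF \<rho>] by (auto simp: \<tau>_def C_def O'_def)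
  qed (use V'V in \<open>auto simp: \<tau>_def V_def\<close>)
qed

section \<open>Ergodic actions and fundamental sets\<close>

locale ergodic_action = mp_action G M \<alpha> + prob_space M for G (structure) and M :: "'x measure" and \<alpha> +
  assumes countable_group: "countable (carrier G)" and ergodic: "ergodic_on (carrier G) M \<alpha>"
begin

text \<open>Translates of \<open>Y\<close> by coset representatives are disjoint and of equal
  measure, so there are finitely many, and their union is invariant, hence conull. It is applied to
  a level set of X, for the index of its stabilizer, and to the target set in the other
  space.\<close>

theorem index_fundamental_set:
  assumes H: "subgroup H G" and Y [measurable]: "Y \<in> sets M" and pos: "measure M Y > 0"
    and inv: "\<And>h y. h \<in> H \<Longrightarrow> y \<in> Y \<Longrightarrow> \<alpha> h y \<in> Y"
    and sep: "\<And>g y. g \<in> carrier G \<Longrightarrow> y \<in> Y \<Longrightarrow> \<alpha> g y \<in> Y \<Longrightarrow> g \<in> H"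
  shows "finite (lcosets H)" "measure M Y = 1 / real (group_index G H)" "induced_from G H M \<alpha> Y"
proof -
  have Ys: "Y \<subseteq> space M" using Y by (rule sets.sets_into_space)
  have Hc: "h \<in> H \<Longrightarrow> h \<in> carrier G" for h using H subgroup.subset by blast
  define r where "r C = (SOME g. g \<in> carrier G \<and> C = g <# H)" for C
  have r: "r C \<in> carrier G \<and> C = r C <# H" if "C \<in> lcosets H" for C
  proof -
    have "\<exists>g. g \<in> carrier G \<and> C = g <# H" using that by (auto simp: LCOSETS_def)
    from someI_ex[OF this] show ?thesis by (simp add: r_def)
  qed
  have disj: "\<alpha> g ` Y \<inter> \<alpha> h ` Y = {}" if gh: "g \<in> carrier G" "h \<in> carrier G" "g <# H \<noteq> h <# H" for g h
  proof (rule ccontr)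
    assume "\<alpha> g ` Y \<inter> \<alpha> h ` Y \<noteq> {}"
    then obtain y y' where y: "y \<in> Y" "y' \<in> Y" "\<alpha> g y = \<alpha> h y'" by blast
    have ym: "y \<in> space M" "y' \<in> space M" using y Ys by auto
    have "\<alpha> (inv h \<otimes> g) y = \<alpha> (inv h) (\<alpha> h y')" using gh ym y(3) by (simp add: T_mult)
    also have "\<dots> = y'" using gh ym by simp
    finally have "\<alpha> (inv h \<otimes> g) y \<in> Y" using y by simp
    then have "inv h \<otimes> g \<in> H" using y(1) gh by (intro sep[of _ y]) simp_all
    then show False using lcosets_cases(1)[OF H gh(1,2)] gh(3) by simp
  qed
  have same: "\<alpha> g ` Y \<subseteq> \<alpha> h ` Y" if gh: "g \<in> carrier G" "h \<in> carrier G" "g <# H = h <# H" for g h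
  proof
    fix z assume "z \<in> \<alpha> g ` Y"
    then obtain y where y: "y \<in> Y" "z = \<alpha> g y" by blast
    have "inv h \<otimes> g \<in> H" using lcosets_cases(1)[OF H gh(1,2)] gh(3) by simp
    then have "\<alpha> (inv h \<otimes> g) y \<in> Y" using inv y by blast
    moreover have "z = \<alpha> h (\<alpha> (inv h \<otimes> g) y)"
      using gh y Ys T_mult[of h "inv h \<otimes> g" y] by (auto simp: inv_mult_cancel)
    ultimately show "z \<in> \<alpha> h ` Y" by blast
  qed
  have dr: "disjoint_family_on (\<lambda>C. \<alpha> (r C) ` Y) (lcosets H)"
    unfolding disjoint_family_on_def using disj r by metis
  have meas: "measure M (\<alpha> g ` Y) = measure M Y" if "g \<in> carrier G" for g
    using emeasure_image_T[OF that Y] by (simp add: measure_def)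
  have sumF: "measure M (\<Union>C\<in>F. \<alpha> (r C) ` Y) = real (card F) * measure M Y"
    if F: "finite F" "F \<subseteq> lcosets H" for F
  proof -
    have "measure M (\<Union>C\<in>F. \<alpha> (r C) ` Y) = (\<Sum>C\<in>F. measure M (\<alpha> (r C) ` Y))"
      using F dr r by (intro finite_measure_finite_Union)
        (auto intro!: image_T_sets Y simp: disjoint_family_on_def subset_iff)
    also have "\<dots> = (\<Sum>C\<in>F. measure M Y)" using F r by (intro sum.cong meas) auto
    finally show ?thesis by simp
  qed
  show fin: "finite (lcosets H)"
  proof (rule ccontr)
    assume "infinite (lcosets H)"
    obtain n :: nat where n: "1 < real n * measure M Y" using reals_Archimedean3[OF pos] by blast
    obtain F where F: "F \<subseteq> lcosets H" "finite F" "card F = n"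
      using infinite_arbitrarily_large[OF \<open>infinite (lcosets H)\<close>] by blast
    then have "real n * measure M Y \<le> 1" using sumF[of F] prob_le_1 by metis
    then show False using n by simp
  qed
  define U where "U = (\<Union>g\<in>carrier G. \<alpha> g ` Y)"
  have Um [measurable]: "U \<in> sets M" unfolding U_def
    using countable_group Y by (intro sets.countable_UN'' image_T_sets)
  have Uin: "\<alpha> g z \<in> U" if gz: "g \<in> carrier G" "z \<in> U" for g z
  proof -
    obtain h y where h: "h \<in> carrier G" "y \<in> Y" "z = \<alpha> h y" using gz(2) unfolding U_def by blast
    then have "\<alpha> g z = \<alpha> (g \<otimes> h) y" using gz Ys T_mult[of g h y] by auto
    then show ?thesis unfolding U_def using h gz by blast
  qed
  have Uout: "z \<in> U" if "g \<in> carrier G" "z \<in> space M" "\<alpha> g z \<in> U" for g z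
    using Uin[of "inv g" "\<alpha> g z"] that by simp
  have "Y \<subseteq> U"
  proof
    fix y assume "y \<in> Y"
    then show "y \<in> U" unfolding U_def using T_one[of y] Ys by (intro UN_I[of \<one>] image_eqI[of _ _ y]) auto
  qed
  then have "emeasure M U \<noteq> 0" using pos finite_measure_mono[of Y U] by (auto simp: emeasure_eq_measure)
  have "AE x in M. \<alpha> g x \<in> U \<longleftrightarrow> x \<in> U" if "g \<in> carrier G" for g
    using Uin Uout that by (intro AE_I2) blast
  then have U0: "emeasure M (space M - U) = 0"
    using ergodic Um \<open>emeasure M U \<noteq> 0\<close> unfolding ergodic_on_def by blast
  have "U = (\<Union>C\<in>lcosets H. \<alpha> (r C) ` Y)"
  proof
    show "U \<subseteq> (\<Union>C\<in>lcosets H. \<alpha> (r C) ` Y)"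
    proof
      fix z assume "z \<in> U"
      then obtain g where g: "g \<in> carrier G" "z \<in> \<alpha> g ` Y" by (auto simp: U_def)
      then have C: "g <# H \<in> lcosets H" by (auto simp: LCOSETS_def)
      then have "z \<in> \<alpha> (r (g <# H)) ` Y" using same[of g "r (g <# H)"] r[OF C] g by blast
      then show "z \<in> (\<Union>C\<in>lcosets H. \<alpha> (r C) ` Y)" using C by blast
    qed
    show "(\<Union>C\<in>lcosets H. \<alpha> (r C) ` Y) \<subseteq> U"
    proof
      fix z assume "z \<in> (\<Union>C\<in>lcosets H. \<alpha> (r C) ` Y)"
      then obtain C where "C \<in> lcosets H" "z \<in> \<alpha> (r C) ` Y" by blast
      then show "z \<in> U" using r[of C] unfolding U_def by blast
    qed
  qed
  then have "measure M U = real (card (lcosets H)) * measure M Y" using sumF[OF fin order_refl] by simp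
  moreover have "measure M U = 1"
    using U0 prob_compl[OF Um] by (simp add: emeasure_eq_measure)
  ultimately have one: "real (card (lcosets H)) * measure M Y = 1" by simp
  then have "real (card (lcosets H)) \<noteq> 0" by (metis mult_zero_left zero_neq_one)
  then show "measure M Y = 1 / real (group_index G H)"
    using one unfolding group_index_def by (metis nonzero_mult_div_cancel_left)
  show "induced_from G H M \<alpha> Y"
    unfolding induced_from_def
  proof (intro allI impI conjI ballI)
    fix T assume T: "coset_representatives G H T"
    have Tc: "g \<in> carrier G" if "g \<in> T" for g using T that by (auto simp: coset_representatives_def)
    have Tu: "g = h" if gh: "g \<in> T" "h \<in> T" "g <# H = h <# H" for g h
    proof -
      have "g <# H \<in> lcosets H" using Tc[OF gh(1)] by (auto simp: LCOSETS_def)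
      then have "\<exists>!k. k \<in> T \<and> k \<in> g <# H" using T by (auto simp: coset_representatives_def)
      moreover have "g \<in> g <# H" "h \<in> g <# H"
        using lcosets_cases(2)[OF H Tc[OF gh(1)] Tc[OF gh(1)]] lcosets_cases(2)[OF H Tc[OF gh(2)] Tc[OF gh(2)]] gh(3) by auto
      ultimately show ?thesis using gh by blast
    qed
    show "AE x in M. x \<notin> \<alpha> g ` Y \<inter> \<alpha> h ` Y" if "g \<in> T" "h \<in> T" "g \<noteq> h" for g h
      using disj[OF Tc[OF that(1)] Tc[OF that(2)]] Tu that by (intro AE_I2) blast
    have UT: "U \<subseteq> (\<Union>g\<in>T. \<alpha> g ` Y)"
    proof
      fix z assume "z \<in> U"
      then obtain g where g: "g \<in> carrier G" "z \<in> \<alpha> g ` Y" by (auto simp: U_def)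
      then have "g <# H \<in> lcosets H" by (auto simp: LCOSETS_def)
      then obtain k where k: "k \<in> T" "k \<in> g <# H" using T by (auto simp: coset_representatives_def)
      then have "inv g \<otimes> k \<in> H" using lcosets_cases(3)[OF H Tc[OF k(1)] g(1)] by simp
      then have "k <# H = g <# H" using lcosets_cases(1)[OF H Tc[OF k(1)] g(1)] by simp
      then show "z \<in> (\<Union>g\<in>T. \<alpha> g ` Y)" using same[of g k] g Tc k by blast
    qed
    have "space M - U \<in> null_sets M" using U0 by (auto simp: null_sets_def)
    from AE_not_in[OF this] AE_space show "AE x in M. x \<in> (\<Union>g\<in>T. \<alpha> g ` Y)"
    proof eventually_elim
      case (elim x)
      then have "x \<in> U" by blast
      then show ?case using UT by (rule subsetD[rotated])
    qed
  qed
qed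

end

section \<open>Conjugacy of orbit equivalent actions\<close>

lemma amp_slice_piso:
  assumes "prob_space N"
  shows "piso (completion (amp_space N)) (completion N) 1 fst (space N \<times> {j}) (space N)"
proof (rule piso_completion)
  interpret C: sigma_finite_measure "count_space (UNIV :: nat set)"
    by (rule sigma_finite_measure_count_space)
  show "space N \<times> {j} \<in> sets (amp_space N)" unfolding amp_space_def by (intro pair_measureI) auto
  show "space N \<in> sets N" by simp
  show "bij_betw fst (space N \<times> {j}) (space N)" by (auto simp: bij_betw_def inj_on_def image_iff)
  show "(1::ennreal) \<noteq> 0" by simp
  fix E assume E: "E \<in> sets (amp_space N)" "E \<subseteq> space N \<times> {j}"
  have eq: "fst ` E = (\<lambda>y. (y, j)) -` E" using E(2) by (force simp: image_iff)
  have m: "fst ` E \<in> sets N" unfolding eq using E(1) unfolding amp_space_def by (rule sets_Pair2)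
  have "E = fst ` E \<times> {j}" using E(2) by (force simp: image_iff)
  then have "emeasure (amp_space N) E = emeasure (amp_space N) (fst ` E \<times> {j})" by simp
  also have "\<dots> = emeasure N (fst ` E)"
    unfolding amp_space_def using m by (subst C.emeasure_pair_measure_Times) (auto simp: emeasure_count_space)
  finally show "fst ` E \<in> sets N \<and> emeasure N (fst ` E) = 1 * emeasure (amp_space N) E" using m by simp
next
  fix E assume E: "E \<in> sets N" "E \<subseteq> space N"
  then have "{x \<in> space N \<times> {j}. fst x \<in> E} = E \<times> {j}" by auto
  then show "{x \<in> space N \<times> {j}. fst x \<in> E} \<in> sets (amp_space N)"
    unfolding amp_space_def using E by (simp add: pair_measureI)
qed

lemma amp_slice_piso':
  assumes "prob_space N"
  shows "piso (completion N) (completion (amp_space N)) 1 (\<lambda>y. (y, j)) (space N) (space N \<times> {j})"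
proof -
  have "piso (completion N) (completion (amp_space N)) 1 (inv_into (space N \<times> {j}) fst) (space N) (space N \<times> {j})"
    using piso_inv[OF amp_slice_piso[OF assms]] by simp
  then show ?thesis
  proof (rule piso_cong)
    fix y assume "y \<in> space N"
    then show "inv_into (space N \<times> {j}) fst y = (y, j)"
      using inv_into_f_f[of fst "space N \<times> {j}" "(y, j)"] by (auto simp: inj_on_def)
  qed
qed

lemma (in ergodic_action) act_piso:
  assumes g: "g \<in> carrier G"
  shows "piso (completion M) (completion M) 1 (\<alpha> g) (space M) (space M)"
proof (rule piso_completion)
  show "bij_betw (\<alpha> g) (space M) (space M)"
    by (rule bij_betwI[where g="\<alpha> (inv g)"]) (use g T_space in auto)
  show "\<alpha> g ` E \<in> sets M \<and> emeasure M (\<alpha> g ` E) = 1 * emeasure M E" if "E \<in> sets M" for E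
    using image_T_sets emeasure_image_T g that by simp
  show "{x \<in> space M. \<alpha> g x \<in> E} \<in> sets M" if "E \<in> sets M" for E
    using measurable_sets[OF T_measurable[OF g] that] by (simp add: vimage_def Int_def conj_commute)
qed auto

lemma (in profinite_system) ergodic_action: "ergodic_action G M \<alpha>"
proof
  show "countable (carrier G)" by (rule countable_G)
  show "ergodic_on (carrier G) M \<alpha>"
    using G0_ergodic G0_carrier unfolding ergodic_on_def by blast
qed

lemma (in profinite_system) level_index:
  assumes x: "x \<in> space M" and pos: "measure M (X n x) > 0"
  shows "measure M (X n x) = 1 / real (group_index G (St n x))"
proof -
  interpret E: ergodic_action G M \<alpha> by (rule ergodic_action)
  show ?thesis
  proof (rule E.index_fundamental_set(2)[OF St_subgroup[OF x, of n] X_sets[of n x] pos])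
    show "\<alpha> h y \<in> X n x" if "h \<in> St n x" "y \<in> X n x" for h y
      using that St_level_iff[OF x, of y h] by (auto simp: X_iff)
    show "g \<in> St n x" if "g \<in> carrier G" "y \<in> X n x" "\<alpha> g y \<in> X n x" for g y
    proof -
      have "g \<in> St n y" using that by (auto simp: St_def X_iff)
      then show ?thesis using St_X[OF x that(2)] by simp
    qed
  qed
qed

text \<open>All almost-everywhere information is gathered on the invariant conull set
  \<open>X0\<close>, where freeness and the correspondence of orbits hold at every point.\<close>

locale orbit_equivalence_core = cocycle_system G M \<alpha> G0 L w + A: ergodic_action L N \<beta>
    for G (structure) and M :: "(nat \<Rightarrow> 'b) measure" and \<alpha> and G0 and L and w
      and N :: "'y measure" and \<beta> +
  fixes X0 :: "(nat \<Rightarrow> 'b) set" and \<theta> :: "(nat \<Rightarrow> 'b) \<Rightarrow> 'y \<times> nat" and t :: real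
  assumes X0_sets [measurable]: "X0 \<in> sets M" and X0_null: "space M - X0 \<in> null_sets M"
    and X0_inv: "\<lbrakk>g \<in> carrier G; x \<in> X0\<rbrakk> \<Longrightarrow> \<alpha> g x \<in> X0"
    and t_pos: "t > 0"
    and \<theta>_piso: "piso (completion M) (completion (amp_space N)) (ennreal t) \<theta> X0 (\<theta> ` X0)"
    and \<theta>_space: "x \<in> X0 \<Longrightarrow> fst (\<theta> x) \<in> space N"
    and w_orbit: "\<lbrakk>g \<in> carrier G; x \<in> X0\<rbrakk> \<Longrightarrow> fst (\<theta> (\<alpha> g x)) = \<beta> (w g x) (fst (\<theta> x))"
    and orbit_back: "\<lbrakk>x \<in> X0; x' \<in> X0; l \<in> carrier L; fst (\<theta> x') = \<beta> l (fst (\<theta> x))\<rbrakk>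
      \<Longrightarrow> \<exists>g\<in>carrier G. x' = \<alpha> g x"
    and free_G: "\<lbrakk>x \<in> X0; g \<in> carrier G; \<alpha> g x = x\<rbrakk> \<Longrightarrow> g = \<one>"
    and free_L: "\<lbrakk>x \<in> X0; l \<in> carrier L; \<beta> l (fst (\<theta> x)) = fst (\<theta> x)\<rbrakk> \<Longrightarrow> l = \<one>\<^bsub>L\<^esub>"
begin

lemma \<beta>_cancel:
  assumes x: "x \<in> X0" and a: "a \<in> carrier L" and b: "b \<in> carrier L"
    and e: "\<beta> a (fst (\<theta> x)) = \<beta> b (fst (\<theta> x))"
  shows "a = b"
proof -
  note ps = \<theta>_space[OF x]
  have "\<beta> (inv\<^bsub>L\<^esub> b \<otimes>\<^bsub>L\<^esub> a) (fst (\<theta> x)) = fst (\<theta> x)"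
    using A.T_mult[of "inv\<^bsub>L\<^esub> b" a "fst (\<theta> x)"] e a b ps by simp
  then have "inv\<^bsub>L\<^esub> b \<otimes>\<^bsub>L\<^esub> a = \<one>\<^bsub>L\<^esub>" using free_L[OF x] a b by simp
  then show ?thesis using a b L.inv_mult_cancel(1)[of b a] by simp
qed

lemma X0_space: "x \<in> X0 \<Longrightarrow> x \<in> space M"
  using sets.sets_into_space[OF X0_sets] by auto

lemma \<theta>_inj: "inj_on \<theta> X0"
  by (rule pisoD(4)[OF \<theta>_piso])

lemma level_of_snd: "{y \<in> X0. snd (\<theta> y) = j} \<in> sets (completion M)"
proof -
  have "{y \<in> X0. \<theta> y \<in> space N \<times> {j}} \<in> sets (completion M)"
    by (rule piso_vimage[OF \<theta>_piso pisoD(1)[OF amp_slice_piso[OF A.prob_space_axioms]]])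
  moreover have "{y \<in> X0. \<theta> y \<in> space N \<times> {j}} = {y \<in> X0. snd (\<theta> y) = j}"
    using \<theta>_space by (auto simp: mem_Times_iff)
  ultimately show ?thesis by simp
qed

text \<open>Injectivity of \<open>q\<close> on a whole level set is the crux: it first holds on a
  piece of positive measure, then on more than half of a deeper level set, and a comparison of
  measures together with ergodicity gives the rest.\<close>

theorem conjugacy:
  assumes fg: "finitely_generated_group (G Mod G0)"
  obtains n x \<psi> L0 q D Y0 where "x \<in> space M" "measure M (X n x) > 0"
    "subgroup L0 L" "\<psi> \<in> iso (G\<lparr>carrier := St n x\<rparr>) (L\<lparr>carrier := L0\<rparr>)"
    "D \<subseteq> X n x" "D \<subseteq> X0" "X n x - D \<in> null_sets (completion M)"
    "Y0 \<in> sets N" "piso (completion M) (completion N) (ennreal t) q D Y0"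
    "\<And>y. y \<in> D \<Longrightarrow> \<exists>l\<in>carrier L. q y = \<beta> l (fst (\<theta> y))"
    "\<And>g y. g \<in> St n x \<Longrightarrow> y \<in> D \<Longrightarrow> \<alpha> g y \<in> D \<and> q (\<alpha> g y) = \<beta> (\<psi> g) (q y)"
    "finite (lcosets\<^bsub>L\<^esub> L0)" "measure N Y0 = 1 / real (group_index L L0)" "induced_from L L0 N \<beta> Y0"
    "\<And>l y. l \<in> L0 \<Longrightarrow> y \<in> Y0 \<Longrightarrow> \<beta> l y \<in> Y0"
    "measure N Y0 = t * measure M (X n x)"
proof -
  note found = that
  obtain n x \<phi> \<psi> where x: "x \<in> space M" and posx: "measure M (X n x) > 0"
    and \<phi> [measurable]: "\<phi> \<in> measurable M (count_space (carrier L))"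
    and \<psi>hom: "\<psi> \<in> hom (G\<lparr>carrier := St n x\<rparr>) L"
    and tw: "\<And>g. g \<in> St n x \<Longrightarrow> AE y in M. y \<in> X n x \<longrightarrow>
       w g y = \<phi> (\<alpha> g y) \<otimes>\<^bsub>L\<^esub> \<psi> g \<otimes>\<^bsub>L\<^esub> inv\<^bsub>L\<^esub> \<phi> y"
    by (rule cocycle_superrigidity[OF fg]) (rule that)
  have \<phi>c: "\<phi> y \<in> carrier L" if "y \<in> space M" for y using measurable_space[OF \<phi> that] by simp
  have \<psi>c: "\<psi> g \<in> carrier L" if "g \<in> St n x" for g using \<psi>hom that by (auto simp: hom_def)
  have \<psi>m: "\<psi> (g \<otimes> h) = \<psi> g \<otimes>\<^bsub>L\<^esub> \<psi> h" if "g \<in> St n x" "h \<in> St n x" for g h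
    using \<psi>hom that by (auto simp: hom_def)
  note Sx = St_subgroup[OF x, of n]
  have tw_sets: "{y \<in> space M. P (w g y) (\<phi> (\<alpha> g y)) (\<phi> y)} \<in> sets M" if g: "g \<in> carrier G" for g P
  proof -
    note [measurable] = w_measurable[OF g] T_measurable[OF g]
    have "(\<lambda>y. (w g y, \<phi> (\<alpha> g y), \<phi> y)) \<in> measurable M
        (count_space (carrier L) \<Otimes>\<^sub>M (count_space (carrier L) \<Otimes>\<^sub>M count_space (carrier L)))"
      by measurable
    then have m: "(\<lambda>y. (w g y, \<phi> (\<alpha> g y), \<phi> y)) \<in> measurable M (count_space (carrier L \<times> carrier L \<times> carrier L))"
      by (simp add: pair_measure_countable countable_L)
    let ?P = "{z \<in> carrier L \<times> carrier L \<times> carrier L. P (fst z) (fst (snd z)) (snd (snd z))}"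
    have "(\<lambda>y. (w g y, \<phi> (\<alpha> g y), \<phi> y)) -` ?P \<inter> space M \<in> sets M"
      by (rule measurable_sets[OF m]) auto
    moreover have "(\<lambda>y. (w g y, \<phi> (\<alpha> g y), \<phi> y)) -` ?P \<inter> space M = {y \<in> space M. P (w g y) (\<phi> (\<alpha> g y)) (\<phi> y)}"
      using \<phi>c w_closed[OF g] T_space[OF g] by auto
    ultimately show ?thesis by simp
  qed
  define q where "q y = \<beta> (inv\<^bsub>L\<^esub> \<phi> y) (fst (\<theta> y))" for y
  \<comment> \<open>The part of the level set on which the untwisting identity holds for all
    stabilizing elements at once; it is conull there and stable under the stabilizer.\<close>
  define D1 where "D1 = {y \<in> X n x \<inter> X0. \<forall>g\<in>St n x. w g y = \<phi> (\<alpha> g y) \<otimes>\<^bsub>L\<^esub> \<psi> g \<otimes>\<^bsub>L\<^esub> inv\<^bsub>L\<^esub> \<phi> y}"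
  have cSt: "countable (St m z)" for m z
    using countable_G St_carrier by (meson countable_subset subsetI)
  have "D1 = (X n x \<inter> X0) - (\<Union>g\<in>St n x. {y \<in> space M. w g y \<noteq> \<phi> (\<alpha> g y) \<otimes>\<^bsub>L\<^esub> \<psi> g \<otimes>\<^bsub>L\<^esub> inv\<^bsub>L\<^esub> \<phi> y})"
    unfolding D1_def using X0_space by blast
  moreover have "(\<Union>g\<in>St n x. {y \<in> space M. w g y \<noteq> \<phi> (\<alpha> g y) \<otimes>\<^bsub>L\<^esub> \<psi> g \<otimes>\<^bsub>L\<^esub> inv\<^bsub>L\<^esub> \<phi> y}) \<in> sets M"
    by (intro sets.countable_UN'' tw_sets[OF St_carrier] cSt)
  ultimately have D1 [measurable]: "D1 \<in> sets M" by simp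
  have D1X: "D1 \<subseteq> X n x" "D1 \<subseteq> X0" by (auto simp: D1_def)
  have D1AE: "AE y in M. y \<in> X n x \<longrightarrow> y \<in> D1"
  proof -
    have "AE y in M. \<forall>g\<in>St n x. y \<in> X n x \<longrightarrow> w g y = \<phi> (\<alpha> g y) \<otimes>\<^bsub>L\<^esub> \<psi> g \<otimes>\<^bsub>L\<^esub> inv\<^bsub>L\<^esub> \<phi> y"
      using tw cSt by (subst AE_ball_countable) auto
    then show ?thesis using AE_not_in[OF X0_null] AE_space
      by eventually_elim (auto simp: D1_def)
  qed
  have D1_inv: "\<alpha> g y \<in> D1" if g: "g \<in> St n x" and y: "y \<in> D1" for g y
  proof -
    have gc: "g \<in> carrier G" using g by (rule St_carrier)
    have ym: "y \<in> space M" "y \<in> X0" "y \<in> X n x" using y D1X X0_space by auto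
    have gy: "\<alpha> g y \<in> X n x" "\<alpha> g y \<in> X0" "\<alpha> g y \<in> space M"
      using St_level_iff[OF x ym(1) g] ym X0_inv gc T_space by auto
    have "w h (\<alpha> g y) = \<phi> (\<alpha> h (\<alpha> g y)) \<otimes>\<^bsub>L\<^esub> \<psi> h \<otimes>\<^bsub>L\<^esub> inv\<^bsub>L\<^esub> \<phi> (\<alpha> g y)" if h: "h \<in> St n x" for h
    proof -
      have hc: "h \<in> carrier G" using h by (rule St_carrier)
      have hg: "h \<otimes> g \<in> St n x" using Sx h g by (simp add: subgroup.m_closed)
      have c: "\<phi> y \<in> carrier L" "\<phi> (\<alpha> g y) \<in> carrier L" "\<phi> (\<alpha> h (\<alpha> g y)) \<in> carrier L"
        "\<psi> g \<in> carrier L" "\<psi> h \<in> carrier L" "w h (\<alpha> g y) \<in> carrier L" "w g y \<in> carrier L"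
        using \<phi>c \<psi>c ym gy gc hc h g T_space by auto
      have 1: "w g y = \<phi> (\<alpha> g y) \<otimes>\<^bsub>L\<^esub> \<psi> g \<otimes>\<^bsub>L\<^esub> inv\<^bsub>L\<^esub> \<phi> y" using y g unfolding D1_def by blast
      have "w (h \<otimes> g) y = \<phi> (\<alpha> (h \<otimes> g) y) \<otimes>\<^bsub>L\<^esub> \<psi> (h \<otimes> g) \<otimes>\<^bsub>L\<^esub> inv\<^bsub>L\<^esub> \<phi> y"
        using y hg unfolding D1_def by blast
      then have 2: "w h (\<alpha> g y) \<otimes>\<^bsub>L\<^esub> w g y = \<phi> (\<alpha> h (\<alpha> g y)) \<otimes>\<^bsub>L\<^esub> (\<psi> h \<otimes>\<^bsub>L\<^esub> \<psi> g) \<otimes>\<^bsub>L\<^esub> inv\<^bsub>L\<^esub> \<phi> y"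
        using w_mult[OF hc gc ym(1)] T_mult[OF hc gc ym(1)] \<psi>m[OF h g] by simp
      have "w h (\<alpha> g y) = (w h (\<alpha> g y) \<otimes>\<^bsub>L\<^esub> w g y) \<otimes>\<^bsub>L\<^esub> inv\<^bsub>L\<^esub> w g y"
        using c(6,7) by (simp add: L.m_assoc)
      also have "\<dots> = \<phi> (\<alpha> h (\<alpha> g y)) \<otimes>\<^bsub>L\<^esub> \<psi> h \<otimes>\<^bsub>L\<^esub> inv\<^bsub>L\<^esub> \<phi> (\<alpha> g y)"
        unfolding 2 unfolding 1 using c by (simp add: L.m_assoc L.inv_mult_group L.inv_mult_cancel)
      finally show ?thesis .
    qed
    then show ?thesis using gy unfolding D1_def by blast
  qed
  have q_space: "q y \<in> space N" if "y \<in> X0" for y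
    unfolding q_def using A.T_space \<theta>_space \<phi>c X0_space that by auto
  have q_equi: "q (\<alpha> g y) = \<beta> (\<psi> g) (q y)" if g: "g \<in> St n x" and y: "y \<in> D1" for g y
  proof -
    have gc: "g \<in> carrier G" using g by (rule St_carrier)
    have ym: "y \<in> space M" "y \<in> X0" "y \<in> X n x" using y D1X X0_space by auto
    have c: "\<phi> y \<in> carrier L" "\<phi> (\<alpha> g y) \<in> carrier L" "\<psi> g \<in> carrier L"
      using \<phi>c \<psi>c ym gc g T_space by auto
    have ps: "fst (\<theta> y) \<in> space N" using \<theta>_space ym by simp
    have 1: "w g y = \<phi> (\<alpha> g y) \<otimes>\<^bsub>L\<^esub> \<psi> g \<otimes>\<^bsub>L\<^esub> inv\<^bsub>L\<^esub> \<phi> y" using y g unfolding D1_def by blast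
    have "q (\<alpha> g y) = \<beta> (inv\<^bsub>L\<^esub> \<phi> (\<alpha> g y) \<otimes>\<^bsub>L\<^esub> w g y) (fst (\<theta> y))"
      unfolding q_def w_orbit[OF gc ym(2)] using c ps ym gc by (simp add: A.T_mult)
    also have "inv\<^bsub>L\<^esub> \<phi> (\<alpha> g y) \<otimes>\<^bsub>L\<^esub> w g y = \<psi> g \<otimes>\<^bsub>L\<^esub> inv\<^bsub>L\<^esub> \<phi> y"
      unfolding 1 using c by (simp add: L.m_assoc L.inv_mult_cancel)
    also have "\<beta> (\<psi> g \<otimes>\<^bsub>L\<^esub> inv\<^bsub>L\<^esub> \<phi> y) (fst (\<theta> y)) = \<beta> (\<psi> g) (q y)"
      unfolding q_def using c ps by (simp add: A.T_mult)
    finally show ?thesis .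
  qed
  have \<theta>_q: "fst (\<theta> y) = \<beta> (\<phi> y) (q y)" if "y \<in> X0" for y
    unfolding q_def using A.T_mult[of "\<phi> y" "inv\<^bsub>L\<^esub> \<phi> y" "fst (\<theta> y)"] A.T_one \<theta>_space \<phi>c X0_space that by auto
  \<comment> \<open>On each of these countably many pieces \<open>\<phi>\<close> and the second
    component of \<theta> are constant. There \<open>q\<close> is \<theta> followed by a projection
    of one slice and by one group element, so it is injective and multiplies measure by
    \<open>t\<close>.\<close>
  define P where "P = (\<lambda>(l, j). {y \<in> X0. \<phi> y = l \<and> snd (\<theta> y) = j})"
  have \<phi>_sets: "{y \<in> space M. \<phi> y = l} \<in> sets M" if "l \<in> carrier L" for l
    using measurable_sets[OF \<phi>, of "{l}"] that by (simp add: vimage_def Int_def conj_commute)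
  have P: "P i \<in> sets (completion M)" if i: "i \<in> carrier L \<times> UNIV" for i
  proof -
    obtain l j where lj: "i = (l, j)" "l \<in> carrier L" using i by auto
    have "P i = {y \<in> space M. \<phi> y = l} \<inter> {y \<in> X0. snd (\<theta> y) = j}"
      using lj X0_space by (auto simp: P_def)
    then show ?thesis using \<phi>_sets[OF lj(2)] level_of_snd by auto
  qed
  have q_inj_P: "y = y'" if "y \<in> P i" "y' \<in> P i" "q y = q y'" for y y' i
  proof -
    obtain l j where i: "i = (l, j)" by (cases i)
    have y: "y \<in> X0" "y' \<in> X0" "\<phi> y = \<phi> y'" "snd (\<theta> y) = snd (\<theta> y')" using that i by (auto simp: P_def)
    then have "\<theta> y = \<theta> y'" using \<theta>_q[OF y(1)] \<theta>_q[OF y(2)] that(3) by (simp add: prod_eq_iff)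
    then show ?thesis using \<theta>_inj y by (auto dest: inj_onD)
  qed
  have cI: "countable (carrier L \<times> (UNIV :: nat set))" using countable_L by simp
  have P_cover: "\<exists>i\<in>carrier L \<times> UNIV. y \<in> P i" if "y \<in> X0" for y
    using that \<phi>c X0_space by (intro bexI[of _ "(\<phi> y, snd (\<theta> y))"]) (auto simp: P_def)
  have "\<exists>i\<in>carrier L \<times> UNIV. emeasure (completion M) (D1 \<inter> P i) \<noteq> 0"
  proof (rule ccontr)
    assume null: "\<not> (\<exists>i\<in>carrier L \<times> UNIV. emeasure (completion M) (D1 \<inter> P i) \<noteq> 0)"
    have "(\<Union>i\<in>carrier L \<times> UNIV. D1 \<inter> P i) \<in> null_sets (completion M)"
    proof (intro null_sets_UN' cI)
      fix i assume i: "i \<in> carrier L \<times> (UNIV :: nat set)"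
      have "D1 \<inter> P i \<in> sets (completion M)" by (rule sets.Int[OF sets_completionI_sets[OF D1] P[OF i]])
      moreover have "emeasure (completion M) (D1 \<inter> P i) = 0" using null i by blast
      ultimately show "D1 \<inter> P i \<in> null_sets (completion M)" by (rule null_setsI[rotated])
    qed
    moreover have "D1 = (\<Union>i\<in>carrier L \<times> UNIV. D1 \<inter> P i)" using P_cover D1X by blast
    ultimately have "D1 \<in> null_sets (completion M)" by simp
    then have "AE y in completion M. y \<notin> D1" by (rule AE_not_in)
    then have "AE y in M. y \<notin> D1" unfolding AE_completion_iff .
    then have "AE y in M. y \<in> X n x \<longrightarrow> False" using D1AE by eventually_elim auto
    then show False using AE_X_nonempty[of n x "\<lambda>_. False"] posx by metis
  qed
  then obtain i0 where i0: "i0 \<in> carrier L \<times> UNIV" "emeasure (completion M) (D1 \<inter> P i0) \<noteq> 0" by blast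
  have "D1 \<inter> P i0 \<in> sets (completion M)" using P[OF i0(1)] by auto
  then obtain S where S [measurable]: "S \<in> sets M" and SP: "S \<subseteq> D1 \<inter> P i0"
    and eS: "emeasure (completion M) (D1 \<inter> P i0) = emeasure M S" by (rule completion_sandwich)
  have mS: "measure M S > 0" using eS i0(2) by (simp add: emeasure_eq_measure zero_less_measure_iff)
  have q_inj_S: "y = y'" if "y \<in> S" "y' \<in> S" "q y = q y'" for y y'
    using q_inj_P[of y i0 y'] that SP by blast
  \<comment> \<open>A level set more than half filled by a set on which \<open>q\<close> is
    injective; the proportion 1/2 decides the comparison of measures in
    \<open>F_nonnull\<close>.\<close>
  obtain m d where mn: "m \<ge> n" and dm: "d \<in> space M" and posd: "measure M (X m d) > 0"
    and den: "measure M (X m d - S) < 1 / 2 * measure M (X m d)"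
    by (rule density[OF S mS, of "1/2" n]) auto
  have dx: "d \<in> X n x"
  proof -
    have "X m d \<inter> S \<noteq> {}"
    proof
      assume "X m d \<inter> S = {}"
      then have "X m d - S = X m d" by auto
      then show False using den posd by simp
    qed
    then obtain y where "y \<in> X m d" "y \<in> X n x" using SP D1X by blast
    then show ?thesis using refine_le[OF mn, of d y] dm by (auto simp: X_iff)
  qed
  have Xsub: "X m d \<subseteq> X n x" using X_antimono[OF mn dm] dx by (auto simp: X_iff)
  have Ssub: "St m d \<subseteq> St n x" using St_antimono[OF mn dm] St_X[OF x dx] by simp
  note Sd = St_subgroup[OF dm, of m]
  define D2 where "D2 = D1 \<inter> X m d"
  have D2 [measurable]: "D2 \<in> sets M" by (simp add: D2_def)
  have D2D1: "D2 \<subseteq> D1" "D2 \<subseteq> X m d" "D2 \<subseteq> X0" using D1X by (auto simp: D2_def)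
  have D2_inv: "\<alpha> g y \<in> D2" if "g \<in> St m d" "y \<in> D2" for g y
    using D1_inv[of g y] St_level_iff[OF dm, of y g] that Ssub D2D1 X0_space by (auto simp: D2_def)
  \<comment> \<open>The points of \<open>D2\<close> whose value under \<open>q\<close> is taken
    nowhere else in \<open>D2\<close>. Points with equal values lie in one orbit, so the complement
    is a union of the sets \<open>B g\<close>, whose measurability is clear since they are expressed
    by the cocycle.\<close>
  define F where "F = {y \<in> D2. \<forall>y'\<in>D2. q y' = q y \<longrightarrow> y' = y}"
  define B where "B g = {y \<in> D2. g \<noteq> \<one> \<and> \<alpha> g y \<in> D2 \<and> w g y = \<phi> (\<alpha> g y) \<otimes>\<^bsub>L\<^esub> inv\<^bsub>L\<^esub> \<phi> y}" for g
  have B_iff: "q (\<alpha> g y) = q y \<longleftrightarrow> w g y = \<phi> (\<alpha> g y) \<otimes>\<^bsub>L\<^esub> inv\<^bsub>L\<^esub> \<phi> y"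
    if g: "g \<in> carrier G" and y: "y \<in> X0" for g y
  proof -
    have ym: "y \<in> space M" using y by (rule X0_space)
    have c: "\<phi> y \<in> carrier L" "\<phi> (\<alpha> g y) \<in> carrier L" "w g y \<in> carrier L"
      using \<phi>c ym g T_space by auto
    have ps: "fst (\<theta> y) \<in> space N" using \<theta>_space y by simp
    have "q (\<alpha> g y) = \<beta> (inv\<^bsub>L\<^esub> \<phi> (\<alpha> g y) \<otimes>\<^bsub>L\<^esub> w g y) (fst (\<theta> y))"
      unfolding q_def w_orbit[OF g y] using c ps by (simp add: A.T_mult)
    then have "q (\<alpha> g y) = q y \<longleftrightarrow> inv\<^bsub>L\<^esub> \<phi> (\<alpha> g y) \<otimes>\<^bsub>L\<^esub> w g y = inv\<^bsub>L\<^esub> \<phi> y"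
      unfolding q_def using c \<beta>_cancel[OF y] by (metis L.inv_closed L.m_closed)
    also have "\<dots> \<longleftrightarrow> w g y = \<phi> (\<alpha> g y) \<otimes>\<^bsub>L\<^esub> inv\<^bsub>L\<^esub> \<phi> y"
    proof
      assume "inv\<^bsub>L\<^esub> \<phi> (\<alpha> g y) \<otimes>\<^bsub>L\<^esub> w g y = inv\<^bsub>L\<^esub> \<phi> y"
      then show "w g y = \<phi> (\<alpha> g y) \<otimes>\<^bsub>L\<^esub> inv\<^bsub>L\<^esub> \<phi> y"
        using L.inv_mult_cancel(1)[OF c(2,3)] by simp
    next
      assume "w g y = \<phi> (\<alpha> g y) \<otimes>\<^bsub>L\<^esub> inv\<^bsub>L\<^esub> \<phi> y"
      then show "inv\<^bsub>L\<^esub> \<phi> (\<alpha> g y) \<otimes>\<^bsub>L\<^esub> w g y = inv\<^bsub>L\<^esub> \<phi> y"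
        using L.inv_mult_cancel(2)[OF c(2)] c by simp
    qed
    finally show ?thesis .
  qed
  have fib: "\<exists>g\<in>carrier G. y' = \<alpha> g y" if y: "y \<in> X0" "y' \<in> X0" and l: "l \<in> carrier L" "q y' = \<beta> l (q y)" for y y' l
  proof -
    have c: "\<phi> y \<in> carrier L" "\<phi> y' \<in> carrier L" using \<phi>c X0_space y by auto
    have "fst (\<theta> y') = \<beta> (\<phi> y') (\<beta> l (\<beta> (inv\<^bsub>L\<^esub> \<phi> y) (fst (\<theta> y))))"
      using \<theta>_q[OF y(2)] l by (simp add: q_def)
    also have "\<dots> = \<beta> (\<phi> y' \<otimes>\<^bsub>L\<^esub> (l \<otimes>\<^bsub>L\<^esub> inv\<^bsub>L\<^esub> \<phi> y)) (fst (\<theta> y))"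
      using c l \<theta>_space[OF y(1)] A.T_space by (simp add: A.T_mult)
    finally have e: "fst (\<theta> y') = \<beta> (\<phi> y' \<otimes>\<^bsub>L\<^esub> (l \<otimes>\<^bsub>L\<^esub> inv\<^bsub>L\<^esub> \<phi> y)) (fst (\<theta> y))" .
    show ?thesis by (rule orbit_back[OF y _ e]) (use c l in simp)
  qed
  have qF: "D2 - F = (\<Union>g\<in>carrier G. B g)"
  proof (intro equalityI subsetI)
    fix y assume y: "y \<in> D2 - F"
    then obtain y' where y': "y' \<in> D2" "q y' = q y" "y' \<noteq> y" by (auto simp: F_def)
    have y0: "y \<in> X0" "y' \<in> X0" using y y' D2D1 by auto
    have "q y' = \<beta> \<one>\<^bsub>L\<^esub> (q y)" using y' A.T_one q_space y0 by simp
    then obtain g where g: "g \<in> carrier G" "y' = \<alpha> g y" using fib[OF y0 L.one_closed] by blast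
    have "g \<noteq> \<one>" using y'(3) g T_one X0_space y0 by auto
    then have "y \<in> B g" using B_iff[OF g(1) y0(1)] y y' g by (simp add: B_def)
    then show "y \<in> (\<Union>g\<in>carrier G. B g)" using g by blast
  next
    fix y assume "y \<in> (\<Union>g\<in>carrier G. B g)"
    then obtain g where g: "g \<in> carrier G" "y \<in> B g" by blast
    then have y: "y \<in> D2" "\<alpha> g y \<in> D2" "g \<noteq> \<one>" "y \<in> X0" using D2D1 by (auto simp: B_def)
    have "q (\<alpha> g y) = q y" using B_iff[OF g(1) y(4)] g(2) by (simp add: B_def)
    moreover have "\<alpha> g y \<noteq> y" using free_G[OF y(4) g(1)] y(3) by blast
    ultimately show "y \<in> D2 - F" using y by (auto simp: F_def)
  qed
  have Bm: "B g \<in> sets M" if g: "g \<in> carrier G" for g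
  proof -
    have "B g = (if g = \<one> then {} else D2 \<inter> (\<alpha> g -` D2 \<inter> space M) \<inter>
       {y \<in> space M. w g y = \<phi> (\<alpha> g y) \<otimes>\<^bsub>L\<^esub> inv\<^bsub>L\<^esub> \<phi> y})"
      using sets.sets_into_space[OF D2] by (auto simp: B_def)
    then show ?thesis
      using measurable_sets[OF T_measurable[OF g] D2] D2 tw_sets[OF g, of "\<lambda>a b c. a = b \<otimes>\<^bsub>L\<^esub> inv\<^bsub>L\<^esub> c"] by auto
  qed
  have "(\<Union>g\<in>carrier G. B g) \<in> sets M" using Bm countable_G by (intro sets.countable_UN'') auto
  moreover have FD2: "F \<subseteq> D2" by (auto simp: F_def)
  then have "F = D2 - (\<Union>g\<in>carrier G. B g)" using qF by blast
  ultimately have F [measurable]: "F \<in> sets M" by simp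
  have FX: "F \<subseteq> X m d" "F \<subseteq> X0" "F \<subseteq> D1" using FD2 D2D1 by auto
  have q_inj_F: "inj_on q F" using FD2 by (auto simp: F_def inj_on_def)
  have F_inv: "\<alpha> h y \<in> F" if h: "h \<in> St m d" and y: "y \<in> F" for h y
  proof -
    have hi: "inv h \<in> St m d" using Sd h by (simp add: subgroup.m_inv_closed)
    have hc: "h \<in> carrier G" using h by (rule St_carrier)
    have yD: "y \<in> D2" "y \<in> D1" "y \<in> space M" using y FD2 D2D1 X0_space by auto
    have "y' = \<alpha> h y" if y': "y' \<in> D2" "q y' = q (\<alpha> h y)" for y'
    proof -
      have y'm: "y' \<in> space M" "y' \<in> D1" using y' D2D1 X0_space by auto
      have "q (\<alpha> (inv h) y') = q (\<alpha> (inv h) (\<alpha> h y))"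
        unfolding q_equi[OF subsetD[OF Ssub hi] y'm(2)]
          q_equi[OF subsetD[OF Ssub hi] D1_inv[OF subsetD[OF Ssub h] yD(2)]] y'(2) ..
      then have "q (\<alpha> (inv h) y') = q y" using hc yD by simp
      then have "\<alpha> (inv h) y' = y" using y D2_inv[OF hi y'(1)] by (auto simp: F_def)
      then show ?thesis using hc y'm by auto
    qed
    then show ?thesis using D2_inv[OF h yD(1)] by (auto simp: F_def)
  qed
  have F_iff: "\<alpha> h y \<in> F \<longleftrightarrow> y \<in> F" if h: "h \<in> St m d" and y: "y \<in> space M" for h y
  proof
    assume a: "\<alpha> h y \<in> F"
    have "\<alpha> (inv h) (\<alpha> h y) \<in> F" using Sd h by (intro F_inv a) (simp add: subgroup.m_inv_closed)
    then show "y \<in> F" using St_carrier[OF h] y by simp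
  qed (rule F_inv[OF h])
  have D2AE: "AE y in M. y \<in> X m d \<longrightarrow> y \<in> D2" using D1AE by eventually_elim (use Xsub in \<open>auto simp: D2_def\<close>)
  \<comment> \<open>If \<open>F\<close> were null, almost every point of \<open>S\<close> in the
    level set would share its value with another point, which lies outside \<open>S\<close>.
    Choosing the first group element that leads to such a point maps more than half of the level set
    injectively and without change of measure into the rest.\<close>
  have F_nonnull: "F \<notin> null_sets M"
  proof
    assume Fnull: "F \<in> null_sets M"
    define S2 where "S2 = (S \<inter> D2) - F"
    have S2 [measurable]: "S2 \<in> sets M" by (simp add: S2_def)
    have "AE y in M. y \<in> S2 \<longleftrightarrow> y \<in> X m d \<inter> S"
      using D2AE AE_not_in[OF Fnull] by eventually_elim (use D2D1 in \<open>auto simp: S2_def\<close>)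
    then have "measure M S2 = measure M (X m d \<inter> S)" by (intro measure_eq_AE) auto
    also have "\<dots> = measure M (X m d) - measure M (X m d - S)"
      using finite_measure_Diff'[of "X m d" S] by simp
    finally have big: "measure M S2 > measure M (X m d - S)" using den by simp
    define e where "e = from_nat_into (carrier G)"
    have ne: "carrier G \<noteq> {}" using one_closed by blast
    have ec: "e i \<in> carrier G" for i unfolding e_def by (rule from_nat_into[OF ne])
    have er: "range e = carrier G" unfolding e_def by (rule range_from_nat_into[OF ne countable_G])
    define C where "C i = S2 \<inter> B (e i) - (\<Union>j<i. B (e j))" for i
    have C [measurable]: "C i \<in> sets M" for i unfolding C_def using Bm ec by auto
    have dC: "disjoint_family C"
      unfolding disjoint_family_on_def
    proof (intro ballI impI)
      fix i j :: nat assume "i \<noteq> j"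
      then consider "i < j" | "j < i" by linarith
      then show "C i \<inter> C j = {}" by cases (auto simp: C_def)
    qed
    have UC: "(\<Union>i. C i) = S2"
    proof
      show "S2 \<subseteq> (\<Union>i. C i)"
      proof
        fix y assume y: "y \<in> S2"
        then have "y \<in> D2 - F" by (auto simp: S2_def)
        then obtain i where "y \<in> B (e i)" using qF er by (metis UN_iff imageE)
        then have "y \<in> B (e (LEAST i. y \<in> B (e i)))" by (rule LeastI)
        moreover have "y \<notin> B (e j)" if "j < (LEAST i. y \<in> B (e i))" for j using not_less_Least[OF that] .
        ultimately show "y \<in> (\<Union>i. C i)" using y unfolding C_def by blast
      qed
    qed (auto simp: C_def)
    have CB: "y \<in> D2 \<and> y \<in> S \<and> \<alpha> (e i) y \<in> D2 \<and> q (\<alpha> (e i) y) = q y \<and> \<alpha> (e i) y \<noteq> y \<and> y \<in> X0"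
      if y: "y \<in> C i" for y i
    proof -
      have b: "y \<in> B (e i)" "y \<in> S" using y by (auto simp: C_def S2_def)
      then have y0: "y \<in> D2" "y \<in> X0" "\<alpha> (e i) y \<in> D2" "e i \<noteq> \<one>" using D2D1 by (auto simp: B_def)
      have "q (\<alpha> (e i) y) = q y" using B_iff[OF ec y0(2)] b by (simp add: B_def)
      moreover have "\<alpha> (e i) y \<noteq> y" using free_G[OF y0(2) ec] y0(4) by blast
      ultimately show ?thesis using y0 b by blast
    qed
    define K where "K i = \<alpha> (e i) ` C i" for i
    have K [measurable]: "K i \<in> sets M" for i unfolding K_def using ec by auto
    \<comment> \<open>The moves do not change \<open>q\<close>, and \<open>q\<close> is injective on
      \<open>S\<close>, so points of different pieces cannot meet.\<close>
    have dK: "disjoint_family K"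
      unfolding disjoint_family_on_def
    proof (intro ballI impI, rule ccontr)
      fix i j :: nat assume ij: "i \<noteq> j" "K i \<inter> K j \<noteq> {}"
      then obtain y y' where y: "y \<in> C i" "y' \<in> C j" "\<alpha> (e i) y = \<alpha> (e j) y'" by (auto simp: K_def)
      have "q y = q y'" using CB[OF y(1)] CB[OF y(2)] y(3) by metis
      then have "y = y'" using q_inj_S CB[OF y(1)] CB[OF y(2)] by blast
      then show False using dC y ij unfolding disjoint_family_on_def by blast
    qed
    have "emeasure M S2 = (\<Sum>i. emeasure M (C i))"
      using suminf_emeasure[of C M] dC UC by (auto simp: image_subset_iff)
    also have "\<dots> = (\<Sum>i. emeasure M (K i))" unfolding K_def using ec by (simp add: emeasure_image_T)
    also have "\<dots> = emeasure M (\<Union>i. K i)"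
      using suminf_emeasure[of K M] dK by (auto simp: image_subset_iff)
    also have "\<dots> \<le> emeasure M (X m d - S)"
    proof (rule emeasure_mono)
      show "(\<Union>i. K i) \<subseteq> X m d - S"
      proof
        fix z assume "z \<in> (\<Union>i. K i)"
        then obtain i y where y: "y \<in> C i" "z = \<alpha> (e i) y" by (auto simp: K_def)
        have "z \<notin> S"
        proof
          assume "z \<in> S"
          then have "z = y" using q_inj_S[of z y] CB[OF y(1)] y(2) by blast
          then show False using CB[OF y(1)] y(2) by metis
        qed
        then show "z \<in> X m d - S" using CB[OF y(1)] y(2) D2D1 by blast
      qed
    qed simp
    finally have "measure M S2 \<le> measure M (X m d - S)" by (simp add: emeasure_eq_measure)
    then show False using big by simp
  qed
  have XF: "X m d - F \<in> null_sets M"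
    using ergodic_level[OF dm F FX(1)] F_nonnull F_iff by (auto intro: AE_I2)
  have eF: "emeasure M F = emeasure M (X m d)"
    using AE_not_in[OF XF] by (intro emeasure_eq_AE) (auto elim!: eventually_mono dest: subsetD[OF FX(1)])
  have Fne: "F \<noteq> {}" using F_nonnull by auto
  define I where "I = carrier L \<times> (UNIV :: nat set)"
  have FP: "F = (\<Union>i\<in>I. F \<inter> P i)" using P_cover FX(2) unfolding I_def by blast
  have qP: "piso (completion M) (completion N) (ennreal t) q (F \<inter> P i) (q ` (F \<inter> P i))" if i: "i \<in> I" for i
  proof -
    obtain l j where lj: "i = (l, j)" "l \<in> carrier L" using i by (auto simp: I_def)
    have s: "F \<inter> P i \<in> sets (completion M)" using P i F unfolding I_def by auto
    have p1: "piso (completion M) (completion (amp_space N)) (ennreal t) \<theta> (F \<inter> P i) (\<theta> ` (F \<inter> P i))"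
      by (rule piso_restrict[OF \<theta>_piso _ s]) (use FX in auto)
    have sub: "\<theta> ` (F \<inter> P i) \<subseteq> space N \<times> {j}"
    proof
      fix z assume "z \<in> \<theta> ` (F \<inter> P i)"
      then obtain y where "z = \<theta> y" "y \<in> X0" "snd (\<theta> y) = j" using lj by (auto simp: P_def)
      then show "z \<in> space N \<times> {j}" using \<theta>_space[of y] by (simp add: mem_Times_iff)
    qed
    have p2: "piso (completion (amp_space N)) (completion N) 1 fst (\<theta> ` (F \<inter> P i)) (fst ` \<theta> ` (F \<inter> P i))"
      by (rule piso_restrict[OF amp_slice_piso[OF A.prob_space_axioms] sub pisoD(2)[OF p1]])
    have p3: "piso (completion N) (completion N) 1 (\<beta> (inv\<^bsub>L\<^esub> l)) (fst ` \<theta> ` (F \<inter> P i))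
        (\<beta> (inv\<^bsub>L\<^esub> l) ` fst ` \<theta> ` (F \<inter> P i))"
      by (rule piso_restrict[OF A.act_piso _ pisoD(2)[OF p2]]) (use lj sub in auto)
    have qe: "(\<beta> (inv\<^bsub>L\<^esub> l) \<circ> (fst \<circ> \<theta>)) y = q y" if "y \<in> F \<inter> P i" for y
      using that lj by (auto simp: q_def P_def)
    have "q ` (F \<inter> P i) = \<beta> (inv\<^bsub>L\<^esub> l) ` fst ` \<theta> ` (F \<inter> P i)"
      using qe by (force simp: image_iff)
    then show ?thesis
      using piso_cong[OF piso_comp[OF piso_comp[OF p1 p2] p3] qe] by simp
  qed
  have qF_piso: "piso (completion M) (completion N) (ennreal t) q F (q ` F)"
  proof -
    have "piso (completion M) (completion N) (ennreal t) q (\<Union>i\<in>I. F \<inter> P i) (\<Union>i\<in>I. q ` (F \<inter> P i))"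
    proof (rule piso_glue[OF _ qP])
      show "countable I" unfolding I_def by (rule cI)
      have dis: "P i \<inter> P j = {}" if "i \<noteq> j" for i j using that by (auto simp: P_def split: prod.splits)
      then show "disjoint_family_on (\<lambda>i. F \<inter> P i) I" unfolding disjoint_family_on_def by blast
      show "disjoint_family_on (\<lambda>i. q ` (F \<inter> P i)) I"
        unfolding disjoint_family_on_def using dis q_inj_F by (fastforce dest: inj_onD)
    qed
    then show ?thesis using FP by (metis image_UN)
  qed
  define L0 where "L0 = \<psi> ` St m d"
  have hx: "group_hom (G\<lparr>carrier := St n x\<rparr>) L \<psi>"
    using subgroup.subgroup_is_group[OF Sx group_axioms] \<psi>hom L.group_axioms
    by (intro group_hom.intro group_hom_axioms.intro)
  have L0: "subgroup L0 L" unfolding L0_def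
    by (rule group_hom.subgroup_img_is_subgroup[OF hx subgroup_incl[OF Sd Sx Ssub]])
  have iso: "\<psi> \<in> iso (G\<lparr>carrier := St m d\<rparr>) (L\<lparr>carrier := L0\<rparr>)"
  proof (rule isoI)
    show "\<psi> \<in> hom (G\<lparr>carrier := St m d\<rparr>) (L\<lparr>carrier := L0\<rparr>)"
      using \<psi>m Ssub by (intro homI) (auto simp: L0_def)
    \<comment> \<open>An element of the kernel keeps the \<open>q\<close>-value of a point of
      \<open>F\<close>, hence fixes the point, hence is trivial by freeness.\<close>
    have "inj_on \<psi> (St m d)"
    proof (rule inj_onI)
      fix g h assume gh: "g \<in> St m d" "h \<in> St m d" "\<psi> g = \<psi> h"
      have hi: "inv h \<in> St m d" using gh Sd by (simp add: subgroup.m_inv_closed)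
      have k: "g \<otimes> inv h \<in> St m d" using gh hi Sd by (simp add: subgroup.m_closed)
      have gc: "g \<in> carrier G" "h \<in> carrier G" using gh St_carrier by auto
      have "\<psi> (g \<otimes> inv h) = \<psi> (h \<otimes> inv h)"
        using \<psi>m[OF subsetD[OF Ssub gh(1)] subsetD[OF Ssub hi]]
          \<psi>m[OF subsetD[OF Ssub gh(2)] subsetD[OF Ssub hi]] gh(3) by simp
      also have "\<dots> = \<one>\<^bsub>L\<^esub>" using group_hom.hom_one[OF hx] gc by simp
      finally have one: "\<psi> (g \<otimes> inv h) = \<one>\<^bsub>L\<^esub>" .
      obtain y where y: "y \<in> F" using Fne by blast
      have "q (\<alpha> (g \<otimes> inv h) y) = q y"
        using q_equi[OF subsetD[OF Ssub k] subsetD[OF FX(3) y]] one A.T_one[OF q_space[OF subsetD[OF FX(2) y]]] by simp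
      then have "\<alpha> (g \<otimes> inv h) y = y" using q_inj_F F_inv[OF k y] y by (auto dest: inj_onD)
      then have "g \<otimes> inv h = \<one>" using free_G[of y] y FX gc by auto
      then show "g = h" using gc by (metis inv_closed inv_equality inv_inv)
    qed
    then show "bij_betw \<psi> (carrier (G\<lparr>carrier := St m d\<rparr>)) (carrier (L\<lparr>carrier := L0\<rparr>))"
      by (simp add: bij_betw_def L0_def)
  qed
  \<comment> \<open>Two points of the image in one \<Lambda>-orbit come from one \<Gamma>-orbit
    within the level set, hence from an element of its stabilizer; freeness of \<Lambda> identifies
    \<open>l\<close> with the image of that element under \<open>\<psi>\<close>.\<close>
  have sep: "l \<in> L0" if l: "l \<in> carrier L" and z: "z \<in> q ` F" "\<beta> l z \<in> q ` F" for l z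
  proof -
    obtain y y' where y: "y \<in> F" "z = q y" "y' \<in> F" "\<beta> l z = q y'" using z by blast
    have y0: "y \<in> X0" "y' \<in> X0" using y FX by auto
    obtain g where g: "g \<in> carrier G" "y' = \<alpha> g y" using fib[OF y0 l] y by metis
    have yX: "y \<in> X m d" "y' \<in> X m d" using y FX by auto
    then have "g \<in> St m y" using g by (auto simp: St_def X_iff)
    then have gS: "g \<in> St m d" using St_X[OF dm yX(1)] by simp
    have "\<beta> l (q y) = \<beta> (\<psi> g) (q y)" using q_equi[of g y] gS Ssub y FX g by auto
    have c: "\<phi> y \<in> carrier L" "\<psi> g \<in> carrier L" using \<phi>c X0_space y0 \<psi>c gS Ssub by auto
    have "\<beta> (l \<otimes>\<^bsub>L\<^esub> inv\<^bsub>L\<^esub> \<phi> y) (fst (\<theta> y)) = \<beta> (\<psi> g \<otimes>\<^bsub>L\<^esub> inv\<^bsub>L\<^esub> \<phi> y) (fst (\<theta> y))"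
      using \<open>\<beta> l (q y) = \<beta> (\<psi> g) (q y)\<close> l c \<theta>_space[OF y0(1)] by (simp add: q_def A.T_mult)
    then have "l \<otimes>\<^bsub>L\<^esub> inv\<^bsub>L\<^esub> \<phi> y = \<psi> g \<otimes>\<^bsub>L\<^esub> inv\<^bsub>L\<^esub> \<phi> y"
      using \<beta>_cancel[OF y0(1)] l c by simp
    then have "l = \<psi> g" using l c by simp
    then show ?thesis using gS by (simp add: L0_def)
  qed
  have Yinv: "\<beta> l z \<in> q ` F" if "l \<in> L0" "z \<in> q ` F" for l z
  proof -
    obtain g y where g: "g \<in> St m d" "l = \<psi> g" "y \<in> F" "z = q y" using \<open>l \<in> L0\<close> \<open>z \<in> q ` F\<close> by (auto simp: L0_def)
    then have "\<beta> l z = q (\<alpha> g y)" using q_equi[OF subsetD[OF Ssub g(1)] subsetD[OF FX(3) g(3)]] by simp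
    then show ?thesis using F_inv[OF g(1,3)] by blast
  qed
  have L0c: "l \<in> carrier L" if "l \<in> L0" for l using that L0 subgroup.subset by blast
  obtain S0 N' where S0 [measurable]: "S0 \<in> sets N" and S0sub: "S0 \<subseteq> q ` F" and N': "N' \<in> null_sets N"
    and S0N: "q ` F - S0 \<subseteq> N'" by (rule completion_sandwich[OF pisoD(2)[OF qF_piso]])
  \<comment> \<open>The image of \<open>F\<close> is only known to be measurable for the completion
    of \<open>N\<close>. \<open>Y0\<close> is the largest \<open>L0\<close>-invariant subset of a
    measurable part \<open>S0\<close> of the image; it has full measure there because the image is
    itself invariant and \<open>L0\<close> is countable.\<close>
  define Y0 where "Y0 = {z \<in> space N. \<forall>l\<in>L0. \<beta> l z \<in> S0}"
  have cL0: "countable L0" unfolding L0_def using cSt by simp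
  have pre: "{z \<in> space N. \<beta> l z \<in> E} \<in> sets N" if "l \<in> L0" "E \<in> sets N" for l E
    using measurable_sets[OF A.T_measurable[OF L0c[OF that(1)]] that(2)] by (simp add: vimage_def Int_def conj_commute)
  have "Y0 = space N - (\<Union>l\<in>L0. {z \<in> space N. \<beta> l z \<in> space N - S0})"
    using A.T_space L0c unfolding Y0_def by blast
  moreover have "(\<Union>l\<in>L0. {z \<in> space N. \<beta> l z \<in> space N - S0}) \<in> sets N"
    using cL0 pre S0 by (intro sets.countable_UN'') auto
  ultimately have Y0 [measurable]: "Y0 \<in> sets N" by simp
  have Y0S0: "Y0 \<subseteq> S0"
    using A.T_one subgroup.one_closed[OF L0] unfolding Y0_def by force
  have Y0inv: "\<beta> h z \<in> Y0" if h: "h \<in> L0" and z: "z \<in> Y0" for h z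
  proof -
    have zs: "z \<in> space N" using z by (simp add: Y0_def)
    have "\<beta> l (\<beta> h z) \<in> S0" if l: "l \<in> L0" for l
    proof -
      have "l \<otimes>\<^bsub>L\<^esub> h \<in> L0" using L0 l h by (simp add: subgroup.m_closed)
      then have "\<beta> (l \<otimes>\<^bsub>L\<^esub> h) z \<in> S0" using z by (simp add: Y0_def)
      then show ?thesis using A.T_mult[of l h z] L0c l h zs by simp
    qed
    then show ?thesis using A.T_space[OF L0c[OF h] zs] by (simp add: Y0_def)
  qed
  have Ynull: "q ` F - Y0 \<in> null_sets (completion N)"
  proof -
    have null: "{z \<in> space N. \<beta> l z \<in> N'} \<in> null_sets N" if l: "l \<in> L0" for l
    proof -
      have "emeasure N {z \<in> space N. \<beta> l z \<in> N'} = emeasure (distr N N (\<beta> l)) N'"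
        using N' A.T_measurable[OF L0c[OF l]] by (subst emeasure_distr) (auto simp: vimage_def Int_def conj_commute)
      also have "\<dots> = 0" using N' A.T_distr[OF L0c[OF l]] by auto
      finally show ?thesis using pre[OF l, of N'] N' by auto
    qed
    then have "(\<Union>l\<in>L0. {z \<in> space N. \<beta> l z \<in> N'}) \<in> null_sets N" using cL0 by (intro null_sets_UN') auto
    moreover have "q ` F - Y0 \<subseteq> (\<Union>l\<in>L0. {z \<in> space N. \<beta> l z \<in> N'})"
    proof
      fix z assume z: "z \<in> q ` F - Y0"
      then have zs: "z \<in> space N" using q_space FX by auto
      then obtain l where l: "l \<in> L0" "\<beta> l z \<notin> S0" using z by (auto simp: Y0_def)
      then have "\<beta> l z \<in> N'" using Yinv[OF l(1)] z S0N by blast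
      then show "z \<in> (\<Union>l\<in>L0. {z \<in> space N. \<beta> l z \<in> N'})" using l zs by blast
    qed
    ultimately show ?thesis by (rule null_sets_completion_subset[rotated, OF null_sets_completionI])
  qed
  have Y0F: "Y0 \<subseteq> q ` F" using Y0S0 S0sub by blast
  have "emeasure N Y0 = emeasure (completion N) (q ` F)"
  proof -
    have "emeasure (completion N) Y0 = emeasure (completion N) (q ` F)"
      using AE_not_in[OF Ynull] Y0F pisoD(2)[OF qF_piso]
      by (intro emeasure_eq_AE) (auto elim!: eventually_mono)
    then show ?thesis by simp
  qed
  also have "\<dots> = ennreal t * emeasure M (X m d)" using pisoD(8)[OF qF_piso] eF by simp
  finally have "measure N Y0 = t * measure M (X m d)"
    using t_pos by (simp add: A.emeasure_eq_measure emeasure_eq_measure ennreal_mult[symmetric] measure_nonneg del: ennreal_mult)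
  then have mY: "measure N Y0 = t * measure M (X m d)" .
  then have posY: "measure N Y0 > 0" using t_pos posd by simp
  have sepY: "l \<in> L0" if "l \<in> carrier L" "z \<in> Y0" "\<beta> l z \<in> Y0" for l z
    using sep[of l z] that Y0F by blast
  note idx = A.index_fundamental_set[OF L0 Y0 posY Y0inv sepY]
  define D where "D = {y \<in> F. q y \<in> Y0}"
  have Dm: "D \<in> sets (completion M)" unfolding D_def by (rule piso_vimage[OF qF_piso]) auto
  have DF: "D \<subseteq> F" by (auto simp: D_def)
  have qD: "q ` D = Y0" using Y0F by (auto simp: D_def)
  have pD: "piso (completion M) (completion N) (ennreal t) q D Y0"
    using piso_restrict[OF qF_piso DF Dm] qD by simp
  have "q ` (F - D) = q ` F - Y0" by (auto simp: D_def)
  then have "ennreal t * emeasure (completion M) (F - D) = 0"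
    using pisoD(7)[OF qF_piso Diff_subset sets.Diff[OF sets_completionI_sets[OF F] Dm]] null_setsD1[OF Ynull] by simp
  then have FD: "F - D \<in> null_sets (completion M)" using t_pos Dm F by (auto simp: null_sets_def)
  have "X m d - D = (X m d - F) \<union> (F - D)" using DF FX by blast
  then have XD: "X m d - D \<in> null_sets (completion M)"
    using FD null_sets_completionI[OF XF] by (simp add: null_sets.Un)
  have Dorb: "\<exists>l\<in>carrier L. q y = \<beta> l (fst (\<theta> y))" if "y \<in> D" for y
  proof -
    have "y \<in> space M" using that DF FX X0_space by blast
    then show ?thesis unfolding q_def using \<phi>c by blast
  qed
  have Dequi: "\<alpha> g y \<in> D \<and> q (\<alpha> g y) = \<beta> (\<psi> g) (q y)" if g: "g \<in> St m d" and y: "y \<in> D" for g y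
  proof -
    have yF: "y \<in> F" "q y \<in> Y0" using y by (auto simp: D_def)
    have e: "q (\<alpha> g y) = \<beta> (\<psi> g) (q y)" using q_equi[of g y] g Ssub yF FX by blast
    moreover have "\<beta> (\<psi> g) (q y) \<in> Y0" using Y0inv[of "\<psi> g"] g yF by (simp add: L0_def)
    ultimately show ?thesis using F_inv[OF g yF(1)] by (simp add: D_def)
  qed
  show ?thesis
    by (rule found[OF dm posd L0 iso _ _ XD Y0 pD Dorb Dequi idx Y0inv mY]) (use DF FX in auto)
qed

end

section \<open>The cocycle of an orbit equivalence\<close>

lemma (in ergodic_action) invariant_core:
  assumes "AE x in M. P x"
  obtains X1 where "X1 \<in> sets M" "space M - X1 \<in> null_sets M"
    "\<And>g x. g \<in> carrier G \<Longrightarrow> x \<in> X1 \<Longrightarrow> \<alpha> g x \<in> X1" "\<And>x. x \<in> X1 \<Longrightarrow> P x"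
proof -
  obtain Q where Q: "Q \<in> null_sets M" "{x \<in> space M. \<not> P x} \<subseteq> Q"
    using assms by (auto elim!: AE_E simp: null_sets_def)
  \<comment> \<open>The points whose whole orbit avoids the exceptional set; countability of the
    group keeps the complement null.\<close>
  define X1 where "X1 = {x \<in> space M. \<forall>g\<in>carrier G. \<alpha> g x \<notin> Q}"
  have pre: "\<alpha> g -` Q \<inter> space M \<in> null_sets M" if g: "g \<in> carrier G" for g
  proof -
    have "emeasure M (\<alpha> g -` Q \<inter> space M) = emeasure (distr M M (\<alpha> g)) Q"
      using Q T_measurable[OF g] by (subst emeasure_distr) auto
    then show ?thesis using Q T_measurable[OF g] T_distr[OF g] by (auto simp: null_sets_def measurable_sets)
  qed
  have eq: "space M - X1 = (\<Union>g\<in>carrier G. \<alpha> g -` Q \<inter> space M)" by (auto simp: X1_def)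
  have null: "space M - X1 \<in> null_sets M"
    unfolding eq using countable_group pre by (intro null_sets_UN') auto
  have "X1 = space M - (space M - X1)" by (auto simp: X1_def)
  then have m: "X1 \<in> sets M" using null by (metis null_setsD2 sets.compl_sets)
  show ?thesis
  proof (rule that[OF m null])
    fix g x assume g: "g \<in> carrier G" and x: "x \<in> X1"
    have "\<alpha> h (\<alpha> g x) \<notin> Q" if h: "h \<in> carrier G" for h
    proof -
      have "\<alpha> (h \<otimes> g) x \<notin> Q" using x g h by (simp add: X1_def)
      then show ?thesis using T_mult[OF h g] x by (simp add: X1_def)
    qed
    then show "\<alpha> g x \<in> X1" using x g T_space by (simp add: X1_def)
  next
    fix x assume x: "x \<in> X1"
    then have "x \<notin> Q" using T_one[of x] one_closed unfolding X1_def by force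
    then show "P x" using Q x by (auto simp: X1_def)
  qed
qed

text \<open>One null set can be discarded for all members of a countable family. With it the
  cocycle, at first measurable only for the completion, becomes measurable for \<open>M\<close>
  itself.\<close>

lemma completion_countable_null:
  assumes "countable I" "\<And>i. i \<in> I \<Longrightarrow> E i \<in> sets (completion M)"
  obtains Q where "Q \<in> null_sets M" "\<And>i. i \<in> I \<Longrightarrow> E i - Q \<in> sets M"
proof -
  have "\<exists>S Q. S \<in> sets M \<and> S \<subseteq> E i \<and> Q \<in> null_sets M \<and> E i - S \<subseteq> Q" if "i \<in> I" for i
    using completion_sandwich[OF assms(2)[OF that]] by metis
  then obtain S Q where SQ: "\<And>i. i \<in> I \<Longrightarrow> S i \<in> sets M" "\<And>i. i \<in> I \<Longrightarrow> S i \<subseteq> E i"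
    "\<And>i. i \<in> I \<Longrightarrow> Q i \<in> null_sets M" "\<And>i. i \<in> I \<Longrightarrow> E i - S i \<subseteq> Q i" by metis
  have n: "(\<Union>i\<in>I. Q i) \<in> null_sets M" using assms(1) SQ(3) by (intro null_sets_UN')
  have "E i - (\<Union>i\<in>I. Q i) \<in> sets M" if i: "i \<in> I" for i
  proof -
    have "E i - (\<Union>i\<in>I. Q i) = S i - (\<Union>i\<in>I. Q i)" using SQ(2)[OF i] SQ(4)[OF i] i by blast
    then show ?thesis using SQ(1)[OF i] n by auto
  qed
  then show ?thesis using that n by blast
qed

lemma iso_mod_nullI:
  assumes "piso (completion M) (completion N) 1 f A B"
    "space M - A \<in> null_sets (completion M)" "space N - B \<in> null_sets (completion N)"
  shows "iso_mod_null M N f"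
proof -
  have "A \<subseteq> space M" "B \<subseteq> space N"
    using sets.sets_into_space[OF pisoD(1)[OF assms(1)]] sets.sets_into_space[OF pisoD(2)[OF assms(1)]] by auto
  moreover have "\<forall>E\<subseteq>A. (E \<in> sets (completion M) \<longleftrightarrow> f ` E \<in> sets (completion N)) \<and>
      (E \<in> sets (completion M) \<longrightarrow> emeasure (completion N) (f ` E) = emeasure (completion M) E)"
    using pisoD(6,7)[OF assms(1)] by simp
  ultimately show ?thesis unfolding iso_mod_null_def using assms(2,3) pisoD(3)[OF assms(1)] by blast
qed

text \<open>Undoing the normalization of the target turns a measure preserving map into one that
  multiplies measure by \<open>t\<close>.\<close>

lemma iso_mod_null_normalizedD:
  assumes iso: "iso_mod_null M (normalized_restriction P Y) f"
    and Y: "Y \<in> sets P" and e: "emeasure P Y = ennreal t" and t: "t > 0"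
  obtains A B where "space M - A \<in> null_sets (completion M)" "B \<subseteq> Y"
    "piso (completion M) (completion P) (ennreal t) f A B"
proof -
  have nz: "emeasure P Y \<noteq> 0" "emeasure P Y \<noteq> \<infinity>" using e t by auto
  note R = completion_normalized_restriction[OF Y nz]
  obtain A B where A: "A \<subseteq> space M" "space M - A \<in> null_sets (completion M)"
    and B: "B \<subseteq> Y" "Y - B \<in> null_sets (completion (normalized_restriction P Y))"
    and bij: "bij_betw f A B"
    and sets: "\<And>E. E \<subseteq> A \<Longrightarrow> E \<in> sets (completion M) \<longleftrightarrow> f ` E \<in> sets (completion (normalized_restriction P Y))"
    and em: "\<And>E. E \<subseteq> A \<Longrightarrow> E \<in> sets (completion M) \<Longrightarrow>
        emeasure (completion (normalized_restriction P Y)) (f ` E) = emeasure (completion M) E"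
    using iso unfolding iso_mod_null_def R(3) by blast
  have fE: "f ` E \<subseteq> Y" if "E \<subseteq> A" for E using that bij B by (auto simp: bij_betw_def)
  have "A = space M - (space M - A)" using A by auto
  then have Am: "A \<in> sets (completion M)" using A(2) by (metis null_setsD2 sets.compl_sets space_completion)
  have "piso (completion M) (completion P) (ennreal t) f A B"
  proof (rule pisoI[OF Am _ bij])
    have s: "E \<in> sets (completion M) \<longleftrightarrow> f ` E \<in> sets (completion P)" if "E \<subseteq> A" for E
      using sets[OF that] R(1)[of "f ` E"] fE[OF that] by blast
    show "E \<in> sets (completion M) \<longleftrightarrow> f ` E \<in> sets (completion P)" if "E \<subseteq> A" for E by (rule s[OF that])
    show "B \<in> sets (completion P)" using s[of A] Am bij by (simp add: bij_betw_def)
    fix E assume E: "E \<subseteq> A" "E \<in> sets (completion M)"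
    have "emeasure (completion M) E = emeasure (completion P) (f ` E) / ennreal t"
      using em[OF E] R(2)[of "f ` E"] s[OF E(1)] E fE[OF E(1)] e by simp
    then have "ennreal t * emeasure (completion M) E = ennreal t * (emeasure (completion P) (f ` E) / ennreal t)" by simp
    also have "\<dots> = emeasure (completion P) (f ` E)"
      using t mult_divide_eq_ennreal[of "ennreal t" "emeasure (completion P) (f ` E)"]
      by (simp add: ennreal_times_divide mult.commute[of "ennreal t"])
    finally show "emeasure (completion P) (f ` E) = ennreal t * emeasure (completion M) E" by simp
  qed
  then show ?thesis using that A B by blast
qed

locale orbit_equivalence_data = profinite_system G M \<alpha> G0 + A: ergodic_action L N \<beta>
    for G (structure) and M :: "(nat \<Rightarrow> 'b) measure" and \<alpha> and G0
      and L and N :: "'y measure" and \<beta> +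
  fixes \<theta> :: "(nat \<Rightarrow> 'b) \<Rightarrow> 'y \<times> nat" and t :: real and Y' :: "('y \<times> nat) set"
  assumes rel_T: "relative_property_T G G0"
    and free_G: "free_action G M \<alpha>" and free_L: "free_action L N \<beta>"
    and t_pos: "t > 0" and Y'_sets: "Y' \<in> sets (amp_space N)" and Y'_measure: "emeasure (amp_space N) Y' = ennreal t"
    and oe: "orbit_equivalence M (orbit_relation G M \<alpha>)
           (normalized_restriction (amp_space N) Y')
           (restrict_relation (amp_relation (orbit_relation L N \<beta>)) Y') \<theta>"
begin

text \<open>Freeness of the \<Lambda>-action makes the cocycle unique, so the difficulty is its
  measurability: the defining condition is an equation between two points of \<open>N\<close>. It is
  rewritten through \<theta>-images of level sets, which are measurable for the completion.\<close>

theorem core: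
  obtains X0 w where "orbit_equivalence_core G M \<alpha> G0 L w N \<beta> X0 \<theta> t" "\<And>x. x \<in> X0 \<Longrightarrow> \<theta> x \<in> Y'"
proof -
  note found = that
  let ?R = "orbit_relation G M \<alpha>"
  let ?S = "restrict_relation (amp_relation (orbit_relation L N \<beta>)) Y'"
  let ?O = "completion (amp_space N)"
  interpret E: ergodic_action G M \<alpha> by (rule ergodic_action)
  have spO: "space (amp_space N) = space N \<times> UNIV" by (simp add: amp_space_def space_pair_measure)
  have Y'sub: "Y' \<subseteq> space N \<times> UNIV" using sets.sets_into_space[OF Y'_sets] spO by simp
  have "iso_mod_null M (normalized_restriction (amp_space N) Y') \<theta>"
    using oe by (simp add: orbit_equivalence_def)
  then obtain A0 B0 where A0: "space M - A0 \<in> null_sets (completion M)" and B0: "B0 \<subseteq> Y'"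
    and p\<theta>: "piso (completion M) ?O (ennreal t) \<theta> A0 B0"
    by (rule iso_mod_null_normalizedD[OF _ Y'_sets Y'_measure t_pos])
  have A0Y: "\<theta> x \<in> Y'" if "x \<in> A0" for x using that pisoD(5)[OF p\<theta>] B0 by blast
  have ae1: "AE x in M. x \<in> A0"
    using AE_not_in[OF A0] AE_space unfolding AE_completion_iff by eventually_elim auto
  have ae2: "AE x in M. bij_betw \<theta> (?R `` {x}) (?S `` {\<theta> x})" using oe by (simp add: orbit_equivalence_def)
  have ae3: "AE x in M. \<forall>g\<in>carrier G. g \<noteq> \<one> \<longrightarrow> \<alpha> g x \<noteq> x"
    using free_G countable_G by (subst AE_ball_countable) (auto simp: free_action_def)
  have "AE y in N. \<forall>l\<in>carrier L. l \<noteq> \<one>\<^bsub>L\<^esub> \<longrightarrow> \<beta> l y \<noteq> y"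
    using free_L A.countable_group by (subst AE_ball_countable) (auto simp: free_action_def)
  then obtain Q where Q: "Q \<in> null_sets N" "{y \<in> space N. \<not> (\<forall>l\<in>carrier L. l \<noteq> \<one>\<^bsub>L\<^esub> \<longrightarrow> \<beta> l y \<noteq> y)} \<subseteq> Q"
    by (auto elim!: AE_E simp: null_sets_def)
  have QU: "Q \<times> UNIV \<in> null_sets (amp_space N)"
  proof -
    interpret C: sigma_finite_measure "count_space (UNIV :: nat set)"
      by (rule sigma_finite_measure_count_space)
    have "emeasure (amp_space N) (Q \<times> UNIV) = 0"
      unfolding amp_space_def using Q by (subst C.emeasure_pair_measure_Times) auto
    moreover have "Q \<times> UNIV \<in> sets (amp_space N)" unfolding amp_space_def using Q by (intro pair_measureI) auto
    ultimately show ?thesis by (simp add: null_sets_def)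
  qed
  \<comment> \<open>The points sent to a place where \<Lambda> may fail to act freely. Since
    \<theta> multiplies measure by \<open>t > 0\<close>, the preimage of a null set is null.\<close>
  define E1 where "E1 = {x \<in> A0. \<theta> x \<in> Q \<times> UNIV}"
  have E1: "E1 \<in> sets (completion M)" unfolding E1_def
    by (rule piso_vimage[OF p\<theta>]) (use QU in auto)
  have E1A: "E1 \<subseteq> A0" by (auto simp: E1_def)
  have "\<theta> ` E1 \<subseteq> Q \<times> UNIV" by (auto simp: E1_def)
  then have "\<theta> ` E1 \<in> null_sets ?O"
    by (rule null_sets_completion_subset[OF _ null_sets_completionI[OF QU]])
  then have "ennreal t * emeasure (completion M) E1 = 0" using pisoD(7)[OF p\<theta> E1A E1] by auto
  then have "E1 \<in> null_sets (completion M)" using E1 t_pos by (auto simp: null_sets_def)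
  then have "AE x in completion M. x \<notin> E1" by (rule AE_not_in)
  then have "AE x in M. x \<notin> E1" unfolding AE_completion_iff .
  then have ae4: "AE x in M. \<forall>l\<in>carrier L. l \<noteq> \<one>\<^bsub>L\<^esub> \<longrightarrow> \<beta> l (fst (\<theta> x)) \<noteq> fst (\<theta> x)"
    using ae1
  proof eventually_elim
    case (elim x)
    then have "\<theta> x \<notin> Q \<times> UNIV" by (auto simp: E1_def)
    then have "fst (\<theta> x) \<notin> Q" by (auto simp: mem_Times_iff)
    moreover have "fst (\<theta> x) \<in> space N" using A0Y[OF elim(2)] Y'sub by auto
    ultimately show ?case using Q(2) by blast
  qed
  have "AE x in M. x \<in> A0 \<and> bij_betw \<theta> (?R `` {x}) (?S `` {\<theta> x})
    \<and> (\<forall>g\<in>carrier G. g \<noteq> \<one> \<longrightarrow> \<alpha> g x \<noteq> x) \<and> (\<forall>l\<in>carrier L. l \<noteq> \<one>\<^bsub>L\<^esub> \<longrightarrow> \<beta> l (fst (\<theta> x)) \<noteq> fst (\<theta> x))"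
    using ae1 ae2 ae3 ae4 by eventually_elim blast
  then obtain X0 where X0m: "X0 \<in> sets M" and X0n: "space M - X0 \<in> null_sets M"
    and X0i: "\<And>g x. g \<in> carrier G \<Longrightarrow> x \<in> X0 \<Longrightarrow> \<alpha> g x \<in> X0"
    and X0P: "\<And>x. x \<in> X0 \<Longrightarrow> x \<in> A0 \<and> bij_betw \<theta> (?R `` {x}) (?S `` {\<theta> x})
    \<and> (\<forall>g\<in>carrier G. g \<noteq> \<one> \<longrightarrow> \<alpha> g x \<noteq> x) \<and> (\<forall>l\<in>carrier L. l \<noteq> \<one>\<^bsub>L\<^esub> \<longrightarrow> \<beta> l (fst (\<theta> x)) \<noteq> fst (\<theta> x))"
    by (rule E.invariant_core) (rule that)
  have X0s: "x \<in> space M" if "x \<in> X0" for x using that sets.sets_into_space[OF X0m] by blast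
  have X0Y: "\<theta> x \<in> Y'" if "x \<in> X0" for x using X0P[OF that] A0Y by blast
  have ps: "fst (\<theta> x) \<in> space N" if "x \<in> X0" for x using X0Y[OF that] Y'sub by auto
  have pX: "piso (completion M) ?O (ennreal t) \<theta> X0 (\<theta> ` X0)"
    by (rule piso_restrict[OF p\<theta>]) (use X0P X0m in auto)
  have inj: "inj_on \<theta> X0" by (rule pisoD(4)[OF pX])
  have fwd: "\<exists>l\<in>carrier L. fst (\<theta> (\<alpha> g x)) = \<beta> l (fst (\<theta> x))" if g: "g \<in> carrier G" and x: "x \<in> X0" for g x
  proof -
    have "\<alpha> g x \<in> ?R `` {x}" using g X0s[OF x] by (auto simp: orbit_relation_def)
    then have "\<theta> (\<alpha> g x) \<in> ?S `` {\<theta> x}" using X0P[OF x] by (auto simp: bij_betw_def)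
    then show ?thesis by (auto simp: restrict_relation_def amp_relation_def orbit_relation_def)
  qed
  have bwd: "\<exists>g\<in>carrier G. x' = \<alpha> g x"
    if x: "x \<in> X0" "x' \<in> X0" and l: "l \<in> carrier L" "fst (\<theta> x') = \<beta> l (fst (\<theta> x))" for x x' l
  proof -
    have "(fst (\<theta> x), fst (\<theta> x')) \<in> orbit_relation L N \<beta>"
      using l ps[OF x(1)] by (auto simp: orbit_relation_def)
    then have "((fst (\<theta> x), snd (\<theta> x)), (fst (\<theta> x'), snd (\<theta> x'))) \<in> amp_relation (orbit_relation L N \<beta>)"
      unfolding amp_relation_def by blast
    then have "\<theta> x' \<in> ?S `` {\<theta> x}" using X0Y x by (auto simp: restrict_relation_def)
    then have "\<theta> x' \<in> \<theta> ` (?R `` {x})" using X0P[OF x(1)] by (auto simp: bij_betw_def)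
    then obtain g where g: "g \<in> carrier G" "\<theta> x' = \<theta> (\<alpha> g x)" by (auto simp: orbit_relation_def)
    then have "x' = \<alpha> g x" using inj x X0i by (auto dest: inj_onD)
    then show ?thesis using g by blast
  qed
  have \<beta>u: "a = b" if x: "x \<in> X0" and ab: "a \<in> carrier L" "b \<in> carrier L"
    and e: "\<beta> a (fst (\<theta> x)) = \<beta> b (fst (\<theta> x))" for x a b
  proof -
    have "\<beta> (inv\<^bsub>L\<^esub> b \<otimes>\<^bsub>L\<^esub> a) (fst (\<theta> x)) = fst (\<theta> x)"
      using A.T_mult[of "inv\<^bsub>L\<^esub> b" a "fst (\<theta> x)"] e ab ps[OF x] by simp
    then have "inv\<^bsub>L\<^esub> b \<otimes>\<^bsub>L\<^esub> a = \<one>\<^bsub>L\<^esub>" using X0P[OF x] ab by (meson A.inv_closed A.m_closed)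
    then show ?thesis using ab A.inv_mult_cancel(1)[of b a] by simp
  qed
  define V where "V = (\<lambda>(g, l). {x \<in> X0. fst (\<theta> (\<alpha> g x)) = \<beta> l (fst (\<theta> x))})"
  have Vm: "V i \<in> sets (completion M)" if i: "i \<in> carrier G \<times> carrier L" for i
  proof -
    obtain g l where gl: "i = (g, l)" "g \<in> carrier G" "l \<in> carrier L" using i by auto
    define Dj where "Dj j n a = fst ` (\<theta> ` (level_set M n a \<inter> X0) \<inter> (space N \<times> {j}))" for j :: nat and n a
    define U where "U j n a = {x \<in> X0. \<beta> l (fst (\<theta> x)) \<in> Dj j n a}" for j n a
    have Djm: "Dj j n a \<in> sets (completion N)" for j n a
    proof -
      have "\<theta> ` (level_set M n a \<inter> X0) \<in> sets ?O"
        using pisoD(6)[OF pX, of "level_set M n a \<inter> X0"] level_measurable X0m by auto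
      then have "\<theta> ` (level_set M n a \<inter> X0) \<inter> (space N \<times> {j}) \<in> sets ?O"
        using pisoD(1)[OF amp_slice_piso[OF A.prob_space_axioms]] by auto
      then show ?thesis unfolding Dj_def
        using pisoD(6)[OF amp_slice_piso[OF A.prob_space_axioms, of j], of "\<theta> ` (level_set M n a \<inter> X0) \<inter> (space N \<times> {j})"] by auto
    qed
    have Um: "U j n a \<in> sets (completion M)" for j n a
    proof -
      define D' where "D' = {y \<in> space N. \<beta> l y \<in> Dj j n a}"
      have D': "D' \<in> sets (completion N)" unfolding D'_def by (rule piso_vimage[OF A.act_piso[OF gl(3)] Djm])
      have D's: "D' \<subseteq> space N" by (auto simp: D'_def)
      have "(\<lambda>y. (y, k)) ` D' \<in> sets ?O" for k
        using pisoD(6)[OF amp_slice_piso'[OF A.prob_space_axioms, of k] D's] D' by simp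
      then have "(\<Union>k. {x \<in> X0. \<theta> x \<in> (\<lambda>y. (y, k)) ` D'}) \<in> sets (completion M)"
        using piso_vimage[OF pX] by auto
      moreover have "U j n a = (\<Union>k. {x \<in> X0. \<theta> x \<in> (\<lambda>y. (y, k)) ` D'})"
      proof (intro equalityI subsetI)
        fix x assume x: "x \<in> U j n a"
        then have "fst (\<theta> x) \<in> D'" using ps by (auto simp: U_def D'_def)
        then have "\<theta> x \<in> (\<lambda>y. (y, snd (\<theta> x))) ` D'" by (intro image_eqI[of _ _ "fst (\<theta> x)"]) auto
        then show "x \<in> (\<Union>k. {x \<in> X0. \<theta> x \<in> (\<lambda>y. (y, k)) ` D'})" using x by (auto simp: U_def)
      next
        fix x assume "x \<in> (\<Union>k. {x \<in> X0. \<theta> x \<in> (\<lambda>y. (y, k)) ` D'})"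
        then obtain k y where "x \<in> X0" "y \<in> D'" "\<theta> x = (y, k)" by blast
        then show "x \<in> U j n a" by (simp add: U_def D'_def)
      qed
      ultimately show ?thesis by simp
    qed
    define I where "I n = (\<lambda>x. x n) ` space M" for n
    have fI: "countable (I n)" for n using finite_level by (simp add: I_def countable_finite)
    \<comment> \<open>For some slice \<open>j\<close> and every \<open>n\<close>, the point
      \<open>(\<beta> l (fst (\<theta> x)), j)\<close> has a preimage in \<open>X0\<close> that
      agrees with \<open>\<alpha> g x\<close> in coordinate \<open>n\<close>. Since \<theta> is
      injective, the preimage is the same for all \<open>n\<close> and therefore equals
      \<open>\<alpha> g x\<close>.\<close>
    have "V i = (\<Union>j. \<Inter>n. \<Union>a\<in>I n. (\<alpha> g -` level_set M n a \<inter> space M) \<inter> U j n a)"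
    proof (intro equalityI subsetI)
      fix x assume "x \<in> V i"
      then have x: "x \<in> X0" "fst (\<theta> (\<alpha> g x)) = \<beta> l (fst (\<theta> x))" by (auto simp: V_def gl)
      have gx: "\<alpha> g x \<in> X0" "\<alpha> g x \<in> space M" using X0i gl x X0s by auto
      have mem: "x \<in> (\<alpha> g -` level_set M n (\<alpha> g x n) \<inter> space M) \<inter> U (snd (\<theta> (\<alpha> g x))) n (\<alpha> g x n)" for n
      proof -
        have "\<theta> (\<alpha> g x) \<in> \<theta> ` (level_set M n (\<alpha> g x n) \<inter> X0) \<inter> (space N \<times> {snd (\<theta> (\<alpha> g x))})"
          using gx ps by (auto simp: level_set_def mem_Times_iff)
        then have "\<beta> l (fst (\<theta> x)) \<in> Dj (snd (\<theta> (\<alpha> g x))) n (\<alpha> g x n)"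
          unfolding Dj_def x(2)[symmetric] by (rule imageI)
        then have "x \<in> U (snd (\<theta> (\<alpha> g x))) n (\<alpha> g x n)" using x(1) unfolding U_def by blast
        then show ?thesis using X0s[OF x(1)] gx(2) by (simp add: level_set_def)
      qed
      have idx: "\<alpha> g x n \<in> I n" for n using gx by (auto simp: I_def)
      show "x \<in> (\<Union>j. \<Inter>n. \<Union>a\<in>I n. (\<alpha> g -` level_set M n a \<inter> space M) \<inter> U j n a)"
        by (rule UN_I[where a = "snd (\<theta> (\<alpha> g x))"], rule UNIV_I, rule INT_I) (rule UN_I[OF idx], rule mem)
    next
      fix x assume "x \<in> (\<Union>j. \<Inter>n. \<Union>a\<in>I n. (\<alpha> g -` level_set M n a \<inter> space M) \<inter> U j n a)"
      then obtain j where "x \<in> (\<Inter>n. \<Union>a\<in>I n. (\<alpha> g -` level_set M n a \<inter> space M) \<inter> U j n a)" by (rule UN_E)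
      then have j: "\<exists>a. \<alpha> g x \<in> level_set M n a \<and> x \<in> U j n a" for n by auto
      have x0: "x \<in> X0" using j[of 0] unfolding U_def by blast
      have "\<exists>u\<in>X0. u n = \<alpha> g x n \<and> \<theta> u = (\<beta> l (fst (\<theta> x)), j)" for n
      proof -
        obtain a where a: "\<alpha> g x n = a" "\<beta> l (fst (\<theta> x)) \<in> Dj j n a"
          using j[of n] unfolding U_def level_set_def by blast
        then obtain z where z: "\<beta> l (fst (\<theta> x)) = fst z" "z \<in> \<theta> ` (level_set M n a \<inter> X0)" "z \<in> space N \<times> {j}"
          unfolding Dj_def by - (erule imageE, erule IntE, rule that)
        then obtain u where "z = \<theta> u" "u \<in> X0" "u n = a" unfolding level_set_def by blast
        then show ?thesis using a(1) z by (intro bexI[of _ u]) (auto simp: prod_eq_iff)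
      qed
      then obtain u where u: "\<And>n. u n \<in> X0" "\<And>n. u n n = \<alpha> g x n" "\<And>n. \<theta> (u n) = (\<beta> l (fst (\<theta> x)), j)" by metis
      have "u n = u 0" for n by (rule inj_onD[OF inj _ u(1) u(1)]) (simp add: u(3))
      then have "u 0 = \<alpha> g x" using u(2) by (intro ext) metis
      then show "x \<in> V i" using u(3)[of 0] x0 by (simp add: V_def gl)
    qed
    moreover have "(\<alpha> g -` level_set M n a \<inter> space M) \<inter> U j n a \<in> sets (completion M)" for j n a
      using measurable_sets[OF T_measurable[OF gl(2)] level_measurable] Um by auto
    then have "(\<Union>j. \<Inter>n. \<Union>a\<in>I n. (\<alpha> g -` level_set M n a \<inter> space M) \<inter> U j n a) \<in> sets (completion M)"
      by (intro sets.countable_UN sets.countable_INT sets.countable_UN'' fI image_subsetI) auto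
    ultimately show ?thesis by simp
  qed
  have "countable (carrier G \<times> carrier L)" using countable_G A.countable_group by simp
  then obtain Q0 where Q0: "Q0 \<in> null_sets M" "\<And>i. i \<in> carrier G \<times> carrier L \<Longrightarrow> V i - Q0 \<in> sets M"
    using completion_countable_null[of "carrier G \<times> carrier L" V M] Vm by blast
  have "AE x in M. x \<in> X0 \<and> x \<notin> Q0"
    using AE_not_in[OF X0n] AE_not_in[OF Q0(1)] AE_space by eventually_elim auto
  then obtain X1 where X1m: "X1 \<in> sets M" and X1n: "space M - X1 \<in> null_sets M"
    and X1i: "\<And>g x. g \<in> carrier G \<Longrightarrow> x \<in> X1 \<Longrightarrow> \<alpha> g x \<in> X1"
    and X1P: "\<And>x. x \<in> X1 \<Longrightarrow> x \<in> X0 \<and> x \<notin> Q0"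
    by (rule E.invariant_core) (rule that)
  \<comment> \<open>The default outside \<open>X1\<close> is the unit; as the complement of
    \<open>X1\<close> is invariant too, the cocycle identity holds there as well and hence
    everywhere.\<close>
  define w where "w g x = (if x \<in> X1 then (THE l. l \<in> carrier L \<and> fst (\<theta> (\<alpha> g x)) = \<beta> l (fst (\<theta> x))) else \<one>\<^bsub>L\<^esub>)" for g x
  have wP: "w g x \<in> carrier L \<and> fst (\<theta> (\<alpha> g x)) = \<beta> (w g x) (fst (\<theta> x))" if g: "g \<in> carrier G" and x: "x \<in> X1" for g x
  proof -
    have x0: "x \<in> X0" using X1P x by blast
    have "\<exists>!l. l \<in> carrier L \<and> fst (\<theta> (\<alpha> g x)) = \<beta> l (fst (\<theta> x))"
      using fwd[OF g x0] \<beta>u[OF x0] by metis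
    from theI'[OF this] show ?thesis using x by (simp add: w_def)
  qed
  have wU: "w g x = l" if "g \<in> carrier G" "x \<in> X1" "l \<in> carrier L" "fst (\<theta> (\<alpha> g x)) = \<beta> l (fst (\<theta> x))" for g x l
    using wP[OF that(1,2)] \<beta>u[of x "w g x" l] X1P that by metis
  have wc: "w g x \<in> carrier L" if "g \<in> carrier G" for g x using wP[OF that] by (cases "x \<in> X1") (auto simp: w_def)
  have "orbit_equivalence_core G M \<alpha> G0 L w N \<beta> X1 \<theta> t"
  proof
    show "relative_property_T G G0" by (rule rel_T)
    show "countable (carrier L)" by (rule A.countable_group)
    show "X1 \<in> sets M" by (rule X1m)
    show "space M - X1 \<in> null_sets M" by (rule X1n)
    show "0 < t" by (rule t_pos)
    show "piso (completion M) ?O (ennreal t) \<theta> X1 (\<theta> ` X1)"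
      by (rule piso_restrict[OF pX]) (use X1P X1m in auto)
  next
    fix g assume g: "g \<in> carrier G"
    show "w g \<in> measurable M (count_space (carrier L))"
    proof (subst measurable_count_space_eq_countable[OF A.countable_group], intro conjI ballI)
      show "w g \<in> space M \<rightarrow> carrier L" using wc[OF g] by simp
      fix l assume l: "l \<in> carrier L"
      have "w g -` {l} \<inter> space M = ((V (g, l) - Q0) \<inter> X1) \<union> (if l = \<one>\<^bsub>L\<^esub> then space M - X1 else {})"
      proof (intro equalityI subsetI)
        fix x assume x: "x \<in> w g -` {l} \<inter> space M"
        show "x \<in> ((V (g, l) - Q0) \<inter> X1) \<union> (if l = \<one>\<^bsub>L\<^esub> then space M - X1 else {})"
        proof (cases "x \<in> X1")
          case True
          then show ?thesis using wP[OF g True] X1P[OF True] x by (auto simp: V_def)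
        next
          case False
          then show ?thesis using x by (auto simp: w_def)
        qed
      next
        fix x assume x: "x \<in> ((V (g, l) - Q0) \<inter> X1) \<union> (if l = \<one>\<^bsub>L\<^esub> then space M - X1 else {})"
        show "x \<in> w g -` {l} \<inter> space M"
        proof (cases "x \<in> X1")
          case True
          then have "x \<in> V (g, l)" using x by (auto split: if_splits)
          then show ?thesis using wU[OF g True l] X0s X1P[OF True] by (auto simp: V_def)
        next
          case False
          then show ?thesis using x by (auto simp: w_def split: if_splits)
        qed
      qed
      then show "w g -` {l} \<inter> space M \<in> sets M" using Q0(2)[of "(g, l)"] g l X1m by auto
    qed
  next
    fix g h x assume gh: "g \<in> carrier G" "h \<in> carrier G" and x: "x \<in> space M"
    show "w (g \<otimes> h) x = w g (\<alpha> h x) \<otimes>\<^bsub>L\<^esub> w h x"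
    proof (cases "x \<in> X1")
      case True
      have hx: "\<alpha> h x \<in> X1" using X1i gh True by blast
      have c: "w g (\<alpha> h x) \<in> carrier L" "w h x \<in> carrier L" using wc gh by auto
      have "fst (\<theta> (\<alpha> (g \<otimes> h) x)) = \<beta> (w g (\<alpha> h x)) (\<beta> (w h x) (fst (\<theta> x)))"
        using wP[OF gh(1) hx] wP[OF gh(2) True] T_mult[OF gh x] by simp
      also have "\<dots> = \<beta> (w g (\<alpha> h x) \<otimes>\<^bsub>L\<^esub> w h x) (fst (\<theta> x))"
        using A.T_mult c ps X1P[OF True] by simp
      finally show ?thesis using wU[OF _ True, of "g \<otimes> h" "w g (\<alpha> h x) \<otimes>\<^bsub>L\<^esub> w h x"] c gh by simp
    next
      case False
      then have "\<alpha> h x \<notin> X1" using X1i[of "inv h" "\<alpha> h x"] gh x by auto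
      then show ?thesis using False by (simp add: w_def)
    qed
  next
    fix g x assume g: "g \<in> carrier G" and x: "x \<in> X1"
    show "\<alpha> g x \<in> X1" by (rule X1i[OF g x])
    show "fst (\<theta> (\<alpha> g x)) = \<beta> (w g x) (fst (\<theta> x))" using wP[OF g x] by blast
  next
    show "fst (\<theta> x) \<in> space N" if "x \<in> X1" for x using ps X1P that by blast
    show "\<exists>g\<in>carrier G. x' = \<alpha> g x" if "x \<in> X1" "x' \<in> X1" "l \<in> carrier L" "fst (\<theta> x') = \<beta> l (fst (\<theta> x))" for x x' l
      using bwd X1P that by blast
    show "g = \<one>" if "x \<in> X1" "g \<in> carrier G" "\<alpha> g x = x" for x g
      using X0P X1P that by blast
    show "l = \<one>\<^bsub>L\<^esub>" if "x \<in> X1" "l \<in> carrier L" "\<beta> l (fst (\<theta> x)) = fst (\<theta> x)" for x l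
      using X0P X1P that by blast
  qed
  then show ?thesis using found X0Y X1P by blast
qed

end

section \<open>The full group of the amplified relation\<close>

lemma space_amp_space: "space (amp_space N) = space N \<times> UNIV"
  by (simp add: amp_space_def space_pair_measure)

lemma piso_null:
  assumes f: "piso M N c f A B" and E: "E \<subseteq> A" "E \<in> null_sets M"
  shows "f ` E \<in> null_sets N"
  using pisoD(6)[OF f E(1)] pisoD(7)[OF f E(1)] E(2) by (auto simp: null_sets_def)

lemma piso_amp:
  assumes N: "prob_space N" and \<sigma>: "piso (completion N) (completion N) 1 \<sigma> A B"
  shows "piso (completion (amp_space N)) (completion (amp_space N)) 1
    (\<lambda>z. (\<sigma> (fst z), snd z)) (A \<times> UNIV) (B \<times> UNIV)"
proof -
  have A: "A \<subseteq> space N" "B \<subseteq> space N"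
    using sets.sets_into_space[OF pisoD(1)[OF \<sigma>]] sets.sets_into_space[OF pisoD(2)[OF \<sigma>]] by auto
  have slice: "piso (completion (amp_space N)) (completion (amp_space N)) 1
    (\<lambda>z. (\<sigma> (fst z), snd z)) (A \<times> {j}) (B \<times> {j})" for j :: nat
  proof -
    have e: "(\<lambda>y. (y, j)) ` A = A \<times> {j}" "(\<lambda>y. (y, j)) ` B = B \<times> {j}" "fst ` (A \<times> {j}) = A" by force+
    have "piso (completion N) (completion (amp_space N)) 1 (\<lambda>y. (y, j)) A (A \<times> {j})"
      using piso_restrict[OF amp_slice_piso'[OF N] A(1) pisoD(1)[OF \<sigma>], of j] e by simp
    then have "A \<times> {j} \<in> sets (completion (amp_space N))" by (rule pisoD(2))
    then have p1: "piso (completion (amp_space N)) (completion N) 1 fst (A \<times> {j}) A"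
      using piso_restrict[OF amp_slice_piso[OF N, of j], of "A \<times> {j}"] A e by auto
    have p3: "piso (completion N) (completion (amp_space N)) 1 (\<lambda>y. (y, j)) B (B \<times> {j})"
      using piso_restrict[OF amp_slice_piso'[OF N] A(2) pisoD(2)[OF \<sigma>], of j] e by simp
    have "piso (completion (amp_space N)) (completion (amp_space N)) 1
      ((\<lambda>y. (y, j)) \<circ> (\<sigma> \<circ> fst)) (A \<times> {j}) (B \<times> {j})"
      using piso_comp[OF piso_comp[OF p1 \<sigma>] p3] by simp
    then show ?thesis by (rule piso_cong) auto
  qed
  have "piso (completion (amp_space N)) (completion (amp_space N)) 1
    (\<lambda>z. (\<sigma> (fst z), snd z)) (\<Union>j\<in>UNIV. A \<times> {j}) (\<Union>j\<in>UNIV. B \<times> {j})"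
    by (rule piso_glue[OF _ slice]) (auto simp: disjoint_family_on_def)
  moreover have "(\<Union>j\<in>UNIV. A \<times> {j :: nat}) = A \<times> UNIV" "(\<Union>j\<in>UNIV. B \<times> {j :: nat}) = B \<times> UNIV" by auto
  ultimately show ?thesis by simp
qed

lemma null_sets_amp:
  assumes N: "prob_space N" and Q: "Q \<in> null_sets (completion N)"
  shows "Q \<times> (UNIV :: nat set) \<in> null_sets (completion (amp_space N))"
proof -
  have sub: "Q \<subseteq> space N" using sets.sets_into_space[of Q "completion N"] Q by auto
  have "Q \<times> {j} \<in> null_sets (completion (amp_space N))" for j :: nat
  proof -
    have "(\<lambda>y. (y, j)) ` Q \<in> null_sets (completion (amp_space N))"
      by (rule piso_null[OF amp_slice_piso'[OF N] sub Q])
    moreover have "(\<lambda>y. (y, j)) ` Q = Q \<times> {j}" by auto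
    ultimately show ?thesis by simp
  qed
  then have "(\<Union>j. Q \<times> {j}) \<in> null_sets (completion (amp_space N))" by (intro null_sets_UN)
  moreover have "(\<Union>j. Q \<times> {j}) = Q \<times> (UNIV :: nat set)" by auto
  ultimately show ?thesis by simp
qed

text \<open>Normalizing both sides cancels the factor \<open>c\<close>.\<close>

lemma iso_mod_null_normalizedI:
  assumes f: "piso (completion M) (completion P) c f D W"
    and X: "X \<in> sets M" "emeasure M X \<noteq> 0" "emeasure M X \<noteq> \<infinity>" and D: "D \<subseteq> X" "X - D \<in> null_sets (completion M)"
    and W: "W \<in> sets P" "emeasure P W = c * emeasure M X" and c: "c \<noteq> 0" "c \<noteq> \<infinity>"
  shows "iso_mod_null (normalized_restriction M X) (normalized_restriction P W) f"
proof -
  have nz: "emeasure P W \<noteq> 0" "emeasure P W \<noteq> \<infinity>"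
    using X c W(2) by (auto simp: ennreal_mult_eq_top_iff)
  note R = completion_normalized_restriction[OF X]
  note S = completion_normalized_restriction[OF W(1) nz]
  have fE: "f ` E \<subseteq> W" if "E \<subseteq> D" for E using that pisoD(5)[OF f] by blast
  have XD: "X - D \<in> sets (completion M)" "emeasure (completion M) (X - D) = 0"
    using D(2) by auto
  have "X - D \<in> null_sets (completion (normalized_restriction M X))"
    using R(1)[of "X - D"] R(2)[of "X - D"] XD by (intro null_setsI) auto
  moreover have "\<forall>E\<subseteq>D. (E \<in> sets (completion (normalized_restriction M X)) \<longleftrightarrow>
       f ` E \<in> sets (completion (normalized_restriction P W))) \<and>
     (E \<in> sets (completion (normalized_restriction M X)) \<longrightarrow>
       emeasure (completion (normalized_restriction P W)) (f ` E) =
       emeasure (completion (normalized_restriction M X)) E)"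
  proof (intro allI impI)
    fix E assume E: "E \<subseteq> D"
    have EX: "E \<subseteq> X" using E D by blast
    have iff: "E \<in> sets (completion M) \<longleftrightarrow> f ` E \<in> sets (completion P)" by (rule pisoD(6)[OF f E])
    have "emeasure (completion (normalized_restriction P W)) (f ` E) =
       emeasure (completion (normalized_restriction M X)) E" if m: "E \<in> sets (completion M)"
    proof -
      have "emeasure (completion (normalized_restriction P W)) (f ` E)
          = emeasure (completion P) (f ` E) / emeasure P W"
        using S(2)[of "f ` E"] iff m fE[OF E] by simp
      also have "\<dots> = emeasure (completion M) E * c / (emeasure M X * c)"
        using pisoD(7)[OF f E m] W(2) by (simp add: mult.commute)
      also have "\<dots> = emeasure (completion M) E / emeasure M X" by (rule divide_mult_eq[OF c])
      also have "\<dots> = emeasure (completion (normalized_restriction M X)) E"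
        using R(2)[OF m EX] by simp
      finally show ?thesis .
    qed
    then show "(E \<in> sets (completion (normalized_restriction M X)) \<longleftrightarrow>
       f ` E \<in> sets (completion (normalized_restriction P W))) \<and>
     (E \<in> sets (completion (normalized_restriction M X)) \<longrightarrow>
       emeasure (completion (normalized_restriction P W)) (f ` E) =
       emeasure (completion (normalized_restriction M X)) E)"
      using R(1)[of E] S(1)[of "f ` E"] iff EX fE[OF E] by blast
  qed
  ultimately show ?thesis
    unfolding iso_mod_null_def R(3) S(3)
    using D(1) pisoD(3)[OF f] by (intro exI[of _ D] exI[of _ W] conjI; (assumption | simp))
qed

context ergodic_action begin

lemma orbit_relation_refl: "y \<in> space M \<Longrightarrow> (y, y) \<in> orbit_relation G M \<alpha>"
  using T_one[of y] one_closed unfolding orbit_relation_def by force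

lemma orbit_relation_sym: "sym (orbit_relation G M \<alpha>)"
proof (rule symI)
  fix y z assume "(y, z) \<in> orbit_relation G M \<alpha>"
  then obtain g where g: "y \<in> space M" "g \<in> carrier G" "z = \<alpha> g y" by (auto simp: orbit_relation_def)
  then have "z \<in> space M" "y = \<alpha> (inv g) z" using T_space by auto
  then show "(z, y) \<in> orbit_relation G M \<alpha>" using g(2) inv_closed unfolding orbit_relation_def by blast
qed

lemma orbit_relation_trans: "trans (orbit_relation G M \<alpha>)"
proof (rule transI)
  fix x y z assume "(x, y) \<in> orbit_relation G M \<alpha>" "(y, z) \<in> orbit_relation G M \<alpha>"
  then obtain g h where gh: "x \<in> space M" "g \<in> carrier G" "y = \<alpha> g x" "h \<in> carrier G" "z = \<alpha> h y"
    by (auto simp: orbit_relation_def)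
  then have "z = \<alpha> (h \<otimes> g) x" by (simp add: T_mult)
  then show "(x, z) \<in> orbit_relation G M \<alpha>" using gh m_closed unfolding orbit_relation_def by blast
qed

end

lemma amp_relation_iff: "(z, z') \<in> amp_relation R \<longleftrightarrow> (fst z, fst z') \<in> R"
  by (cases z; cases z') (auto simp: amp_relation_def)

lemma AE_completionD: "N - A \<in> null_sets (completion M) \<Longrightarrow> AE x in M. x \<in> N \<longrightarrow> x \<in> A"
proof -
  assume "N - A \<in> null_sets (completion M)"
  then have "AE x in completion M. x \<notin> N - A" by (rule AE_not_in)
  then have "AE x in M. x \<notin> N - A" unfolding AE_completion_iff .
  then show ?thesis by eventually_elim auto
qed

context ergodic_action begin

text \<open>The extension by \<open>piso_extend\<close> fixes its points outside
  \<open>Z \<union> Z'\<close>. If both sets lie in slice 0, it preserves this slice up to a null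
  set, and its restriction \<sigma> is then applied in every slice instead; on \<open>Z\<close> this
  agrees with \<rho>.\<close>

lemma full_group_extension:
  assumes \<rho>: "piso (completion (amp_space M)) (completion (amp_space M)) 1 \<rho> Z Z'"
    and fin: "emeasure (completion (amp_space M)) (Z \<union> Z') \<noteq> \<infinity>"
    and R: "\<And>z. z \<in> Z \<Longrightarrow> (z, \<rho> z) \<in> amp_relation (orbit_relation G M \<alpha>)"
  obtains \<tau> where "\<tau> \<in> full_group (amp_space M) (amp_relation (orbit_relation G M \<alpha>))"
    "\<And>z. z \<in> Z \<Longrightarrow> \<tau> z = \<rho> z"
    "Z \<union> Z' \<subseteq> space M \<times> {0} \<Longrightarrow> \<exists>\<sigma>\<in>full_group M (orbit_relation G M \<alpha>). \<forall>z. \<tau> z = (\<sigma> (fst z), snd z)"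
proof -
  note found = that
  let ?S = "completion (amp_space M)" and ?R = "amp_relation (orbit_relation G M \<alpha>)"
  have R_refl: "(z, z) \<in> ?R" if "z \<in> space ?S" for z
    using that orbit_relation_refl by (auto simp: amp_relation_iff space_amp_space)
  have R_sym: "sym ?R"
    by (rule symI) (use orbit_relation_sym in \<open>auto simp: amp_relation_iff dest: symD\<close>)
  have R_trans: "trans ?R"
    by (rule transI) (use orbit_relation_trans in \<open>auto simp: amp_relation_iff dest: transD\<close>)
  obtain \<tau> A B where \<tau>: "piso ?S ?S 1 \<tau> A B" and An: "space ?S - A \<in> null_sets ?S"
    and Bn: "space ?S - B \<in> null_sets ?S" and ZA: "Z \<subseteq> A" and \<tau>Z: "\<And>z. z \<in> Z \<Longrightarrow> \<tau> z = \<rho> z"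
    and \<tau>R: "\<And>z. z \<in> A \<Longrightarrow> (z, \<tau> z) \<in> ?R"
    and \<tau>out: "\<And>z. z \<in> A - (Z \<union> Z') \<Longrightarrow> \<tau> z = z"
    and \<tau>in: "\<And>z. z \<in> A \<inter> (Z \<union> Z') \<Longrightarrow> \<tau> z \<in> Z \<union> Z'"
    by (rule piso_extend[OF \<rho> fin R R_refl R_sym R_trans]) (assumption, assumption, rule that)
  show ?thesis
  proof (cases "Z \<union> Z' \<subseteq> space M \<times> {0}")
    case False
    have "AE z in amp_space M. (z, \<tau> z) \<in> ?R"
      using AE_completionD[OF An] AE_space by eventually_elim (use \<tau>R in auto)
    moreover have "iso_mod_null (amp_space M) (amp_space M) \<tau>"
      by (rule iso_mod_nullI[OF \<tau>]) (use An Bn in auto)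
    ultimately have "\<tau> \<in> full_group (amp_space M) ?R" by (simp add: full_group_def)
    then show ?thesis by (rule found[OF _ \<tau>Z]) (use False in auto)
  next
    case True
    have AB: "A \<subseteq> space M \<times> UNIV" "B \<subseteq> space M \<times> UNIV"
      using sets.sets_into_space[OF pisoD(1)[OF \<tau>]] sets.sets_into_space[OF pisoD(2)[OF \<tau>]]
      by (auto simp: space_amp_space)
    let ?N0 = "space M \<times> {0 :: nat}"
    have N0: "\<tau> z \<in> ?N0 \<longleftrightarrow> z \<in> ?N0" if "z \<in> A" for z
      using \<tau>out[of z] \<tau>in[of z] True that by (cases "z \<in> Z \<union> Z'") auto
    have \<tau>N0: "\<tau> ` (A \<inter> ?N0) = B \<inter> ?N0"
    proof (intro equalityI subsetI)
      fix z assume "z \<in> \<tau> ` (A \<inter> ?N0)"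
      then obtain c where c: "z = \<tau> c" "c \<in> A" "c \<in> ?N0" by (elim imageE IntE)
      then show "z \<in> B \<inter> ?N0" using N0[OF c(2)] imageI[OF c(2), of \<tau>] pisoD(5)[OF \<tau>] by simp
    next
      fix z assume z: "z \<in> B \<inter> ?N0"
      then have "z \<in> \<tau> ` A" using pisoD(5)[OF \<tau>] by simp
      then obtain c where c: "z = \<tau> c" "c \<in> A" by (elim imageE)
      have "c \<in> A \<inter> ?N0" using N0[OF c(2)] c z by (intro IntI) (simp_all only: Int_iff)
      then show "z \<in> \<tau> ` (A \<inter> ?N0)" unfolding c(1) by (rule imageI)
    qed
    have slice: "piso ?S (completion M) 1 fst ?N0 (space M)" by (rule amp_slice_piso[OF prob_space_axioms])
    have N0m: "?N0 \<in> sets ?S" by (rule pisoD(1)[OF slice])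
    define A0 where "A0 = fst ` (A \<inter> ?N0)"
    define B0 where "B0 = fst ` (B \<inter> ?N0)"
    have A0e: "A \<inter> ?N0 = A0 \<times> {0}" and B0e: "B \<inter> ?N0 = B0 \<times> {0}" unfolding A0_def B0_def by force+
    have pA: "piso ?S (completion M) 1 fst (A \<inter> ?N0) A0"
      unfolding A0_def by (rule piso_restrict[OF slice]) (use N0m pisoD(1)[OF \<tau>] in auto)
    have pB: "piso ?S (completion M) 1 fst (B \<inter> ?N0) B0"
      unfolding B0_def by (rule piso_restrict[OF slice]) (use N0m pisoD(2)[OF \<tau>] in auto)
    have p\<tau>: "piso ?S ?S 1 \<tau> (A \<inter> ?N0) (B \<inter> ?N0)"
      unfolding \<tau>N0[symmetric] by (rule piso_restrict[OF \<tau>]) (use N0m pisoD(1)[OF \<tau>] in auto)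
    have A0s: "A0 \<subseteq> space M" by (auto simp: A0_def)
    have pA': "piso (completion M) ?S 1 (\<lambda>y. (y, 0)) A0 (A \<inter> ?N0)"
      unfolding A0e using piso_restrict[OF amp_slice_piso'[OF prob_space_axioms] A0s pisoD(2)[OF pA], of 0]
      by (simp add: image_Pair_const)
    define \<sigma> where "\<sigma> y = fst (\<tau> (y, 0))" for y
    have \<sigma>: "piso (completion M) (completion M) 1 \<sigma> A0 B0"
      using piso_comp[OF piso_comp[OF pA' p\<tau>] pB] by (auto intro: piso_cong simp: \<sigma>_def)
    have compl: "space M - fst ` (E \<inter> ?N0) = fst ` (?N0 - E)" for E
    proof (intro equalityI subsetI)
      fix y assume y: "y \<in> space M - fst ` (E \<inter> ?N0)"
      have "(y, 0) \<notin> E"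
      proof
        assume "(y, 0) \<in> E"
        then have "fst (y, 0 :: nat) \<in> fst ` (E \<inter> ?N0)" using y by (intro imageI) simp
        then show False using y by simp
      qed
      then have "fst (y, 0 :: nat) \<in> fst ` (?N0 - E)" using y by (intro imageI) simp
      then show "y \<in> fst ` (?N0 - E)" by simp
    next
      fix y assume "y \<in> fst ` (?N0 - E)"
      then show "y \<in> space M - fst ` (E \<inter> ?N0)" by auto
    qed
    have "space M - A0 = fst ` (?N0 - A)" unfolding A0_def by (rule compl)
    moreover have "?N0 - A \<in> null_sets ?S"
      by (rule null_sets_completion_subset[OF _ An]) (auto simp: space_amp_space)
    ultimately have A0n: "space M - A0 \<in> null_sets (completion M)"
      using piso_null[OF slice, of "?N0 - A"] by auto
    have "space M - B0 = fst ` (?N0 - B)" unfolding B0_def by (rule compl)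
    moreover have "?N0 - B \<in> null_sets ?S"
      by (rule null_sets_completion_subset[OF _ Bn]) (auto simp: space_amp_space)
    ultimately have B0n: "space M - B0 \<in> null_sets (completion M)"
      using piso_null[OF slice, of "?N0 - B"] by auto
    have \<sigma>R: "(y, \<sigma> y) \<in> orbit_relation G M \<alpha>" if "y \<in> A0" for y
    proof -
      have "(y, 0) \<in> A" using that A0e by blast
      then show ?thesis using \<tau>R[of "(y, 0)"] by (simp add: amp_relation_iff \<sigma>_def)
    qed
    have "AE y in M. (y, \<sigma> y) \<in> orbit_relation G M \<alpha>"
      using AE_completionD[OF A0n] AE_space by eventually_elim (use \<sigma>R in auto)
    then have \<sigma>F: "\<sigma> \<in> full_group M (orbit_relation G M \<alpha>)"
      using iso_mod_nullI[OF \<sigma> A0n B0n] by (simp add: full_group_def)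
    define \<tau>' where "\<tau>' z = (\<sigma> (fst z), snd z)" for z :: "'x \<times> nat"
    have e: "space (amp_space M) - A0 \<times> UNIV = (space M - A0) \<times> UNIV"
       "space (amp_space M) - B0 \<times> UNIV = (space M - B0) \<times> UNIV" by (auto simp: space_amp_space)
    have null: "space (amp_space M) - A0 \<times> UNIV \<in> null_sets ?S" "space (amp_space M) - B0 \<times> UNIV \<in> null_sets ?S"
      unfolding e by (rule null_sets_amp[OF prob_space_axioms A0n] null_sets_amp[OF prob_space_axioms B0n])+
    have "iso_mod_null (amp_space M) (amp_space M) \<tau>'"
      unfolding \<tau>'_def by (rule iso_mod_nullI[OF piso_amp[OF prob_space_axioms \<sigma>] null])
    moreover have "AE z in amp_space M. (z, \<tau>' z) \<in> ?R"
      using AE_completionD[OF null(1)] AE_space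
      by eventually_elim (use \<sigma>R in \<open>auto simp: amp_relation_iff \<tau>'_def mem_Times_iff\<close>)
    ultimately have \<tau>'F: "\<tau>' \<in> full_group (amp_space M) ?R" by (simp add: full_group_def)
    have \<tau>'Z: "\<tau>' z = \<rho> z" if z: "z \<in> Z" for z
    proof -
      have "z \<in> ?N0" "\<rho> z \<in> ?N0" using z True pisoD(5)[OF \<rho>] by auto
      then show ?thesis using \<tau>Z[OF z] by (auto simp: \<tau>'_def \<sigma>_def prod_eq_iff)
    qed
    show ?thesis by (rule found[OF \<tau>'F \<tau>'Z]) (use \<sigma>F in \<open>auto simp: \<tau>'_def\<close>)
  qed
qed

end

text \<open>The element \<tau> extends the partial isomorphism that sends \<open>\<theta> y\<close>
  to \<open>(q y, 0)\<close>; this is possible because both sides have the same finite measure. The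
  index formulas for the level set and for \<open>Y0\<close>, combined with the scaling by
  \<open>t\<close>, give the value of \<open>t\<close>.\<close>

theorem (in orbit_equivalence_data) superrigidity:
  assumes fg: "finitely_generated_group (G Mod G0)"
  shows "\<exists>n. \<exists>x\<in>space M. \<exists>L0 \<tau> \<psi> Y0.
      subgroup L0 L \<and> finite (lcosets\<^bsub>L\<^esub> L0) \<and>
      \<tau> \<in> full_group (amp_space N) (amp_relation (orbit_relation L N \<beta>)) \<and>
      (Y' \<subseteq> space N \<times> {0} \<longrightarrow>
         (\<exists>\<sigma>\<in>full_group N (orbit_relation L N \<beta>). AE z in amp_space N. \<tau> z = (\<sigma> (fst z), snd z))) \<and>
      \<psi> \<in> iso (G\<lparr>carrier := set_stabilizer G \<alpha> (X n x)\<rparr>) (L\<lparr>carrier := L0\<rparr>) \<and>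
      Y0 \<in> sets N \<and> invariant_mod_null L0 N \<beta> Y0 \<and>
      iso_mod_null (normalized_restriction M (X n x))
        (normalized_restriction (amp_space N) (Y0 \<times> {0})) (\<tau> \<circ> \<theta>) \<and>
      (\<forall>g\<in>set_stabilizer G \<alpha> (X n x). AE y in M. y \<in> X n x \<longrightarrow>
         (\<tau> \<circ> \<theta>) (\<alpha> g y) = (\<beta> (\<psi> g) (fst ((\<tau> \<circ> \<theta>) y)), 0)) \<and>
      measure N Y0 = 1 / real (group_index L L0) \<and>
      t = real (group_index G (set_stabilizer G \<alpha> (X n x))) / real (group_index L L0) \<and>
      t \<in> \<rat> \<and> induced_from L L0 N \<beta> Y0"
proof -
  obtain X0 w where core': "orbit_equivalence_core G M \<alpha> G0 L w N \<beta> X0 \<theta> t"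
    and X0Y: "\<And>x. x \<in> X0 \<Longrightarrow> \<theta> x \<in> Y'"
    by (rule core) (rule that)
  interpret C: orbit_equivalence_core G M \<alpha> G0 L w N \<beta> X0 \<theta> t by (rule core')
  let ?S = "completion (amp_space N)"
  note pN = A.prob_space_axioms
  obtain n x \<psi> L0 q D Y0 where x: "x \<in> space M" and posx: "measure M (X n x) > 0"
    and L0: "subgroup L0 L" and \<psi>: "\<psi> \<in> iso (G\<lparr>carrier := St n x\<rparr>) (L\<lparr>carrier := L0\<rparr>)"
    and DX: "D \<subseteq> X n x" and D0: "D \<subseteq> X0" and Dn: "X n x - D \<in> null_sets (completion M)"
    and Y0: "Y0 \<in> sets N" and pq: "piso (completion M) (completion N) (ennreal t) q D Y0"
    and q_orb: "\<And>y. y \<in> D \<Longrightarrow> \<exists>l\<in>carrier L. q y = \<beta> l (fst (\<theta> y))"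
    and q_equi: "\<And>g y. g \<in> St n x \<Longrightarrow> y \<in> D \<Longrightarrow> \<alpha> g y \<in> D \<and> q (\<alpha> g y) = \<beta> (\<psi> g) (q y)"
    and fin: "finite (lcosets\<^bsub>L\<^esub> L0)" and mY0: "measure N Y0 = 1 / real (group_index L L0)"
    and ind: "induced_from L L0 N \<beta> Y0" and Yinv: "\<And>l y. l \<in> L0 \<Longrightarrow> y \<in> Y0 \<Longrightarrow> \<beta> l y \<in> Y0"
    and mYX: "measure N Y0 = t * measure M (X n x)"
    by (rule C.conjugacy[OF fg]) (rule that)
  have t: "ennreal t \<noteq> 0" "ennreal t \<noteq> \<infinity>" using t_pos by auto
  have Y0s: "Y0 \<subseteq> space N" by (rule sets.sets_into_space[OF Y0])
  define Z where "Z = \<theta> ` D"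
  have pZ: "piso (completion M) ?S (ennreal t) \<theta> D Z"
    unfolding Z_def by (rule piso_restrict[OF C.\<theta>_piso D0 pisoD(1)[OF pq]])
  have ZY: "Z \<subseteq> Y'" unfolding Z_def using X0Y D0 by blast
  have pY: "piso (completion N) ?S 1 (\<lambda>y. (y, 0)) Y0 (Y0 \<times> {0})"
    using piso_restrict[OF amp_slice_piso'[OF pN] Y0s sets_completionI_sets[OF Y0], of 0]
    by (simp add: image_Pair_const)
  \<comment> \<open>The inverse of \<theta> scales measure by \<open>1 / t\<close> and
    \<open>q\<close> by \<open>t\<close>, so \<rho> preserves it.\<close>
  define \<rho> where "\<rho> = (\<lambda>y. (y, 0 :: nat)) \<circ> (q \<circ> inv_into D \<theta>)"
  have "1 / ennreal t * ennreal t * 1 = 1"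
    using t by (simp add: ennreal_times_divide mult.commute[of _ "ennreal t"] ennreal_divide_self less_top)
  then have p\<rho>: "piso ?S ?S 1 \<rho> Z (Y0 \<times> {0})"
    using piso_comp[OF piso_comp[OF piso_inv[OF pZ t] pq] pY] unfolding \<rho>_def by simp
  have \<rho>\<theta>: "\<rho> (\<theta> y) = (q y, 0)" if "y \<in> D" for y
    using that pisoD(4)[OF pZ] by (simp add: \<rho>_def)
  have eY: "emeasure ?S (Y0 \<times> {0}) = emeasure N Y0"
    using pisoD(8)[OF pY] Y0 by simp
  have Y00: "Y0 \<times> {0 :: nat} \<in> sets (amp_space N)"
    unfolding amp_space_def using Y0 by (intro pair_measureI) auto
  have "emeasure ?S (Z \<union> Y0 \<times> {0}) \<le> emeasure ?S Z + emeasure ?S (Y0 \<times> {0})"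
    by (rule emeasure_subadditive[OF pisoD(1)[OF p\<rho>] pisoD(2)[OF p\<rho>]])
  also have "\<dots> = emeasure N Y0 + emeasure N Y0" using pisoD(8)[OF p\<rho>] eY by simp
  finally have finU: "emeasure ?S (Z \<union> Y0 \<times> {0}) \<noteq> \<infinity>"
    by (auto simp: A.emeasure_eq_measure ennreal_plus[symmetric] top_unique simp del: ennreal_plus)
  have R: "(z, \<rho> z) \<in> amp_relation (orbit_relation L N \<beta>)" if z: "z \<in> Z" for z
  proof -
    obtain y where y: "y \<in> D" "z = \<theta> y" using z by (auto simp: Z_def)
    obtain l where "l \<in> carrier L" "q y = \<beta> l (fst (\<theta> y))" using q_orb[OF y(1)] by blast
    moreover have "fst (\<theta> y) \<in> space N" using C.\<theta>_space D0 y by blast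
    ultimately show ?thesis using \<rho>\<theta> y by (auto simp: amp_relation_iff orbit_relation_def)
  qed
  obtain \<tau> where \<tau>: "\<tau> \<in> full_group (amp_space N) (amp_relation (orbit_relation L N \<beta>))"
    and \<tau>Z: "\<And>z. z \<in> Z \<Longrightarrow> \<tau> z = \<rho> z"
    and \<tau>0: "Z \<union> Y0 \<times> {0} \<subseteq> space N \<times> {0} \<Longrightarrow>
       \<exists>\<sigma>\<in>full_group N (orbit_relation L N \<beta>). \<forall>z. \<tau> z = (\<sigma> (fst z), snd z)"
    by (rule A.full_group_extension[OF p\<rho> finU R]) (assumption, rule that)
  have \<tau>\<theta>: "(\<tau> \<circ> \<theta>) y = (q y, 0)" if "y \<in> D" for y
    using \<tau>Z[of "\<theta> y"] \<rho>\<theta>[OF that] that by (simp add: Z_def)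
  have "piso (completion M) ?S (ennreal t * 1) ((\<lambda>y. (y, 0)) \<circ> q) D (Y0 \<times> {0})"
    by (rule piso_comp[OF pq pY])
  then have p\<tau>: "piso (completion M) ?S (ennreal t) (\<tau> \<circ> \<theta>) D (Y0 \<times> {0})"
    using piso_cong[of _ _ _ "(\<lambda>y. (y, 0)) \<circ> q" D "Y0 \<times> {0}" "\<tau> \<circ> \<theta>"] \<tau>\<theta> by auto
  have eYX: "emeasure (amp_space N) (Y0 \<times> {0}) = ennreal t * emeasure M (X n x)"
    using eY Y00 mYX t_pos by (simp add: A.emeasure_eq_measure emeasure_eq_measure ennreal_mult)
  have iso: "iso_mod_null (normalized_restriction M (X n x))
        (normalized_restriction (amp_space N) (Y0 \<times> {0})) (\<tau> \<circ> \<theta>)"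
    by (rule iso_mod_null_normalizedI[OF p\<tau> X_sets[of n x] _ _ DX Dn Y00 eYX t])
      (use posx in \<open>auto simp: emeasure_eq_measure\<close>)
  have equi: "AE y in M. y \<in> X n x \<longrightarrow> (\<tau> \<circ> \<theta>) (\<alpha> g y) = (\<beta> (\<psi> g) (fst ((\<tau> \<circ> \<theta>) y)), 0)"
    if g: "g \<in> St n x" for g
    using AE_completionD[OF Dn]
  proof eventually_elim
    case (elim y)
    show ?case
    proof
      assume "y \<in> X n x"
      then have y: "y \<in> D" using elim by blast
      show "(\<tau> \<circ> \<theta>) (\<alpha> g y) = (\<beta> (\<psi> g) (fst ((\<tau> \<circ> \<theta>) y)), 0)"
        using q_equi[OF g y] \<tau>\<theta>[OF y] \<tau>\<theta>[of "\<alpha> g y"] by simp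
    qed
  qed
  have inv: "invariant_mod_null L0 N \<beta> Y0"
    unfolding invariant_mod_null_def
  proof (intro ballI AE_I2 iffI)
    fix l y assume l: "l \<in> L0" and y: "y \<in> space N"
    have lc: "l \<in> carrier L" using subgroup.subset[OF L0] l by blast
    show "\<beta> l y \<in> Y0" if "y \<in> Y0" by (rule Yinv[OF l that])
    show "y \<in> Y0" if "\<beta> l y \<in> Y0"
      using Yinv[OF subgroup.m_inv_closed[OF L0 l] that] lc y by simp
  qed
  have mX: "measure M (X n x) = 1 / real (group_index G (St n x))" by (rule level_index[OF x posx])
  have "group_index G (St n x) \<noteq> 0" using mX posx by (cases "group_index G (St n x) = 0") auto
  then have t_eq: "t = real (group_index G (St n x)) / real (group_index L L0)"
    using mYX mY0 mX by (auto simp: field_simps)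
  then have "t \<in> \<rat>" by (metis Rats_divide Rats_of_nat)
  moreover have "Y' \<subseteq> space N \<times> {0} \<longrightarrow>
         (\<exists>\<sigma>\<in>full_group N (orbit_relation L N \<beta>). AE z in amp_space N. \<tau> z = (\<sigma> (fst z), snd z))"
  proof
    assume "Y' \<subseteq> space N \<times> {0}"
    then have "Z \<union> Y0 \<times> {0} \<subseteq> space N \<times> {0}" using ZY Y0s by blast
    then show "\<exists>\<sigma>\<in>full_group N (orbit_relation L N \<beta>). AE z in amp_space N. \<tau> z = (\<sigma> (fst z), snd z)"
      using \<tau>0 AE_I2 by meson
  qed
  ultimately show ?thesis
    using x L0 fin \<tau> \<psi> Y0 inv iso equi mY0 t_eq ind
    by (intro exI[of _ n] bexI[of _ x] exI[of _ L0] exI[of _ \<tau>] exI[of _ \<psi>] exI[of _ Y0],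
        unfold St_eq[OF x]) blast+
qed

section \<open>From the given actions to the locales\<close>

lemma mp_action_pmp:
  assumes "group G" "pmp_action G M \<alpha>"
  shows "mp_action G M \<alpha>"
proof -
  interpret group G by fact
  interpret group_action G "space M" \<alpha> using assms(2) by (simp add: pmp_action_def)
  show ?thesis
  proof
    fix g assume g: "g \<in> carrier G"
    show "\<alpha> g \<in> measurable M M" "distr M M (\<alpha> g) = M"
      using assms(2) g by (auto simp: pmp_action_def measure_preserving_map_def)
  next
    show "\<alpha> (g \<otimes>\<^bsub>G\<^esub> h) z = \<alpha> g (\<alpha> h z)" if "g \<in> carrier G" "h \<in> carrier G" "z \<in> space M" for g h z
      using composition_rule[OF that(3,1,2)] by simp
    show "\<alpha> \<one>\<^bsub>G\<^esub> z = z" if "z \<in> space M" for z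
      using id_eq_one that by (metis restrict_apply')
  qed
qed

text \<open>The factors are finite and discrete, so a condition on one coordinate describes a finite
  union of level sets; such conditions generate the product \<sigma>-algebra and its trace on the
  limit.\<close>

lemma profinite_limit_generated:
  assumes fin: "\<And>n. finite (space (\<mu> n))" and Pow: "\<And>n. sets (\<mu> n) = Pow (space (\<mu> n))"
    and M: "space M \<subseteq> space (Pi\<^sub>M UNIV \<mu>)" and sM: "sets M = sets (restrict_space (Pi\<^sub>M UNIV \<mu>) (space M))"
  shows "sets M = sigma_sets (space M) {level_set M n a | n a. True}"
proof (rule equalityI)
  let ?L = "{level_set M n a | n a. True}"
  define S where "S = sigma (space M) ?L"
  have L: "?L \<subseteq> Pow (space M)" by (auto simp: level_set_def)
  have S: "space S = space M" "sets S = sigma_sets (space M) ?L"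
    unfolding S_def using L by (auto simp: space_measure_of sets_measure_of)
  have Mc: "x n \<in> space (\<mu> n)" if "x \<in> space M" for x n
    using that M by (auto simp: space_PiM)
  have lev: "level_set M n a \<in> sets S" for n a unfolding S(2) by blast
  have coord: "(\<lambda>x. x n) \<in> measurable S (\<mu> n)" for n
  proof (rule measurableI)
    show "x n \<in> space (\<mu> n)" if "x \<in> space S" for x using that Mc S(1) by simp
    fix A assume "A \<in> sets (\<mu> n)"
    then have "finite A" using fin[of n] Pow[of n] finite_subset by auto
    then have "(\<Union>a\<in>A. level_set M n a) \<in> sets S" using lev by (intro sets.finite_UN) auto
    moreover have "(\<Union>a\<in>A. level_set M n a) = (\<lambda>x. x n) -` A \<inter> space S" by (auto simp: level_set_def S(1))
    ultimately show "(\<lambda>x. x n) -` A \<inter> space S \<in> sets S" by simp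
  qed
  have id: "(\<lambda>x n. x n) \<in> measurable S (Pi\<^sub>M UNIV \<mu>)"
    by (rule measurable_PiM_single'[OF coord]) (use Mc S(1) in auto)
  show "sets M \<subseteq> sigma_sets (space M) ?L"
  proof
    fix E assume "E \<in> sets M"
    then have "E \<in> (\<inter>) (space M) ` sets (Pi\<^sub>M UNIV \<mu>)" unfolding sM sets_restrict_space .
    then obtain E' where E': "E' \<in> sets (Pi\<^sub>M UNIV \<mu>)" "E = space M \<inter> E'" by (elim imageE)
    have "E = (\<lambda>x n. x n) -` E' \<inter> space S" unfolding E'(2) S(1) by auto
    then show "E \<in> sigma_sets (space M) ?L" using measurable_sets[OF id E'(1)] S(2) by simp
  qed
  have "level_set M n a \<in> sets M" for n a
  proof (cases "a \<in> space (\<mu> n)")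
    case True
    then have "(\<lambda>x. x n) -` {a} \<inter> space (Pi\<^sub>M UNIV \<mu>) \<in> sets (Pi\<^sub>M UNIV \<mu>)"
      using Pow by (intro measurable_sets[OF measurable_component_singleton]) auto
    moreover have "level_set M n a = space M \<inter> ((\<lambda>x. x n) -` {a} \<inter> space (Pi\<^sub>M UNIV \<mu>))"
      using M by (auto simp: level_set_def)
    ultimately have "level_set M n a \<in> (\<inter>) (space M) ` sets (Pi\<^sub>M UNIV \<mu>)" by (rule image_eqI[rotated])
    then show ?thesis unfolding sM sets_restrict_space .
  next
    case False
    then have "level_set M n a = {}" using Mc by (auto simp: level_set_def)
    then show ?thesis by simp
  qed
  then show "sigma_sets (space M) ?L \<subseteq> sets M" by (intro sets.sigma_sets_subset) auto
qed

lemma profinite_system_limit: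
  assumes G: "group G" "countable (carrier G)" "G0 \<lhd> G"
    and lim: "profinite_limit G M \<alpha> \<mu> \<alpha>n q" and erg: "ergodic_on G0 M \<alpha>"
  shows "profinite_system G M \<alpha> G0"
proof -
  have fin: "finite (space (\<mu> n))" and Pow: "sets (\<mu> n) = Pow (space (\<mu> n))" for n
    using lim by (auto simp: profinite_limit_def)
  have space: "space M = {x. \<forall>n. x n \<in> space (\<mu> n) \<and> q n (x (Suc n)) = x n}"
    and sets: "sets M = sets (restrict_space (Pi\<^sub>M UNIV \<mu>) (space M))"
    and pmp: "pmp_action G M \<alpha>"
    and act: "\<And>g x n. g \<in> carrier G \<Longrightarrow> x \<in> space M \<Longrightarrow> \<alpha> g x n = \<alpha>n n g (x n)"
    using lim unfolding profinite_limit_def by blast+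
  have gen: "sets M = sigma_sets (space M) {level_set M n a | n a. True}"
    by (rule profinite_limit_generated[OF fin Pow _ sets]) (auto simp: space space_PiM)
  show ?thesis
  proof (intro profinite_system.intro profinite_system_axioms.intro)
    show "mp_action G M \<alpha>" by (rule mp_action_pmp[OF G(1) pmp])
    show "prob_space M" using pmp by (simp add: pmp_action_def)
    show "G0 \<lhd> G" "countable (carrier G)" "ergodic_on G0 M \<alpha>" by fact+
    show "level_set M n a \<in> sets M" for n a unfolding gen by blast
    show "finite ((\<lambda>x. x n) ` space M)" for n
      by (rule finite_subset[OF _ fin[of n]]) (auto simp: space)
    show "x n = y n" if "x \<in> space M" "y \<in> space M" "x (Suc n) = y (Suc n)" for x y n
      using that unfolding space by (metis (mono_tags) mem_Collect_eq)
    show "\<alpha> g x n = \<alpha> g y n" if "g \<in> carrier G" "x \<in> space M" "y \<in> space M" "x n = y n" for g x y n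
      using that act by simp
    show "sets M = sigma_sets (space M) {level_set M n a | n a. True}" by (rule gen)
  qed
qed

theorem theorem4p1:
  fixes \<Gamma> :: "('g, 'c) monoid_scheme" and \<Gamma>0 :: "'g set"
    and \<Lambda> :: "('l, 'd) monoid_scheme"
    and M :: "(nat \<Rightarrow> 'b) measure" and \<alpha> :: "'g \<Rightarrow> (nat \<Rightarrow> 'b) \<Rightarrow> (nat \<Rightarrow> 'b)"
    and \<mu> :: "nat \<Rightarrow> 'b measure" and \<alpha>n :: "nat \<Rightarrow> 'g \<Rightarrow> 'b \<Rightarrow> 'b" and q :: "nat \<Rightarrow> 'b \<Rightarrow> 'b"
    and N :: "'y measure" and \<beta> :: "'l \<Rightarrow> 'y \<Rightarrow> 'y"
    and t :: real and Y' :: "('y \<times> nat) set" and \<theta> :: "(nat \<Rightarrow> 'b) \<Rightarrow> 'y \<times> nat"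
  assumes "group \<Gamma>" and "countable (carrier \<Gamma>)"
    and "\<Gamma>0 \<lhd> \<Gamma>" and "infinite \<Gamma>0"
    and "relative_property_T \<Gamma> \<Gamma>0"
    and "finitely_generated_group (\<Gamma> Mod \<Gamma>0)"
    and "standard_prob_space M"
    and "profinite_limit \<Gamma> M \<alpha> \<mu> \<alpha>n q"
    and "free_action \<Gamma> M \<alpha>"
    and "ergodic_on (carrier \<Gamma>) M \<alpha>"
    and "ergodic_on \<Gamma>0 M \<alpha>"
    and "group \<Lambda>" and "countable (carrier \<Lambda>)"
    and "standard_prob_space N"
    and "pmp_action \<Lambda> N \<beta>"
    and "free_action \<Lambda> N \<beta>"
    and "ergodic_on (carrier \<Lambda>) N \<beta>"
    and "t > 0"
    and "Y' \<in> sets (amp_space N)" and "emeasure (amp_space N) Y' = ennreal t"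
    and "orbit_equivalence M (orbit_relation \<Gamma> M \<alpha>)
           (normalized_restriction (amp_space N) Y')
           (restrict_relation (amp_relation (orbit_relation \<Lambda> N \<beta>)) Y') \<theta>"
  shows "\<exists>n. \<exists>a\<in>space (\<mu> n). \<exists>\<Lambda>0 \<tau> \<psi> Y0.
      subgroup \<Lambda>0 \<Lambda> \<and> finite (lcosets\<^bsub>\<Lambda>\<^esub> \<Lambda>0) \<and>
      \<comment> \<open>\<open>\<theta>\<close> takes values in \<open>Y \<times> \<nat>\<close>, so \<open>\<tau>\<close> lies in the full group of the amplified relation there;
          if \<open>\<theta>\<close> takes its values in \<open>Y = Y \<times> {0}\<close>, then \<open>\<tau>\<close> comes from the full group on \<open>Y\<close>.\<close>
      \<tau> \<in> full_group (amp_space N) (amp_relation (orbit_relation \<Lambda> N \<beta>)) \<and>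
      (Y' \<subseteq> space N \<times> {0} \<longrightarrow>
         (\<exists>\<sigma>\<in>full_group N (orbit_relation \<Lambda> N \<beta>).
            AE z in amp_space N. \<tau> z = (\<sigma> (fst z), snd z))) \<and>
      \<psi> \<in> iso (\<Gamma>\<lparr>carrier := set_stabilizer \<Gamma> \<alpha> (level_set M n a)\<rparr>) (\<Lambda>\<lparr>carrier := \<Lambda>0\<rparr>) \<and>
      Y0 \<in> sets N \<and>
      invariant_mod_null \<Lambda>0 N \<beta> Y0 \<and>
      \<comment> \<open>in particular \<open>Y0 \<times> {0}\<close> is the image of \<open>X\<^sub>a\<^sub>,\<^sub>n\<close> under \<open>\<tau> \<circ> \<theta>\<close>, up to null sets\<close>
      iso_mod_null (normalized_restriction M (level_set M n a))
        (normalized_restriction (amp_space N) (Y0 \<times> {0})) (\<tau> \<circ> \<theta>) \<and>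
      (\<forall>\<gamma>\<in>set_stabilizer \<Gamma> \<alpha> (level_set M n a). AE x in M. x \<in> level_set M n a \<longrightarrow>
         (\<tau> \<circ> \<theta>) (\<alpha> \<gamma> x) = (\<beta> (\<psi> \<gamma>) (fst ((\<tau> \<circ> \<theta>) x)), 0)) \<and>
      measure N Y0 = 1 / real (group_index \<Lambda> \<Lambda>0) \<and>
      t = real (group_index \<Gamma> (set_stabilizer \<Gamma> \<alpha> (level_set M n a)))
            / real (group_index \<Lambda> \<Lambda>0) \<and>
      t \<in> \<rat> \<and>
      induced_from \<Lambda> \<Lambda>0 N \<beta> Y0"
proof -
  interpret profinite_system \<Gamma> M \<alpha> \<Gamma>0
    by (rule profinite_system_limit) fact+
  have "mp_action \<Lambda> N \<beta>" by (rule mp_action_pmp) fact+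
  have "prob_space N" using \<open>pmp_action \<Lambda> N \<beta>\<close> by (simp add: pmp_action_def)
  interpret A: ergodic_action \<Lambda> N \<beta>
    by (intro ergodic_action.intro ergodic_action_axioms.intro) fact+
  interpret orbit_equivalence_data \<Gamma> M \<alpha> \<Gamma>0 \<Lambda> N \<beta> \<theta> t Y'
    by unfold_locales fact+
  have level: "x n \<in> space (\<mu> n)" if "x \<in> space M" for x n
    using \<open>profinite_limit \<Gamma> M \<alpha> \<mu> \<alpha>n q\<close> that unfolding profinite_limit_def by blast
  \<comment> \<open>The vertex \<open>a\<close> arises as the coordinate \<open>x n\<close> of a
    point, so the body of the goal is abstracted in order to be instantiated there.\<close>
  let "\<exists>n. \<exists>a\<in>_. ?P n a" = ?thesis
  have "\<exists>n. \<exists>x\<in>space M. ?P n (x n)"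
    by (rule superrigidity) fact
  then obtain n where n: "\<exists>x\<in>space M. ?P n (x n)" by (rule exE)
  then obtain x where x: "x \<in> space M" "?P n (x n)" by (rule bexE)
  show ?thesis by (rule exI[of _ n], rule bexI[of _ "x n"]) (rule x(2), rule level[OF x(1)])
qed

end
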